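(* Let $\{\gamma_g\}_{g\ge0}$ be a sequence in $\mathbb D$ and let $\sigma\in\mathcal M(\mathbb T)$ be the measure with Schur parameters $\{\gamma_g\}$. Suppose that either $\{\gamma_g\}\in\ell^p(\mathbb Z_+)$ for some $p\in[1,2)$, or $\{\gamma_g\log(g+2)\}\in\ell^2(\mathbb Z_+)$. Let $a>0$ and put $r_{a,n}=1-a/n$ (for $n>a$). Then for a.e. $\xi\in\mathbb T$ all of the following hold: (a) $\lim_{n\to\infty}|\phi_n^*(\xi,\sigma)|^2=|D_\sigma^{-1}(\xi)|^2$; (b) $\lim_{n\to\infty}\operatorname{dist}(Z(\phi_n),\xi)\,n=+\infty$; (c) $\lim_{n\to\infty}f_n(r_{a,n}\xi)=0$; (d) $\lim_{n\to\infty}\sup_{z\in S^*_\rho(\xi)}|f_n(z)|=0$ for every $\rho\in(0,1)$.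
   Context: Notation: $\mathbb Z_+=\{0,1,2,\dots\}$, $\mathbb T=\{z\in\mathbb C:|z|=1\}$, $\mathbb D=\{z\in\mathbb C:|z|<1\}$, and $m$ is normalized Lebesgue measure on $\mathbb T$, $dm=d\theta/(2\pi)$; "a.e." refers to Lebesgue measure. $\mathcal M(\mathbb T)$ is the set of probability measures on $\mathbb T$ whose support is not a finite set. For $\sigma\in\mathcal M(\mathbb T)$, $\Phi_n(z,\sigma)$, $n\in\mathbb Z_+$, are the monic orthogonal polynomials: $\Phi_n(z,\sigma)=z^n+\dots$ has degree $n$ and $\int_{\mathbb T}\Phi_n(\xi,\sigma)\overline{\xi^j}\,d\sigma(\xi)=0$ for $0\le j\le n-1$. The orthonormal polynomials are $\phi_n=\Phi_n/\|\Phi_n\|_{L^2_\sigma}$. Put $\Phi_n^*(z,\sigma)=z^n\overline{\Phi_n(\bar z^{-1},\sigma)}$ and $\phi_n^*(z,\sigma)=z^n\overline{\phi_n(\bar z^{-1},\sigma)}$. The Schur (Verblunsky) parameters $\{\gamma_n\}_{n\ge0}\subset\mathbb D$ of $\sigma$ are defined by the recursion $\Phi_{n+1}=z\Phi_n-\overline{\gamma_n}\Phi_n^*$, $\Phi_{n+1}^*=\Phi_n^*-\gamma_nz\Phi_n$, $\Phi_0=\Phi_0^*=1$; the map sending $\sigma$ to its Schur parameters is a bijection between $\mathcal M(\mathbb T)$ and the set of all sequences in $\mathbb D$. Write $d\sigma=w\,dm+d\sigma_s$ with $\sigma_s$ singular. One has $\{\gamma_g\}\in\ell^2(\mathbb Z_+)$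 if and only if $\int_{\mathbb T}\log w\,dm>-\infty$ (Szegő's theorem), and in this case (which includes both cases of the claim) the Szegő function is $$D_\sigma(z)=\exp\left(\frac12\int_{\mathbb T}\frac{\xi+z}{\xi-z}\log w(\xi)\,dm(\xi)\right),\qquad z\in\mathbb D,$$ an outer function in $H^2(\mathbb D)$ with $D_\sigma(0)>0$ and $|D_\sigma(\xi)|^2=w(\xi)$ for a.e. $\xi\in\mathbb T$; $D_\sigma(\xi)$ for $\xi\in\mathbb T$ denotes its nontangential boundary value, and $D_\sigma^{-1}=1/D_\sigma$. $Z(\phi_n)=\{z\in\mathbb D:\phi_n(z,\sigma)=0\}$ (all zeros of $\phi_n$ lie in $\mathbb D$), and $\operatorname{dist}$ is Euclidean distance. For $\rho\in(0,1)$ and $\xi\in\mathbb T$, the Stolz angle $S^*_\rho(\xi)$ is the convex hull of $\rho\mathbb D$ and $\xi$. The Schur iterates $\{f_n\}_{n\ge0}$ of $\sigma$ are the analytic functions on $\mathbb D$ with $|f_n|\le 1$ defined by $$\int_{\mathbb T}\frac{\xi+z}{\xi-z}\,d\sigma(\xi)=\frac{1+zf_0(z)}{1-zf_0(z)},\qquad zf_{n+1}(z)=\frac{f_n(z)-f_n(0)}{1-\overline{f_n(0)}\,f_n(z)},\quad n\ge0 .$$ With these conventions $f_n(0)=\gamma_n$. At the point $\xi\in\mathbb T$ itself, $f_n(\xi)$ denotes the nontangential boundary value, which exists for a.e. $\xi$. *)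

theory Defs
  imports "HOL-Probability.Probability" "HOL-Complex_Analysis.Complex_Analysis"
begin

definition borel_circle :: "complex measure" where
  "borel_circle = restrict_space borel (sphere 0 1)"

definition circle_measure :: "complex measure" where
  "circle_measure = distr (uniform_measure lborel {0..<2 * pi}) borel_circle cis"

definition circle_support :: "complex measure \<Rightarrow> complex set" where
  "circle_support \<sigma> =
     {\<xi> \<in> sphere 0 1. \<forall>U. open U \<and> \<xi> \<in> U \<longrightarrow> emeasure \<sigma> (U \<inter> sphere 0 1) > 0}"

definition nontrivial_circle_measures :: "complex measure set" where
  "nontrivial_circle_measures =
     {\<sigma>. sets \<sigma> = sets borel_circle \<and> prob_space \<sigma> \<and> infinite (circle_support \<sigma>)}"


text \<open>The orthogonality conditions determine the polynomial uniquely only because the support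
  of the measure is infinite; outside \<^const>\<open>nontrivial_circle_measures\<close> the description
  need not denote.\<close>

definition monic_OP :: "complex measure \<Rightarrow> nat \<Rightarrow> complex poly" where
  "monic_OP \<sigma> n = (THE p. degree p = n \<and> lead_coeff p = 1 \<and>
     (\<forall>j<n. (\<integral>\<xi>. poly p \<xi> * cnj (\<xi> ^ j) \<partial>\<sigma>) = 0))"

definition orthonormal_OP :: "complex measure \<Rightarrow> nat \<Rightarrow> complex poly" where
  "orthonormal_OP \<sigma> n =
     smult (1 / complex_of_real (sqrt (\<integral>\<xi>. (cmod (poly (monic_OP \<sigma> n) \<xi>))\<^sup>2 \<partial>\<sigma>)))
           (monic_OP \<sigma> n)"

text \<open>The reversal is taken with respect to the actual degree of the polynomial, which is
  \<open>n\<close> for the \<open>n\<close>-th orthogonal polynomial.  It is defined on coefficients because the formula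
  in \<open>poly_star_poly_nz\<close> makes no sense at \<open>z = 0\<close>.\<close>

definition poly_star :: "complex poly \<Rightarrow> complex poly" where
  "poly_star p = reflect_poly (map_poly cnj p)"

lemma poly_star_poly_nz:
  assumes "z \<noteq> 0"
  shows "poly (poly_star p) z = z ^ degree p * cnj (poly p (inverse (cnj z)))"
proof -
  have deg: "degree (map_poly cnj p) = degree p"
    by (rule degree_map_poly) simp
  have "cnj (poly p x) = poly (map_poly cnj p) (cnj x)" for x
    by (induction p) (auto simp: map_poly_pCons)
  then show ?thesis
    using assms by (simp add: poly_star_def poly_reflect_poly_nz deg)
qed

definition schur_parameters :: "complex measure \<Rightarrow> (nat \<Rightarrow> complex) \<Rightarrow> bool" where
  "schur_parameters \<sigma> \<gamma> \<longleftrightarrow> (\<forall>n.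
     monic_OP \<sigma> (Suc n) =
       [:0, 1:] * monic_OP \<sigma> n - smult (cnj (\<gamma> n)) (poly_star (monic_OP \<sigma> n)) \<and>
     poly_star (monic_OP \<sigma> (Suc n)) =
       poly_star (monic_OP \<sigma> n) - smult (\<gamma> n) ([:0, 1:] * monic_OP \<sigma> n))"

definition OP_zeros :: "complex measure \<Rightarrow> nat \<Rightarrow> complex set" where
  "OP_zeros \<sigma> n = {z \<in> ball 0 1. poly (orthonormal_OP \<sigma> n) z = 0}"


definition circle_lebesgue_decomposition ::
    "complex measure \<Rightarrow> (complex \<Rightarrow> real) \<Rightarrow> complex measure \<Rightarrow> bool" where
  "circle_lebesgue_decomposition \<sigma> w \<sigma>s \<longleftrightarrow>
     w \<in> borel_measurable circle_measure \<and> (AE \<xi> in circle_measure. 0 \<le> w \<xi>) \<and>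
     sets \<sigma>s = sets borel_circle \<and>
     (\<exists>N \<in> null_sets circle_measure. emeasure \<sigma>s (sphere 0 1 - N) = 0) \<and>
     (\<forall>A \<in> sets borel_circle.
        emeasure \<sigma> A = emeasure (density circle_measure (\<lambda>\<xi>. ennreal (w \<xi>))) A + emeasure \<sigma>s A)"

text \<open>This is the Szego function only if \<open>ln \<circ> w\<close> is integrable and \<open>w > 0\<close> almost everywhere:
  \<^const>\<open>ln\<close> does not take the value \<open>-\<infinity>\<close> at \<open>0\<close>, and the Bochner integral of a
  non-integrable function is \<open>0\<close>.  By Szego's theorem both conditions hold whenever the Schur
  parameters are square summable.\<close>

definition szego_function :: "(complex \<Rightarrow> real) \<Rightarrow> complex \<Rightarrow> complex" where
  "szego_function w z =
     exp (1 / 2 * (\<integral>\<xi>. (\<xi> + z) / (\<xi> - z) * complex_of_real (ln (w \<xi>)) \<partial>circle_measure))"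

definition schur_iterates :: "complex measure \<Rightarrow> (nat \<Rightarrow> complex \<Rightarrow> complex) \<Rightarrow> bool" where
  "schur_iterates \<sigma> f \<longleftrightarrow>
     (\<forall>n. f n holomorphic_on ball 0 1 \<and> (\<forall>z \<in> ball 0 1. cmod (f n z) \<le> 1)) \<and>
     (\<forall>z \<in> ball 0 1. (\<integral>\<xi>. (\<xi> + z) / (\<xi> - z) \<partial>\<sigma>) = (1 + z * f 0 z) / (1 - z * f 0 z)) \<and>
     (\<forall>n. \<forall>z \<in> ball 0 1.
        z * f (Suc n) z = (f n z - f n 0) / (1 - cnj (f n 0) * f n z))"


definition stolz_angle :: "real \<Rightarrow> complex \<Rightarrow> complex set" where
  "stolz_angle \<rho> \<xi> = convex hull (insert \<xi> (ball 0 \<rho>))"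

text \<open>The filter \<open>at \<xi> within _\<close> ignores the value at \<open>\<xi>\<close>, and the rest of the Stolz angle lies
  in the open unit disc.\<close>

definition has_nontangential_limit ::
    "(complex \<Rightarrow> complex) \<Rightarrow> complex \<Rightarrow> complex \<Rightarrow> bool" where
  "has_nontangential_limit f \<xi> l \<longleftrightarrow>
     (\<forall>\<rho> \<in> {0<..<1}. (f \<longlongrightarrow> l) (at \<xi> within stolz_angle \<rho> \<xi>))"

end

theory Submission
  imports Defs "HOL-Real_Asymp.Real_Asymp" "HOL-Computational_Algebra.Fundamental_Theorem_Algebra"
begin

text \<open>
  Write \<open>D\<close> for the Szego function, \<open>d\<close> for its boundary values, \<open>ph
  n\<close> and \<open>ps n\<close> for the orthonormal polynomial and its reversal. In the basis
  \<open>ph 1, ph 2, \<dots>\<close> the reversed polynomial is, up to the factor \<open>sqrt (Cn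
  n)\<close>, a partial sum of one fixed orthonormal series whose coefficients have the size of the
  Schur parameters (\<open>Ps_expansion\<close>). Both hypotheses on the parameters are conditions
  of Menshov type under which the maximal function of the partial sums is square integrable and the
  partial sums converge almost everywhere (\<open>menshov_log\<close>, \<open>menshov_lp\<close>).
  Since \<open>w > 0\<close> almost everywhere (\<open>szego\<close>), this passes from
  \<open>\<sigma>\<close> to Lebesgue measure. As \<open>h n = ps n * d - 1\<close> tends to
  \<open>0\<close> in \<open>L\<^sup>2\<close> (\<open>h_L2_lim\<close>), it tends to
  \<open>0\<close> almost everywhere below an integrable majorant. That is (a); and the weak type
  maximal inequality, applied to \<open>sup\<close> of \<open>\<bar>h n\<bar>\<close> over \<open>n
  \<ge> N\<close>, shows that \<open>ps n * D\<close> tends to \<open>1\<close> uniformly in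
  nontangential regions (\<open>h_poisson_uniform\<close>).

  For the Schur iterates, \<open>Y n = (ps n - z * f n * ph n) * D\<close> has no zeros in the disc
  and satisfies \<open>\<bar>Y n\<bar>\<^sup>2 \<le> 1 - \<bar>z * f n\<bar>\<^sup>2\<close>, so
  \<open>f n\<close> is small where \<open>\<bar>Y n\<bar>\<close> is close to \<open>1\<close>. On
  the circle \<open>ph n * d\<close> equals \<open>z ^ n\<close> times the conjugate of \<open>ps n
  * d\<close> times the phase \<open>d / cnj d\<close>, hence at a Lebesgue point of the phase
  \<open>\<bar>ph n * D\<bar>\<close> is about \<open>\<bar>z\<bar> ^ n\<close>, which is negligible
  when \<open>n * (1 - \<bar>z\<bar>)\<close> is large. Harnack's inequality for \<open>- ln \<bar>Y
  n\<bar>\<close> then reaches all points with \<open>n * (1 - \<bar>z\<bar>) \<ge> \<eta>\<close>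
  (\<open>f_small_deep\<close>); this contains (c).

  Closer to the boundary the Wall polynomials take over: \<open>f 0 = (A + a * f n) / (B + b * f
  n)\<close>. The polynomial \<open>B\<close> dominates the other three in the disc and has no zeros
  there. Moving outwards along a radius by \<open>1 / n\<close> increases the distance to each zero
  of \<open>B\<close> by a factor \<open>1 + O(1 / n)\<close> at most, so \<open>B\<close> is
  controlled by its values at depth \<open>1 / n\<close>, where it is comparable to \<open>ps
  n\<close>. Reflection in the circle extends the bound to a full disc of radius \<open>R /
  n\<close> (\<open>wall_local_bound\<close>). Therefore \<open>f 0 * B - A = f n * (a - f 0 *
  b)\<close> changes little between depth \<open>\<eta> / n\<close> and the boundary, because
  \<open>f 0\<close> has a nontangential limit and \<open>A\<close>, \<open>B\<close> vary slowly on
  the scale \<open>1 / n\<close>. This gives (d) (\<open>f_small\<close>).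

  The same local bound makes \<open>Ps n (\<xi> * (1 + v / n))\<close> a normal family in
  \<open>v\<close>. It converges to a nonzero constant for \<open>v\<close> in an open set, hence
  locally uniformly everywhere, so \<open>ps n\<close> has no zeros within \<open>R / n\<close> of
  \<open>\<xi>\<close>; by reflection neither has \<open>ph n\<close>, which is (b)
  (\<open>zeros_far\<close>).
\<close>

section \<open>Poisson and Cauchy integrals on the circle\<close>

abbreviation cm :: "complex measure" where "cm \<equiv> circle_measure"

abbreviation circle_integral :: "(complex \<Rightarrow> 'a::{banach, second_countable_topology}) \<Rightarrow> 'a" (binder "\<ointegral>" 10) where
  "circle_integral g \<equiv> integral\<^sup>L cm g"

lemmas bint_cong = Bochner_Integration.integral_cong
lemmas bint_diff = Bochner_Integration.integral_diff
lemmas bint_add = Bochner_Integration.integral_add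
lemmas bint_sum = Bochner_Integration.integral_sum
lemmas bint_nonneg_AE = Bochner_Integration.integral_nonneg_AE
lemmas bint_bound = Bochner_Integration.integrable_bound

lemma space_borel_circle [simp]: "space borel_circle = sphere 0 1" by (simp add: borel_circle_def space_restrict_space)

lemma space_cm [simp]: "space cm = sphere 0 1" by (simp add: circle_measure_def)

lemma sets_cm [simp, measurable_cong]: "sets cm = sets borel_circle" by (simp add: circle_measure_def)

lemma sets_borel_circle_iff: "A \<in> sets borel_circle \<longleftrightarrow> A \<in> sets borel \<and> A \<subseteq> sphere 0 1"
proof -
  have "sphere (0::complex) 1 \<in> sets borel" by (simp add: borel_closed)
  then show ?thesis by (auto simp: borel_circle_def sets_restrict_space_iff)
qed

lemma cis_measurable [measurable]: "cis \<in> measurable lborel borel_circle"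
proof -
  have "cis \<in> borel_measurable borel" by (intro borel_measurable_continuous_onI continuous_intros)
  then show ?thesis by (simp add: borel_circle_def measurable_restrict_space2 measurable_lborel1)
qed

lemma cis_measurable_uniform: "cis \<in> measurable (uniform_measure lborel {0..<2 * pi}) borel_circle"
  using cis_measurable by (simp add: measurable_cong_sets[OF sets_uniform_measure refl])

lemma prob_space_cm: "prob_space cm" unfolding circle_measure_def
  by (intro prob_space.prob_space_distr prob_space_uniform_measure cis_measurable_uniform) auto

interpretation cm: prob_space cm by (rule prob_space_cm)

lemma borel_measurable_circle_continuous:
  fixes f :: "complex \<Rightarrow> 'b::topological_space"
  assumes "continuous_on (sphere 0 1) f"
  shows "f \<in> borel_measurable borel_circle" unfolding borel_circle_def by (rule borel_measurable_continuous_on_restrict) fact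

lemma integrable_circle_continuous:
  fixes f :: "complex \<Rightarrow> 'b::{banach, second_countable_topology}"
  assumes "continuous_on (sphere 0 1) f" "finite_measure \<nu>" "sets \<nu> = sets borel_circle"
  shows "integrable \<nu> f"
proof -
  interpret finite_measure \<nu> by fact
  have "bounded (f ` sphere 0 1)" by (intro compact_imp_bounded compact_continuous_image assms) simp
  then obtain B where B: "\<And>x. x \<in> sphere 0 1 \<Longrightarrow> norm (f x) \<le> B" unfolding bounded_iff by blast
  have "f \<in> borel_measurable \<nu>"
    using borel_measurable_circle_continuous[OF assms(1)] measurable_cong_sets[OF assms(3) refl] by blast
  moreover have "space \<nu> = sphere 0 1" using sets_eq_imp_space_eq[OF assms(3)] by simp
  ultimately show ?thesis using B by (intro integrable_const_bound[where B=B]) auto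
qed

lemma integral_cm:
  fixes f :: "complex \<Rightarrow> complex"
  assumes "continuous_on (sphere 0 1) f"
  shows "((\<lambda>t. f (cis t)) has_integral (2 * pi * (\<ointegral>u. f u))) {0..2*pi}"
proof -
  have fm: "f \<in> borel_measurable borel_circle" using assms by (rule borel_measurable_circle_continuous)
  have cont: "continuous_on {0..2*pi} (\<lambda>t. f (cis t))"
    by (rule continuous_on_compose2[OF assms]) (auto intro!: continuous_intros)
  have si: "set_integrable lborel {0..2*pi} (\<lambda>t. f (cis t))" by (rule borel_integrable_atLeastAtMost') fact
  have U: "uniform_measure lborel {0..<2*pi} = density lborel (\<lambda>x. ennreal (indicator {0..<2*pi} x / (2*pi)))"
  proof -
    have "indicator {0..<2 * pi} x / ennreal (2 * pi) = ennreal (indicat_real {0..<2 * pi} x / (2*pi))" for x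
      by (auto simp: indicator_def divide_ennreal[symmetric] simp del: divide_ennreal)
    then show ?thesis by (simp add: uniform_measure_def)
  qed
  have "(\<ointegral>u. f u) = (\<integral>t. f (cis t) \<partial>uniform_measure lborel {0..<2*pi})" unfolding circle_measure_def
    by (rule integral_distr[OF cis_measurable_uniform fm])
  also have "\<dots> = (\<integral>t. (indicat_real {0..<2*pi} t / (2*pi)) *\<^sub>R f (cis t) \<partial>lborel)" unfolding U
    by (rule integral_density) (use fm in \<open>auto intro!: measurable_compose[OF cis_measurable]\<close>)
  also have "\<dots> = (\<integral>t. (1/(2*pi)) *\<^sub>R (indicat_real {0..2*pi} t *\<^sub>R f (cis t)) \<partial>lborel)"
  proof (rule integral_cong_AE)
    have "AE t in lborel. t \<noteq> 2*pi" by (rule AE_lborel_singleton)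
    then show "AE t in lborel. (indicat_real {0..<2*pi} t / (2*pi)) *\<^sub>R f (cis t) =
      (1/(2*pi)) *\<^sub>R (indicat_real {0..2*pi} t *\<^sub>R f (cis t))" by eventually_elim (auto simp: indicator_def)
    have [measurable]: "(\<lambda>t. f (cis t)) \<in> borel_measurable lborel"
      using fm by (rule measurable_compose[OF cis_measurable])
    show "(\<lambda>t. (indicat_real {0..<2*pi} t / (2*pi)) *\<^sub>R f (cis t)) \<in> borel_measurable lborel" by measurable
    show "(\<lambda>t. (1/(2*pi)) *\<^sub>R (indicat_real {0..2*pi} t *\<^sub>R f (cis t))) \<in> borel_measurable lborel"
      by measurable
  qed
  also have "\<dots> = (1/(2*pi)) *\<^sub>R (LINT t:{0..2*pi}|lborel. f (cis t))"
    unfolding set_lebesgue_integral_def by (rule integral_scaleR_right)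
  also have "\<dots> = (1/(2*pi)) *\<^sub>R integral {0..2*pi} (\<lambda>t. f (cis t))"
    using set_borel_integral_eq_integral(2)[OF si] by simp
  finally have "2 * pi * (\<ointegral>u. f u) = integral {0..2*pi} (\<lambda>t. f (cis t))" by (simp add: scaleR_conv_of_real)
  then show ?thesis using set_borel_integral_eq_integral(1)[OF si] by (simp add: has_integral_integral)
qed

lemma circle_inverse: "cmod t = 1 \<Longrightarrow> inverse t = cnj t"
  by (metis complex_div_cnj divide_inverse mult_1 power_one of_real_1 div_by_1)

lemma circle_cnj_mult [simp]: "cmod t = 1 \<Longrightarrow> t * cnj t = 1" "cmod t = 1 \<Longrightarrow> cnj t * t = 1"
  by (simp_all add: complex_norm_square[symmetric] mult.commute)

lemma one_minus_neq_0: "cmod z < 1 \<Longrightarrow> cmod t = 1 \<Longrightarrow> 1 - z * cnj t \<noteq> 0"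
proof
  assume a: "cmod z < 1" "cmod t = 1" "1 - z * cnj t = 0"
  then have "z * cnj t = 1" by simp
  then have "cmod (z * cnj t) = 1" by (metis norm_one)
  with a(1,2) show False unfolding norm_mult by simp
qed

lemma cauchy_cm:
  assumes hol: "u holomorphic_on cball 0 1" and z: "cmod z < 1"
  shows "(\<ointegral>y. u y / (1 - z * cnj y)) = u z"
proof -
  have cont: "continuous_on (sphere 0 1) (\<lambda>y. u y / (1 - z * cnj y))" using holomorphic_on_imp_continuous_on[OF hol] z
    by (intro continuous_intros) (auto intro: continuous_on_subset dest: one_minus_neq_0)
  have "((\<lambda>w. u w / (w - z)) has_contour_integral (2 * of_real pi * \<i> * u z)) (part_circlepath 0 1 0 (2*pi))"
    using Cauchy_integral_circlepath_simple[OF hol, of z] z by (simp add: circlepath_def)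
  then have "((\<lambda>t. u (cis t) / (cis t - z) * \<i> * cis t) has_integral 2 * of_real pi * \<i> * u z) {0..2*pi}"
    by (simp add: has_contour_integral_part_circlepath_iff)
  moreover have "u (cis t) / (cis t - z) * \<i> * cis t = \<i> * (u (cis t) / (1 - z * cnj (cis t)))" for t
  proof -
    have "cis t - z = cis t * (1 - z * cnj (cis t))" by (simp add: algebra_simps cis_cnj cis_mult)
    moreover have "1 - z * cnj (cis t) \<noteq> 0" by (rule one_minus_neq_0) (use z in auto)
    ultimately show ?thesis by simp
  qed
  ultimately have "((\<lambda>t. \<i> * (u (cis t) / (1 - z * cnj (cis t)))) has_integral 2 * of_real pi * \<i> * u z) {0..2*pi}"
    by simp
  moreover have "((\<lambda>t. \<i> * (u (cis t) / (1 - z * cnj (cis t)))) has_integral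
      \<i> * (2 * pi * (\<ointegral>y. u y / (1 - z * cnj y)))) {0..2*pi}" by (intro has_integral_mult_right integral_cm cont)
  ultimately have "2 * of_real pi * \<i> * u z = \<i> * (2 * pi * (\<ointegral>y. u y / (1 - z * cnj y)))"
    by (rule has_integral_unique)
  then show ?thesis by simp
qed

definition pk :: "complex \<Rightarrow> complex \<Rightarrow> real" where
  "pk z t = (1 - (cmod z)^2) / (cmod (t - z))^2"

lemma circle_minus_ge: "cmod t = 1 \<Longrightarrow> 1 - cmod z \<le> cmod (t - z)" using norm_triangle_ineq2[of t z] by simp

lemma circle_minus_pos: "cmod t = 1 \<Longrightarrow> cmod z < 1 \<Longrightarrow> cmod (t - z) > 0"
  using circle_minus_ge[of t z] by linarith

lemma pk_pos: "cmod z < 1 \<Longrightarrow> cmod t = 1 \<Longrightarrow> pk z t > 0"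
  using circle_minus_pos[of t z] by (auto simp: pk_def abs_square_less_1 intro!: divide_pos_pos)

lemma pk_le:
  assumes "cmod z < 1" "cmod t = 1" shows "pk z t \<le> 2 / (1 - cmod z)"
proof -
  have "(1 - cmod z)^2 \<le> (cmod (t - z))^2" using circle_minus_ge[OF assms(2), of z] assms by (intro power_mono) auto
  then have "pk z t \<le> (1 - (cmod z)^2) / (1 - cmod z)^2"
    unfolding pk_def using assms by (intro divide_left_mono) (auto simp: abs_square_le_1 intro!: mult_pos_pos circle_minus_pos)
  also have "\<dots> = (1 + cmod z) / (1 - cmod z)"
  proof -
    have "1 - (cmod z)^2 = (1 + cmod z) * (1 - cmod z)" by (simp add: power2_eq_square algebra_simps)
    then show ?thesis using assms by (simp add: power2_eq_square)
  qed
  also have "\<dots> \<le> 2 / (1 - cmod z)" using assms by (intro divide_right_mono) auto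
  finally show ?thesis .
qed

lemma continuous_on_pk: "cmod z < 1 \<Longrightarrow> continuous_on (sphere 0 1) (pk z)"
  unfolding pk_def by (intro continuous_intros) (auto dest: circle_minus_pos)

lemma pk_measurable [measurable]: "pk z \<in> borel_measurable borel_circle"
proof -
  have "pk z \<in> borel_measurable borel" unfolding pk_def by measurable
  then show ?thesis unfolding borel_circle_def by (rule measurable_restrict_space1)
qed

lemma pk_schwarz:
  assumes "cmod z < 1" "cmod t = 1"
  shows "(t + z) / (t - z) = Complex (pk z t) (Im ((t + z) / (t - z)))"
    and "Re ((t + z) / (t - z)) = pk z t"
proof -
  have "Re ((t + z) / (t - z)) = Re ((t + z) * cnj (t - z)) / (cmod (t - z))^2"
    by (subst complex_div_cnj) (simp flip: of_real_power)
  also have "Re ((t + z) * cnj (t - z)) = (cmod t)^2 - (cmod z)^2"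
    unfolding cmod_power2 by (simp add: algebra_simps power2_eq_square)
  finally show "Re ((t + z) / (t - z)) = pk z t" using assms by (simp add: pk_def)
  then show "(t + z) / (t - z) = Complex (pk z t) (Im ((t + z) / (t - z)))" by (simp add: complex_eq_iff)
qed

text \<open>On the circle the Poisson kernel is the Cauchy kernel times \<open>(1 - \<bar>z\<bar>\<^sup>2) /
  (1 - cnj z * t)\<close>, a holomorphic function of \<open>t\<close> with value \<open>1\<close> at
  \<open>t = z\<close>; Cauchy's formula is applied to the product of \<open>u\<close> with it.\<close>

lemma poisson_cm:
  assumes hol: "u holomorphic_on cball 0 1" and z: "cmod z < 1"
  shows "(\<ointegral>t. pk z t *\<^sub>R u t) = u z"
proof -
  have ne: "1 - cnj z * t \<noteq> 0" if "cmod t \<le> 1" for t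
  proof
    assume "1 - cnj z * t = 0"
    then have "cmod z * cmod t = 1" by (metis complex_mod_cnj eq_iff_diff_eq_0 norm_mult norm_one)
    moreover have "cmod z * cmod t \<le> cmod z" using that by (simp add: mult_left_le)
    ultimately show False using z by simp
  qed
  let ?v = "\<lambda>t. (1 - (cmod z)^2) * u t / (1 - cnj z * t)"
  have "?v holomorphic_on cball 0 1" using hol ne by (intro holomorphic_intros) auto
  from cauchy_cm[OF this z] have "(\<ointegral>t. ?v t / (1 - z * cnj t)) = ?v z" .
  also have "?v z = u z"
  proof -
    have "1 - cnj z * z = of_real (1 - (cmod z)^2)" by (simp add: complex_norm_square[symmetric] mult.commute flip: of_real_power)
    moreover have "of_real (1 - (cmod z)^2) \<noteq> (0::complex)" using z by (simp add: abs_square_eq_1 flip: of_real_power)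
    ultimately show ?thesis by simp
  qed
  also have "(\<ointegral>t. ?v t / (1 - z * cnj t)) = (\<ointegral>t. pk z t *\<^sub>R u t)"
  proof (rule bint_cong)
    fix t assume "t \<in> space cm"
    then have e: "cmod t = 1" by simp
    have "(1 - cnj z * t) * (1 - z * cnj t) = (t - z) * cnj (t - z)" using circle_cnj_mult[OF e] by (simp add: algebra_simps)
    also have "\<dots> = of_real ((cmod (t - z))^2)" by (metis complex_norm_square of_real_power)
    finally show "?v t / (1 - z * cnj t) = pk z t *\<^sub>R u t" by (simp add: pk_def scaleR_conv_of_real)
  qed simp
  finally show ?thesis by simp
qed

lemma pk_integral [simp]: assumes "cmod z < 1" shows "(\<ointegral>t. pk z t) = 1"
proof -
  have "complex_of_real (\<ointegral>t. pk z t) = (\<ointegral>t. pk z t *\<^sub>R (1::complex))" by (simp add: scaleR_conv_of_real)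
  also have "\<dots> = 1" by (rule poisson_cm) (use assms in auto)
  finally show ?thesis by simp
qed

lemma pk_integrable:
  assumes "cmod z < 1" "finite_measure \<nu>" "sets \<nu> = sets borel_circle"
  shows "integrable \<nu> (pk z)" using assms by (intro integrable_circle_continuous continuous_on_pk)

text \<open>Harnack's inequality at the level of kernels, in the form needed later: the ratio is controlled by
  the depths of the two points and their distance relative to the depth of the first.\<close>

lemma pk_harnack:
  assumes z: "cmod z < 1" and z': "cmod z' < 1" and e: "cmod t = 1"
  shows "pk z t \<le> (1 - (cmod z)^2) / (1 - (cmod z')^2) * (1 + cmod (z - z') / (1 - cmod z))^2 * pk z' t"
proof -
  have p: "cmod (t - z) > 0" "cmod (t - z') > 0" using z z' e circle_minus_pos by auto
  have "cmod (t - z') \<le> cmod (t - z) + cmod (z - z')" using norm_triangle_ineq[of "t - z" "z - z'"] by simp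
  also have "cmod (z - z') \<le> cmod (t - z) * (cmod (z - z') / (1 - cmod z))"
    using mult_right_mono[OF circle_minus_ge[OF e, of z], of "cmod (z - z')"] z by (simp add: field_simps)
  finally have "cmod (t - z') \<le> cmod (t - z) * (1 + cmod (z - z') / (1 - cmod z))" by (simp add: algebra_simps)
  then have "(cmod (t - z'))^2 \<le> (cmod (t - z) * (1 + cmod (z - z') / (1 - cmod z)))^2" by (intro power_mono) auto
  then have "1 / (cmod (t - z))^2 \<le> (1 + cmod (z - z') / (1 - cmod z))^2 / (cmod (t - z'))^2"
    using p by (simp add: divide_simps power_mult_distrib mult.commute)
  moreover have "0 < 1 - (cmod z)^2" "0 < 1 - (cmod z')^2" using z z' by (auto simp: abs_square_less_1)
  ultimately have "(1 - (cmod z)^2) * (1 / (cmod (t - z))^2) \<le>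
     (1 - (cmod z)^2) * ((1 + cmod (z - z') / (1 - cmod z))^2 / (cmod (t - z'))^2)" by (intro mult_left_mono) auto
  then show ?thesis using \<open>0 < 1 - (cmod z')^2\<close> by (simp add: pk_def)
qed

section \<open>The maximal inequality and nontangential limits of Poisson integrals\<close>

definition carc :: "complex \<Rightarrow> real \<Rightarrow> complex set" where
  "carc a t = {u \<in> sphere 0 1. dist a u \<le> t}"

lemma carc_sets [measurable]: "carc a t \<in> sets borel_circle"
proof -
  have "carc a t = sphere 0 1 \<inter> cball a t" by (auto simp: carc_def)
  then show ?thesis by (auto simp: sets_borel_circle_iff intro!: sets.Int borel_closed)
qed

lemma emeasure_carc_le:
  assumes a: "cmod a = 1" and t: "t > 0"
  shows "emeasure cm (carc a t) \<le> ennreal (4 * t)"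
proof (cases "t \<le> 1/2")
  case True
  let ?z = "(1 - t) *\<^sub>R a"
  have nz: "cmod ?z = 1 - t" using True a by simp
  then have z: "cmod ?z < 1" using t by simp
  have az: "cmod (a - ?z) = t"
  proof -
    have "a - ?z = t *\<^sub>R a" by (simp add: algebra_simps)
    then show ?thesis using a t by simp
  qed
  have *: "1 / (4 * t) \<le> pk ?z u" if "u \<in> carc a t" for u
  proof -
    have e: "cmod u = 1" "cmod (u - a) \<le> t" using that by (auto simp: carc_def dist_norm norm_minus_commute)
    have "cmod (u - ?z) \<le> 2 * t" using norm_triangle_ineq[of "u - a" "a - ?z"] az e by simp
    then have "(cmod (u - ?z))^2 \<le> (2*t)^2" by (intro power_mono) auto
    moreover have "1 - (cmod ?z)^2 \<ge> t" unfolding nz using True t by (simp add: power2_eq_square algebra_simps)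
    moreover have "cmod (u - ?z) > 0" using circle_minus_pos e z by blast
    moreover have "0 \<le> 1 - (cmod ?z)^2" using z by (simp add: abs_square_le_1)
    ultimately have "t / (2*t)^2 \<le> pk ?z u" unfolding pk_def by (intro frac_le) (auto simp del: norm_scaleR)
    then show ?thesis using t by (simp add: power2_eq_square field_simps)
  qed
  have "measure cm (carc a t) / (4 * t) = (\<ointegral>u. indicator (carc a t) u * (1/(4*t)))"
  proof -
    have "carc a t \<inter> sphere 0 1 = carc a t" by (auto simp: carc_def)
    then show ?thesis by simp
  qed
  also have "\<dots> \<le> (\<ointegral>u. pk ?z u)"
  proof (rule integral_mono)
    show "integrable cm (\<lambda>u. indicator (carc a t) u * (1/(4*t)))"
      by (intro integrable_mult_left integrable_real_indicator) (auto simp: less_top[symmetric])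
    show "integrable cm (pk ?z)" by (rule pk_integrable[OF z]) (simp_all add: cm.finite_measure_axioms)
    fix u assume "u \<in> space cm"
    then show "indicator (carc a t) u * (1/(4*t)) \<le> pk ?z u" using *[of u] pk_pos[OF z, of u] by (auto simp: indicator_def)
  qed
  also have "\<dots> = 1" using z by simp
  finally have "measure cm (carc a t) \<le> 4 * t" using t by (simp add: field_simps)
  then show ?thesis by (simp add: cm.emeasure_eq_measure ennreal_leI)
next
  case False
  then have "measure cm (carc a t) \<le> 4 * t" using cm.prob_le_1[of "carc a t"] by linarith
  then show ?thesis by (simp add: cm.emeasure_eq_measure ennreal_leI)
qed

text \<open>The measure has Hardy-Littlewood maximal function at most \<open>l\<close> at the point, up to a
  constant. Arcs are cut out by Euclidean discs, so that the covering lemma for balls in the plane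
  applies to them.\<close>

definition arc_growth :: "complex measure \<Rightarrow> real \<Rightarrow> complex \<Rightarrow> bool" where
  "arc_growth \<nu> l x \<longleftrightarrow> (\<forall>t>0. emeasure \<nu> (carc x t) \<le> ennreal (l * t))"

text \<open>The Hardy-Littlewood maximal theorem. Points where the growth condition fails are centres of arcs
  with large \<open>\<nu>\<close>-measure; a Vitali subfamily is disjoint, which bounds the sum of
  the radii, and its fivefold enlargement covers the exceptional set.\<close>

lemma arc_growth_weak_type:
  assumes fin: "finite_measure \<nu>" and sets: "sets \<nu> = sets borel_circle" and l: "l > 0"
  shows "\<exists>A\<in>sets cm. emeasure cm A \<le> ennreal (20 / l * measure \<nu> (sphere 0 1)) \<and>
           (\<forall>u\<in>sphere 0 1 - A. arc_growth \<nu> l u)"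
proof -
  interpret finite_measure \<nu> by fact
  have sp: "space \<nu> = sphere 0 1" using sets_eq_imp_space_eq[OF sets] by simp
  have cs [measurable]: "carc a t \<in> sets \<nu>" for a t by (simp add: sets)
  define K where "K = {p. cmod (fst p) = 1 \<and> snd p > 0 \<and> measure \<nu> (carc (fst p) (snd p)) > l * snd p}"
  have bd: "0 < snd p \<and> snd p \<le> measure \<nu> (sphere 0 1) / l" if "p \<in> K" for p
  proof -
    have "l * snd p \<le> measure \<nu> (sphere 0 1)" using that bounded_measure[of "carc (fst p) (snd p)"] by (auto simp: K_def sp)
    then show ?thesis using l that by (auto simp: K_def field_simps)
  qed
  \<comment> \<open>Vitali: disjoint balls whose fivefold enlargements cover all bad arcs.\<close>
  obtain C where C: "countable C" "C \<subseteq> K"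
     "pairwise (\<lambda>i j. disjnt (cball (fst i) (snd i)) (cball (fst j) (snd j))) C"
     "\<And>i. i \<in> K \<Longrightarrow> \<exists>j. j \<in> C \<and> \<not> disjnt (cball (fst i) (snd i)) (cball (fst j) (snd j)) \<and>
                        cball (fst i) (snd i) \<subseteq> ball (fst j) (5 * snd j)"
    using Vitali_covering_lemma_cballs_balls[of K snd "measure \<nu> (sphere 0 1) / l" fst] bd by blast
  define idx where "idx = to_nat_on C"
  have inj: "inj_on idx C" unfolding idx_def using C(1) by (rule inj_on_to_nat_on)
  define X where "X n = (if n \<in> idx ` C then carc (fst (the_inv_into C idx n)) (snd (the_inv_into C idx n)) else {})" for n
  define Y where "Y n = (if n \<in> idx ` C then carc (fst (the_inv_into C idx n)) (5 * snd (the_inv_into C idx n)) else {})" for n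
  define A where "A = (\<Union>n. Y n)"
  have Cn: "the_inv_into C idx n \<in> C" if "n \<in> idx ` C" for n by (rule the_inv_into_into[OF inj that]) simp
  have disj: "disjoint_family X" unfolding disjoint_family_on_def
  proof (intro ballI impI)
    fix m n :: nat assume "m \<noteq> n"
    show "X m \<inter> X n = {}"
    proof (cases "m \<in> idx ` C \<and> n \<in> idx ` C")
      case True
      then have "the_inv_into C idx m \<noteq> the_inv_into C idx n"
        using \<open>m \<noteq> n\<close> by (metis f_the_inv_into_f inj)
      then have "disjnt (cball (fst (the_inv_into C idx m)) (snd (the_inv_into C idx m)))
         (cball (fst (the_inv_into C idx n)) (snd (the_inv_into C idx n)))" using C(3) Cn True by (auto simp: pairwise_def)
      then show ?thesis using True by (auto simp: X_def carc_def disjnt_def)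
    qed (auto simp: X_def)
  qed
  have YX: "emeasure cm (Y n) \<le> ennreal (20 / l) * emeasure \<nu> (X n)" for n
  proof (cases "n \<in> idx ` C")
    case True
    define p where "p = the_inv_into C idx n"
    have p: "p \<in> K" using Cn[OF True] C(2) by (auto simp: p_def)
    have "emeasure cm (Y n) \<le> ennreal (4 * (5 * snd p))"
      using emeasure_carc_le[of "fst p" "5 * snd p"] p True by (auto simp: Y_def p_def K_def)
    also have "\<dots> \<le> ennreal (20 / l * measure \<nu> (carc (fst p) (snd p)))"
      using p l by (intro ennreal_leI) (auto simp: K_def field_simps)
    also have "\<dots> = ennreal (20/l) * emeasure \<nu> (X n)"
      using True l by (simp add: X_def p_def emeasure_eq_measure ennreal_mult'[symmetric])
    finally show ?thesis .
  qed (simp add: Y_def)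
  have Ys: "Y n \<in> sets cm" and Xs: "X n \<in> sets \<nu>" for n by (auto simp: Y_def X_def sets)
  have "emeasure cm A \<le> (\<Sum>n. emeasure cm (Y n))" unfolding A_def by (rule emeasure_subadditive_countably) (use Ys in auto)
  also have "\<dots> \<le> (\<Sum>n. ennreal (20 / l) * emeasure \<nu> (X n))" by (intro suminf_le YX) auto
  also have "\<dots> = ennreal (20 / l) * emeasure \<nu> (\<Union>n. X n)"
    by (subst ennreal_suminf_cmult, subst suminf_emeasure) (use disj Xs in auto)
  also have "\<dots> \<le> ennreal (20 / l) * emeasure \<nu> (space \<nu>)" by (intro mult_left_mono emeasure_space) auto
  also have "\<dots> = ennreal (20 / l * measure \<nu> (sphere 0 1))"
    using l by (simp add: sp emeasure_eq_measure ennreal_mult'[symmetric])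
  finally have 1: "emeasure cm A \<le> ennreal (20 / l * measure \<nu> (sphere 0 1))" .
  have 2: "arc_growth \<nu> l u" if x: "u \<in> sphere 0 1 - A" for u unfolding arc_growth_def
  proof (intro allI impI, rule ccontr)
    fix t :: real assume t: "t > 0" and "\<not> emeasure \<nu> (carc u t) \<le> ennreal (l * t)"
    then have "(u, t) \<in> K" using x l by (auto simp: K_def emeasure_eq_measure not_le ennreal_less_iff)
    then obtain j where j: "j \<in> C" "cball u t \<subseteq> ball (fst j) (5 * snd j)" using C(4)[of "(u, t)"] by auto
    have "idx j \<in> idx ` C" "the_inv_into C idx (idx j) = j" using j(1) inj by (auto simp: the_inv_into_f_f)
    moreover have "u \<in> ball (fst j) (5 * snd j)" using j(2) t by (meson centre_in_cball less_imp_le subsetD)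
    ultimately have "u \<in> Y (idx j)" using x by (auto simp: Y_def carc_def)
    then show False using x by (auto simp: A_def)
  qed
  show ?thesis using 1 2 Ys by (intro bexI[of _ A]) (auto simp: A_def)
qed

text \<open>A Stolz angle without its vertex lies in such a region (next lemma), and this description by an
  inequality between the distance and the depth is the one that estimates use. The vertex is not a
  member.\<close>

definition ntr :: "real \<Rightarrow> complex \<Rightarrow> complex set" where
  "ntr C x = {z. cmod z < 1 \<and> cmod (z - x) \<le> C * (1 - cmod z)}"

lemma stolz_angle_subset_ntr:
  assumes \<rho>: "0 < \<rho>" "\<rho> < 1" and x: "cmod s = 1"
  shows "stolz_angle \<rho> s - {s} \<subseteq> ntr (2 / (1 - \<rho>)) s"
proof
  fix z assume z: "z \<in> stolz_angle \<rho> s - {s}"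
  have ne: "ball (0::complex) \<rho> \<noteq> {}" using \<rho> by simp
  have "z \<in> {(1 - u) *\<^sub>R s + u *\<^sub>R y |u y. 0 \<le> u \<and> u \<le> 1 \<and> y \<in> convex hull (ball 0 \<rho>)}"
    using z convex_hull_insert_alt[of s "ball 0 \<rho>"] ne by (auto simp: stolz_angle_def)
  then obtain u y where u: "0 \<le> u" "u \<le> 1" "cmod y < \<rho>" "z = (1 - u) *\<^sub>R s + u *\<^sub>R y"
    by (auto simp: convex_hull_eq[THEN iffD2, OF convex_ball])
  have "u \<noteq> 0" using u z by auto
  then have u0: "u > 0" using u by simp
  have "cmod z \<le> cmod ((1 - u) *\<^sub>R s) + cmod (u *\<^sub>R y)" unfolding u(4) by (rule norm_triangle_ineq)
  also have "\<dots> = (1 - u) + u * cmod y" using u x by simp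
  also have "\<dots> \<le> (1 - u) + u * \<rho>" using u by (intro add_left_mono mult_left_mono) auto
  finally have 1: "u * (1 - \<rho>) \<le> 1 - cmod z" by (simp add: algebra_simps)
  have "z - s = u *\<^sub>R (y - s)" unfolding u(4) by (simp add: algebra_simps)
  then have "cmod (z - s) = u * cmod (y - s)" using u by simp
  also have "\<dots> \<le> u * 2" using norm_triangle_ineq4[of y s] u x \<rho> by (intro mult_left_mono) auto
  also have "\<dots> = 2 / (1 - \<rho>) * (u * (1 - \<rho>))" using \<rho> by simp
  also have "\<dots> \<le> 2 / (1 - \<rho>) * (1 - cmod z)" using 1 \<rho> by (intro mult_left_mono) auto
  finally have "cmod (z - s) \<le> 2 / (1 - \<rho>) * (1 - cmod z)" .
  moreover have "0 < u * (1 - \<rho>)" using u0 \<rho> by simp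
  then have "cmod z < 1" using 1 by linarith
  ultimately show "z \<in> ntr (2 / (1 - \<rho>)) s" by (simp add: ntr_def)
qed

text \<open>The Poisson maximal function is bounded by the Hardy-Littlewood one: on the dyadic arcs of radius
  \<open>2 ^ k * (1 + C) * \<delta>\<close>, where \<open>\<delta>\<close> is the depth of
  \<open>z\<close>, the kernel is at most \<open>8 / (4 ^ k * \<delta>)\<close>, and the resulting
  bounds form a geometric series.\<close>

lemma pk_arc_growth:
  assumes sets: "sets \<nu> = sets borel_circle" and HL: "arc_growth \<nu> l s" and x: "cmod s = 1"
    and z: "z \<in> ntr C s" and C: "C \<ge> 0" and l: "l \<ge> 0"
  shows "(\<integral>\<^sup>+u. ennreal (pk z u) \<partial>\<nu>) \<le> ennreal (16 * (1 + C) * l)"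
proof -
  have sp: "space \<nu> = sphere 0 1" using sets_eq_imp_space_eq[OF sets] by simp
  define \<delta> where "\<delta> = 1 - cmod z"
  have d: "\<delta> > 0" and zd: "cmod (z - s) \<le> C * \<delta>" using z by (auto simp: ntr_def \<delta>_def)
  define r where "r k = 2 ^ k * (1 + C) * \<delta>" for k :: nat
  define c where "c k = 8 / (4 ^ k * \<delta>)" for k :: nat
  have rpos: "r k > 0" for k using d C by (simp add: r_def)
  have cpos: "c k > 0" for k using d by (simp add: c_def)
  have ptw: "\<exists>k. u \<in> carc s (r k) \<and> pk z u \<le> c k" if e: "cmod u = 1" for u
  proof -
    have "\<exists>k. 2 < 2 ^ k * ((1 + C) * \<delta>)"
    proof -
      obtain k where "2 / ((1 + C) * \<delta>) < 2 ^ k" using real_arch_pow[of 2] by auto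
      moreover have "0 < (1 + C) * \<delta>" using d C by simp
      ultimately have "2 < 2 ^ k * ((1 + C) * \<delta>)" by (simp only: pos_divide_less_eq)
      then show ?thesis by blast
    qed
    then obtain k0 where "2 < r k0" by (auto simp: r_def mult.assoc)
    moreover have "dist s u \<le> 2" using e x norm_triangle_ineq4[of s u] by (simp add: dist_norm)
    ultimately have ex: "\<exists>k. dist s u \<le> r k" by (auto intro: exI[of _ k0])
    define k where "k = (LEAST k. dist s u \<le> r k)"
    have k: "dist s u \<le> r k" unfolding k_def using ex by (rule LeastI_ex)
    have "cmod (u - s) \<le> cmod (u - z) + cmod (z - s)" using norm_triangle_ineq[of "u - z" "z - s"] by simp
    also have "\<dots> \<le> cmod (u - z) + C * cmod (u - z)"
      using zd mult_left_mono[OF circle_minus_ge[OF e, of z] C] by (simp add: \<delta>_def)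
    finally have ez: "cmod (u - s) \<le> (1 + C) * cmod (u - z)" by (simp add: algebra_simps)
    have num: "1 - (cmod z)^2 \<le> 2 * \<delta>" "0 \<le> 1 - (cmod z)^2"
      using zero_le_power2[of "1 - cmod z"] d by (simp_all add: \<delta>_def power2_diff abs_square_le_1)
    have "pk z u \<le> c k"
    proof (cases k)
      case 0
      have "pk z u \<le> 2 / \<delta>" using pk_le[of z u] e d by (simp add: \<delta>_def)
      also have "\<dots> \<le> c k" using d 0 by (simp add: c_def divide_right_mono)
      finally show ?thesis .
    next
      case (Suc j)
      have "\<not> dist s u \<le> r j" unfolding k_def[symmetric] using not_less_Least[of j "\<lambda>k. dist s u \<le> r k"] Suc by (simp add: k_def)
      then have "r j < (1 + C) * cmod (u - z)" using ez by (simp add: dist_norm norm_minus_commute)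
      then have "(1 + C) * (2 ^ j * \<delta>) < (1 + C) * cmod (u - z)" by (simp add: r_def algebra_simps)
      then have "2 ^ j * \<delta> < cmod (u - z)" using C by simp
      then have "(2 ^ j * \<delta>)^2 \<le> (cmod (u - z))^2" using d by (intro power_mono) auto
      then have "pk z u \<le> 2 * \<delta> / (2 ^ j * \<delta>)^2" unfolding pk_def using num d by (intro frac_le) auto
      also have "\<dots> = c k" using d Suc by (simp add: c_def power2_eq_square field_simps power_mult_distrib[symmetric])
      finally show ?thesis .
    qed
    then show ?thesis using k e by (intro exI[of _ k]) (auto simp: carc_def)
  qed
  have "(\<integral>\<^sup>+u. ennreal (pk z u) \<partial>\<nu>) \<le> (\<integral>\<^sup>+u. (\<Sum>k. ennreal (c k) * indicator (carc s (r k)) u) \<partial>\<nu>)"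
  proof (rule nn_integral_mono)
    fix u assume "u \<in> space \<nu>"
    then obtain k where k: "u \<in> carc s (r k)" "pk z u \<le> c k" using ptw[of u] sp by auto
    have "ennreal (pk z u) \<le> ennreal (c k) * indicator (carc s (r k)) u" using k by (simp add: ennreal_leI)
    also have "\<dots> \<le> (\<Sum>k. ennreal (c k) * indicator (carc s (r k)) u)"
    proof -
      let ?f = "\<lambda>k. ennreal (c k) * indicator (carc s (r k)) u :: ennreal"
      have "sum ?f {k} \<le> suminf ?f" by (rule sum_le_suminf) auto
      then show ?thesis by (simp only: sum.insert finite.emptyI empty_iff sum.empty add_0_right not_False_eq_True)
    qed
    finally show "ennreal (pk z u) \<le> (\<Sum>k. ennreal (c k) * indicator (carc s (r k)) u)" .
  qed
  also have "\<dots> = (\<Sum>k. ennreal (c k) * emeasure \<nu> (carc s (r k)))"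
  proof -
    have cs [measurable]: "carc s t \<in> sets \<nu>" for t by (simp add: sets)
    have "(\<integral>\<^sup>+u. (\<Sum>k. ennreal (c k) * indicator (carc s (r k)) u) \<partial>\<nu>) =
        (\<Sum>k. \<integral>\<^sup>+u. ennreal (c k) * indicator (carc s (r k)) u \<partial>\<nu>)"
      by (rule nn_integral_suminf) measurable
    also have "\<dots> = (\<Sum>k. ennreal (c k) * emeasure \<nu> (carc s (r k)))"
      by (simp only: nn_integral_cmult_indicator[OF cs])
    finally show ?thesis .
  qed
  also have "\<dots> \<le> (\<Sum>k. ennreal ((8 * (1 + C) * l) * (1/2) ^ k))"
  proof (intro suminf_le)
    fix k
    have "ennreal (c k) * emeasure \<nu> (carc s (r k)) \<le> ennreal (c k) * ennreal (l * r k)"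
      using HL rpos by (intro mult_left_mono) (auto simp: arc_growth_def)
    also have "\<dots> = ennreal (c k * (l * r k))" by (rule ennreal_mult'[symmetric]) (use cpos[of k] in simp)
    also have "c k * (l * r k) = (8 * (1 + C) * l) * (1/2) ^ k"
    proof -
      have "(4::real) ^ k = 2 ^ k * 2 ^ k" by (simp flip: power_mult_distrib)
      then show ?thesis using d by (simp add: c_def r_def field_simps power_divide)
    qed
    finally show "ennreal (c k) * emeasure \<nu> (carc s (r k)) \<le> ennreal ((8 * (1 + C) * l) * (1/2) ^ k)" .
  qed auto
  also have "\<dots> = ennreal (\<Sum>k. (8 * (1 + C) * l) * (1/2) ^ k)"
    using C l by (intro suminf_ennreal2) (auto intro!: summable_mult)
  also have "(\<Sum>k. (8 * (1 + C) * l) * (1/2) ^ k) = 16 * (1 + C) * l" by (subst suminf_mult) (auto simp: suminf_geometric)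
  finally show ?thesis .
qed

lemma weak_type_measure:
  assumes fin: "finite_measure \<nu>" and sets: "sets \<nu> = sets borel_circle" and l: "l > 0"
  shows "\<exists>A\<in>sets cm. emeasure cm A \<le> ennreal (20 / l * measure \<nu> (sphere 0 1)) \<and>
           (\<forall>x\<in>sphere 0 1 - A. \<forall>C\<ge>0. \<forall>z\<in>ntr C x. (\<integral>\<^sup>+t. ennreal (pk z t) \<partial>\<nu>) \<le> ennreal (16 * (1 + C) * l))"
proof -
  obtain A where "A\<in>sets cm" "emeasure cm A \<le> ennreal (20 / l * measure \<nu> (sphere 0 1))"
     "\<And>x. x \<in> sphere 0 1 - A \<Longrightarrow> arc_growth \<nu> l x" using arc_growth_weak_type[OF assms] by blast
  then show ?thesis using l by (intro bexI[of _ A] conjI ballI allI impI pk_arc_growth[OF sets]) auto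
qed

lemma integrable_pk_scaleR:
  fixes g :: "complex \<Rightarrow> 'b::{banach, second_countable_topology}"
  assumes z: "cmod z < 1" and g: "integrable cm g"
  shows "integrable cm (\<lambda>t. pk z t *\<^sub>R g t)"
proof (rule bint_bound)
  show "integrable cm (\<lambda>t. 2 / (1 - cmod z) * norm (g t))" using g by simp
  show "(\<lambda>t. pk z t *\<^sub>R g t) \<in> borel_measurable cm" using borel_measurable_integrable[OF g] by measurable
  show "AE t in cm. norm (pk z t *\<^sub>R g t) \<le> norm (2 / (1 - cmod z) * norm (g t))"
  proof (rule AE_I2)
    fix t assume "t \<in> space cm"
    then show "norm (pk z t *\<^sub>R g t) \<le> norm (2 / (1 - cmod z) * norm (g t))"
      using pk_pos[OF z, of t] pk_le[OF z, of t] mult_right_mono[of "pk z t" "2 / (1 - cmod z)" "norm (g t)"] z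
      by (simp add: abs_of_pos)
  qed
qed

lemma weak_type_fun:
  fixes g :: "complex \<Rightarrow> 'b::{banach, second_countable_topology}"
  assumes g: "integrable cm g" and l: "l > 0"
  shows "\<exists>A\<in>sets cm. emeasure cm A \<le> ennreal (20 / l * (\<ointegral>t. norm (g t))) \<and>
           (\<forall>x\<in>sphere 0 1 - A. \<forall>C\<ge>0. \<forall>z\<in>ntr C x. (\<ointegral>t. pk z t * norm (g t)) \<le> 16 * (1 + C) * l)"
proof -
  define \<nu> where "\<nu> = density cm (\<lambda>t. ennreal (norm (g t)))"
  have [measurable]: "g \<in> borel_measurable borel_circle" using borel_measurable_integrable[OF g] by simp
  have sets: "sets \<nu> = sets borel_circle" by (simp add: \<nu>_def)
  have sp: "space \<nu> = sphere 0 1" by (simp add: \<nu>_def)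
  have tot: "emeasure \<nu> (sphere 0 1) = ennreal (\<ointegral>t. norm (g t))"
  proof -
    have "emeasure \<nu> (space cm) = (\<integral>\<^sup>+t. ennreal (norm (g t)) \<partial>cm)"
      unfolding \<nu>_def by (subst emeasure_density) (auto intro!: nn_integral_cong simp: sets.top[of cm, simplified] indicator_def)
    also have "\<dots> = ennreal (\<ointegral>t. norm (g t))" using g by (intro nn_integral_eq_integral) auto
    finally show ?thesis by simp
  qed
  have fin: "finite_measure \<nu>" by (rule finite_measureI) (simp add: sp tot)
  have m: "measure \<nu> (sphere 0 1) = (\<ointegral>t. norm (g t))" using tot by (simp add: measure_def)
  obtain A where A: "A\<in>sets cm" "emeasure cm A \<le> ennreal (20 / l * (\<ointegral>t. norm (g t)))"
     "\<And>x C z. x\<in>sphere 0 1 - A \<Longrightarrow> C \<ge> 0 \<Longrightarrow> z\<in>ntr C x \<Longrightarrow> (\<integral>\<^sup>+t. ennreal (pk z t) \<partial>\<nu>) \<le> ennreal (16 * (1 + C) * l)"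
    using weak_type_measure[OF fin sets l] unfolding m by blast
  have "(\<ointegral>t. pk z t * norm (g t)) \<le> 16 * (1 + C) * l" if "x\<in>sphere 0 1 - A" "C \<ge> 0" "z\<in>ntr C x" for x C z
  proof -
    have z: "cmod z < 1" using that by (simp add: ntr_def)
    have "ennreal (\<ointegral>t. pk z t * norm (g t)) = (\<integral>\<^sup>+t. ennreal (pk z t * norm (g t)) \<partial>cm)"
      using integrable_pk_scaleR[OF z integrable_norm[OF g]] pk_pos[OF z]
      by (intro nn_integral_eq_integral[symmetric]) (auto intro!: AE_I2 mult_nonneg_nonneg simp: less_imp_le)
    also have "\<dots> = (\<integral>\<^sup>+t. ennreal (pk z t) \<partial>\<nu>)"
      unfolding \<nu>_def by (subst nn_integral_density) (auto intro!: nn_integral_cong simp: ennreal_mult' ennreal_mult'' mult.commute)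
    also have "\<dots> \<le> ennreal (16 * (1 + C) * l)" using A(3) that by blast
    finally show ?thesis using that l by (subst (asm) ennreal_le_iff) auto
  qed
  then show ?thesis using A(1,2) by blast
qed

lemma AE_small:
  assumes "\<And>e. e > 0 \<Longrightarrow> \<exists>A\<in>sets cm. emeasure cm A \<le> ennreal e \<and> (\<forall>x\<in>sphere 0 1 - A. P x)"
  shows "AE x in cm. P x"
proof -
  have "\<forall>n::nat. \<exists>A\<in>sets cm. emeasure cm A \<le> ennreal (1 / Suc n) \<and> (\<forall>x\<in>sphere 0 1 - A. P x)"
    using assms by simp
  then obtain A where A: "\<And>n::nat. A n \<in> sets cm" "\<And>n. emeasure cm (A n) \<le> ennreal (1 / Suc n)"
      "\<And>n x. x\<in>sphere 0 1 - A n \<Longrightarrow> P x" by metis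
  have "emeasure cm (\<Inter>n. A n) \<le> ennreal (1 / Suc n)" for n
    using emeasure_mono[OF _ A(1), of "\<Inter>n. A n" n] A(2)[of n] by (meson INT_lower UNIV_I order_trans)
  moreover have "(\<lambda>n. ennreal (1 / Suc n)) \<longlonglongrightarrow> ennreal 0"
    by (intro tendsto_ennrealI LIMSEQ_Suc lim_1_over_n[unfolded inverse_eq_divide])
  ultimately have "emeasure cm (\<Inter>n. A n) \<le> 0" by (intro LIMSEQ_le_const[of "\<lambda>n. ennreal (1 / Suc n)"]) auto
  then have "(\<Inter>n. A n) \<in> null_sets cm" using A(1) by (auto simp: null_sets_def)
  then show ?thesis by (rule AE_I') (use A(3) in auto)
qed

text \<open>Inner regularity is available for measures on all of the plane, so the measure is pushed forward
  along the inclusion of the circle.\<close>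

lemma circle_inner_regular:
  assumes fin: "finite_measure \<nu>" and sets: "sets \<nu> = sets borel_circle" and B: "B \<in> sets borel_circle" and e: "e > 0"
  shows "\<exists>K. compact K \<and> K \<subseteq> B \<and> measure \<nu> (B - K) \<le> e"
proof -
  interpret finite_measure \<nu> by fact
  let ?M = "distr \<nu> borel (\<lambda>x. x)"
  have meas: "(\<lambda>x. x) \<in> measurable \<nu> borel"
    by (subst measurable_cong_sets[OF sets refl]) (simp add: borel_circle_def measurable_restrict_space1)
  have sp: "space \<nu> = sphere 0 1" using sets_eq_imp_space_eq[OF sets] by simp
  have Bb: "B \<in> sets borel" "B \<subseteq> sphere 0 1" using B by (auto simp: sets_borel_circle_iff)
  have em: "emeasure ?M X = emeasure \<nu> X" if "X \<in> sets borel" "X \<subseteq> sphere 0 1" for X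
    using that by (subst emeasure_distr[OF meas]) (auto simp: sp Int_absorb2)
  have "emeasure ?M (space ?M) \<noteq> \<infinity>" using emeasure_distr[OF meas, of UNIV] by simp
  then have "emeasure ?M B = (SUP K \<in> {K. K \<subseteq> B \<and> compact K}. emeasure ?M K)" by (intro inner_regular Bb) auto
  then have S: "emeasure \<nu> B = (SUP K \<in> {K. K \<subseteq> B \<and> compact K}. emeasure ?M K)" using em Bb by simp
  have "\<exists>K\<in>{K. K \<subseteq> B \<and> compact K}. emeasure \<nu> B < emeasure ?M K + ennreal e"
    using e by (intro SUP_approx_ennreal[OF _ _ S]) auto
  then obtain K where K: "K \<subseteq> B" "compact K" "emeasure \<nu> B < emeasure ?M K + ennreal e" by blast
  have Ks: "K \<in> sets \<nu>" "emeasure ?M K = emeasure \<nu> K"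
    using K Bb by (auto simp: sets sets_borel_circle_iff intro!: em borel_compact)
  have "measure \<nu> B < measure \<nu> K + e"
    using K(3) e unfolding Ks(2) by (simp add: emeasure_eq_measure ennreal_plus[symmetric] ennreal_less_iff del: ennreal_plus)
  moreover have "measure \<nu> (B - K) = measure \<nu> B - measure \<nu> K"
    using K Ks B by (intro finite_measure_Diff) (auto simp: sets)
  ultimately show ?thesis using K by (intro exI[of _ K]) auto
qed

text \<open>Induction over integrable functions. For an indicator, Urysohn's lemma separates compact sets that
  nearly exhaust the set and its complement.\<close>

lemma continuous_dense_cm:
  fixes g :: "complex \<Rightarrow> complex"
  assumes "integrable cm g"
  shows "\<forall>e>0. \<exists>k. continuous_on UNIV k \<and> (\<ointegral>t. norm (g t - k t)) \<le> e" using assms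
proof (induction rule: integrable_induct)
  case (base A c)
  show ?case
  proof (intro allI impI)
    fix e :: real assume e: "e > 0"
    define e' where "e' = e / (2 * (norm c + 1))"
    have e': "e' > 0"
    proof -
      have "0 < 2 * (norm c + 1)" using norm_ge_zero[of c] by (simp only: zero_less_mult_iff) linarith
      then show ?thesis unfolding e'_def using e by (intro divide_pos_pos)
    qed
    have A: "A \<in> sets borel_circle" "sphere 0 1 - A \<in> sets borel_circle" using base(1) sets.compl_sets[OF base(1)] by auto
    obtain K where K: "compact K" "K \<subseteq> A" "measure cm (A - K) \<le> e'"
      using circle_inner_regular[OF cm.finite_measure_axioms _ A(1) e'] by auto
    obtain L where L: "compact L" "L \<subseteq> sphere 0 1 - A" "measure cm (sphere 0 1 - A - L) \<le> e'"
      using circle_inner_regular[OF cm.finite_measure_axioms _ A(2) e'] by auto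
    have "closed K" "closed L" "K \<inter> L = {}" using K L by (auto simp: compact_imp_closed)
    then obtain f :: "complex \<Rightarrow> real" where f: "continuous_on UNIV f" "\<And>x. f x \<in> closed_segment 1 0"
        "\<And>x. x \<in> K \<Longrightarrow> f x = 1" "\<And>x. x \<in> L \<Longrightarrow> f x = 0"
      using Urysohn[of K L "1::real" 0] by metis
    have KL: "K \<in> sets cm" "L \<in> sets cm" using K L A by (auto simp: sets_borel_circle_iff borel_compact)
    let ?R = "(A - K) \<union> (sphere 0 1 - A - L)"
    have Rs: "A - K \<in> sets cm" "sphere 0 1 - A - L \<in> sets cm" using KL A by auto
    have fm[measurable]: "f \<in> borel_measurable borel_circle"
      using f(1) by (intro borel_measurable_circle_continuous) (auto intro: continuous_on_subset)
    have bd: "norm (indicator A t *\<^sub>R c - f t *\<^sub>R c) \<le> norm c * indicator ?R t" if "cmod t = 1" for t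
    proof -
      have fr: "0 \<le> f t" "f t \<le> 1" using f(2)[of t] by (auto simp: closed_segment_eq_real_ivl)
      have "norm (indicator A t *\<^sub>R c - f t *\<^sub>R c) = \<bar>indicator A t - f t\<bar> * norm c"
        by (simp flip: scaleR_diff_left)
      also have "\<bar>indicator A t - f t\<bar> \<le> indicator ?R t" using fr f(3,4) that K(2) L(2) by (auto simp: indicator_def)
      finally show ?thesis by (simp add: mult.commute mult_right_mono)
    qed
    have int: "integrable cm (\<lambda>t. norm c * indicator ?R t)" using Rs
      by (intro integrable_mult_right integrable_real_indicator) (auto simp: less_top[symmetric])
    have "(\<ointegral>t. norm (indicator A t *\<^sub>R c - f t *\<^sub>R c)) \<le> (\<ointegral>t. norm c * indicator ?R t)"
    proof (rule integral_mono)
      have [measurable]: "A \<in> sets borel_circle" by fact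
      show "integrable cm (\<lambda>t. norm (indicator A t *\<^sub>R c - f t *\<^sub>R c))"
        by (rule bint_bound[OF int]) (auto simp: bd)
    qed (use int bd in auto)
    also have "\<dots> = norm c * measure cm ?R"
    proof -
      have "?R \<inter> sphere 0 1 = ?R" using sets.sets_into_space[OF Rs(1)] by auto
      moreover have "measure cm (?R \<inter> space cm) = measure cm ?R" using calculation by simp
      ultimately show ?thesis by (simp only: integral_mult_right_zero Bochner_Integration.integral_indicator)
    qed
    also have "\<dots> \<le> norm c * (e' + e')"
      using K(3) L(3) Rs by (intro mult_left_mono order_trans[OF measure_Un_le[OF Rs]]) auto
    also have "\<dots> \<le> (norm c + 1) * (2 * e')" using e' by (simp add: algebra_simps)
    also have "\<dots> = e" by (simp add: e'_def field_simps add_nonneg_eq_0_iff)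
    finally show "\<exists>k. continuous_on UNIV k \<and> (\<ointegral>t. norm (indicator A t *\<^sub>R c - k t)) \<le> e"
      using f(1) by (intro exI[of _ "\<lambda>t. f t *\<^sub>R c"]) (auto intro!: continuous_intros)
  qed
next
  case (add f g)
  show ?case
  proof (intro allI impI)
    fix e :: real assume e: "e > 0"
    then have e2: "e / 2 > 0" by simp
    obtain k where k: "continuous_on UNIV k" "(\<ointegral>t. norm (f t - k t)) \<le> e/2" using add(3) e2 by blast
    obtain h where h: "continuous_on UNIV h" "(\<ointegral>t. norm (g t - h t)) \<le> e/2" using add(4) e2 by blast
    have ik: "integrable cm k" "integrable cm h"
      using k h by (auto intro!: integrable_circle_continuous intro: continuous_on_subset cm.finite_measure_axioms)
    have "(\<ointegral>t. norm (f t + g t - (k t + h t))) \<le> (\<ointegral>t. norm (f t - k t) + norm (g t - h t))"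
      using add(1,2) ik by (intro integral_mono) (auto intro!: norm_triangle_le simp: add_diff_add norm_triangle_ineq)
    also have "\<dots> \<le> e" using add(1,2) ik k(2) h(2) by simp
    finally show "\<exists>k. continuous_on UNIV k \<and> (\<ointegral>t. norm (f t + g t - k t)) \<le> e"
      using k h by (intro exI[of _ "\<lambda>t. k t + h t"]) (auto intro!: continuous_intros)
  qed
next
  case (lim f s)
  show ?case
  proof (intro allI impI)
    fix e :: real assume e: "e > 0"
    have "(\<lambda>i. \<ointegral>t. norm (f t - s i t)) \<longlonglongrightarrow> (\<ointegral>t. 0)"
    proof (rule integral_dominated_convergence[where w="\<lambda>t. 3 * norm (f t)"])
      show "AE x in cm. (\<lambda>i. norm (f x - s i x)) \<longlonglongrightarrow> 0"
      proof (rule AE_I2)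
        fix x assume "x \<in> space cm"
        then have "(\<lambda>i. norm (f x - s i x)) \<longlonglongrightarrow> norm (f x - f x)" using lim(2) by (intro tendsto_intros) auto
        then show "(\<lambda>i. norm (f x - s i x)) \<longlonglongrightarrow> 0" by simp
      qed
      show "AE x in cm. norm (norm (f x - s i x)) \<le> 3 * norm (f x)" for i
        using lim(3) by (intro AE_I2) (smt (verit) norm_ge_zero norm_triangle_ineq4 real_norm_def)
    qed (use lim(1,4) in auto)
    then obtain i where i: "(\<ointegral>t. norm (f t - s i t)) < e / 2"
      using order_tendstoD(2)[of _ "\<ointegral>t. 0" sequentially "e/2"] e by (auto simp: eventually_sequentially)
    obtain k where k: "continuous_on UNIV k" "(\<ointegral>t. norm (s i t - k t)) \<le> e/2"
      using lim(5)[of i] e by (meson half_gt_zero)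
    have ik: "integrable cm k"
      using k by (auto intro!: integrable_circle_continuous intro: continuous_on_subset cm.finite_measure_axioms)
    have "(\<ointegral>t. norm (f t - k t)) \<le> (\<ointegral>t. norm (f t - s i t) + norm (s i t - k t))"
      using lim(1,4) ik norm_triangle_ineq[of "f x - s i x" "s i x - k x" for x] by (intro integral_mono) auto
    also have "\<dots> \<le> e" using lim(1,4) ik k(2) i by simp
    finally show "\<exists>k. continuous_on UNIV k \<and> (\<ointegral>t. norm (f t - k t)) \<le> e" using k by blast
  qed
qed

lemma pk_far:
  assumes x: "cmod u = 1" and e: "cmod t = 1" and z: "cmod z < 1" and d: "d > 0"
    and far: "d \<le> cmod (t - u)" and near: "cmod (z - u) \<le> d / 2"
  shows "pk z t \<le> 8 * (1 - cmod z) / d^2"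
proof -
  have "cmod (t - u) \<le> cmod (t - z) + cmod (z - u)" using norm_triangle_ineq[of "t - z" "z - u"] by simp
  then have "d / 2 \<le> cmod (t - z)" using far near by linarith
  then have "(d / 2)^2 \<le> (cmod (t - z))^2" using d by (intro power_mono) auto
  moreover have "1 - (cmod z)^2 \<le> 2 * (1 - cmod z)" "0 \<le> 1 - (cmod z)^2"
    using zero_le_power2[of "1 - cmod z"] z by (simp_all add: power2_diff abs_square_le_1)
  ultimately have "pk z t \<le> 2 * (1 - cmod z) / (d / 2)^2" unfolding pk_def using d z by (intro frac_le) auto
  then show ?thesis by (simp add: power_divide)
qed

lemma pk_continuous_vanish:
  assumes phi: "continuous_on UNIV \<phi>" "\<And>u. \<phi> u \<ge> 0" "\<phi> s = 0" and x: "cmod s = 1"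
  shows "((\<lambda>z. \<ointegral>u. pk z u * \<phi> u) \<longlongrightarrow> 0) (at s within ball 0 1)"
proof (rule tendstoI)
  fix e :: real assume e: "e > 0"
  have ip: "integrable cm \<phi>" using phi(1)
    by (auto intro!: integrable_circle_continuous intro: continuous_on_subset cm.finite_measure_axioms)
  have "bounded (\<phi> ` sphere 0 1)" by (intro compact_imp_bounded compact_continuous_image continuous_on_subset[OF phi(1)]) auto
  then obtain B where B: "B > 0" "\<And>u. u \<in> sphere 0 1 \<Longrightarrow> \<phi> u \<le> B"
    unfolding bounded_pos by (metis imageI abs_le_D1 real_norm_def)
  have "\<phi> \<midarrow>s\<rightarrow> \<phi> s" using phi(1) by (simp add: continuous_on_def)
  then obtain d where d: "d > 0" "\<And>u. u \<noteq> s \<Longrightarrow> dist u s < d \<Longrightarrow> dist (\<phi> u) (\<phi> s) < e / 2"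
    using e by (auto simp: LIM_def dest!: spec[of _ "e/2"])
  define t where "t = min (d / 2) (e * d^2 / (32 * B))"
  have t: "t > 0" using d B e by (simp add: t_def)
  have main: "\<bar>(\<ointegral>u. pk z u * \<phi> u)\<bar> < e" if z: "z \<in> ball 0 1" "dist z s < t" for z
  proof -
    have z1: "cmod z < 1" using z by simp
    have zt: "1 - cmod z < t" using z x norm_triangle_ineq2[of s z] by (simp add: dist_norm norm_minus_commute)
    have le: "pk z u * \<phi> u \<le> e / 2 * pk z u + e / 4" if "cmod u = 1" for u
    proof (cases "dist u s < d")
      case True
      then have "\<phi> u \<le> e / 2" using d(2)[of u] phi(3) e by (cases "u = s") (auto simp: dist_real_def)
      then have "pk z u * \<phi> u \<le> pk z u * (e / 2)" using pk_pos[OF z1 that] by (intro mult_left_mono) auto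
      then show ?thesis using e by (simp add: mult.commute)
    next
      case False
      have "pk z u \<le> 8 * (1 - cmod z) / d^2"
        using False z that x d(1) by (intro pk_far[OF x that z1]) (auto simp: t_def dist_norm)
      then have "pk z u * \<phi> u \<le> 8 * (1 - cmod z) / d^2 * B" using B(2)[of u] that phi(2) B(1) z1 by (intro mult_mono) auto
      also have "\<dots> \<le> 8 * (e * d^2 / (32 * B)) / d^2 * B"
        using zt B(1) d by (intro mult_right_mono divide_right_mono mult_left_mono) (auto simp: t_def)
      also have "\<dots> = e / 4" using B d by (simp add: field_simps)
      finally show ?thesis using pk_pos[OF z1 that] e by (simp add: add_increasing)
    qed
    have "(\<ointegral>u. pk z u * \<phi> u) \<le> (\<ointegral>u. e / 2 * pk z u + e / 4)"
      using integrable_pk_scaleR[OF z1 ip] pk_integrable[OF z1 cm.finite_measure_axioms] le by (intro integral_mono) auto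
    also have "\<dots> = e / 2 + e / 4" using pk_integrable[OF z1 cm.finite_measure_axioms] z1 cm.prob_space by simp
    finally have "(\<ointegral>u. pk z u * \<phi> u) < e" using e by linarith
    moreover have "0 \<le> (\<ointegral>u. pk z u * \<phi> u)"
      using pk_pos[OF z1] phi(2) by (intro bint_nonneg_AE AE_I2 mult_nonneg_nonneg) (auto simp: less_imp_le)
    ultimately show ?thesis by simp
  qed
  show "\<forall>\<^sub>F z in at s within ball 0 1. dist (\<ointegral>u. pk z u * \<phi> u) 0 < e"
    unfolding eventually_at using t main by (intro exI[of _ t]) auto
qed

lemma ntr_subset_ball: "ntr C x \<subseteq> ball 0 1" by (auto simp: ntr_def)

text \<open>The strong Lebesgue point property, with nontangential Poisson averages in place of arc averages.
  The statement is clear for continuous functions; the weak type inequality controls the error of a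
  continuous approximation outside a set of small measure.\<close>

lemma lebesgue_points:
  fixes g :: "complex \<Rightarrow> complex"
  assumes g: "integrable cm g"
  shows "AE u in cm. \<forall>C\<ge>0. ((\<lambda>z. \<ointegral>t. pk z t * norm (g t - g u)) \<longlongrightarrow> 0) (at u within ntr C u)"
proof -
  define P where "P j u \<longleftrightarrow> (\<forall>C\<ge>0. \<forall>\<^sub>F z in at u within ntr C u.
      (\<ointegral>t. pk z t * norm (g t - g u)) \<le> (16 * (1 + C) + 2) / real (Suc j))" for j u
  have [measurable]: "g \<in> borel_measurable borel_circle" using borel_measurable_integrable[OF g] by simp
  have "AE u in cm. P j u" for j
  proof (rule AE_small)
    fix e :: real assume e: "e > 0"
    define l where "l = 1 / real (Suc j)"
    have l: "l > 0" by (simp add: l_def)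
    define e' where "e' = e * l / 21"
    have e': "e' > 0" using e l by (simp add: e'_def)
    obtain k where k: "continuous_on UNIV k" "(\<ointegral>t. norm (g t - k t)) \<le> e'"
      using continuous_dense_cm[OF g] e' by blast
    have ik: "integrable cm k"
      using k by (auto intro!: integrable_circle_continuous intro: continuous_on_subset cm.finite_measure_axioms)
    have igk: "integrable cm (\<lambda>t. g t - k t)" using g ik by simp
    have [measurable]: "k \<in> borel_measurable borel_circle" using borel_measurable_integrable[OF ik] by simp
    obtain A where A: "A\<in>sets cm" "emeasure cm A \<le> ennreal (20 / l * (\<ointegral>t. norm (g t - k t)))"
      "\<And>u C z. u\<in>sphere 0 1 - A \<Longrightarrow> C\<ge>0 \<Longrightarrow> z\<in>ntr C u \<Longrightarrow> (\<ointegral>t. pk z t * norm (g t - k t)) \<le> 16 * (1 + C) * l"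
      using weak_type_fun[OF igk l] by blast
    define B where "B = {u \<in> space cm. norm (g u - k u) \<ge> l}"
    have Bs: "B \<in> sets cm" unfolding B_def by measurable
    have "measure cm B \<le> (\<ointegral>t. norm (g t - k t)) / l"
      unfolding B_def using igk l by (intro integral_Markov_inequality_measure[where A="{}"]) auto
    also have "\<dots> \<le> e' / l" using k(2) l by (intro divide_right_mono) auto
    finally have Bm: "measure cm B \<le> e' / l" .
    have "measure cm A \<le> 20 / l * (\<ointegral>t. norm (g t - k t))"
      using A(2) l by (subst (asm) cm.emeasure_eq_measure, subst (asm) ennreal_le_iff) auto
    also have "\<dots> \<le> 20 / l * e'" using k(2) l by (intro mult_left_mono) auto
    finally have Am: "measure cm A \<le> 20 / l * e'" .
    have "measure cm (A \<union> B) \<le> 20 / l * e' + e' / l" using measure_Un_le[OF A(1) Bs] Am Bm by linarith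
    also have "\<dots> = e" using l by (simp add: e'_def field_simps)
    finally have AB: "emeasure cm (A \<union> B) \<le> ennreal e" by (simp add: cm.emeasure_eq_measure ennreal_leI)
    have "P j u" if x: "u \<in> sphere 0 1 - (A \<union> B)" for u unfolding P_def
    proof (intro allI impI)
      fix C :: real assume C: "C \<ge> 0"
      have xn: "cmod u = 1" using x by simp
      have "((\<lambda>z. \<ointegral>t. pk z t * norm (k t - k u)) \<longlongrightarrow> 0) (at u within ball 0 1)"
        by (intro pk_continuous_vanish continuous_intros k xn) auto
      then have "((\<lambda>z. \<ointegral>t. pk z t * norm (k t - k u)) \<longlongrightarrow> 0) (at u within ntr C u)"
        by (rule tendsto_within_subset[OF _ ntr_subset_ball])
      then have "\<forall>\<^sub>F z in at u within ntr C u. (\<ointegral>t. pk z t * norm (k t - k u)) < l"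
        using l by (rule order_tendstoD)
      moreover have "\<forall>\<^sub>F z in at u within ntr C u. z \<in> ntr C u" by (simp add: eventually_at_filter)
      ultimately show "\<forall>\<^sub>F z in at u within ntr C u.
      (\<ointegral>t. pk z t * norm (g t - g u)) \<le> (16 * (1 + C) + 2) / real (Suc j)"
      proof eventually_elim
        case (elim z)
        then have z: "cmod z < 1" by (simp add: ntr_def)
        note pi = integrable_pk_scaleR[OF z integrable_norm[OF igk], simplified]
        have ikx: "integrable cm (\<lambda>t. k t - k u)" using ik by simp
        note pi2 = integrable_pk_scaleR[OF z integrable_norm[OF ikx], simplified]
        have pi3: "integrable cm (pk z)" by (rule pk_integrable[OF z cm.finite_measure_axioms]) simp
        have igx: "integrable cm (\<lambda>t. g t - g u)" using g by simp
        note pi4 = integrable_pk_scaleR[OF z integrable_norm[OF igx], simplified]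
        have "(\<ointegral>t. pk z t * norm (g t - g u)) \<le>
           (\<ointegral>t. pk z t * norm (g t - k t) + (pk z t * norm (k t - k u) + pk z t * norm (g u - k u)))"
        proof (rule integral_mono)
          fix t assume "t \<in> space cm"
          then have p: "pk z t > 0" using pk_pos[OF z] by simp
          have "norm (g t - g u) \<le> norm (g t - k t) + (norm (k t - k u) + norm (g u - k u))"
            using norm_triangle_ineq[of "g t - k t" "k t - g u"] norm_triangle_ineq[of "k t - k u" "k u - g u"]
            by (simp add: norm_minus_commute)
          then have "pk z t * norm (g t - g u) \<le> pk z t * (norm (g t - k t) + (norm (k t - k u) + norm (g u - k u)))"
            using p by (intro mult_left_mono) auto
          then show "pk z t * norm (g t - g u) \<le> pk z t * norm (g t - k t) + (pk z t * norm (k t - k u) + pk z t * norm (g u - k u))"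
            by (simp add: algebra_simps)
        qed (use pi pi2 pi3 pi4 in simp_all)
        also have "\<dots> = (\<ointegral>t. pk z t * norm (g t - k t)) + ((\<ointegral>t. pk z t * norm (k t - k u)) + norm (g u - k u))"
          using pi pi2 pi3 z by simp
        also have "\<dots> \<le> 16 * (1 + C) * l + (l + l)" using A(3)[of u C z] elim x C by (intro add_mono) (auto simp: B_def)
        also have "\<dots> = (16 * (1 + C) + 2) / real (Suc j)" by (simp add: l_def add_divide_distrib)
        finally show ?case .
      qed
    qed
    then show "\<exists>A\<in>sets cm. emeasure cm A \<le> ennreal e \<and> (\<forall>u\<in>sphere 0 1 - A. P j u)"
      using AB A(1) Bs by (intro bexI[of _ "A \<union> B"]) auto
  qed
  then have "AE u in cm. \<forall>j. P j u" by (simp add: AE_all_countable)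
  then show ?thesis
  proof eventually_elim
    case (elim u)
    show ?case
    proof (intro allI impI tendstoI)
      fix C e :: real assume C: "C \<ge> 0" and e: "e > 0"
      obtain j where j: "(16 * (1 + C) + 2) / e < real (Suc j)"
        using reals_Archimedean2[of "(16 * (1 + C) + 2) / e"] by (metis less_Suc_eq of_nat_less_iff order.strict_trans)
      then have j2: "(16 * (1 + C) + 2) / real (Suc j) < e" using e by (simp add: field_simps)
      have "\<forall>\<^sub>F z in at u within ntr C u. (\<ointegral>t. pk z t * norm (g t - g u)) \<le> (16 * (1 + C) + 2) / real (Suc j)"
        using elim C by (auto simp: P_def)
      moreover have "\<forall>\<^sub>F z in at u within ntr C u. z \<in> ntr C u" by (simp add: eventually_at_filter)
      ultimately show "\<forall>\<^sub>F z in at u within ntr C u. dist (\<ointegral>t. pk z t * norm (g t - g u)) 0 < e"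
      proof eventually_elim
        case (elim z)
        have "0 \<le> (\<ointegral>t. pk z t * norm (g t - g u))"
          using pk_pos[of z] elim(2) by (intro bint_nonneg_AE AE_I2 mult_nonneg_nonneg) (auto simp: less_imp_le ntr_def)
        then show ?case using elim(1) j2 by simp
      qed
    qed
  qed
qed

text \<open>Up to a part of small mass, a singular measure lives on a compact null set. At a point outside
  that set the Poisson integral of this part tends to \<open>0\<close> because the kernel does so
  away from its pole; the remaining part is handled by the weak type inequality.\<close>

lemma singular_poisson:
  assumes fin: "finite_measure \<nu>" and sets: "sets \<nu> = sets borel_circle"
    and N: "N \<in> null_sets cm" "emeasure \<nu> (sphere 0 1 - N) = 0"
  shows "AE s in cm. \<forall>C\<ge>0. ((\<lambda>z. \<integral>u. pk z u \<partial>\<nu>) \<longlongrightarrow> 0) (at s within ntr C s)"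
proof -
  interpret finite_measure \<nu> by fact
  have sp: "space \<nu> = sphere 0 1" using sets_eq_imp_space_eq[OF sets] by simp
  define P where "P j s \<longleftrightarrow> (\<forall>C\<ge>0. \<forall>\<^sub>F z in at s within ntr C s.
      (\<integral>u. pk z u \<partial>\<nu>) \<le> (16 * (1 + C) + 1) / real (Suc j))" for j s
  have "AE s in cm. P j s" for j
  proof (rule AE_small)
    fix e :: real assume e: "e > 0"
    define l where "l = 1 / real (Suc j)"
    have l: "l > 0" by (simp add: l_def)
    define e' where "e' = e * l / 20"
    have e': "e' > 0" using e l by (simp add: e'_def)
    have Ns: "N \<in> sets borel_circle" using N(1) by auto
    obtain K where K: "compact K" "K \<subseteq> N" "measure \<nu> (N - K) \<le> e'"
      using circle_inner_regular[OF fin sets Ns e'] by auto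
    have Ks: "K \<in> sets borel_circle" using K Ns by (auto simp: sets_borel_circle_iff borel_compact)
    let ?K' = "sphere 0 1 - K"
    have K's: "?K' \<in> sets \<nu>" using sets.compl_sets[of K \<nu>] Ks by (simp add: sets sp)
    have "measure \<nu> ?K' \<le> measure \<nu> ((N - K) \<union> (sphere 0 1 - N))"
      using K's Ns Ks sets.compl_sets[of N \<nu>] by (intro finite_measure_mono) (auto simp: sets sp)
    also have "\<dots> \<le> measure \<nu> (N - K) + measure \<nu> (sphere 0 1 - N)"
      using Ns Ks sets.compl_sets[of N \<nu>] by (intro measure_Un_le) (auto simp: sets sp)
    also have "\<dots> \<le> e'" using K(3) N(2) by (simp add: measure_def)
    finally have mK': "measure \<nu> ?K' \<le> e'" .
    define \<nu>' where "\<nu>' = density \<nu> (indicator ?K')"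
    have s': "sets \<nu>' = sets borel_circle" by (simp add: \<nu>'_def sets)
    have sp': "space \<nu>' = sphere 0 1" by (simp add: \<nu>'_def sp)
    have em': "emeasure \<nu>' (sphere 0 1) = emeasure \<nu> ?K'" unfolding \<nu>'_def using K's sets.top[of \<nu>]
      by (subst emeasure_density) (auto simp: sp intro!: borel_measurable_indicator trans[OF nn_integral_cong nn_integral_indicator] simp: indicator_def)
    have f': "finite_measure \<nu>'" by (rule finite_measureI) (simp add: sp' em')
    obtain A where A: "A\<in>sets cm" "emeasure cm A \<le> ennreal (20 / l * measure \<nu>' (sphere 0 1))"
      "\<And>s C z. s\<in>sphere 0 1 - A \<Longrightarrow> C\<ge>0 \<Longrightarrow> z\<in>ntr C s \<Longrightarrow> (\<integral>\<^sup>+u. ennreal (pk z u) \<partial>\<nu>') \<le> ennreal (16 * (1 + C) * l)"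
      using weak_type_measure[OF f' s' l] by blast
    have "20 / l * measure \<nu>' (sphere 0 1) \<le> e"
    proof -
      have "measure \<nu>' (sphere 0 1) = measure \<nu> ?K'" using em' by (simp add: measure_def)
      then have "20 / l * measure \<nu>' (sphere 0 1) \<le> 20 / l * e'" using mK' l by (simp add: mult_left_mono divide_right_mono)
      also have "\<dots> = e" using l by (simp add: e'_def)
      finally show ?thesis .
    qed
    then have Ae: "emeasure cm A \<le> ennreal e" using A(2) by (meson ennreal_leI order_trans)
    have "emeasure cm (A \<union> N) \<le> emeasure cm A + emeasure cm N" using A(1) N(1) by (intro emeasure_subadditive) auto
    also have "\<dots> \<le> ennreal e" using Ae N(1) by auto
    finally have AN: "emeasure cm (A \<union> N) \<le> ennreal e" .
    have "P j s" if x: "s \<in> sphere 0 1 - (A \<union> N)" for s unfolding P_def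
    proof (intro allI impI)
      fix C :: real assume C: "C \<ge> 0"
      have xn: "cmod s = 1" using x by simp
      have "open (-K)" using K(1) by (simp add: compact_imp_closed open_Compl)
      moreover have "s \<in> -K" using x K(2) by auto
      ultimately obtain d where d: "d > 0" "ball s d \<subseteq> -K" by (auto simp: open_contains_ball)
      define t where "t = min (d / 2) (l * d^2 / (8 * (measure \<nu> (sphere 0 1) + 1)))"
      have mp: "measure \<nu> (sphere 0 1) + 1 > 0" using measure_nonneg[of \<nu> "sphere 0 1"] by linarith
      have t: "t > 0" unfolding t_def using d l mp by (auto intro!: divide_pos_pos mult_pos_pos)
      show "\<forall>\<^sub>F z in at s within ntr C s. (\<integral>u. pk z u \<partial>\<nu>) \<le> (16 * (1 + C) + 1) / real (Suc j)"
        unfolding eventually_at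
      proof (intro exI[of _ t] conjI t ballI impI)
        fix z assume zC: "z \<in> ntr C s" and "z \<noteq> s \<and> dist z s < t"
        then have zt: "cmod (z - s) < t" by (simp add: dist_norm)
        have z: "cmod z < 1" using zC by (simp add: ntr_def)
        have zt': "1 - cmod z < t" using zt xn norm_triangle_ineq2[of s z] by (simp add: norm_minus_commute)
        let ?c = "8 * (1 - cmod z) / d^2"
        have c0: "?c \<ge> 0" using z by simp
        have [measurable]: "pk z \<in> borel_measurable \<nu>" using pk_measurable[of z] by (simp add: measurable_cong_sets[OF sets refl])
        have [measurable]: "?K' \<in> sets \<nu>" by fact
        have pkK: "ennreal (pk z u) \<le> ennreal ?c" if "u \<in> K" for u
        proof -
          have "u \<notin> ball s d" "cmod u = 1" using that d(2) K(2) Ns by (auto simp: sets_borel_circle_iff)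
          then show ?thesis using zt d(1) by (intro ennreal_leI pk_far[OF xn _ z]) (auto simp: dist_norm norm_minus_commute t_def)
        qed
        have "(\<integral>\<^sup>+u. ennreal (pk z u) \<partial>\<nu>) \<le> (\<integral>\<^sup>+u. indicator ?K' u * ennreal (pk z u) + ennreal ?c \<partial>\<nu>)"
          using pkK by (intro nn_integral_mono) (auto simp: sp indicator_def add_increasing2)
        also have "\<dots> = (\<integral>\<^sup>+u. indicator ?K' u * ennreal (pk z u) \<partial>\<nu>) + ennreal ?c * emeasure \<nu> (space \<nu>)"
          by (subst nn_integral_add) auto
        also have "(\<integral>\<^sup>+u. indicator ?K' u * ennreal (pk z u) \<partial>\<nu>) = (\<integral>\<^sup>+u. ennreal (pk z u) \<partial>\<nu>')"
          unfolding \<nu>'_def by (subst nn_integral_density) auto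
        also have "\<dots> + ennreal ?c * emeasure \<nu> (space \<nu>) \<le> ennreal (16 * (1 + C) * l) + ennreal ?c * emeasure \<nu> (space \<nu>)"
          using A(3)[of s C z] x C zC by (intro add_mono) auto
        also have "\<dots> = ennreal (16 * (1 + C) * l + ?c * measure \<nu> (sphere 0 1))"
        proof -
          have "ennreal ?c * emeasure \<nu> (space \<nu>) = ennreal (?c * measure \<nu> (sphere 0 1))"
            unfolding emeasure_eq_measure sp by (rule ennreal_mult[symmetric]) (use c0 in auto)
          moreover have "0 \<le> 16 * (1 + C) * l" "0 \<le> ?c * measure \<nu> (sphere 0 1)"
            using C l by (auto simp only: intro!: mult_nonneg_nonneg c0 measure_nonneg)
          ultimately show ?thesis by (simp only: ennreal_plus)
        qed
        finally have nn: "(\<integral>\<^sup>+u. ennreal (pk z u) \<partial>\<nu>) \<le> ennreal (16 * (1 + C) * l + ?c * measure \<nu> (sphere 0 1))" .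
        have "(\<integral>\<^sup>+u. ennreal (pk z u) \<partial>\<nu>) = ennreal (\<integral>u. pk z u \<partial>\<nu>)"
          using pk_pos[OF z] by (intro nn_integral_eq_integral pk_integrable[OF z fin sets] AE_I2) (auto simp: sp less_imp_le)
        then have "ennreal (\<integral>u. pk z u \<partial>\<nu>) \<le> ennreal (16 * (1 + C) * l + ?c * measure \<nu> (sphere 0 1))"
          using nn by (simp only:)
        moreover have "0 \<le> 16 * (1 + C) * l + ?c * measure \<nu> (sphere 0 1)"
          using C l by (intro add_nonneg_nonneg mult_nonneg_nonneg c0 measure_nonneg) auto
        ultimately have "(\<integral>u. pk z u \<partial>\<nu>) \<le> 16 * (1 + C) * l + ?c * measure \<nu> (sphere 0 1)"
          by (simp only: ennreal_le_iff)
        also have "?c * measure \<nu> (sphere 0 1) \<le> l"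
        proof -
          have "?c * measure \<nu> (sphere 0 1) \<le> ?c * (measure \<nu> (sphere 0 1) + 1)" using c0 by (intro mult_left_mono) auto
          also have "\<dots> \<le> 8 * (l * d^2 / (8 * (measure \<nu> (sphere 0 1) + 1))) / d^2 * (measure \<nu> (sphere 0 1) + 1)"
            using zt' mp by (intro mult_right_mono divide_right_mono mult_left_mono) (auto simp: t_def)
          also have "\<dots> = l" using mp d by (simp add: divide_simps)
          finally show ?thesis .
        qed
        finally have "(\<integral>u. pk z u \<partial>\<nu>) \<le> 16 * (1 + C) * l + l" by simp
        also have "\<dots> = (16 * (1 + C) + 1) / real (Suc j)" by (simp add: l_def add_divide_distrib)
        finally show "(\<integral>u. pk z u \<partial>\<nu>) \<le> (16 * (1 + C) + 1) / real (Suc j)" .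
      qed
    qed
    then show "\<exists>A\<in>sets cm. emeasure cm A \<le> ennreal e \<and> (\<forall>s\<in>sphere 0 1 - A. P j s)"
      using AN A(1) N(1) by (intro bexI[of _ "A \<union> N"]) auto
  qed
  then have "AE s in cm. \<forall>j. P j s" by (simp add: AE_all_countable)
  then show ?thesis
  proof eventually_elim
    case (elim s)
    show ?case
    proof (intro allI impI tendstoI)
      fix C e :: real assume C: "C \<ge> 0" and e: "e > 0"
      obtain j where j: "(16 * (1 + C) + 1) / e < real (Suc j)"
        using reals_Archimedean2[of "(16 * (1 + C) + 1) / e"] by (metis less_Suc_eq of_nat_less_iff order.strict_trans)
      then have j2: "(16 * (1 + C) + 1) / real (Suc j) < e" using e by (simp add: field_simps)
      have "\<forall>\<^sub>F z in at s within ntr C s. (\<integral>u. pk z u \<partial>\<nu>) \<le> (16 * (1 + C) + 1) / real (Suc j)"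
        using elim C by (auto simp: P_def)
      moreover have "\<forall>\<^sub>F z in at s within ntr C s. z \<in> ntr C s" by (simp add: eventually_at_filter)
      ultimately show "\<forall>\<^sub>F z in at s within ntr C s. dist (\<integral>u. pk z u \<partial>\<nu>) 0 < e"
      proof eventually_elim
        case (elim z)
        have "0 \<le> (\<integral>u. pk z u \<partial>\<nu>)"
          using pk_pos[of z] elim(2) by (intro bint_nonneg_AE AE_I2) (auto simp: less_imp_le ntr_def sp)
        then show ?case using elim(1) j2 by simp
      qed
    qed
  qed
qed

section \<open>Harnack's inequality and boundary values in the Hardy space\<close>

lemma holomorphic_dilation:
  assumes "f holomorphic_on ball 0 1" "0 \<le> s" "s < 1"
  shows "(\<lambda>t. f (of_real s * t)) holomorphic_on cball 0 1"
proof -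
  have "cmod (of_real s * t) < 1" if "cmod t \<le> 1" for t :: complex
  proof -
    have "cmod (of_real s * t) \<le> s * 1" unfolding norm_mult using assms that by (intro mult_mono) auto
    then show ?thesis using assms by simp
  qed
  then show ?thesis by (intro holomorphic_on_compose_gen[OF _ assms(1), unfolded o_def] holomorphic_intros) auto
qed

lemma poisson_Re:
  assumes u: "u holomorphic_on cball 0 1" and z: "cmod z < 1"
  shows "(\<ointegral>t. pk z t * Re (u t)) = Re (u z)"
proof -
  have iu: "integrable cm u" using holomorphic_on_imp_continuous_on[OF u]
    by (auto intro!: integrable_circle_continuous intro: continuous_on_subset cm.finite_measure_axioms)
  have "(\<ointegral>t. Re (pk z t *\<^sub>R u t)) = Re (\<ointegral>t. pk z t *\<^sub>R u t)"
    by (rule integral_Re[OF integrable_pk_scaleR[OF z iu]])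
  then show ?thesis by (simp add: poisson_cm[OF u z])
qed

lemma dilation_tendsto:
  assumes "f holomorphic_on ball 0 1" and z: "cmod z < 1"
  shows "(\<lambda>j. f (of_real (1 - 1 / (real j + 2)) * z)) \<longlonglongrightarrow> f z"
proof -
  have "isCont f z" using assms by (metis continuous_on_interior holomorphic_on_imp_continuous_on
     interior_open mem_ball_0 open_ball)
  moreover have "(\<lambda>j. of_real (1 - 1 / (real j + 2)) * z) \<longlonglongrightarrow> of_real (1 - 0) * z"
    by (intro tendsto_intros real_tendsto_divide_at_top[OF tendsto_const] filterlim_tendsto_add_at_top[OF _ _]
       filterlim_tendsto_add_at_top[OF tendsto_const filterlim_real_sequentially, of 2, simplified add.commute])
  ultimately show ?thesis by (intro isCont_tendsto_compose[of z f]) auto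
qed

lemma rad_bounds: "0 \<le> 1 - 1 / (real j + 2)" "1 - 1 / (real j + 2) < 1" "0 < 1 - 1 / (real j + 2)" by (auto simp: field_simps)

text \<open>The kernel inequality integrated over a circle of radius slightly less than \<open>1\<close>,
  followed by a passage to the limit. A dilation is needed because nothing is assumed about boundary
  values.\<close>

lemma harnack:
  assumes L: "L holomorphic_on ball 0 1" and pos: "\<And>z. cmod z < 1 \<Longrightarrow> Re (L z) \<ge> 0"
    and z: "cmod z < 1" and z': "cmod z' < 1"
  shows "Re (L z) \<le> (1 - (cmod z)^2) / (1 - (cmod z')^2) * (1 + cmod (z - z') / (1 - cmod z))^2 * Re (L z')"
    (is "_ \<le> ?K * _")
proof -
  define r where "r j = 1 - 1 / (real j + 2)" for j
  have K: "?K \<ge> 0" using z z' by (intro mult_nonneg_nonneg divide_nonneg_nonneg) (auto simp: abs_square_le_1)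
  have le: "Re (L (of_real (r j) * z)) \<le> ?K * Re (L (of_real (r j) * z'))" for j
  proof -
    let ?u = "\<lambda>t. L (of_real (r j) * t)"
    have rj: "0 \<le> r j" "r j < 1" unfolding r_def by (rule rad_bounds)+
    have u: "?u holomorphic_on cball 0 1" by (rule holomorphic_dilation[OF L rj])
    have iu: "integrable cm (\<lambda>t. Re (?u t))" using holomorphic_on_imp_continuous_on[OF u]
      by (auto intro!: integrable_circle_continuous continuous_intros intro: continuous_on_subset cm.finite_measure_axioms)
    have "Re (?u z) = (\<ointegral>t. pk z t * Re (?u t))" by (rule poisson_Re[OF u z, symmetric])
    also have "\<dots> \<le> (\<ointegral>t. ?K * (pk z' t * Re (?u t)))"
    proof (rule integral_mono)
      fix t assume "t \<in> space cm"
      then have e: "cmod t = 1" by simp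
      have "Re (?u t) \<ge> 0" by (rule pos) (use e rj in \<open>simp add: norm_mult\<close>)
      then have "pk z t * Re (?u t) \<le> (?K * pk z' t) * Re (?u t)" using pk_harnack[OF z z' e] by (intro mult_right_mono)
      then show "pk z t * Re (?u t) \<le> ?K * (pk z' t * Re (?u t))" by (simp only: mult.assoc)
    qed (use integrable_pk_scaleR[OF z iu] integrable_pk_scaleR[OF z' iu] in \<open>auto intro!: integrable_mult_right\<close>)
    also have "\<dots> = ?K * Re (?u z')" using poisson_Re[OF u z'] by simp
    finally show ?thesis .
  qed
  show ?thesis
    by (rule LIMSEQ_le[OF tendsto_Re[OF dilation_tendsto[OF L z]] tendsto_mult_left[OF tendsto_Re[OF dilation_tendsto[OF L z']]]])
       (use le in \<open>auto simp: r_def\<close>)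
qed

lemma fatou_bound:
  fixes g :: "nat \<Rightarrow> 'a \<Rightarrow> real"
  assumes int: "\<And>k. integrable M (g k)" and nn: "\<And>k. AE x in M. g k x \<ge> 0"
    and lim: "AE x in M. (\<lambda>k. g k x) \<longlonglongrightarrow> h x" and h: "h \<in> borel_measurable M"
    and le: "\<forall>\<^sub>F k in sequentially. integral\<^sup>L M (g k) \<le> c"
  shows "integrable M h" "integral\<^sup>L M h \<le> c"
proof -
  have [measurable]: "g k \<in> borel_measurable M" for k using int by auto
  have nnI: "(\<integral>\<^sup>+x. ennreal (g k x) \<partial>M) = ennreal (integral\<^sup>L M (g k))" for k
    by (rule nn_integral_eq_integral[OF int nn])
  have all: "AE x in M. (\<lambda>k. g k x) \<longlonglongrightarrow> h x \<and> (\<forall>k. g k x \<ge> 0)"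
    using lim nn by (simp add: AE_all_countable)
  have h0: "AE x in M. h x \<ge> 0" using all by eventually_elim (auto intro: LIMSEQ_le_const)
  obtain k where "integral\<^sup>L M (g k) \<le> c" using le by (auto simp: eventually_sequentially)
  moreover have "0 \<le> integral\<^sup>L M (g k)" using nn by (intro bint_nonneg_AE)
  ultimately have c: "c \<ge> 0" by simp
  have "(\<integral>\<^sup>+x. ennreal (h x) \<partial>M) = (\<integral>\<^sup>+x. liminf (\<lambda>k. ennreal (g k x)) \<partial>M)"
  proof (rule nn_integral_cong_AE, use all in eventually_elim)
    case (elim x)
    then have "(\<lambda>k. ennreal (g k x)) \<longlonglongrightarrow> ennreal (h x)" by (intro tendsto_ennrealI) auto
    then show ?case by (simp add: lim_imp_Liminf)
  qed
  also have "\<dots> \<le> liminf (\<lambda>k. \<integral>\<^sup>+x. ennreal (g k x) \<partial>M)" by (rule nn_integral_liminf) measurable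
  also have "\<dots> \<le> ennreal c" unfolding nnI using le by (intro Liminf_le) (auto intro: eventually_mono ennreal_leI)
  finally have le': "(\<integral>\<^sup>+x. ennreal (h x) \<partial>M) \<le> ennreal c" .
  show ih: "integrable M h" by (rule integrableI_nonneg[OF h h0]) (use le' in \<open>auto intro: le_less_trans\<close>)
  have "ennreal (integral\<^sup>L M h) \<le> ennreal c" using nn_integral_eq_integral[OF ih h0] le' by simp
  then show "integral\<^sup>L M h \<le> c" using c by (simp add: ennreal_le_iff)
qed

definition psum :: "(nat \<Rightarrow> complex) \<Rightarrow> (complex \<Rightarrow> complex) \<Rightarrow> bool" where
  "psum a f \<longleftrightarrow> (\<forall>z. cmod z < 1 \<longrightarrow> (\<lambda>k. a k * z ^ k) sums f z)"

lemma holomorphic_psum: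
  assumes "f holomorphic_on ball 0 1"
  shows "psum (\<lambda>n. (deriv ^^ n) f 0 / fact n) f" using holomorphic_power_series[OF assms] by (auto simp: psum_def)

lemma psum_abs:
  assumes "psum a f" "0 \<le> s" "s < 1"
  shows "summable (\<lambda>k. cmod (a k) * s ^ k)"
proof -
  obtain t where t: "s < t" "t < 1" using assms dense by blast
  have "summable (\<lambda>k. a k * (of_real t) ^ k)" using assms(1) t assms(2) by (auto simp: psum_def sums_iff)
  then have "summable (\<lambda>k. norm (a k * (of_real s :: complex) ^ k))" by (rule powser_insidea) (use t assms in simp)
  then show ?thesis using assms by (simp add: norm_mult norm_power)
qed

lemma psum_hol: assumes "psum a f" shows "f holomorphic_on ball 0 1"
proof -
  have "(\<lambda>n. a n * (w - 0) ^ n) sums f w" if "w \<in> ball 0 1" for w using assms that by (auto simp: psum_def)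
  then show ?thesis by (rule power_series_holomorphic)
qed

lemma integral_power_cm:
  "(\<ointegral>t. t ^ j * cnj (t ^ k)) = (if j = k then 1 else 0)"
proof -
  have pw: "(\<ointegral>t. t ^ m) = (0::complex) ^ m" for m
    using cauchy_cm[of "\<lambda>t. t ^ m" 0] by (simp add: holomorphic_intros)
  have cp: "t ^ i * cnj (t ^ i) = 1" if "cmod t = 1" for t :: complex and i
    using circle_cnj_mult[OF that] by (simp flip: power_mult_distrib)
  show ?thesis
  proof (cases "k \<le> j")
    case True
    have "(\<ointegral>t. t ^ j * cnj (t ^ k)) = (\<ointegral>t. t ^ (j - k))"
    proof (rule bint_cong)
      fix t assume "t \<in> space cm"
      have "t ^ j = t ^ (j - k) * t ^ k" using True by (simp flip: power_add)
      then show "t ^ j * cnj (t ^ k) = t ^ (j - k)" using cp[of t k] \<open>t \<in> space cm\<close> by (simp add: mult.assoc)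
    qed simp
    then show ?thesis using True by (simp add: pw power_0_left)
  next
    case False
    have "(\<ointegral>t. t ^ j * cnj (t ^ k)) = (\<ointegral>t. cnj (t ^ (k - j)))"
    proof (rule bint_cong)
      fix t assume "t \<in> space cm"
      have "t ^ k = t ^ j * t ^ (k - j)" using False by (simp flip: power_add)
      then show "t ^ j * cnj (t ^ k) = cnj (t ^ (k - j))" using cp[of t j] \<open>t \<in> space cm\<close>
        by (simp flip: mult.assoc)
    qed simp
    also have "\<dots> = cnj (\<ointegral>t. t ^ (k - j))" by (rule Bochner_Integration.integral_cnj)
    finally show ?thesis using False by (simp add: pw power_0_left)
  qed
qed

lemma sums_integral_uniform:
  fixes u :: "nat \<Rightarrow> complex \<Rightarrow> complex"
  assumes int: "\<And>k. integrable cm (u k)" and bd: "\<And>k t. cmod t = 1 \<Longrightarrow> norm (u k t) \<le> b k" and b: "summable b"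
    and s: "\<And>t. cmod t = 1 \<Longrightarrow> (\<lambda>k. u k t) sums f t"
  shows "(\<lambda>k. \<ointegral>t. u k t) sums (\<ointegral>t. f t)"
proof -
  have "(\<lambda>k. \<ointegral>t. u k t) sums (\<ointegral>t. (\<Sum>k. u k t))"
  proof (rule sums_integral[OF int])
    show "AE t in cm. summable (\<lambda>k. norm (u k t))" by (intro AE_I2 summable_comparison_test'[OF b]) (use bd in auto)
    have "(\<ointegral>t. norm (u k t)) \<le> (\<ointegral>t. b k)" for k using int bd by (intro integral_mono) auto
    then have "(\<ointegral>t. norm (u k t)) \<le> b k" for k using cm.prob_space by simp
    then show "summable (\<lambda>k. \<ointegral>t. norm (u k t))" by (intro summable_comparison_test'[OF b]) auto
  qed
  also have "(\<ointegral>t. (\<Sum>k. u k t)) = (\<ointegral>t. f t)" using s by (intro bint_cong) (auto simp: sums_iff)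
  finally show ?thesis .
qed

lemma integrable_cm_continuous:
  fixes f :: "complex \<Rightarrow> 'b::{banach, second_countable_topology}"
  assumes "continuous_on (sphere 0 1) f" shows "integrable cm f"
  using assms by (intro integrable_circle_continuous cm.finite_measure_axioms) auto

lemma dilation_continuous:
  assumes "f holomorphic_on ball 0 1" "0 \<le> s" "s < 1"
  shows "continuous_on (sphere 0 1) (\<lambda>t. f (of_real s * t))"
  using holomorphic_on_imp_continuous_on[OF holomorphic_dilation[OF assms]] by (rule continuous_on_subset) auto

lemma psum_coeff:
  assumes f: "psum a f" and s: "0 \<le> s" "s < 1"
  shows "(\<ointegral>t. f (of_real s * t) * cnj (t ^ k)) = a k * of_real s ^ k"
proof -
  have "(\<lambda>j. \<ointegral>t. a j * (of_real s * t) ^ j * cnj (t ^ k)) sums (\<ointegral>t. f (of_real s * t) * cnj (t ^ k))"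
  proof (rule sums_integral_uniform[where b="\<lambda>j. cmod (a j) * s ^ j"])
    show "integrable cm (\<lambda>t. a j * (of_real s * t) ^ j * cnj (t ^ k))" for j
      by (intro integrable_cm_continuous continuous_intros)
    show "norm (a j * (of_real s * t) ^ j * cnj (t ^ k)) \<le> cmod (a j) * s ^ j" if "cmod t = 1" for j t
      using s that by (simp add: norm_mult norm_power)
    show "summable (\<lambda>j. cmod (a j) * s ^ j)" by (rule psum_abs[OF f s])
    show "(\<lambda>j. a j * (of_real s * t) ^ j * cnj (t ^ k)) sums (f (of_real s * t) * cnj (t ^ k))" if "cmod t = 1" for t
      using f s that by (intro sums_mult2) (auto simp: psum_def norm_mult)
  qed
  moreover have "(\<ointegral>t. a j * (of_real s * t) ^ j * cnj (t ^ k)) = (if j = k then a k * of_real s ^ k else 0)" for j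
  proof -
    have "(\<ointegral>t. a j * (of_real s * t) ^ j * cnj (t ^ k)) = (\<ointegral>t. (a j * of_real s ^ j) * (t ^ j * cnj (t ^ k)))"
      by (simp only: power_mult_distrib mult.assoc)
    also have "\<dots> = (a j * of_real s ^ j) * (\<ointegral>t. t ^ j * cnj (t ^ k))" by (rule integral_mult_right_zero)
    finally show ?thesis by (simp only: integral_power_cm) simp
  qed
  ultimately have "(\<lambda>j. if j = k then a k * of_real s ^ k else 0) sums (\<ointegral>t. f (of_real s * t) * cnj (t ^ k))"
    by (simp only:)
  moreover have "(\<lambda>j. if j = k then a k * of_real s ^ k else 0) sums (a k * of_real s ^ k)"
    using sums_single[of k "\<lambda>_. a k * of_real s ^ k"] by simp
  ultimately show ?thesis by (rule sums_unique2)
qed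

lemma parseval:
  assumes f: "psum a f" and s: "0 \<le> s" "s < 1"
  shows "(\<lambda>k. (cmod (a k))^2 * s ^ (2 * k)) sums (\<ointegral>t. (cmod (f (of_real s * t)))^2)"
proof -
  note cont = dilation_continuous[OF psum_hol[OF f] s]
  obtain B where B: "\<And>t. cmod t = 1 \<Longrightarrow> cmod (f (of_real s * t)) \<le> B"
    using compact_imp_bounded[OF compact_continuous_image[OF cont compact_sphere]] unfolding bounded_iff by (metis image_eqI mem_sphere_0)
  have "(\<lambda>k. \<ointegral>t. f (of_real s * t) * cnj (a k * (of_real s * t) ^ k)) sums (\<ointegral>t. f (of_real s * t) * cnj (f (of_real s * t)))"
  proof (rule sums_integral_uniform[where b="\<lambda>j. B * (cmod (a j) * s ^ j)"])
    show "integrable cm (\<lambda>t. f (of_real s * t) * cnj (a k * (of_real s * t) ^ k))" for k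
      by (intro integrable_cm_continuous continuous_intros cont)
    show "norm (f (of_real s * t) * cnj (a k * (of_real s * t) ^ k)) \<le> B * (cmod (a k) * s ^ k)" if "cmod t = 1" for k t
    proof -
      have "norm (f (of_real s * t) * cnj (a k * (of_real s * t) ^ k)) = cmod (f (of_real s * t)) * (cmod (a k) * s ^ k)"
        using s that by (simp add: norm_mult norm_power)
      also have "\<dots> \<le> B * (cmod (a k) * s ^ k)" using B[OF that] s by (intro mult_right_mono) auto
      finally show ?thesis .
    qed
    show "summable (\<lambda>k. B * (cmod (a k) * s ^ k))" by (intro summable_mult psum_abs[OF f s])
    show "(\<lambda>k. f (of_real s * t) * cnj (a k * (of_real s * t) ^ k)) sums (f (of_real s * t) * cnj (f (of_real s * t)))" if "cmod t = 1" for t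
      using f s that by (intro sums_mult sums_cnj[THEN iffD2]) (auto simp: psum_def norm_mult)
  qed
  moreover have "(\<ointegral>t. f (of_real s * t) * cnj (a k * (of_real s * t) ^ k)) = of_real ((cmod (a k))^2 * s ^ (2 * k))" for k
  proof -
    have "(\<ointegral>t. f (of_real s * t) * cnj (a k * (of_real s * t) ^ k)) = (\<ointegral>t. (cnj (a k) * of_real s ^ k) * (f (of_real s * t) * cnj (t ^ k)))"
      by (simp only: power_mult_distrib complex_cnj_mult complex_cnj_power complex_cnj_complex_of_real ac_simps)
    also have "\<dots> = (cnj (a k) * of_real s ^ k) * (a k * of_real s ^ k)"
      by (simp only: integral_mult_right_zero psum_coeff[OF f s])
    also have "\<dots> = (a k * cnj (a k)) * (of_real s ^ k * of_real s ^ k)" by (simp add: mult_ac)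
    also have "\<dots> = of_real ((cmod (a k))^2) * of_real (s ^ (2 * k))"
      by (subst complex_norm_square) (simp only: mult_2 power_add of_real_mult of_real_power)
    finally show ?thesis by simp
  qed
  moreover have "(\<ointegral>t. f (of_real s * t) * cnj (f (of_real s * t))) = of_real (\<ointegral>t. (cmod (f (of_real s * t)))^2)"
    by (simp only: complex_norm_square[symmetric] flip: of_real_power integral_complex_of_real)
  ultimately show ?thesis by (simp only: sums_of_real_iff)
qed

text \<open>The bound \<open>K\<close> on the square means over circles is carried along, because the norms of
  the boundary functions are needed with their constants.\<close>

definition hardy2 :: "real \<Rightarrow> (complex \<Rightarrow> complex) \<Rightarrow> bool" where
  "hardy2 K f \<longleftrightarrow> f holomorphic_on ball 0 1 \<and>
     (\<forall>s. 0 \<le> s \<and> s < 1 \<longrightarrow> (\<ointegral>t. (cmod (f (of_real s * t)))^2) \<le> K)"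

text \<open>The limit along one fixed sequence of radii. Where the nontangential limit exists the choice of
  the sequence is irrelevant, and a sequence makes measurability immediate.\<close>

definition bdv :: "(complex \<Rightarrow> complex) \<Rightarrow> complex \<Rightarrow> complex" where
  "bdv f x = lim (\<lambda>j. f (of_real (1 - 1 / (real j + 2)) * x))"

text \<open>By Parseval's identity the distance between \<open>f\<close> and its dilation by \<open>R\<close>
  is at most the sum of \<open>\<bar>a k\<bar>\<^sup>2 * (1 - R ^ k)\<^sup>2\<close>, uniformly over
  all circles.\<close>

lemma hardy2_dilation_close:
  assumes f: "hardy2 K f"
  shows "\<exists>E. (E \<longlongrightarrow> 0) (at_left (1::real)) \<and> (\<forall>R s. 0 \<le> R \<and> R \<le> 1 \<and> 0 \<le> s \<and> s < 1 \<longrightarrow>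
      (\<ointegral>t. (cmod (f (of_real s * t) - f (of_real R * (of_real s * t))))^2) \<le> E R) \<and>
      (\<forall>R R'. 0 \<le> R \<and> R \<le> R' \<and> R' \<le> 1 \<longrightarrow> E R' \<le> E R)"
proof -
  have hol: "f holomorphic_on ball 0 1" using f by (simp add: hardy2_def)
  obtain a where a: "psum a f" using holomorphic_psum[OF hol] by blast
  have part: "(\<Sum>k<n. (cmod (a k))^2) \<le> K" for n
  proof (rule tendsto_upperbound)
    show "((\<lambda>s. \<Sum>k<n. (cmod (a k))^2 * s ^ (2 * k)) \<longlongrightarrow> (\<Sum>k<n. (cmod (a k))^2)) (at_left (1::real))"
    proof -
      have "((\<lambda>s. \<Sum>k<n. (cmod (a k))^2 * s ^ (2 * k)) \<longlongrightarrow> (\<Sum>k<n. (cmod (a k))^2 * 1 ^ (2 * k))) (at_left (1::real))"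
        by (intro tendsto_intros)
      then show ?thesis by simp
    qed
    have "\<forall>\<^sub>F s in at_left (1::real). 0 < s \<and> s < 1" using eventually_at_left_real[of 0 1] by simp
    then show "\<forall>\<^sub>F s in at_left (1::real). (\<Sum>k<n. (cmod (a k))^2 * s ^ (2 * k)) \<le> K"
    proof eventually_elim
      case (elim s)
      have "(\<Sum>k<n. (cmod (a k))^2 * s ^ (2 * k)) \<le> (\<ointegral>t. (cmod (f (of_real s * t)))^2)"
      proof -
        have P: "(\<lambda>k. (cmod (a k))^2 * s ^ (2 * k)) sums (\<ointegral>t. (cmod (f (of_real s * t)))^2)"
          using parseval[OF a, of s] elim by simp
        show ?thesis unfolding sums_unique[OF P] using elim by (intro sum_le_suminf sums_summable[OF P]) auto
      qed
      also have "\<dots> \<le> K" using f elim by (simp add: hardy2_def)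
      finally show ?case .
    qed
  qed simp
  have sm: "summable (\<lambda>k. (cmod (a k))^2)" by (rule summableI_nonneg_bounded[where x=K]) (use part in auto)
  define E where "E R = (\<Sum>k. (cmod (a k))^2 * (1 - R ^ k)^2)" for R :: real
  have dom: "norm ((cmod (a k))^2 * (1 - R ^ k)^2) \<le> (cmod (a k))^2" if "0 \<le> R" "R \<le> 1" for R k
  proof -
    have "0 \<le> R ^ k" "R ^ k \<le> 1" using that by (auto intro: power_le_one)
    then have "(1 - R ^ k)^2 \<le> 1" by (simp add: power_le_one)
    then show ?thesis by (simp add: mult_left_le)
  qed
  have smR: "summable (\<lambda>k. (cmod (a k))^2 * (1 - R ^ k)^2)" if "0 \<le> R" "R \<le> 1" for R
    using dom[OF that] by (intro summable_comparison_test'[OF sm]) auto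
  have "(E \<longlongrightarrow> 0) (at_left 1)"
  proof -
    have ev: "\<forall>\<^sub>F R in at_left (1::real). 0 \<le> R \<and> R \<le> 1"
      using eventually_at_left_real[of 0 1] by (auto elim: eventually_mono)
    have "((\<lambda>R. \<Sum>k. (cmod (a k))^2 * (1 - R ^ k)^2) \<longlongrightarrow> (\<Sum>k::nat. (cmod (a k))^2 * (1 - 1 ^ k)^2)) (at_left (1::real))"
    proof (rule tannerys_theorem[THEN conjunct2, THEN conjunct2])
      show "((\<lambda>R. (cmod (a k))^2 * (1 - R ^ k)^2) \<longlongrightarrow> (cmod (a k))^2 * (1 - 1 ^ k)^2) (at_left (1::real))" for k
        by (intro tendsto_intros)
      show "\<forall>\<^sub>F (k, R) in at_top \<times>\<^sub>F at_left (1::real). norm ((cmod (a k))^2 * (1 - R ^ k)^2) \<le> (cmod (a k))^2"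
      proof -
        have "\<forall>\<^sub>F x in at_top \<times>\<^sub>F at_left (1::real). (True \<and> (0 \<le> snd x \<and> snd x \<le> 1))"
          using eventually_prodI[OF always_eventually[of "\<lambda>_. True"] ev] by simp
        then show ?thesis by (rule eventually_mono) (use dom in auto)
      qed
      show "summable (\<lambda>k. (cmod (a k))^2)" by (rule sm)
    qed simp
    then show ?thesis by (simp add: E_def[abs_def])
  qed
  moreover have "(\<ointegral>t. (cmod (f (of_real s * t) - f (of_real R * (of_real s * t))))^2) \<le> E R"
    if R: "0 \<le> R" "R \<le> 1" and s: "0 \<le> s" "s < 1" for R s
  proof -
    have g: "psum (\<lambda>k. a k * (1 - of_real R ^ k)) (\<lambda>z. f z - f (of_real R * z))" unfolding psum_def
    proof (intro allI impI)
      fix z :: complex assume z: "cmod z < 1"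
      have "cmod (of_real R * z) < 1" using R z mult_left_le_one_le[of "cmod z" R] by (simp add: norm_mult)
      then have "(\<lambda>k. a k * (of_real R * z) ^ k) sums f (of_real R * z)" using a by (simp only: psum_def)
      from sums_diff[OF a[unfolded psum_def, rule_format, OF z] this]
      show "(\<lambda>k. a k * (1 - of_real R ^ k) * z ^ k) sums (f z - f (of_real R * z))"
        by (simp add: power_mult_distrib algebra_simps)
    qed
    have nrm: "(cmod (a k * (1 - of_real R ^ k)))^2 = (cmod (a k))^2 * (1 - R ^ k)^2" for k
    proof -
      have "cmod (1 - of_real R ^ k) = \<bar>1 - R ^ k\<bar>" by (metis norm_of_real of_real_1 of_real_diff of_real_power)
      then show ?thesis by (simp add: norm_mult power_mult_distrib)
    qed
    have P: "(\<lambda>k. (cmod (a k))^2 * (1 - R ^ k)^2 * s ^ (2 * k)) sums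
       (\<ointegral>t. (cmod (f (of_real s * t) - f (of_real R * (of_real s * t))))^2)" using parseval[OF g s] by (simp only: nrm)
    show ?thesis unfolding E_def sums_unique[OF P]
      using s by (intro suminf_le smR R sums_summable[OF P] mult_left_le power_le_one) auto
  qed
  moreover have "E R' \<le> E R" if "0 \<le> R" "R \<le> R'" "R' \<le> 1" for R R' unfolding E_def
  proof (intro suminf_le smR mult_left_mono power_mono)
    show "1 - R' ^ k \<le> 1 - R ^ k" for k using that by (simp add: power_mono)
    show "0 \<le> 1 - R' ^ k" for k using that by (simp add: power_le_one)
  qed (use that in auto)
  ultimately show ?thesis by (intro exI[of _ E]) auto
qed

lemma at_within_ntr_neq_bot:
  assumes x: "cmod u = 1" and C: "C \<ge> 1"
  shows "at u within ntr C u \<noteq> bot"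
    and "filterlim (\<lambda>j. of_real (1 - 1 / (real j + 2)) * u) (at u within ntr C u) sequentially"
proof -
  have "(\<lambda>j. of_real (1 - 1 / (real j + 2)) * u) \<longlonglongrightarrow> of_real (1 - 0) * u"
    by (intro tendsto_intros real_tendsto_divide_at_top[OF tendsto_const]
       filterlim_tendsto_add_at_top[OF tendsto_const filterlim_real_sequentially, of 2, simplified add.commute])
  moreover have "of_real (1 - 1 / (real j + 2)) * u \<in> ntr C u \<and> of_real (1 - 1 / (real j + 2)) * u \<noteq> u" for j
  proof -
    have n: "cmod (of_real (1 - 1 / (real j + 2)) * u) = 1 - 1 / (real j + 2)"
      using rad_bounds(1)[of j] x by (simp only: norm_mult norm_of_real abs_of_nonneg mult_1_right)
    have "of_real (1 - 1 / (real j + 2)) * u - u = of_real (- 1 / (real j + 2)) * u" by (simp add: algebra_simps)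
    then have d: "cmod (of_real (1 - 1 / (real j + 2)) * u - u) = 1 / (real j + 2)"
      using x by (simp only: norm_mult norm_of_real) simp
    show ?thesis
    proof
      show "of_real (1 - 1 / (real j + 2)) * u \<in> ntr C u"
        unfolding ntr_def mem_Collect_eq n d using C rad_bounds[of j] mult_right_mono[OF C, of "1 / (real j + 2)"] by simp
      show "of_real (1 - 1 / (real j + 2)) * u \<noteq> u" using d by force
    qed
  qed
  ultimately show F: "filterlim (\<lambda>j. of_real (1 - 1 / (real j + 2)) * u) (at u within ntr C u) sequentially"
    by (auto simp: filterlim_at)
  show "at u within ntr C u \<noteq> bot" using F filterlim_def[of _ "at u within ntr C u" sequentially] filtermap_bot_iff
    by (metis bot.extremum_uniqueI trivial_limit_sequentially)
qed

text \<open>Cauchy's criterion for filters, which yields a limit without a candidate for it.\<close>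

lemma tendsto_of_oscillation:
  fixes f :: "'a \<Rightarrow> 'b::complete_space"
  assumes F: "F \<noteq> bot" and osc: "\<And>e. e > 0 \<Longrightarrow> \<exists>c. \<forall>\<^sub>F z in F. dist (f z) c \<le> e"
  shows "\<exists>l. (f \<longlongrightarrow> l) F"
proof -
  obtain c where c: "\<And>n. \<forall>\<^sub>F z in F. dist (f z) (c n) \<le> 1 / Suc n"
    using osc[of "1 / Suc n" for n] by (metis divide_pos_pos of_nat_0_less_iff zero_less_Suc zero_less_one)
  have dc: "dist (c m) (c n) \<le> 1 / Suc m + 1 / Suc n" for m n
  proof -
    have "\<forall>\<^sub>F z in F. dist (c m) (c n) \<le> 1 / Suc m + 1 / Suc n" using c[of m] c[of n]
    proof eventually_elim
      case (elim z) then show ?case using dist_triangle3[of "c m" "c n" "f z"] by linarith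
    qed
    then show ?thesis using F by (simp add: eventually_const)
  qed
  have "Cauchy c"
  proof (rule metric_CauchyI)
    fix e :: real assume "e > 0"
    then obtain M where M: "1 / Suc M < e / 2" using nat_approx_posE[of "e/2"] by auto
    have "1 / real (Suc m) \<le> 1 / real (Suc M)" if "M \<le> m" for m using that by (intro divide_left_mono) auto
    then have "dist (c m) (c n) < e" if "M \<le> m" "M \<le> n" for m n using dc[of m n] M that by (smt (verit) field_sum_of_halves)
    then show "\<exists>M. \<forall>m\<ge>M. \<forall>n\<ge>M. dist (c m) (c n) < e" by blast
  qed
  then obtain l where l: "c \<longlonglongrightarrow> l" using Cauchy_convergent_iff convergent_def by blast
  have "(f \<longlongrightarrow> l) F"
  proof (rule tendstoI)
    fix e :: real assume e: "e > 0"
    obtain M where M: "1 / Suc M < e / 2" using nat_approx_posE[of "e/2"] e by auto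
    have "\<forall>\<^sub>F n in sequentially. dist (c n) l < e / 2 \<and> n \<ge> M"
      using tendstoD[OF l, of "e/2"] e eventually_ge_at_top[of M] by (auto intro: eventually_conj)
    then obtain n where n: "dist (c n) l < e / 2" "n \<ge> M" by (auto simp: eventually_sequentially)
    have "1 / real (Suc n) \<le> 1 / real (Suc M)" using n(2) by (intro divide_left_mono) auto
    then show "\<forall>\<^sub>F z in F. dist (f z) l < e" using c[of n] n(1) M
    proof (elim eventually_mono)
      fix z assume "dist (f z) (c n) \<le> 1 / real (Suc n)"
      then show "dist (f z) l < e" using dist_triangle[of "f z" l "c n"] n(1) M \<open>1 / real (Suc n) \<le> 1 / real (Suc M)\<close> by linarith
    qed
  qed
  then show ?thesis by blast
qed

lemma emeasure_liminf_sets: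
  assumes A: "\<And>i. A i \<in> sets cm" and c: "\<And>i. emeasure cm (A i) \<le> c"
  shows "emeasure cm (\<Union>i. \<Inter>k\<in>{i..}. A (k::nat)) \<le> c"
proof -
  have m: "(\<Inter>k\<in>{i..}. A k) \<in> sets cm" for i using A by (intro sets.countable_INT') auto
  have "incseq (\<lambda>i. \<Inter>k\<in>{i..}. A k)" by (intro monoI INF_superset_mono) auto
  then have "emeasure cm (\<Union>i. \<Inter>k\<in>{i..}. A k) = (SUP i. emeasure cm (\<Inter>k\<in>{i..}. A k))"
    using m by (intro SUP_emeasure_incseq[symmetric]) auto
  also have "\<dots> \<le> c"
  proof (rule SUP_least)
    fix i have "emeasure cm (\<Inter>k\<in>{i..}. A k) \<le> emeasure cm (A i)" using A by (intro emeasure_mono) auto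
    then show "emeasure cm (\<Inter>k\<in>{i..}. A k) \<le> c" using c order_trans by blast
  qed
  finally show ?thesis .
qed

lemma integral_abs_le_of_L2:
  fixes g :: "complex \<Rightarrow> complex"
  assumes g: "integrable cm g" "integrable cm (\<lambda>t. (cmod (g t))^2)" and le: "(\<ointegral>t. (cmod (g t))^2) \<le> e^2" and e: "e > 0"
  shows "(\<ointegral>t. cmod (g t)) \<le> e"
proof -
  have "(\<ointegral>t. cmod (g t)) \<le> (\<ointegral>t. e / 2 + (cmod (g t))^2 / (2 * e))"
  proof (rule integral_mono)
    fix t
    have "0 \<le> (cmod (g t) - e)^2" by simp
    then show "cmod (g t) \<le> e / 2 + (cmod (g t))^2 / (2 * e)" using e by (simp add: power2_diff field_simps power2_eq_square)
  qed (use g in auto)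
  also have "\<dots> = e / 2 + (\<ointegral>t. (cmod (g t))^2) / (2 * e)" using g cm.prob_space by simp
  also have "\<dots> \<le> e / 2 + e^2 / (2 * e)" using le e by (intro add_left_mono divide_right_mono) auto
  also have "\<dots> = e" using e by (simp add: power2_eq_square)
  finally show ?thesis .
qed

lemma integral_abs_le_of_square:
  assumes g: "continuous_on (sphere 0 1) g" and le: "(\<ointegral>t. (cmod (g t))^2) \<le> e^2" and e: "e > 0"
  shows "(\<ointegral>t. cmod (g t)) \<le> e"
  by (rule integral_abs_le_of_L2[OF _ _ le e]) (intro integrable_cm_continuous continuous_intros g)+

text \<open>Fatou's theorem. A dilation \<open>f (R * z)\<close> is continuous up to the circle, so the
  oscillation of \<open>f\<close> at a boundary point is that of the difference \<open>g\<close>.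
  Its restrictions to circles of radius \<open>r i\<close> have small mean, and the weak type
  inequality bounds their Poisson integrals outside sets \<open>A i\<close> of small measure.
  Letting \<open>i\<close> tend to infinity along good indices bounds \<open>g\<close> itself in the
  region.\<close>

theorem fatou_nontangential:
  assumes f: "hardy2 K f"
  shows "AE u in cm. \<forall>C\<ge>0. (f \<longlongrightarrow> bdv f u) (at u within ntr C u)"
proof -
  have hol: "f holomorphic_on ball 0 1" using f by (simp add: hardy2_def)
  obtain E where E: "(E \<longlongrightarrow> 0) (at_left (1::real))"
    "\<And>R s. 0 \<le> R \<Longrightarrow> R \<le> 1 \<Longrightarrow> 0 \<le> s \<Longrightarrow> s < 1 \<Longrightarrow>
      (\<ointegral>t. (cmod (f (of_real s * t) - f (of_real R * (of_real s * t))))^2) \<le> E R"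
    using hardy2_dilation_close[OF f] by blast
  define P where "P j u \<longleftrightarrow> (\<forall>C\<ge>0. \<exists>c. \<forall>\<^sub>F z in at u within ntr C u. dist (f z) c \<le> (16 * (1 + C) + 1) / real (Suc j))" for j u
  have "AE u in cm. P j u" for j
  proof (rule AE_small)
    fix e :: real assume e: "e > 0"
    define l where "l = 1 / real (Suc j)"
    have l: "l > 0" by (simp add: l_def)
    define e' where "e' = e * l / 20"
    have e': "e' > 0" using e l by (simp add: e'_def)
    have "\<forall>\<^sub>F R in at_left 1. E R < e'\<^sup>2 \<and> 0 < R \<and> R < 1"
      using order_tendstoD(2)[OF E(1), of "e'^2"] e' eventually_at_left_real[of 0 1] by (auto intro: eventually_conj)
    then obtain R where R: "E R < e'\<^sup>2" "0 < R" "R < 1"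
      by (metis (mono_tags, lifting) eventually_happens trivial_limit_at_left_real)
    define r where "r j = 1 - 1 / (real j + 2)" for j
    have r: "0 \<le> r i" "r i < 1" for i unfolding r_def by (rule rad_bounds)+
    define g where "g z = f z - f (of_real R * z)" for z
    have Rz: "cmod (of_real R * z) < 1" if "cmod z < 1" for z using R that mult_left_le_one_le[of "cmod z" R] by (simp add: norm_mult)
    have ghol: "g holomorphic_on ball 0 1" unfolding g_def using Rz
      by (intro holomorphic_intros hol holomorphic_on_compose_gen[OF _ hol, unfolded o_def]) auto
    have gc: "continuous_on (sphere 0 1) (\<lambda>t. g (of_real (r i) * t))" for i by (rule dilation_continuous[OF ghol r])
    have gi: "integrable cm (\<lambda>t. g (of_real (r i) * t))" for i by (rule integrable_cm_continuous[OF gc])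
    have gl: "(\<ointegral>t. cmod (g (of_real (r i) * t))) \<le> e'" for i
      by (rule integral_abs_le_of_square[OF gc _ e']) (use E(2)[of R "r i"] R r[of i] in \<open>simp add: g_def\<close>)
    have "\<exists>A. A\<in>sets cm \<and> emeasure cm A \<le> ennreal e \<and>
      (\<forall>u\<in>sphere 0 1 - A. \<forall>C\<ge>0. \<forall>z\<in>ntr C u. (\<ointegral>t. pk z t * norm (g (of_real (r i) * t))) \<le> 16 * (1 + C) * l)" for i
    proof -
      obtain A where A: "A\<in>sets cm" "emeasure cm A \<le> ennreal (20 / l * (\<ointegral>t. cmod (g (of_real (r i) * t))))"
        "\<forall>u\<in>sphere 0 1 - A. \<forall>C\<ge>0. \<forall>z\<in>ntr C u. (\<ointegral>t. pk z t * norm (g (of_real (r i) * t))) \<le> 16 * (1 + C) * l"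
        using weak_type_fun[OF gi l] by blast
      have "20 / l * (\<ointegral>t. cmod (g (of_real (r i) * t))) \<le> 20 / l * e'" using gl l by (intro mult_left_mono) auto
      also have "\<dots> = e" using l by (simp add: e'_def)
      finally show ?thesis using A by (meson ennreal_leI order_trans)
    qed
    then obtain A where A: "\<And>i. A i\<in>sets cm" "\<And>i. emeasure cm (A i) \<le> ennreal e"
      "\<And>i u C z. u\<in>sphere 0 1 - A i \<Longrightarrow> C\<ge>0 \<Longrightarrow> z\<in>ntr C u \<Longrightarrow>
         (\<ointegral>t. pk z t * norm (g (of_real (r i) * t))) \<le> 16 * (1 + C) * l" by metis
    define B where "B = (\<Union>i. \<Inter>k\<in>{i..}. A k)"
    have Bs: "B \<in> sets cm" unfolding B_def using A(1) by (intro sets.countable_UN' sets.countable_INT') auto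
    have Be: "emeasure cm B \<le> ennreal e" unfolding B_def by (rule emeasure_liminf_sets[OF A(1,2)])
    have "P j u" if x: "u \<in> sphere 0 1 - B" for u unfolding P_def
    proof (intro allI impI)
      fix C :: real assume C: "C \<ge> 0"
      have x1: "cmod u = 1" using x by simp
      have gz: "cmod (g z) \<le> 16 * (1 + C) * l" if z: "z \<in> ntr C u" for z
      proof -
        have z1: "cmod z < 1" using z by (simp add: ntr_def)
        have inf: "\<exists>k\<ge>i. cmod (g (of_real (r k) * z)) \<le> 16 * (1 + C) * l" for i
        proof -
          obtain k where k: "k \<ge> i" "u \<notin> A k" using x by (auto simp: B_def)
          have "g (of_real (r k) * z) = (\<ointegral>t. pk z t *\<^sub>R g (of_real (r k) * t))"
            by (rule poisson_cm[OF holomorphic_dilation[OF ghol r] z1, symmetric])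
          also have "cmod \<dots> \<le> (\<ointegral>t. norm (pk z t *\<^sub>R g (of_real (r k) * t)))" by (rule integral_norm_bound)
          also have "\<dots> = (\<ointegral>t. pk z t * norm (g (of_real (r k) * t)))"
            using pk_pos[OF z1] by (intro bint_cong) (auto simp: abs_of_pos)
          also have "\<dots> \<le> 16 * (1 + C) * l" using A(3)[of u k C z] x k C z by auto
          finally show ?thesis using k by blast
        qed
        have lim: "(\<lambda>k. cmod (g (of_real (r k) * z))) \<longlonglongrightarrow> cmod (g z)"
          unfolding r_def by (intro tendsto_norm dilation_tendsto ghol z1)
        show ?thesis
        proof (rule ccontr)
          assume "\<not> ?thesis"
          then have "\<forall>\<^sub>F k in sequentially. cmod (g (of_real (r k) * z)) > 16 * (1 + C) * l"
            using lim by (intro order_tendstoD) auto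
          then obtain i where "\<And>k. k \<ge> i \<Longrightarrow> cmod (g (of_real (r k) * z)) > 16 * (1 + C) * l" by (auto simp: eventually_sequentially)
          then show False using inf[of i] by (meson not_le)
        qed
      qed
      have "isCont f (of_real R * u)"
        using hol R x1 by (metis abs_of_pos continuous_on_interior holomorphic_on_imp_continuous_on interior_open
            mem_ball_0 mult.right_neutral norm_mult norm_of_real open_ball)
      then have "((\<lambda>z. f (of_real R * z)) \<longlongrightarrow> f (of_real R * u)) (at u within ntr C u)"
        by (intro isCont_tendsto_compose[of "of_real R * u" f] tendsto_intros)
      from tendstoD[OF this l]
      have "\<forall>\<^sub>F z in at u within ntr C u. dist (f (of_real R * z)) (f (of_real R * u)) < l" .
      moreover have "\<forall>\<^sub>F z in at u within ntr C u. z \<in> ntr C u" by (simp add: eventually_at_filter)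
      ultimately have "\<forall>\<^sub>F z in at u within ntr C u. dist (f z) (f (of_real R * u)) \<le> (16 * (1 + C) + 1) / real (Suc j)"
      proof eventually_elim
        case (elim z)
        have "dist (f z) (f (of_real R * u)) \<le> dist (f z) (f (of_real R * z)) + dist (f (of_real R * z)) (f (of_real R * u))"
          by (rule dist_triangle)
        also have "\<dots> \<le> 16 * (1 + C) * l + l" using gz[OF elim(2)] elim(1) by (auto simp: g_def dist_norm)
        also have "\<dots> = (16 * (1 + C) + 1) / real (Suc j)" by (simp add: l_def add_divide_distrib)
        finally show ?case .
      qed
      then show "\<exists>c. \<forall>\<^sub>F z in at u within ntr C u. dist (f z) c \<le> (16 * (1 + C) + 1) / real (Suc j)" by blast
    qed
    then show "\<exists>A\<in>sets cm. emeasure cm A \<le> ennreal e \<and> (\<forall>u\<in>sphere 0 1 - A. P j u)" using Bs Be by blast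
  qed
  then have "AE u in cm. \<forall>j. P j u" by (simp add: AE_all_countable)
  moreover have "AE u in cm. cmod u = 1" by (rule AE_I2) simp
  ultimately show ?thesis
  proof eventually_elim
    case (elim u)
    have lim: "\<exists>l. (f \<longlongrightarrow> l) (at u within ntr C u)" if C: "C \<ge> 1" for C
    proof (rule tendsto_of_oscillation)
      show "at u within ntr C u \<noteq> bot" by (rule at_within_ntr_neq_bot[OF elim(2) C])
      fix e :: real assume e: "e > 0"
      obtain j where j: "(16 * (1 + C) + 1) / e < real (Suc j)"
        using reals_Archimedean2[of "(16 * (1 + C) + 1) / e"] by (metis less_Suc_eq of_nat_less_iff order.strict_trans)
      then have j2: "(16 * (1 + C) + 1) / real (Suc j) < e" using e by (simp add: field_simps)
      obtain c where "\<forall>\<^sub>F z in at u within ntr C u. dist (f z) c \<le> (16 * (1 + C) + 1) / real (Suc j)"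
        using elim(1) C by (force simp: P_def)
      then show "\<exists>c. \<forall>\<^sub>F z in at u within ntr C u. dist (f z) c \<le> e"
        using j2 by (intro exI[of _ c]) (auto elim!: eventually_mono)
    qed
    show ?case
    proof (intro allI impI)
      fix C :: real assume C: "C \<ge> 0"
      have C1: "max C 1 \<ge> 1" by simp
      obtain l where l: "(f \<longlongrightarrow> l) (at u within ntr (max C 1) u)" using lim[OF C1] by blast
      have "(\<lambda>j. f (of_real (1 - 1 / (real j + 2)) * u)) \<longlonglongrightarrow> l"
        by (rule filterlim_compose[OF l at_within_ntr_neq_bot(2)[OF elim(2) C1]])
      then have "bdv f u = l" unfolding bdv_def by (rule limI)
      moreover have "ntr C u \<subseteq> ntr (max C 1) u"
      proof
        fix z assume "z \<in> ntr C u"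
        then have z: "cmod z < 1" "cmod (z - u) \<le> C * (1 - cmod z)" by (auto simp: ntr_def)
        have "C * (1 - cmod z) \<le> max C 1 * (1 - cmod z)" using z(1) by (intro mult_right_mono) auto
        then show "z \<in> ntr (max C 1) u" using z unfolding ntr_def mem_Collect_eq by linarith
      qed
      ultimately show "(f \<longlongrightarrow> bdv f u) (at u within ntr C u)" using tendsto_within_subset[OF l] by simp
    qed
  qed
qed

lemma bdv_measurable:
  assumes "f holomorphic_on ball 0 1" shows "bdv f \<in> borel_measurable borel_circle" unfolding bdv_def
proof (rule borel_measurable_lim_metric)
  show "(\<lambda>x. f (of_real (1 - 1 / (real j + 2)) * x)) \<in> borel_measurable borel_circle" for j
    by (intro borel_measurable_circle_continuous dilation_continuous assms rad_bounds)
qed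

lemma bdv_radial:
  assumes f: "hardy2 K f"
  shows "AE x in cm. (\<lambda>j. f (of_real (1 - 1 / (real j + 2)) * x)) \<longlonglongrightarrow> bdv f x"
  using fatou_nontangential[OF f] AE_space[of cm]
proof eventually_elim
  case (elim x)
  then have "(f \<longlongrightarrow> bdv f x) (at x within ntr 1 x)" "cmod x = 1" by auto
  then show ?case using filterlim_compose at_within_ntr_neq_bot(2)[of x 1] by fastforce
qed

text \<open>A function of the Hardy space is the Poisson integral of its boundary values: by Fatou's lemma the
  uniform estimate for differences of dilations persists in the limit, so the dilations converge to
  them in mean.\<close>

theorem hardy2_poisson:
  assumes f: "hardy2 K f"
  shows "integrable cm (bdv f)" "integrable cm (\<lambda>x. (cmod (bdv f x))^2)"
    "(\<ointegral>x. (cmod (bdv f x))^2) \<le> K"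
    "\<And>z. cmod z < 1 \<Longrightarrow> (\<ointegral>x. pk z x *\<^sub>R bdv f x) = f z"
proof -
  have hol: "f holomorphic_on ball 0 1" using f by (simp add: hardy2_def)
  define r where "r j = 1 - 1 / (real j + 2)" for j
  have r: "0 \<le> r i" "r i < 1" "r i > 0" for i unfolding r_def by (rule rad_bounds)+
  have rmono: "r i \<le> r j" if "i \<le> j" for i j unfolding r_def using that by (simp add: frac_le)
  have rlim: "r \<longlonglongrightarrow> 1"
  proof -
    have "r \<longlonglongrightarrow> 1 - 0" unfolding r_def by (intro tendsto_intros real_tendsto_divide_at_top[OF tendsto_const] 
       filterlim_tendsto_add_at_top[OF tendsto_const filterlim_real_sequentially, of 2, simplified add.commute])
    then show ?thesis by simp
  qed
  note [measurable] = bdv_measurable[OF hol]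
  have fc: "continuous_on (sphere 0 1) (\<lambda>t. f (of_real (r i) * t))" for i by (rule dilation_continuous[OF hol r(1,2)])
  have fi: "integrable cm (\<lambda>t. f (of_real (r i) * t))" for i by (rule integrable_cm_continuous[OF fc])
  have lim: "AE x in cm. (\<lambda>j. f (of_real (r j) * x)) \<longlonglongrightarrow> bdv f x" unfolding r_def by (rule bdv_radial[OF f])
  have sq: "integrable cm (\<lambda>t. (cmod (f (of_real (r i) * t)))^2)" for i
    by (intro integrable_cm_continuous continuous_intros fc)
  show i2: "integrable cm (\<lambda>x. (cmod (bdv f x))^2)" "(\<ointegral>x. (cmod (bdv f x))^2) \<le> K"
  proof (atomize(full), intro conjI)
    have l2: "AE x in cm. (\<lambda>j. (cmod (f (of_real (r j) * x)))^2) \<longlonglongrightarrow> (cmod (bdv f x))^2"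
      using lim by eventually_elim (intro tendsto_intros)
    have le: "\<forall>\<^sub>F i in sequentially. (\<ointegral>t. (cmod (f (of_real (r i) * t)))^2) \<le> K"
      using f r by (intro always_eventually) (auto simp: hardy2_def)
    show "integrable cm (\<lambda>x. (cmod (bdv f x))^2)" "(\<ointegral>x. (cmod (bdv f x))^2) \<le> K"
      using fatou_bound[OF sq _ l2 _ le] by auto
  qed
  show i1: "integrable cm (bdv f)"
  proof (rule bint_bound)
    show "integrable cm (\<lambda>x. 1 + (cmod (bdv f x))^2)" using i2 by simp
    show "AE x in cm. norm (bdv f x) \<le> norm (1 + (cmod (bdv f x))^2)"
    proof (rule AE_I2)
      fix x have "0 \<le> (cmod (bdv f x) - 1)^2" by simp
      then have "2 * cmod (bdv f x) \<le> 1 + (cmod (bdv f x))^2" by (simp add: power2_diff)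
      then show "norm (bdv f x) \<le> norm (1 + (cmod (bdv f x))^2)" using norm_ge_zero[of "bdv f x"] by (simp del: norm_ge_zero)
    qed
  qed simp
  obtain E where E: "(E \<longlongrightarrow> 0) (at_left (1::real))"
    "\<And>R s. 0 \<le> R \<Longrightarrow> R \<le> 1 \<Longrightarrow> 0 \<le> s \<Longrightarrow> s < 1 \<Longrightarrow>
      (\<ointegral>t. (cmod (f (of_real s * t) - f (of_real R * (of_real s * t))))^2) \<le> E R"
    "\<And>R R'. 0 \<le> R \<Longrightarrow> R \<le> R' \<Longrightarrow> R' \<le> 1 \<Longrightarrow> E R' \<le> E R"
    using hardy2_dilation_close[OF f] by blast
  have close: "(\<ointegral>t. cmod (f (of_real (r k) * t) - f (of_real (r j) * t))) \<le> e"
    if e: "e > 0" "E (r j) \<le> e^2" and kj: "k \<ge> j" for e j k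
  proof (rule integral_abs_le_of_square[OF _ _ e(1)])
    show "continuous_on (sphere 0 1) (\<lambda>t. f (of_real (r k) * t) - f (of_real (r j) * t))" by (intro continuous_intros fc)
    define R where "R = r j / r k"
    have R: "r j \<le> R" "R \<le> 1" "0 \<le> R" using r[of k] r[of j] rmono[OF kj] by (auto simp: R_def field_simps)
    have eq: "of_real R * (of_real (r k) * t) = of_real (r j) * t" for t :: complex using r(3)[of k] by (simp add: R_def)
    have "(\<ointegral>t. (cmod (f (of_real (r k) * t) - f (of_real (r j) * t)))^2) \<le> E R"
      using E(2)[of R "r k"] R r by (simp only: eq)
    also have "\<dots> \<le> E (r j)" using E(3)[of "r j" R] R r by simp
    finally show "(\<ointegral>t. (cmod (f (of_real (r k) * t) - f (of_real (r j) * t)))^2) \<le> e^2" using e(2) by simp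
  qed
  have close2: "(\<ointegral>t. cmod (bdv f t - f (of_real (r j) * t))) \<le> e" if e: "e > 0" "E (r j) \<le> e^2" for e j
  proof (rule fatou_bound(2)[where g="\<lambda>k t. cmod (f (of_real (r k) * t) - f (of_real (r j) * t))" and M=cm])
    show "integrable cm (\<lambda>t. cmod (f (of_real (r k) * t) - f (of_real (r j) * t)))" for k
      by (intro integrable_cm_continuous continuous_intros fc)
    show "AE t in cm. (\<lambda>k. cmod (f (of_real (r k) * t) - f (of_real (r j) * t))) \<longlonglongrightarrow> cmod (bdv f t - f (of_real (r j) * t))"
      using lim by eventually_elim (intro tendsto_intros)
    show "(\<lambda>t. cmod (bdv f t - f (of_real (r j) * t))) \<in> borel_measurable cm"
      using borel_measurable_integrable[OF fi[of j]] by measurable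
    show "\<forall>\<^sub>F k in sequentially. (\<ointegral>t. cmod (f (of_real (r k) * t) - f (of_real (r j) * t))) \<le> e"
      using close[OF e] by (auto simp: eventually_sequentially)
  qed auto
  have L1: "(\<lambda>j. \<ointegral>t. cmod (bdv f t - f (of_real (r j) * t))) \<longlonglongrightarrow> 0"
  proof (rule tendstoI)
    fix e :: real assume e: "e > 0"
    have "filterlim r (at_left 1) sequentially" using rlim r less_imp_neq[OF r(2)] by (auto simp: filterlim_at)
    from filterlim_compose[OF E(1) this] have "(\<lambda>j. E (r j)) \<longlonglongrightarrow> 0" .
    then have "\<forall>\<^sub>F j in sequentially. E (r j) < (e/2)\<^sup>2" using e by (intro order_tendstoD) auto
    then show "\<forall>\<^sub>F j in sequentially. dist (\<ointegral>t. cmod (bdv f t - f (of_real (r j) * t))) 0 < e"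
    proof eventually_elim
      case (elim j)
      have "(\<ointegral>t. cmod (bdv f t - f (of_real (r j) * t))) \<le> e / 2" using close2[of "e/2" j] elim e by simp
      moreover have "0 \<le> (\<ointegral>t. cmod (bdv f t - f (of_real (r j) * t)))" by simp
      ultimately show ?case using e by (simp add: dist_real_def)
    qed
  qed
  fix z :: complex assume z: "cmod z < 1"
  have "(\<lambda>j. f (of_real (r j) * z)) \<longlonglongrightarrow> (\<ointegral>x. pk z x *\<^sub>R bdv f x)"
  proof (rule Lim_transform_bound[where g="\<lambda>j. 2 / (1 - cmod z) * (\<ointegral>t. cmod (bdv f t - f (of_real (r j) * t)))", THEN LIM_zero_cancel])
    show "\<forall>\<^sub>F j in sequentially. norm (f (of_real (r j) * z) - (\<ointegral>x. pk z x *\<^sub>R bdv f x))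
        \<le> norm (2 / (1 - cmod z) * (\<ointegral>t. cmod (bdv f t - f (of_real (r j) * t))))"
    proof (intro always_eventually allI)
      fix j
      have "f (of_real (r j) * z) = (\<ointegral>x. pk z x *\<^sub>R f (of_real (r j) * x))"
        by (rule poisson_cm[OF holomorphic_dilation[OF hol r(1,2)] z, symmetric])
      then have "f (of_real (r j) * z) - (\<ointegral>x. pk z x *\<^sub>R bdv f x) = - (\<ointegral>x. pk z x *\<^sub>R (bdv f x - f (of_real (r j) * x)))"
        using integrable_pk_scaleR[OF z i1] integrable_pk_scaleR[OF z fi[of j]] by (simp add: scaleR_diff_right)
      also have "norm \<dots> \<le> (\<ointegral>x. norm (pk z x *\<^sub>R (bdv f x - f (of_real (r j) * x))))" by (simp only: norm_minus_cancel integral_norm_bound)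
      also have "\<dots> \<le> (\<ointegral>x. 2 / (1 - cmod z) * cmod (bdv f x - f (of_real (r j) * x)))"
      proof (rule integral_mono)
        have i3: "integrable cm (\<lambda>x. bdv f x - f (of_real (r j) * x))" using i1 fi by simp
        show "integrable cm (\<lambda>x. norm (pk z x *\<^sub>R (bdv f x - f (of_real (r j) * x))))"
          by (rule integrable_norm[OF integrable_pk_scaleR[OF z i3]])
        show "integrable cm (\<lambda>x. 2 / (1 - cmod z) * cmod (bdv f x - f (of_real (r j) * x)))"
          using i3 by (intro integrable_mult_right integrable_norm)
        fix x assume "x \<in> space cm"
        then show "norm (pk z x *\<^sub>R (bdv f x - f (of_real (r j) * x))) \<le> 2 / (1 - cmod z) * cmod (bdv f x - f (of_real (r j) * x))"
          using pk_le[OF z, of x] pk_pos[OF z, of x] by (simp only: norm_scaleR abs_of_pos space_cm mem_sphere_0 mult_right_mono norm_ge_zero)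
      qed
      also have "\<dots> = 2 / (1 - cmod z) * (\<ointegral>t. cmod (bdv f t - f (of_real (r j) * t)))" by (rule integral_mult_right_zero)
      also have "\<dots> \<le> norm \<dots>" by (simp only: real_norm_def abs_ge_self)
      finally show "norm (f (of_real (r j) * z) - (\<ointegral>x. pk z x *\<^sub>R bdv f x))
        \<le> norm (2 / (1 - cmod z) * (\<ointegral>t. cmod (bdv f t - f (of_real (r j) * t))))" .
    qed
    show "(\<lambda>j. 2 / (1 - cmod z) * (\<ointegral>t. cmod (bdv f t - f (of_real (r j) * t)))) \<longlonglongrightarrow> 0"
      using tendsto_mult_left[OF L1, of "2 / (1 - cmod z)"] by simp
  qed
  moreover have "(\<lambda>j. f (of_real (r j) * z)) \<longlonglongrightarrow> f z" unfolding r_def by (rule dilation_tendsto[OF hol z])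
  ultimately show "(\<ointegral>x. pk z x *\<^sub>R bdv f x) = f z" by (rule LIMSEQ_unique)
qed

section \<open>Almost everywhere convergence of orthonormal series\<close>

lemma AE_summable_of_integrals:
  fixes g :: "nat \<Rightarrow> 'a \<Rightarrow> real"
  assumes int: "\<And>j. integrable M (g j)" and nn: "\<And>j x. g j x \<ge> 0" and sm: "summable (\<lambda>j. integral\<^sup>L M (g j))"
  shows "AE x in M. summable (\<lambda>j. g j x)" "integrable M (\<lambda>x. \<Sum>j. g j x)"
proof -
  have [measurable]: "g j \<in> borel_measurable M" for j using int by auto
  have "(\<integral>\<^sup>+x. (\<Sum>j. ennreal (g j x)) \<partial>M) = (\<Sum>j. \<integral>\<^sup>+x. ennreal (g j x) \<partial>M)"
    by (rule nn_integral_suminf) measurable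
  also have "\<dots> = (\<Sum>j. ennreal (integral\<^sup>L M (g j)))"
    using int nn by (intro suminf_cong nn_integral_eq_integral) auto
  also have "\<dots> \<noteq> \<infinity>" using sm nn by (simp add: ennreal_suminf_neq_top)
  finally have "(\<integral>\<^sup>+x. (\<Sum>j. ennreal (g j x)) \<partial>M) \<noteq> \<infinity>" .
  then have "AE x in M. (\<Sum>j. ennreal (g j x)) \<noteq> \<infinity>" by (intro nn_integral_PInf_AE) auto
  then show A: "AE x in M. summable (\<lambda>j. g j x)"
    by eventually_elim (use nn in \<open>auto intro: summable_suminf_not_top\<close>)
  show "integrable M (\<lambda>x. \<Sum>j. g j x)" using A sm nn by (intro integrable_suminf int) auto
qed

lemma square_add_le:
  fixes x y t :: real assumes "t > 0"
  shows "(x + y)^2 \<le> (1 + t) * x^2 + (1 + 1 / t) * y^2"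
proof -
  have "0 \<le> (t * x - y)^2 / t" using assms by simp
  also have "\<dots> = t * x^2 - 2 * x * y + y^2 / t" using assms by (simp add: power2_eq_square field_simps)
  finally show ?thesis by (simp add: power2_sum algebra_simps)
qed

lemma summable_inverse_squares: "summable (\<lambda>j. 1 / (real j + 1)^2)"
proof -
  have "summable (\<lambda>n. inverse (real n ^ 2))" by (rule inverse_power_summable) simp
  then have "summable (\<lambda>n. inverse (real (Suc n) ^ 2))" by (subst summable_Suc_iff)
  then show ?thesis by (simp add: inverse_eq_divide add.commute)
qed

abbreviation maximal_convergent :: "'a measure \<Rightarrow> (nat \<Rightarrow> complex) \<Rightarrow> (nat \<Rightarrow> 'a \<Rightarrow> complex) \<Rightarrow> bool" where
  "maximal_convergent M c e \<equiv>
    \<exists>G. integrable M G \<and> (AE x in M. (\<forall>n. (cmod (\<Sum>k<n. c k * e k x))^2 \<le> G x) \<and> convergent (\<lambda>n. \<Sum>k<n. c k * e k x))"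

locale orthonormal_system =
  fixes M :: "'a measure" and e :: "nat \<Rightarrow> 'a \<Rightarrow> complex"
  assumes meas [measurable]: "\<And>k. e k \<in> borel_measurable M"
    and int: "\<And>j k. integrable M (\<lambda>x. e j x * cnj (e k x))"
    and orth: "\<And>j k. (\<integral>x. e j x * cnj (e k x) \<partial>M) = (if j = k then 1 else 0)"
begin

lemma norm_partial_sum:
  assumes "finite A"
  shows "integrable M (\<lambda>x. (cmod (\<Sum>k\<in>A. c k * e k x))^2)"
    "(\<integral>x. (cmod (\<Sum>k\<in>A. c k * e k x))^2 \<partial>M) = (\<Sum>k\<in>A. (cmod (c k))^2)"
proof -
  have eq: "complex_of_real ((cmod (\<Sum>k\<in>A. c k * e k x))^2) = (\<Sum>j\<in>A. \<Sum>k\<in>A. (c j * cnj (c k)) * (e j x * cnj (e k x)))" for x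
    by (simp only: complex_norm_square cnj_sum sum_product complex_cnj_mult) (simp add: mult_ac)
  have i: "integrable M (\<lambda>x. \<Sum>j\<in>A. \<Sum>k\<in>A. (c j * cnj (c k)) * (e j x * cnj (e k x)))"
    by (intro Bochner_Integration.integrable_sum integrable_mult_right int)
  then have "integrable M (\<lambda>x. Re (complex_of_real ((cmod (\<Sum>k\<in>A. c k * e k x))^2)))"
    unfolding eq by (rule integrable_Re)
  then show "integrable M (\<lambda>x. (cmod (\<Sum>k\<in>A. c k * e k x))^2)" by simp
  have "complex_of_real (\<integral>x. (cmod (\<Sum>k\<in>A. c k * e k x))^2 \<partial>M) = (\<integral>x. complex_of_real ((cmod (\<Sum>k\<in>A. c k * e k x))^2) \<partial>M)"
    by (rule integral_complex_of_real[symmetric])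
  also have "\<dots> = (\<Sum>j\<in>A. \<Sum>k\<in>A. (c j * cnj (c k)) * (\<integral>x. e j x * cnj (e k x) \<partial>M))"
    unfolding eq by (subst bint_sum, intro Bochner_Integration.integrable_sum integrable_mult_right int,
        subst bint_sum, intro integrable_mult_right int) (simp only: integral_mult_right_zero)
  also have "\<dots> = (\<Sum>j\<in>A. \<Sum>k\<in>A. if j = k then c j * cnj (c j) else 0)"
    by (intro sum.cong refl) (auto simp: orth)
  also have "\<dots> = (\<Sum>j\<in>A. complex_of_real ((cmod (c j))^2))"
    using assms by (intro sum.cong refl) (simp add: complex_norm_square del: of_real_power)
  finally have "complex_of_real (\<integral>x. (cmod (\<Sum>k\<in>A. c k * e k x))^2 \<partial>M) = complex_of_real (\<Sum>j\<in>A. (cmod (c j))^2)"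
    by simp
  then show "(\<integral>x. (cmod (\<Sum>k\<in>A. c k * e k x))^2 \<partial>M) = (\<Sum>k\<in>A. (cmod (c k))^2)"
    by (simp only: of_real_eq_iff)
qed

text \<open>The Rademacher-Menshov inequality by bisection of the index set. A partial sum over
  \<open>B\<close> is either a partial sum over the lower half, or the full lower half plus a
  partial sum over the upper half. The splitting \<open>square_add_le\<close> with parameter
  depending on \<open>L\<close> makes the constant grow like \<open>(L + 1)\<^sup>2\<close> instead
  of exponentially.\<close>

lemma rademacher_menshov:
  assumes "finite B" "card B \<le> 2 ^ L"
  shows "\<exists>G. integrable M G \<and> (\<forall>x. G x \<ge> 0) \<and> integral\<^sup>L M G \<le> (real L + 1)^2 * (\<Sum>k\<in>B. (cmod (c k))^2) \<and>
    (\<forall>n x. (cmod (\<Sum>k\<in>{k\<in>B. k < n}. c k * e k x))^2 \<le> G x)" using assms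
proof (induction L arbitrary: B)
  case 0
  let ?G = "\<lambda>x. (cmod (\<Sum>k\<in>B. c k * e k x))^2"
  have "{k\<in>B. k < n} = B \<or> {k\<in>B. k < n} = {}" for n
  proof -
    have "card B \<le> Suc 0" using 0 by simp
    then show ?thesis using 0(1) by (auto simp: card_le_Suc0_iff_eq)
  qed
  then have "(cmod (\<Sum>k\<in>{k\<in>B. k < n}. c k * e k x))^2 \<le> ?G x" for n x
    by (metis (no_types, lifting) norm_zero order_refl power_zero_numeral sum.empty zero_le_power2)
  then show ?case using norm_partial_sum[OF 0(1), of c] by (intro exI[of _ ?G]) auto
next
  case (Suc L)
  have "\<exists>m. card {k\<in>B. k < m} \<le> 2 ^ L \<and> card {k\<in>B. k \<ge> m} \<le> 2 ^ L"
  proof (cases "card B \<le> 2 ^ L")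
    case True
    then show ?thesis by (intro exI[of _ 0]) auto
  next
    case False
    have ex: "card {k\<in>B. k < Suc (Max B)} \<ge> 2 ^ L"
    proof -
      have "{k\<in>B. k < Suc (Max B)} = B" using Suc(2) by (auto simp: less_Suc_eq_le)
      then show ?thesis using False by simp
    qed
    define m where "m = (LEAST m. card {k\<in>B. k < m} \<ge> 2 ^ L)"
    have m: "card {k\<in>B. k < m} \<ge> 2 ^ L" unfolding m_def using ex by (rule LeastI)
    have "m \<noteq> 0"
    proof
      assume "m = 0"
      then have "(2::nat) ^ L \<le> 0" using m by simp
      then show False by simp
    qed
    then obtain m' where m': "m = Suc m'" by (cases m) auto
    have "\<not> card {k\<in>B. k < m'} \<ge> 2 ^ L" using not_less_Least[of m' "\<lambda>m. card {k\<in>B. k < m} \<ge> 2 ^ L"] m' by (simp add: m_def)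
    moreover have "{k\<in>B. k < m} \<subseteq> insert m' {k\<in>B. k < m'}" using m' by auto
    then have "card {k\<in>B. k < m} \<le> Suc (card {k\<in>B. k < m'})"
    proof -
      have f: "finite {k\<in>B. k < m'}" using Suc(2) by simp
      have "card {k\<in>B. k < m} \<le> card (insert m' {k\<in>B. k < m'})"
        by (rule card_mono) (use f \<open>{k\<in>B. k < m} \<subseteq> insert m' {k\<in>B. k < m'}\<close> in auto)
      also have "\<dots> \<le> Suc (card {k\<in>B. k < m'})" using f by (simp add: card_insert_if)
      finally show ?thesis .
    qed
    ultimately have 1: "card {k\<in>B. k < m} \<le> 2 ^ L" by linarith
    have "card B = card {k\<in>B. k < m} + card {k\<in>B. k \<ge> m}"
      using Suc(2) by (subst card_Un_disjoint[symmetric]) (auto intro!: arg_cong[where f=card])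
    then have "card {k\<in>B. k \<ge> m} \<le> 2 ^ L" using m Suc(3) by simp
    then show ?thesis using 1 by blast
  qed
  then obtain m where m: "card {k\<in>B. k < m} \<le> 2 ^ L" "card {k\<in>B. k \<ge> m} \<le> 2 ^ L" by blast
  let ?B1 = "{k\<in>B. k < m}" and ?B2 = "{k\<in>B. k \<ge> m}"
  have fin: "finite ?B1" "finite ?B2" using Suc(2) by auto
  obtain G1 where G1: "integrable M G1" "\<And>x. G1 x \<ge> 0" "integral\<^sup>L M G1 \<le> (real L + 1)^2 * (\<Sum>k\<in>?B1. (cmod (c k))^2)"
    "\<And>n x. (cmod (\<Sum>k\<in>{k\<in>?B1. k < n}. c k * e k x))^2 \<le> G1 x" using Suc.IH[OF fin(1) m(1)] by blast
  obtain G2 where G2: "integrable M G2" "\<And>x. G2 x \<ge> 0" "integral\<^sup>L M G2 \<le> (real L + 1)^2 * (\<Sum>k\<in>?B2. (cmod (c k))^2)"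
    "\<And>n x. (cmod (\<Sum>k\<in>{k\<in>?B2. k < n}. c k * e k x))^2 \<le> G2 x" using Suc.IH[OF fin(2) m(2)] by blast
  \<comment> \<open>This parameter makes \<open>(1 + t) + (1 + 1 / t) * t\<^sup>2 = (1 + t)\<^sup>2\<close> the constant for \<open>Suc L\<close>.\<close>
  define t where "t = real L + 1"
  have t: "t \<ge> 1" by (simp add: t_def)
  let ?S = "\<lambda>x. (cmod (\<Sum>k\<in>?B1. c k * e k x))^2"
  define G where "G x = (1 + t) * ?S x + (1 + 1 / t) * (G1 x + G2 x)" for x
  define a1 a2 where "a1 = (\<Sum>k\<in>?B1. (cmod (c k))^2)" and "a2 = (\<Sum>k\<in>?B2. (cmod (c k))^2)"
  have a: "a1 \<ge> 0" "a2 \<ge> 0" by (auto simp: a1_def a2_def intro: sum_nonneg)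
  have aB: "(\<Sum>k\<in>B. (cmod (c k))^2) = a1 + a2"
  proof -
    have "B = ?B1 \<union> ?B2" by auto
    moreover have "sum f (?B1 \<union> ?B2) = sum f ?B1 + sum f ?B2" for f :: "nat \<Rightarrow> real"
      by (rule sum.union_disjoint[OF fin]) auto
    ultimately show ?thesis unfolding a1_def a2_def by metis
  qed
  have iG: "integrable M G" unfolding G_def using norm_partial_sum[OF fin(1), of c] G1(1) G2(1) by auto
  have "integral\<^sup>L M G = (1 + t) * a1 + (1 + 1 / t) * (integral\<^sup>L M G1 + integral\<^sup>L M G2)"
    unfolding G_def a1_def using norm_partial_sum[OF fin(1), of c] G1(1) G2(1) by simp
  also have "\<dots> \<le> (1 + t) * a1 + (1 + 1 / t) * (t^2 * a1 + t^2 * a2)"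
    using G1(3) G2(3) t unfolding a1_def a2_def t_def by (intro add_left_mono mult_left_mono add_mono) auto
  also have "\<dots> = (1 + t) * a1 + (1 + t) * t * (a1 + a2)" using t by (simp add: power2_eq_square field_simps)
  also have "\<dots> \<le> (1 + t) * (a1 + a2) + (1 + t) * t * (a1 + a2)" using a t by (intro add_right_mono mult_left_mono) auto
  also have "\<dots> = (real (Suc L) + 1)^2 * (\<Sum>k\<in>B. (cmod (c k))^2)"
    unfolding aB t_def by (simp add: power2_eq_square algebra_simps)
  finally have le: "integral\<^sup>L M G \<le> (real (Suc L) + 1)^2 * (\<Sum>k\<in>B. (cmod (c k))^2)" .
  have nn: "G x \<ge> 0" for x unfolding G_def using G1(2) G2(2) t by (intro add_nonneg_nonneg mult_nonneg_nonneg) auto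
  have dom: "(cmod (\<Sum>k\<in>{k\<in>B. k < n}. c k * e k x))^2 \<le> G x" for n x
  proof (cases "n \<le> m")
    case True
    then have "{k\<in>B. k < n} = {k\<in>?B1. k < n}" by auto
    then have "(cmod (\<Sum>k\<in>{k\<in>B. k < n}. c k * e k x))^2 \<le> G1 x" using G1(4) by metis
    also have "\<dots> \<le> (1 + t) * 0 + (1 + 1 / t) * (G1 x + 0)" using G1(2)[of x] t by (simp add: algebra_simps)
    also have "\<dots> \<le> G x" unfolding G_def using G1(2) G2(2) t by (intro add_mono mult_left_mono) auto
    finally show ?thesis .
  next
    case False
    have "(\<Sum>k\<in>{k\<in>B. k < n}. c k * e k x) = (\<Sum>k\<in>?B1. c k * e k x) + (\<Sum>k\<in>{k\<in>?B2. k < n}. c k * e k x)"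
    proof -
      have "{k\<in>B. k < n} = ?B1 \<union> {k\<in>?B2. k < n}" using False by auto
      moreover have "sum f (?B1 \<union> {k\<in>?B2. k < n}) = sum f ?B1 + sum f {k\<in>?B2. k < n}" for f :: "nat \<Rightarrow> complex"
        by (rule sum.union_disjoint) (use fin in auto)
      ultimately show ?thesis by metis
    qed
    then have "(cmod (\<Sum>k\<in>{k\<in>B. k < n}. c k * e k x))^2 \<le> (cmod (\<Sum>k\<in>?B1. c k * e k x) + cmod (\<Sum>k\<in>{k\<in>?B2. k < n}. c k * e k x))^2"
      by (intro power_mono) (auto simp: norm_triangle_ineq)
    also have "\<dots> \<le> (1 + t) * ?S x + (1 + 1 / t) * (cmod (\<Sum>k\<in>{k\<in>?B2. k < n}. c k * e k x))^2"
      using t by (intro square_add_le) auto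
    also have "\<dots> \<le> (1 + t) * ?S x + (1 + 1 / t) * (0 + G2 x)" using G2(4)[where n=n and x=x] t by (intro add_left_mono mult_left_mono) auto
    also have "\<dots> \<le> G x" unfolding G_def using G1(2) t by (intro add_left_mono mult_left_mono) auto
    finally show ?thesis .
  qed
  show ?case using iG nn le dom by blast
qed

text \<open>Cauchy-Schwarz with the weights \<open>j + 1\<close>: a loss of a factor \<open>(j +
  1)\<^sup>2\<close> on the \<open>j\<close>-th block pays for summing the blocks without squares.\<close>

lemma weighted_sum_bounds:
  fixes u :: "nat \<Rightarrow> real"
  assumes nn: "\<And>j. u j \<ge> 0" and sm: "summable (\<lambda>j. (real j + 1)^2 * (u j)^2)"
  shows "summable u"
    "(\<Sum>j<J. u j)^2 \<le> (\<Sum>j. 1 / (real j + 1)^2) * (\<Sum>j. (real j + 1)^2 * (u j)^2)"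
proof -
  show "summable u"
  proof (rule summable_comparison_test'[where N=0])
    show "summable (\<lambda>j. 1 / (real j + 1)^2 + (real j + 1)^2 * (u j)^2)"
      by (rule summable_add[OF summable_inverse_squares sm])
    fix j
    have "0 \<le> (1 / (real j + 1) - (real j + 1) * u j)^2" by simp
    then have "2 * u j \<le> 1 / (real j + 1)^2 + (real j + 1)^2 * (u j)^2"
      by (simp add: power2_diff power_mult_distrib power_divide)
    then show "norm (u j) \<le> 1 / (real j + 1)^2 + (real j + 1)^2 * (u j)^2" using nn[of j] by simp
  qed
  have "(\<Sum>j<J. u j)^2 = (\<Sum>j<J. 1 / (real j + 1) * ((real j + 1) * u j))^2"
    by (intro arg_cong[where f="\<lambda>x. x\<^sup>2"] sum.cong) auto
  also have "\<dots> \<le> (\<Sum>j<J. (1 / (real j + 1))^2) * (\<Sum>j<J. ((real j + 1) * u j)^2)" by (rule Cauchy_Schwarz_ineq_sum)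
  also have "\<dots> \<le> (\<Sum>j. 1 / (real j + 1)^2) * (\<Sum>j. (real j + 1)^2 * (u j)^2)"
    unfolding power_mult_distrib power_divide power_one
    by (intro mult_mono sum_le_suminf summable_inverse_squares sm suminf_nonneg sum_nonneg) auto
  finally show "(\<Sum>j<J. u j)^2 \<le> (\<Sum>j. 1 / (real j + 1)^2) * (\<Sum>j. (real j + 1)^2 * (u j)^2)" .
qed

text \<open>The indices are grouped into the dyadic blocks \<open>2 ^ j - 1 \<le> k < 2 ^ (j + 1) - 1\<close>,
  on which the logarithm is of the order of \<open>j + 1\<close>. The factor \<open>(j +
  1)\<^sup>2\<close> that the hypothesis affords is used twice but not multiplied: in the maximal
  inequality inside a block, and for the absolute convergence of the series of full blocks.\<close>

theorem menshov_log:
  assumes c: "summable (\<lambda>k. (cmod (c k) * ln (real k + 2))^2)"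
  shows "maximal_convergent M c e"
proof -
  define B where "B j = {2 ^ j - 1..<2 ^ Suc j - 1 :: nat}" for j
  have cB: "finite (B j)" "card (B j) \<le> 2 ^ j" for j by (auto simp: B_def)
  define a where "a j = (\<Sum>k\<in>B j. (cmod (c k))^2)" for j
  have "\<forall>j. \<exists>G. integrable M G \<and> (\<forall>x. G x \<ge> 0) \<and> integral\<^sup>L M G \<le> (real j + 1)^2 * a j \<and>
    (\<forall>n x. (cmod (\<Sum>k\<in>{k\<in>B j. k < n}. c k * e k x))^2 \<le> G x)"
    unfolding a_def using rademacher_menshov[OF cB] by blast
  from choice[OF this] obtain G where "\<forall>j. integrable M (G j) \<and> (\<forall>x. G j x \<ge> 0) \<and> integral\<^sup>L M (G j) \<le> (real j + 1)^2 * a j \<and>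
    (\<forall>n x. (cmod (\<Sum>k\<in>{k\<in>B j. k < n}. c k * e k x))^2 \<le> G j x)" by blast
  then have G: "\<And>j. integrable M (G j)" "\<And>j x. G j x \<ge> 0" "\<And>j. integral\<^sup>L M (G j) \<le> (real j + 1)^2 * a j"
    "\<And>j n x. (cmod (\<Sum>k\<in>{k\<in>B j. k < n}. c k * e k x))^2 \<le> G j x" by blast+
  define D where "D j x = (\<Sum>k\<in>B j. c k * e k x)" for j x
  have iD: "integrable M (\<lambda>x. (cmod (D j x))^2)" "(\<integral>x. (cmod (D j x))^2 \<partial>M) = a j" for j
    unfolding D_def a_def using norm_partial_sum[OF cB(1)] by auto
  have disj: "disjoint_family B" unfolding disjoint_family_on_def
  proof (intro ballI impI)
    fix i j :: nat assume "i \<noteq> j"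
    then consider "Suc i \<le> j" | "Suc j \<le> i" by linarith
    then show "B i \<inter> B j = {}"
    proof cases
      case 1
      then have "(2::nat) ^ Suc i \<le> 2 ^ j" by (intro power_increasing) auto
      then show ?thesis by (auto simp: B_def)
    next
      case 2
      then have "(2::nat) ^ Suc j \<le> 2 ^ i" by (intro power_increasing) auto
      then show ?thesis by (auto simp: B_def)
    qed
  qed
  have un: "(\<Union>j<J. B j) = {..<2 ^ J - 1}" for J
  proof (induction J)
    case (Suc J)
    have "(2::nat) ^ J \<ge> 1" by simp
    then have "{..<2 ^ J - 1} \<union> B J = {..<2 ^ Suc J - 1}" unfolding B_def by (intro ivl_disj_un_one(2)) simp
    then show ?case using Suc by (simp add: lessThan_Suc Un_commute)
  qed simp
  have blk: "(\<Sum>j<J. \<Sum>k\<in>B j. f k) = (\<Sum>k<2^J - 1. f k)" for J and f :: "nat \<Rightarrow> 'z::comm_monoid_add"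
  proof -
    have "(\<Sum>k\<in>(\<Union>j<J. B j). f k) = (\<Sum>j<J. \<Sum>k\<in>B j. f k)"
      using disj cB by (intro sum.UNION_disjoint) (auto simp: disjoint_family_on_def)
    then show ?thesis by (simp add: un)
  qed
  have sma: "summable (\<lambda>j. (real j + 1)^2 * a j)"
  proof (rule summableI_nonneg_bounded)
    show "0 \<le> (real j + 1)^2 * a j" for j unfolding a_def by (intro mult_nonneg_nonneg sum_nonneg) auto
    have l2: "ln 2 > (0::real)" by simp
    have le: "(real j + 1)^2 * (cmod (c k))^2 \<le> (2 / ln 2)^2 * (cmod (c k) * ln (real k + 2))^2" if k: "k \<in> B j" for j k
    proof -
      have "2 ^ j \<le> k + 2" using k by (auto simp: B_def)
      then have "(2::real) ^ j \<le> real k + 2" by (metis of_nat_add of_nat_le_iff of_nat_numeral of_nat_power)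
      then have "ln ((2::real) ^ j) \<le> ln (real k + 2)" by (subst ln_le_cancel_iff) auto
      then have "real j * ln 2 \<le> ln (real k + 2)" by (simp add: ln_realpow)
      moreover have "ln 2 \<le> ln (real k + 2)" by simp
      moreover have "(real j + 1) * ln 2 = real j * ln 2 + (ln 2 :: real)" by (simp add: algebra_simps)
      ultimately have "(real j + 1) * ln 2 \<le> 2 * ln (real k + 2)" by linarith
      then have "real j + 1 \<le> 2 / ln 2 * ln (real k + 2)" using l2 by (simp add: field_simps)
      then have "(real j + 1) * cmod (c k) \<le> (2 / ln 2 * ln (real k + 2)) * cmod (c k)" by (intro mult_right_mono) auto
      then have "((real j + 1) * cmod (c k))^2 \<le> (2 / ln 2 * (cmod (c k) * ln (real k + 2)))^2"
        by (intro power_mono) (auto simp: mult_ac)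
      then show ?thesis by (simp only: power_mult_distrib)
    qed
    show "(\<Sum>j<J. (real j + 1)^2 * a j) \<le> (2 / ln 2)^2 * (\<Sum>k. (cmod (c k) * ln (real k + 2))^2)" for J
    proof -
      have "(\<Sum>j<J. (real j + 1)^2 * a j) \<le> (\<Sum>j<J. \<Sum>k\<in>B j. (2 / ln 2)^2 * (cmod (c k) * ln (real k + 2))^2)"
        unfolding a_def sum_distrib_left by (intro sum_mono le)
      also have "\<dots> = (2 / ln 2)^2 * (\<Sum>k<2^J - 1. (cmod (c k) * ln (real k + 2))^2)"
        unfolding blk by (simp only: sum_distrib_left)
      also have "\<dots> \<le> (2 / ln 2)^2 * (\<Sum>k. (cmod (c k) * ln (real k + 2))^2)"
        by (intro mult_left_mono sum_le_suminf c) auto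
      finally show ?thesis .
    qed
  qed
  have 1: "AE x in M. summable (\<lambda>j. (real j + 1)^2 * (cmod (D j x))^2)" "integrable M (\<lambda>x. \<Sum>j. (real j + 1)^2 * (cmod (D j x))^2)"
    using AE_summable_of_integrals[of M "\<lambda>j x. (real j + 1)^2 * (cmod (D j x))^2"] iD sma by simp_all
  have smG: "summable (\<lambda>j. integral\<^sup>L M (G j))" by (rule summable_comparison_test'[OF sma, of 0]) (use G(2,3) in simp)
  have 2: "AE x in M. summable (\<lambda>j. G j x)" "integrable M (\<lambda>x. \<Sum>j. G j x)"
    using AE_summable_of_integrals[OF G(1,2) smG] by simp_all
  define K where "K = (\<Sum>j. 1 / (real j + 1)^2)"
  define W where "W x = 2 * (K * (\<Sum>j. (real j + 1)^2 * (cmod (D j x))^2)) + 2 * (\<Sum>j. G j x)" for x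
  have iW: "integrable M W" unfolding W_def using 1(2) 2(2) by auto
  have "AE x in M. (\<forall>n. (cmod (\<Sum>k<n. c k * e k x))^2 \<le> W x) \<and> convergent (\<lambda>n. \<Sum>k<n. c k * e k x)"
    using 1(1) 2(1)
  proof eventually_elim
    case (elim x)
    note wb = weighted_sum_bounds[of "\<lambda>j. cmod (D j x)", OF norm_ge_zero elim(1)]
    have split: "\<exists>J. 2 ^ J \<le> n + 1 \<and> n + 1 < 2 ^ Suc J \<and>
       (\<Sum>k<n. c k * e k x) = (\<Sum>j<J. D j x) + (\<Sum>k\<in>{k\<in>B J. k < n}. c k * e k x)" for n
    proof -
      obtain J where J: "2 ^ J \<le> n + 1" "n + 1 < 2 ^ Suc J" using ex_power_ivl1[of 2 "n+1"] by auto
      have "{..<n} = {..<2 ^ J - 1} \<union> {k\<in>B J. k < n}" using J by (auto simp: B_def)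
      then have "(\<Sum>k<n. c k * e k x) = (\<Sum>k<2^J - 1. c k * e k x) + (\<Sum>k\<in>{k\<in>B J. k < n}. c k * e k x)"
      proof -
        have "sum f ({..<2 ^ J - 1} \<union> {k\<in>B J. k < n}) = sum f {..<2 ^ J - 1} + sum f {k\<in>B J. k < n}" for f :: "nat \<Rightarrow> complex"
          by (rule sum.union_disjoint) (auto simp: B_def)
        then show ?thesis using \<open>{..<n} = _\<close> by metis
      qed
      then show ?thesis using J by (auto simp: D_def blk)
    qed
    have G1: "G J x \<le> (\<Sum>j. G j x)" for J using sum_le_suminf[OF elim(2), of "{J}"] G(2) by simp
    have "(cmod (\<Sum>k<n. c k * e k x))^2 \<le> W x" for n
    proof -
      obtain J where J: "(\<Sum>k<n. c k * e k x) = (\<Sum>j<J. D j x) + (\<Sum>k\<in>{k\<in>B J. k < n}. c k * e k x)" using split by blast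
      have "cmod (\<Sum>k<n. c k * e k x) \<le> (\<Sum>j<J. cmod (D j x)) + cmod (\<Sum>k\<in>{k\<in>B J. k < n}. c k * e k x)"
        unfolding J by (rule order_trans[OF norm_triangle_ineq add_right_mono[OF norm_sum]])
      then have "(cmod (\<Sum>k<n. c k * e k x))^2 \<le> ((\<Sum>j<J. cmod (D j x)) + cmod (\<Sum>k\<in>{k\<in>B J. k < n}. c k * e k x))^2"
        by (intro power_mono) auto
      also have "\<dots> \<le> (1 + 1) * (\<Sum>j<J. cmod (D j x))^2 + (1 + 1 / 1) * (cmod (\<Sum>k\<in>{k\<in>B J. k < n}. c k * e k x))^2"
        by (rule square_add_le) simp
      also have "\<dots> \<le> W x"
        unfolding W_def K_def using wb(2)[of J] order_trans[OF G(4)[where j=J and n=n and x=x] G1[of J]] by simp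
      finally show ?thesis .
    qed
    moreover have "convergent (\<lambda>n. \<Sum>k<n. c k * e k x)"
    proof -
      have "summable (\<lambda>j. D j x)" by (rule summable_norm_cancel[OF wb(1)])
      then obtain l where l: "(\<lambda>J. \<Sum>j<J. D j x) \<longlonglongrightarrow> l" using summable_LIMSEQ by blast
      have G0: "(\<lambda>j. G j x) \<longlonglongrightarrow> 0" by (rule summable_LIMSEQ_zero[OF elim(2)])
      have "(\<lambda>n. \<Sum>k<n. c k * e k x) \<longlonglongrightarrow> l"
      proof (rule metric_LIMSEQ_I)
        fix r :: real assume r: "r > 0"
        obtain J0 where J0: "\<And>J. J \<ge> J0 \<Longrightarrow> dist (\<Sum>j<J. D j x) l < r / 2"
          using metric_LIMSEQ_D[OF l, of "r/2"] r by auto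
        obtain J1 where J1: "\<And>J. J \<ge> J1 \<Longrightarrow> G J x < (r / 2)\<^sup>2"
          using order_tendstoD(2)[OF G0, of "(r/2)^2"] r by (auto simp: eventually_sequentially)
        show "\<exists>no. \<forall>n\<ge>no. dist (\<Sum>k<n. c k * e k x) l < r"
        proof (intro exI[of _ "2 ^ (max J0 J1)"] allI impI)
          fix n assume n: "n \<ge> (2::nat) ^ (max J0 J1)"
          obtain J where J: "n + 1 < 2 ^ Suc J" "(\<Sum>k<n. c k * e k x) = (\<Sum>j<J. D j x) + (\<Sum>k\<in>{k\<in>B J. k < n}. c k * e k x)"
            using split by blast
          have "(2::nat) ^ (max J0 J1) < 2 ^ Suc J" using n J(1) by linarith
          then have "max J0 J1 < Suc J" by (rule power_less_imp_less_exp[rotated]) simp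
          then have JJ: "J \<ge> J0" "J \<ge> J1" by auto
          have "(cmod (\<Sum>k\<in>{k\<in>B J. k < n}. c k * e k x))^2 < (r/2)\<^sup>2" using G(4)[where j=J and n=n and x=x] J1[OF JJ(2)] by linarith
          then have "cmod (\<Sum>k\<in>{k\<in>B J. k < n}. c k * e k x) < r / 2" by (rule power2_less_imp_less) (use r in simp)
          moreover have "dist (\<Sum>k<n. c k * e k x) l \<le> dist (\<Sum>j<J. D j x) l + cmod (\<Sum>k\<in>{k\<in>B J. k < n}. c k * e k x)"
            unfolding J dist_norm using norm_triangle_ineq[of "(\<Sum>j<J. D j x) - l" "\<Sum>k\<in>{k\<in>B J. k < n}. c k * e k x"] by (simp add: algebra_simps)
          ultimately show "dist (\<Sum>k<n. c k * e k x) l < r" using J0[OF JJ(1)] by linarith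
        qed
      qed
      then show ?thesis by (rule convergentI)
    qed
    ultimately show ?case by blast
  qed
  then show ?thesis using iW by blast
qed

text \<open>The indices are grouped by the size of the coefficient instead of by position. The block with
  \<open>\<bar>c k\<bar>\<close> near \<open>2 ^ (- j)\<close> has at most of the order of \<open>2
  ^ (p * j)\<close> members, so the Rademacher-Menshov constant is only of the order of \<open>(j +
  1)\<^sup>2\<close>, while the block has square sum of the order of \<open>2 ^ ((p - 2) *
  j)\<close>. Since \<open>p < 2\<close> the blocks can be summed with room to spare.\<close>

theorem menshov_lp:
  assumes c1: "\<And>k. cmod (c k) \<le> 1" and p: "1 \<le> p" "p < 2" and c: "summable (\<lambda>k. cmod (c k) powr p)"
  shows "maximal_convergent M c e"
proof -
  define B where "B j = {k. (1/2) ^ Suc j < cmod (c k) \<and> cmod (c k) \<le> (1/2) ^ j}" for j :: nat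
  define A where "A = (\<Sum>k. cmod (c k) powr p)"
  have A0: "A \<ge> 0" unfolding A_def by (intro suminf_nonneg c) auto
  have finB: "finite (B j)" and cardB: "real (card (B j)) \<le> A * 2 powr (p * Suc j)" for j
  proof -
    have "finite (B j) \<and> real (card (B j)) \<le> A * 2 powr (p * Suc j)"
    proof -
      have lower: "2 powr (- p * Suc j) \<le> cmod (c k) powr p" if "k \<in> B j" for k
      proof -
        have "((1/2) ^ Suc j) powr p \<le> cmod (c k) powr p" using that p by (intro powr_mono2) (auto simp: B_def)
        moreover have "((1/2::real) ^ Suc j) powr p = 2 powr (- p * Suc j)"
        proof -
          have "(1/2::real) ^ Suc j = 2 powr (- real (Suc j))" by (simp add: powr_minus powr_realpow power_one_over inverse_eq_divide del: power_Suc of_nat_Suc)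
          then show ?thesis by (simp only: powr_powr) (simp add: algebra_simps)
        qed
        ultimately show ?thesis by simp
      qed
      have bnd: "real (card F) \<le> A * 2 powr (p * Suc j)" if F: "finite F" "F \<subseteq> B j" for F
      proof -
        have "real (card F) * 2 powr (- p * Suc j) = (\<Sum>k\<in>F. 2 powr (- p * Suc j))" by simp
        also have "\<dots> \<le> (\<Sum>k\<in>F. cmod (c k) powr p)" using F lower by (intro sum_mono) auto
        also have "\<dots> \<le> A" unfolding A_def using F by (intro sum_le_suminf c) auto
        finally have "real (card F) * 2 powr (- p * Suc j) * 2 powr (p * Suc j) \<le> A * 2 powr (p * Suc j)" by (intro mult_right_mono) auto
        moreover have "2 powr (- p * Suc j) * 2 powr (p * Suc j) = (1::real)" by (simp flip: powr_add del: of_nat_Suc)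
        ultimately show ?thesis by (simp only: mult.assoc mult_1_right)
      qed
      have "finite (B j)"
      proof (rule ccontr)
        assume "infinite (B j)"
        moreover obtain N where N: "A * 2 powr (p * Suc j) < real N" using reals_Archimedean2 by blast
        ultimately obtain F where "finite F" "card F = N" "F \<subseteq> B j" using infinite_arbitrarily_large by blast
        then show False using bnd N by fastforce
      qed
      then show ?thesis using bnd by blast
    qed
    then show "finite (B j)" "real (card (B j)) \<le> A * 2 powr (p * Suc j)" by auto
  qed
  obtain a :: nat where a: "A < 2 ^ a" using real_arch_pow[of 2 A] by auto
  define L where "L j = 2 * (j + 1) + a" for j
  have cardL: "card (B j) \<le> 2 ^ L j" for j
  proof -
    have "real (card (B j)) \<le> A * 2 powr (p * Suc j)" by (rule cardB)
    also have "\<dots> \<le> 2 ^ a * 2 powr (2 * Suc j)"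
    proof (rule mult_mono)
      show "2 powr (p * real (Suc j)) \<le> 2 powr (real (2 * Suc j))"
        using mult_right_mono[of p 2 "real (Suc j)"] p by (intro powr_mono) auto
    qed (use a A0 in auto)
    also have "\<dots> = 2 ^ L j"
    proof -
      have "(2::real) powr (2 * Suc j) = 2 ^ (2 * (j + 1))" by (subst powr_realpow[symmetric]) auto
      then show ?thesis by (simp add: L_def power_add)
    qed
    finally show ?thesis by (metis of_nat_le_iff of_nat_numeral of_nat_power)
  qed
  have "\<forall>j. \<exists>G. integrable M G \<and> (\<forall>x. G x \<ge> 0) \<and> integral\<^sup>L M G \<le> (real (L j) + 1)^2 * (\<Sum>k\<in>B j. (cmod (c k))^2) \<and>
    (\<forall>n x. (cmod (\<Sum>k\<in>{k\<in>B j. k < n}. c k * e k x))^2 \<le> G x)"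
    using rademacher_menshov[OF finB cardL] by blast
  from choice[OF this] obtain G where "\<forall>j. integrable M (G j) \<and> (\<forall>x. G j x \<ge> 0) \<and> integral\<^sup>L M (G j) \<le> (real (L j) + 1)^2 * (\<Sum>k\<in>B j. (cmod (c k))^2) \<and>
    (\<forall>n x. (cmod (\<Sum>k\<in>{k\<in>B j. k < n}. c k * e k x))^2 \<le> G j x)" by blast
  then have G: "\<And>j. integrable M (G j)" "\<And>j x. G j x \<ge> 0" "\<And>j. integral\<^sup>L M (G j) \<le> (real (L j) + 1)^2 * (\<Sum>k\<in>B j. (cmod (c k))^2)"
    "\<And>j n x. (cmod (\<Sum>k\<in>{k\<in>B j. k < n}. c k * e k x))^2 \<le> G j x" by blast+
  have IG: "integral\<^sup>L M (G j) \<le> (real (L j) + 1)^2 * (A * 2 powr (p * Suc j) * (1/4) ^ j)" for j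
  proof -
    have "(\<Sum>k\<in>B j. (cmod (c k))^2) \<le> (\<Sum>k\<in>B j. (1/4) ^ j)"
    proof (rule sum_mono)
      fix k assume "k \<in> B j"
      then have "(cmod (c k))^2 \<le> ((1/2) ^ j)^2" by (intro power_mono) (auto simp: B_def)
      also have "\<dots> = (1/4) ^ j" by (simp add: power2_eq_square flip: power_mult_distrib)
      finally show "(cmod (c k))^2 \<le> (1/4) ^ j" .
    qed
    also have "\<dots> = real (card (B j)) * (1/4) ^ j" by simp
    also have "\<dots> \<le> A * 2 powr (p * Suc j) * (1/4) ^ j" using cardB by (intro mult_right_mono) auto
    finally show ?thesis using G(3)[of j] by (smt (verit) mult_left_mono zero_le_power2)
  qed
  have smbig: "summable (\<lambda>j. (real j + 1)^2 * ((real (L j) + 1)^2 * (A * 2 powr (p * Suc j) * (1/4) ^ j)))"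
  proof -
    define q where "q = 2 powr (p - 2)"
    have q: "0 < q" "q < 1" unfolding q_def using p by (auto simp: powr_less_one)
    have qj: "2 powr (p * Suc j) * (1/4) ^ j = 2 powr p * q ^ j" for j
    proof -
      have "(1/4::real) ^ j = 2 powr (-2 * real j)"
      proof -
        have "(2::real) powr (-2 * real j) = (2 powr (-2)) powr real j" by (simp only: powr_powr)
        also have "\<dots> = (2 powr (-2)) ^ j" by (rule powr_realpow) simp
        also have "(2::real) powr (-2) = 1/4" by (simp add: powr_minus)
        finally show ?thesis by simp
      qed
      moreover have "q ^ j = 2 powr ((p - 2) * real j)" unfolding q_def by (subst powr_realpow[symmetric]) (auto simp: powr_powr)
      ultimately show ?thesis by (simp add: powr_add[symmetric] algebra_simps)
    qed
    have "summable (\<lambda>j. (A * 2 powr p) * ((real j + 1)^2 * (real (L j) + 1)^2 * q ^ j))"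
    proof (intro summable_mult)
      define s where "s = (q + 1) / 2"
      have s: "q < s" "s < 1" "0 < s" using q by (auto simp: s_def)
      have "(\<lambda>j. (real j + 1)^2 * (real (2 * (j + 1) + a) + 1)^2 * q ^ j) \<in> O(\<lambda>j. s ^ j)"
        using q s by real_asymp
      moreover have "summable (\<lambda>j. norm (s ^ j))" using s by (simp add: summable_geometric)
      ultimately show "summable (\<lambda>j. (real j + 1)^2 * (real (L j) + 1)^2 * q ^ j)"
        unfolding L_def by (rule summable_comparison_test_bigo[rotated])
    qed
    moreover have "(real j + 1)^2 * ((real (L j) + 1)^2 * (A * 2 powr (p * Suc j) * (1/4) ^ j)) = (A * 2 powr p) * ((real j + 1)^2 * (real (L j) + 1)^2 * q ^ j)" for j
      using qj[of j] by (simp only: mult.assoc) (simp only: mult_ac)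
    ultimately show ?thesis by (simp only:)
  qed
  have smG: "summable (\<lambda>j. \<integral>x. (real j + 1)^2 * G j x \<partial>M)"
  proof (rule summable_comparison_test'[OF smbig, of 0])
    fix j
    have "0 \<le> integral\<^sup>L M (G j)" using G(2) by simp
    then show "norm (\<integral>x. (real j + 1)^2 * G j x \<partial>M) \<le> (real j + 1)^2 * ((real (L j) + 1)^2 * (A * 2 powr (p * Suc j) * (1/4) ^ j))"
      using mult_left_mono[OF IG[of j], of "(real j + 1)^2"] by simp
  qed
  have i1: "integrable M (\<lambda>x. (real j + 1)^2 * G j x)" for j using G(1) by simp
  have 2: "AE x in M. summable (\<lambda>j. (real j + 1)^2 * G j x)" "integrable M (\<lambda>x. \<Sum>j. (real j + 1)^2 * G j x)"
    using AE_summable_of_integrals[OF i1 _ smG] G(2) by simp_all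
  define W where "W x = (\<Sum>j. 1 / (real j + 1)^2) * (\<Sum>j. (real j + 1)^2 * G j x)" for x
  have iW: "integrable M W" unfolding W_def using 2(2) by auto
  define lev where "lev k = (LEAST j. (1/2) ^ Suc j < cmod (c k))" for k
  have lev: "c k \<noteq> 0 \<Longrightarrow> k \<in> B (lev k)" and levu: "k \<in> B j \<Longrightarrow> j = lev k" for k j
  proof -
    have uniq: "k \<in> B j \<Longrightarrow> k \<in> B i \<Longrightarrow> i = j" for i j
    proof (rule ccontr)
      assume a: "k \<in> B j" "k \<in> B i" "i \<noteq> j"
      have *: False if "Suc i \<le> j" "k \<in> B j" "k \<in> B i" for i j
      proof -
        have "(1/2::real) ^ j \<le> (1/2) ^ Suc i" using that(1) by (intro power_decreasing) auto
        moreover have "cmod (c k) \<le> (1/2) ^ j" "(1/2) ^ Suc i < cmod (c k)" using that(2,3) by (auto simp: B_def)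
        ultimately show False by linarith
      qed
      have "Suc i \<le> j \<or> Suc j \<le> i" using a(3) by linarith
      then show False using *[of i j] *[of j i] a(1,2) by blast
    qed
    show ex: "k \<in> B (lev k)" if nz: "c k \<noteq> 0"
    proof -
      obtain j where "(1/2) ^ j < cmod (c k)" using real_arch_pow_inv[of "cmod (c k)" "1/2"] nz by auto
      moreover have "(1/2::real) ^ Suc j \<le> (1/2) ^ j" by simp
      ultimately have "(1/2) ^ Suc j < cmod (c k)" by linarith
      then have l: "(1/2) ^ Suc (lev k) < cmod (c k)" unfolding lev_def by (rule LeastI)
      have "cmod (c k) \<le> (1/2) ^ lev k"
      proof (cases "lev k")
        case 0 then show ?thesis using c1 by simp
      next
        case (Suc i)
        then have "\<not> (1/2) ^ Suc i < cmod (c k)" using not_less_Least[of i "\<lambda>j. (1/2) ^ Suc j < cmod (c k)"] by (simp add: lev_def)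
        then show ?thesis using Suc by simp
      qed
      then show ?thesis using l by (simp add: B_def)
    qed
    show "j = lev k" if "k \<in> B j"
    proof -
      have "c k \<noteq> 0" using that by (auto simp: B_def not_less[symmetric])
      then show ?thesis using ex uniq that by blast
    qed
  qed
  have "AE x in M. (\<forall>n. (cmod (\<Sum>k<n. c k * e k x))^2 \<le> W x) \<and> convergent (\<lambda>n. \<Sum>k<n. c k * e k x)"
    using 2(1)
  proof eventually_elim
    case (elim x)
    define u where "u j = sqrt (G j x)" for j
    have u: "u j \<ge> 0" "(u j)^2 = G j x" for j using G(2)[of j x] by (auto simp: u_def)
    have sm: "summable (\<lambda>j. (real j + 1)^2 * (u j)^2)" using elim by (simp add: u)
    note wb = weighted_sum_bounds[OF u(1) sm]
    define P where "P j n = (\<Sum>k\<in>{k\<in>B j. k < n}. c k * e k x)" for j n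
    have Pu: "cmod (P j n) \<le> u j" for j n
      using G(4)[where j=j and n=n and x=x] u[of j] unfolding P_def by (metis power2_le_imp_le)
    have split: "\<exists>J0. \<forall>J\<ge>J0. (\<Sum>k<n. c k * e k x) = (\<Sum>j<J. P j n)" for n
    proof -
      obtain J0 where J0: "\<And>k. k < n \<Longrightarrow> lev k < J0" using finite_nat_set_iff_bounded[of "lev ` {..<n}"] by auto
      have "(\<Sum>k<n. c k * e k x) = (\<Sum>j<J. P j n)" if J: "J \<ge> J0" for J
      proof -
        have "(\<Sum>j<J. P j n) = (\<Sum>k\<in>(\<Union>j<J. {k\<in>B j. k < n}). c k * e k x)" unfolding P_def
        proof (rule sum.UNION_disjoint[symmetric])
          show "\<forall>i\<in>{..<J}. \<forall>j\<in>{..<J}. i \<noteq> j \<longrightarrow> {k \<in> B i. k < n} \<inter> {k \<in> B j. k < n} = {}"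
          proof (intro ballI impI)
            fix i j :: nat assume "i \<noteq> j"
            then have "\<not> (k \<in> B i \<and> k \<in> B j)" for k using levu[of k i] levu[of k j] by metis
            then show "{k \<in> B i. k < n} \<inter> {k \<in> B j. k < n} = {}" by blast
          qed
        qed simp_all
        also have "\<dots> = (\<Sum>k<n. c k * e k x)"
        proof (rule sum.mono_neutral_left)
          show "\<forall>i\<in>{..<n} - (\<Union>j<J. {k \<in> B j. k < n}). c i * e i x = 0"
          proof
            fix i assume i: "i \<in> {..<n} - (\<Union>j<J. {k \<in> B j. k < n})"
            then have "i \<notin> B (lev i)" using J0[of i] J by auto
            then show "c i * e i x = 0" using lev by auto
          qed
        qed auto
        finally show ?thesis by simp
      qed
      then show ?thesis by blast
    qed
    have "(cmod (\<Sum>k<n. c k * e k x))^2 \<le> W x" for n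
    proof -
      obtain J where J: "(\<Sum>k<n. c k * e k x) = (\<Sum>j<J. P j n)" using split by blast
      have "cmod (\<Sum>k<n. c k * e k x) \<le> (\<Sum>j<J. u j)" unfolding J by (rule order_trans[OF norm_sum sum_mono[OF Pu]])
      then have "(cmod (\<Sum>k<n. c k * e k x))^2 \<le> (\<Sum>j<J. u j)^2" by (intro power_mono) auto
      also have "\<dots> \<le> W x" using wb(2)[of J] by (simp add: W_def u)
      finally show ?thesis .
    qed
    moreover have "convergent (\<lambda>n. \<Sum>k<n. c k * e k x)"
    proof -
      have Sn: "(\<Sum>k<n. c k * e k x) = (\<Sum>j. P j n)" for n
      proof -
        obtain J0 where "\<forall>J\<ge>J0. (\<Sum>k<n. c k * e k x) = (\<Sum>j<J. P j n)" using split by blast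
        then have "(\<lambda>J. \<Sum>j<J. P j n) \<longlonglongrightarrow> (\<Sum>k<n. c k * e k x)"
          by (intro tendsto_eventually) (unfold eventually_sequentially, metis)
        then have "(\<lambda>j. P j n) sums (\<Sum>k<n. c k * e k x)" by (simp add: sums_def)
        then show ?thesis by (rule sums_unique)
      qed
      have "((\<lambda>n. \<Sum>j. P j n) \<longlongrightarrow> (\<Sum>j. \<Sum>k\<in>B j. c k * e k x)) sequentially"
      proof (rule tannerys_theorem[THEN conjunct2, THEN conjunct2])
        show "((\<lambda>n. P j n) \<longlongrightarrow> (\<Sum>k\<in>B j. c k * e k x)) sequentially" for j
        proof (rule tendsto_eventually)
          obtain N where N: "\<And>k. k \<in> B j \<Longrightarrow> k < N" using finB[of j] by (auto simp: finite_nat_set_iff_bounded)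
          have "P j n = (\<Sum>k\<in>B j. c k * e k x)" if "n \<ge> N" for n
          proof -
            have "{k\<in>B j. k < n} = B j" using N that by (auto intro: less_le_trans)
            then show ?thesis by (simp add: P_def)
          qed
          then show "\<forall>\<^sub>F n in sequentially. P j n = (\<Sum>k\<in>B j. c k * e k x)" by (auto simp: eventually_sequentially)
        qed
        show "\<forall>\<^sub>F (j, n) in at_top \<times>\<^sub>F sequentially. norm (P j n) \<le> u j" using Pu by (intro always_eventually) auto
        show "summable u" by (rule wb(1))
      qed simp
      then show ?thesis unfolding Sn by (rule convergentI)
    qed
    ultimately show ?case by blast
  qed
  then show ?thesis using iW by blast
qed

end

section \<open>Orthogonal polynomials and their reversals\<close>

locale circle_prob =
  fixes \<sigma> :: "complex measure"
  assumes sigma: "\<sigma> \<in> nontrivial_circle_measures"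
begin

lemma sets_sigma [measurable_cong, simp]: "sets \<sigma> = sets borel_circle"
  using sigma by (simp add: nontrivial_circle_measures_def)

lemma space_sigma [simp]: "space \<sigma> = sphere 0 1" using sets_eq_imp_space_eq[OF sets_sigma] by simp

sublocale prob_space \<sigma> using sigma by (simp add: nontrivial_circle_measures_def)

lemma integrable_continuous:
  fixes f :: "complex \<Rightarrow> 'b::{banach, second_countable_topology}"
  assumes "continuous_on (sphere 0 1) f" shows "integrable \<sigma> f"
  using assms by (intro integrable_circle_continuous finite_measure_axioms) auto

text \<open>The only place where the support of \<open>\<sigma>\<close> matters: a polynomial that vanishes
  almost everywhere vanishes on the support by continuity, and the support is infinite.\<close>

lemma poly_L2_zero:
  assumes "(\<integral>u. (cmod (poly p u))^2 \<partial>\<sigma>) = 0" shows "p = 0"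
proof (rule ccontr)
  assume p: "p \<noteq> 0"
  have "integrable \<sigma> (\<lambda>u. (cmod (poly p u))^2)" by (intro integrable_continuous continuous_intros)
  then have "AE u in \<sigma>. (cmod (poly p u))^2 = 0" using assms by (subst (asm) integral_nonneg_eq_0_iff_AE) auto
  then have ae: "AE u in \<sigma>. poly p u = 0" by simp
  define Z where "Z = {u. poly p u = 0}"
  have fZ: "finite Z" unfolding Z_def using p by (rule poly_roots_finite)
  have "circle_support \<sigma> \<subseteq> Z"
  proof
    fix u assume x: "u \<in> circle_support \<sigma>"
    show "u \<in> Z"
    proof (rule ccontr)
      assume nz: "u \<notin> Z"
      have o: "open (-Z)" using fZ by (simp add: finite_imp_closed open_Compl)
      then have pos: "emeasure \<sigma> (-Z \<inter> sphere 0 1) > 0" using x nz by (auto simp: circle_support_def)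
      have m: "-Z \<inter> sphere 0 1 \<in> sets \<sigma>"
        using o by (auto simp: sets_borel_circle_iff intro!: sets.Int borel_open borel_closed)
      have "emeasure \<sigma> (-Z \<inter> sphere 0 1) = 0" using ae m by (subst (asm) AE_iff_measurable[OF m]) (auto simp: Z_def)
      then show False using pos by simp
    qed
  qed
  then have "finite (circle_support \<sigma>)" using fZ finite_subset by blast
  then show False using sigma by (simp add: nontrivial_circle_measures_def)
qed

definition OP :: "nat \<Rightarrow> complex poly \<Rightarrow> bool" where
  "OP n p \<longleftrightarrow> degree p = n \<and> lead_coeff p = 1 \<and> (\<forall>j<n. (\<integral>x. poly p x * cnj (x ^ j) \<partial>\<sigma>) = 0)"

lemma integral_poly_cnj:
  assumes g: "continuous_on (sphere 0 1) g"
  shows "(\<integral>x. g x * cnj (poly q x) \<partial>\<sigma>) = (\<Sum>j\<le>degree q. cnj (coeff q j) * (\<integral>x. g x * cnj (x ^ j) \<partial>\<sigma>))"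
proof -
  have "(\<integral>x. g x * cnj (poly q x) \<partial>\<sigma>) = (\<integral>x. (\<Sum>j\<le>degree q. cnj (coeff q j) * (g x * cnj (x ^ j))) \<partial>\<sigma>)"
    by (intro bint_cong refl) (simp only: poly_altdef cnj_sum complex_cnj_mult sum_distrib_left mult_ac)
  also have "\<dots> = (\<Sum>j\<le>degree q. cnj (coeff q j) * (\<integral>x. g x * cnj (x ^ j) \<partial>\<sigma>))"
    by (subst bint_sum, intro integrable_continuous continuous_intros g) (simp only: integral_mult_right_zero)
  finally show ?thesis .
qed

lemma OP_orth:
  assumes "OP n p" "degree q < n" shows "(\<integral>x. poly p x * cnj (poly q x) \<partial>\<sigma>) = 0"
proof -
  have "continuous_on (sphere 0 1) (poly p)" by (intro continuous_intros)
  from integral_poly_cnj[OF this, of q] show ?thesis using assms by (auto simp: OP_def intro!: sum.neutral)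
qed

lemma OP_unique: assumes "OP n p" "OP n q" shows "p = q"
proof (cases n)
  case 0
  have "p = 1" if "OP n p" for p
  proof -
    have "degree p = 0" "lead_coeff p = 1" using that 0 by (auto simp: OP_def)
    then show ?thesis by (metis degree_eq_zeroE lead_coeff_pCons(2) one_pCons)
  qed
  then show ?thesis using assms by metis
next
  case (Suc m)
  have d: "degree (p - q) < n"
  proof -
    have "coeff (p - q) n = 0" using assms by (auto simp: OP_def)
    moreover have "degree (p - q) \<le> n" using assms degree_diff_le_max[of p q] by (auto simp: OP_def)
    ultimately show ?thesis using Suc by (metis degree_0 le_neq_implies_less leading_coeff_0_iff zero_less_Suc)
  qed
  have c: "continuous_on (sphere 0 1) (\<lambda>x. poly p x * cnj (poly (p - q) x))" "continuous_on (sphere 0 1) (\<lambda>x. poly q x * cnj (poly (p - q) x))"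
    by (intro continuous_intros)+
  have "complex_of_real (\<integral>u. (cmod (poly (p - q) u))^2 \<partial>\<sigma>) = (\<integral>u. poly (p - q) u * cnj (poly (p - q) u) \<partial>\<sigma>)"
    by (simp only: complex_norm_square[symmetric] integral_complex_of_real)
  also have "\<dots> = (\<integral>u. poly p u * cnj (poly (p - q) u) - poly q u * cnj (poly (p - q) u) \<partial>\<sigma>)"
    by (intro bint_cong refl) (simp add: algebra_simps)
  also have "\<dots> = 0"
    using integrable_continuous[OF c(1)] integrable_continuous[OF c(2)] OP_orth[OF assms(1) d] OP_orth[OF assms(2) d]
    by (simp only: bint_diff) simp
  finally have "(\<integral>u. (cmod (poly (p - q) u))^2 \<partial>\<sigma>) = 0" by simp
  then have "p - q = 0" by (rule poly_L2_zero)
  then show ?thesis by simp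
qed

lemma star_circle: "cmod u = 1 \<Longrightarrow> poly (poly_star p) u = u ^ degree p * cnj (poly p u)"
proof -
  assume x: "cmod u = 1"
  then have "inverse (cnj u) = u" using circle_inverse[of "cnj u"] by simp
  then show ?thesis using poly_star_poly_nz[of u p] x by (metis norm_zero zero_neq_one)
qed

lemma star_orth:
  assumes p: "OP n p" and j: "1 \<le> j" "j \<le> n"
  shows "(\<integral>u. poly (poly_star p) u * cnj (u ^ j) \<partial>\<sigma>) = 0"
proof -
  have "(\<integral>u. poly (poly_star p) u * cnj (u ^ j) \<partial>\<sigma>) = (\<integral>u. cnj (poly p u * cnj (u ^ (n - j))) \<partial>\<sigma>)"
  proof (rule bint_cong)
    fix u assume "u \<in> space \<sigma>"
    then have x: "cmod u = 1" by simp
    have "u ^ n = u ^ (n - j) * u ^ j" using j by (simp flip: power_add)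
    moreover have "u ^ j * cnj (u ^ j) = 1" using circle_cnj_mult[OF x] by (simp flip: power_mult_distrib)
    ultimately show "poly (poly_star p) u * cnj (u ^ j) = cnj (poly p u * cnj (u ^ (n - j)))"
      using p x by (simp add: star_circle OP_def mult_ac)
  qed simp
  also have "\<dots> = cnj (\<integral>u. poly p u * cnj (u ^ (n - j)) \<partial>\<sigma>)" by (rule Bochner_Integration.integral_cnj)
  also have "\<dots> = 0" using p j by (simp add: OP_def)
  finally show ?thesis .
qed

lemma OP_norm:
  assumes p: "OP n p"
  shows "(\<integral>x. poly p x * cnj (x ^ n) \<partial>\<sigma>) = of_real (\<integral>x. (cmod (poly p x))^2 \<partial>\<sigma>)"
    "(\<integral>x. poly (poly_star p) x \<partial>\<sigma>) = of_real (\<integral>x. (cmod (poly p x))^2 \<partial>\<sigma>)"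
proof -
  have c: "continuous_on (sphere 0 1) (poly p)" by (intro continuous_intros)
  have "of_real (\<integral>x. (cmod (poly p x))^2 \<partial>\<sigma>) = (\<integral>x. poly p x * cnj (poly p x) \<partial>\<sigma>)"
    by (simp only: complex_norm_square[symmetric] integral_complex_of_real)
  also have "\<dots> = (\<Sum>j\<le>n. cnj (coeff p j) * (\<integral>x. poly p x * cnj (x ^ j) \<partial>\<sigma>))"
    using integral_poly_cnj[OF c, of p] p by (simp add: OP_def)
  also have "\<dots> = (\<Sum>j\<in>{n}. cnj (coeff p j) * (\<integral>x. poly p x * cnj (x ^ j) \<partial>\<sigma>))"
    using p by (intro sum.mono_neutral_right) (auto simp: OP_def)
  also have "\<dots> = cnj (coeff p n) * (\<integral>x. poly p x * cnj (x ^ n) \<partial>\<sigma>)" by simp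
  also have "coeff p n = 1" using p by (auto simp: OP_def)
  finally show 1: "(\<integral>x. poly p x * cnj (x ^ n) \<partial>\<sigma>) = of_real (\<integral>x. (cmod (poly p x))^2 \<partial>\<sigma>)" by simp
  have "(\<integral>x. poly (poly_star p) x \<partial>\<sigma>) = (\<integral>x. cnj (poly p x * cnj (x ^ n)) \<partial>\<sigma>)"
    using p by (intro bint_cong refl) (simp add: star_circle OP_def mult_ac)
  also have "\<dots> = cnj (\<integral>x. poly p x * cnj (x ^ n) \<partial>\<sigma>)" by (rule Bochner_Integration.integral_cnj)
  finally show "(\<integral>x. poly (poly_star p) x \<partial>\<sigma>) = of_real (\<integral>x. (cmod (poly p x))^2 \<partial>\<sigma>)" by (simp only: 1 complex_cnj_complex_of_real)
qed

lemma degree_star: "degree (poly_star p) \<le> degree p"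
proof -
  have "degree (map_poly cnj p) = degree p" by (rule degree_map_poly) simp
  then show ?thesis unfolding poly_star_def by (metis degree_reflect_poly_le)
qed

lemma OP_shift:
  assumes p: "OP n p" and j: "1 \<le> j" "j \<le> n"
  shows "(\<integral>u. u * poly p u * cnj (u ^ j) \<partial>\<sigma>) = 0"
proof -
  have "(\<integral>u. u * poly p u * cnj (u ^ j) \<partial>\<sigma>) = (\<integral>u. poly p u * cnj (u ^ (j - 1)) \<partial>\<sigma>)"
  proof (rule bint_cong)
    fix u assume "u \<in> space \<sigma>"
    then have x: "u * cnj u = 1" by simp
    have "cnj (u ^ j) = cnj u * cnj (u ^ (j - 1))" using j by (metis complex_cnj_mult power_eq_if not_one_le_zero)
    then have "u * poly p u * cnj (u ^ j) = (u * cnj u) * (poly p u * cnj (u ^ (j - 1)))" by (simp only: mult_ac)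
    then show "u * poly p u * cnj (u ^ j) = poly p u * cnj (u ^ (j - 1))" using x by simp
  qed simp
  then show ?thesis using p j by (simp add: OP_def)
qed

lemma OP_exists: "\<exists>p. OP n p"
proof (induction n)
  case 0
  show ?case by (intro exI[of _ 1]) (simp add: OP_def)
next
  case (Suc n)
  then obtain p where p: "OP n p" by blast
  define N where "N = (\<integral>x. (cmod (poly p x))^2 \<partial>\<sigma>)"
  have "p \<noteq> 0" using p by (auto simp: OP_def)
  then have N: "N \<noteq> 0" using poly_L2_zero[of p] by (auto simp: N_def)
  define a where "a = (\<integral>x. x * poly p x \<partial>\<sigma>) / of_real N"
  define q where "q = [:0, 1:] * p - smult a (poly_star p)"
  have dp: "degree ([:0, 1:] * p) = Suc n" using p by (subst degree_mult_eq) (auto simp: OP_def)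
  have ds: "degree (smult a (poly_star p)) \<le> n" using degree_star[of p] p by (auto simp: OP_def intro: order_trans[OF degree_smult_le])
  have cs: "coeff (smult a (poly_star p)) (Suc n) = 0" using ds by (intro coeff_eq_0) auto
  have cq: "coeff q (Suc n) = 1" unfolding q_def coeff_diff cs using p by (auto simp: OP_def)
  have dq: "degree q = Suc n"
  proof (rule antisym)
    show "degree q \<le> Suc n" unfolding q_def using dp ds by (intro degree_diff_le) auto
    show "Suc n \<le> degree q" using cq by (intro le_degree) simp
  qed
  have "(\<integral>x. poly q x * cnj (x ^ j) \<partial>\<sigma>) = 0" if j: "j < Suc n" for j
  proof -
    have i: "integrable \<sigma> (\<lambda>x. x * poly p x * cnj (x ^ j))" "integrable \<sigma> (\<lambda>x. a * (poly (poly_star p) x * cnj (x ^ j)))"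
      by (intro integrable_continuous continuous_intros)+
    have "(\<integral>x. poly q x * cnj (x ^ j) \<partial>\<sigma>) = (\<integral>x. x * poly p x * cnj (x ^ j) - a * (poly (poly_star p) x * cnj (x ^ j)) \<partial>\<sigma>)"
      by (intro bint_cong refl) (simp add: q_def algebra_simps)
    also have "\<dots> = (\<integral>x. x * poly p x * cnj (x ^ j) \<partial>\<sigma>) - a * (\<integral>x. poly (poly_star p) x * cnj (x ^ j) \<partial>\<sigma>)"
      by (simp only: bint_diff[OF i] integral_mult_right_zero)
    also have "\<dots> = 0"
    proof (cases j)
      case 0
      then show ?thesis using OP_norm(2)[OF p] N by (simp add: a_def N_def)
    next
      case (Suc i)
      then have "1 \<le> j" "j \<le> n" using j by auto
      then show ?thesis using star_orth[OF p, of j] OP_shift[OF p, of j] by simp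
    qed
    finally show ?thesis .
  qed
  then have "OP (Suc n) q" using dq cq by (simp add: OP_def)
  then show ?case by blast
qed

lemma monic_OP: "OP n (monic_OP \<sigma> n)"
proof -
  have "\<exists>!p. OP n p" using OP_exists OP_unique by blast
  then have "OP n (THE p. OP n p)" by (rule theI')
  then show ?thesis unfolding monic_OP_def OP_def .
qed

end

locale opuc = circle_prob \<sigma> for \<sigma> +
  fixes \<gamma> :: "nat \<Rightarrow> complex"
  assumes gamma: "\<And>n. cmod (\<gamma> n) < 1" and schur: "schur_parameters \<sigma> \<gamma>"
begin

definition Ph :: "nat \<Rightarrow> complex \<Rightarrow> complex" where "Ph n z = poly (monic_OP \<sigma> n) z"
definition Ps :: "nat \<Rightarrow> complex \<Rightarrow> complex" where "Ps n z = poly (poly_star (monic_OP \<sigma> n)) z"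
text \<open>The square of the norm of the \<open>n\<close>-th monic polynomial (\<open>Ph_norm\<close>),
  expressed by the Schur parameters.\<close>

definition Cn :: "nat \<Rightarrow> real" where "Cn n = (\<Prod>k<n. 1 - (cmod (\<gamma> k))^2)"

lemma gamma2: "0 < 1 - (cmod (\<gamma> k))^2" "1 - (cmod (\<gamma> k))^2 \<le> 1"
  using gamma[of k] by (auto simp: abs_square_less_1)

lemma Cn_pos: "Cn n > 0" unfolding Cn_def by (intro prod_pos ballI gamma2)
lemma Cn_0 [simp]: "Cn 0 = 1" by (simp add: Cn_def)
lemma Cn_Suc: "Cn (Suc n) = Cn n * (1 - (cmod (\<gamma> n))^2)" by (simp add: Cn_def)
lemma Cn_antimono: "Cn (Suc n) \<le> Cn n" using Cn_pos[of n] gamma2[of n] by (simp add: Cn_Suc mult_left_le)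

lemma monic_OP_0: "monic_OP \<sigma> 0 = 1"
proof -
  have "OP 0 1" by (simp add: OP_def)
  then show ?thesis by (rule OP_unique[OF monic_OP])
qed

lemma poly_star_1: "poly_star 1 = 1" by (simp add: poly_star_def one_pCons map_poly_pCons)

lemma Ph_0 [simp]: "Ph 0 z = 1" and Ps_0 [simp]: "Ps 0 z = 1" by (simp_all add: Ph_def Ps_def monic_OP_0 poly_star_1)

lemma Ph_Suc: "Ph (Suc n) z = z * Ph n z - cnj (\<gamma> n) * Ps n z"
proof -
  have "monic_OP \<sigma> (Suc n) = [:0, 1:] * monic_OP \<sigma> n - smult (cnj (\<gamma> n)) (poly_star (monic_OP \<sigma> n))"
    using schur unfolding schur_parameters_def by blast
  then show ?thesis unfolding Ph_def Ps_def by simp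
qed

lemma Ps_Suc: "Ps (Suc n) z = Ps n z - \<gamma> n * (z * Ph n z)"
proof -
  have "poly_star (monic_OP \<sigma> (Suc n)) = poly_star (monic_OP \<sigma> n) - smult (\<gamma> n) ([:0, 1:] * monic_OP \<sigma> n)"
    using schur unfolding schur_parameters_def by blast
  then show ?thesis unfolding Ph_def Ps_def by simp
qed

lemma continuous_on_Ph [continuous_intros]: "continuous_on S g \<Longrightarrow> continuous_on S (\<lambda>x. Ph n (g x))"
  and continuous_on_Ps [continuous_intros]: "continuous_on S g \<Longrightarrow> continuous_on S (\<lambda>x. Ps n (g x))"
  unfolding Ph_def Ps_def by (intro continuous_intros; assumption)+

lemma holomorphic_Ph: "Ph n holomorphic_on S" and holomorphic_Ps: "Ps n holomorphic_on S"
  unfolding Ph_def Ps_def by (intro holomorphic_intros)+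

lemma degree_monic: "degree (monic_OP \<sigma> n) = n" using monic_OP[of n] by (simp add: OP_def)

lemma Ps_reflect: "z \<noteq> 0 \<Longrightarrow> Ps n z = z ^ n * cnj (Ph n (inverse (cnj z)))"
  unfolding Ph_def Ps_def using poly_star_poly_nz[of z "monic_OP \<sigma> n"] by (simp add: degree_monic)

lemma Ps_circle: "cmod t = 1 \<Longrightarrow> Ps n t = t ^ n * cnj (Ph n t)"
  unfolding Ph_def Ps_def using star_circle[of t "monic_OP \<sigma> n"] by (simp add: degree_monic)

lemma cmod_circle: "cmod t = 1 \<Longrightarrow> cmod (Ps n t) = cmod (Ph n t)" by (simp add: Ps_circle norm_mult norm_power)

lemma Ph_orth: "j < n \<Longrightarrow> (\<integral>x. Ph n x * cnj (x ^ j) \<partial>\<sigma>) = 0"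
  using monic_OP[of n] by (simp add: OP_def Ph_def)

lemma Ps_orth: "1 \<le> j \<Longrightarrow> j \<le> n \<Longrightarrow> (\<integral>x. Ps n x * cnj (x ^ j) \<partial>\<sigma>) = 0"
  using star_orth[OF monic_OP[of n]] by (simp add: Ps_def)

lemma norm_recursion: "(\<integral>u. (cmod (Ph (Suc n) u))^2 \<partial>\<sigma>) = (1 - (cmod (\<gamma> n))^2) * (\<integral>u. (cmod (Ph n u))^2 \<partial>\<sigma>)"
proof -
  have i: "integrable \<sigma> (\<lambda>u. (cmod (Ph (Suc n) u))^2)" "integrable \<sigma> (\<lambda>u. (cmod (\<gamma> n))^2 * (cmod (Ph n u))^2)"
     "integrable \<sigma> (\<lambda>u. Ph (Suc n) u * cnj (Ps n u))" "integrable \<sigma> (\<lambda>u. 2 * Re (\<gamma> n * (Ph (Suc n) u * cnj (Ps n u))))"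
    "integrable \<sigma> (\<lambda>u. \<gamma> n * (Ph (Suc n) u * cnj (Ps n u)))"
    by (intro integrable_continuous continuous_intros)+
  have or: "(\<integral>u. Ph (Suc n) u * cnj (Ps n u) \<partial>\<sigma>) = 0"
    unfolding Ph_def Ps_def using degree_star[of "monic_OP \<sigma> n"] by (intro OP_orth[OF monic_OP]) (simp add: degree_monic)
  have re: "(\<integral>u. 2 * Re (\<gamma> n * (Ph (Suc n) u * cnj (Ps n u))) \<partial>\<sigma>) = 0"
    by (simp only: integral_mult_right_zero integral_Re[OF i(5)] or) simp
  have "(\<integral>u. (cmod (Ph n u))^2 \<partial>\<sigma>) = (\<integral>u. ((cmod (Ph (Suc n) u))^2 + (cmod (\<gamma> n))^2 * (cmod (Ph n u))^2) + 2 * Re (\<gamma> n * (Ph (Suc n) u * cnj (Ps n u))) \<partial>\<sigma>)"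
  proof (rule bint_cong)
    fix u assume "u \<in> space \<sigma>"
    then have x: "cmod u = 1" by simp
    have "(cmod (Ph n u))^2 = (cmod (u * Ph n u))^2" using x by (simp add: norm_mult)
    also have "u * Ph n u = Ph (Suc n) u + cnj (\<gamma> n) * Ps n u" by (simp add: Ph_Suc)
    also have "(cmod (Ph (Suc n) u + cnj (\<gamma> n) * Ps n u))^2 = (cmod (Ph (Suc n) u))^2 + (cmod (\<gamma> n))^2 * (cmod (Ps n u))^2
        + 2 * Re (\<gamma> n * (Ph (Suc n) u * cnj (Ps n u)))" unfolding cmod_power2 by (simp add: power2_eq_square algebra_simps)
    finally show "(cmod (Ph n u))^2 = ((cmod (Ph (Suc n) u))^2 + (cmod (\<gamma> n))^2 * (cmod (Ph n u))^2) + 2 * Re (\<gamma> n * (Ph (Suc n) u * cnj (Ps n u)))"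
      by (simp add: cmod_circle[OF x])
  qed simp
  also have "\<dots> = (\<integral>u. (cmod (Ph (Suc n) u))^2 \<partial>\<sigma>) + (cmod (\<gamma> n))^2 * (\<integral>u. (cmod (Ph n u))^2 \<partial>\<sigma>)"
    unfolding bint_add[OF Bochner_Integration.integrable_add[OF i(1,2)] i(4)] re
      bint_add[OF i(1,2)] by simp
  finally show ?thesis by (simp add: algebra_simps)
qed

lemma Ph_norm: "(\<integral>x. (cmod (Ph n x))^2 \<partial>\<sigma>) = Cn n"
proof (induction n)
  case 0 then show ?case using prob_space by simp
next
  case (Suc n) then show ?case by (simp add: norm_recursion Cn_Suc)
qed

lemma Ps_norm: "(\<integral>x. (cmod (Ps n x))^2 \<partial>\<sigma>) = Cn n"
  unfolding Ph_norm[symmetric] by (intro bint_cong refl) (simp add: cmod_circle)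

lemma Ph_integral_top: "(\<integral>x. Ph n x * cnj (x ^ n) \<partial>\<sigma>) = of_real (Cn n)"
  using OP_norm(1)[OF monic_OP[of n]] Ph_norm[of n] by (simp add: Ph_def)

lemma Ph_orthogonal: "(\<integral>x. Ph j x * cnj (Ph k x) \<partial>\<sigma>) = (if j = k then of_real (Cn j) else 0)"
proof -
  consider "j = k" | "k < j" | "j < k" by linarith
  then show ?thesis
  proof cases
    case 1
    then show ?thesis by (simp only: complex_norm_square[symmetric] integral_complex_of_real Ph_norm) simp
  next
    case 2
    then show ?thesis unfolding Ph_def using OP_orth[OF monic_OP, of "monic_OP \<sigma> k" j] by (simp add: degree_monic)
  next
    case 3
    have "(\<integral>x. Ph j x * cnj (Ph k x) \<partial>\<sigma>) = (\<integral>x. cnj (Ph k x * cnj (Ph j x)) \<partial>\<sigma>)"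
      by (intro bint_cong refl) simp
    also have "\<dots> = cnj (\<integral>x. Ph k x * cnj (Ph j x) \<partial>\<sigma>)" by (rule Bochner_Integration.integral_cnj)
    also have "(\<integral>x. Ph k x * cnj (Ph j x) \<partial>\<sigma>) = 0"
      unfolding Ph_def using 3 OP_orth[OF monic_OP, of "monic_OP \<sigma> j" k] by (simp add: degree_monic)
    finally show ?thesis using 3 by simp
  qed
qed

text \<open>The orthonormal series behind \<open>Ps_expansion\<close> has the terms \<open>cf k * en
  k\<close>.\<close>

definition en :: "nat \<Rightarrow> complex \<Rightarrow> complex" where "en k x = Ph (Suc k) x / of_real (sqrt (Cn (Suc k)))"
definition cf :: "nat \<Rightarrow> complex" where "cf k = - \<gamma> k / of_real (sqrt (Cn (Suc k)))"

lemma en_orthonormal: "orthonormal_system \<sigma> en"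
proof
  have c: "continuous_on (sphere 0 1) (en k)" for k unfolding en_def using Cn_pos[of "Suc k"] by (intro continuous_intros) auto
  show "en k \<in> borel_measurable \<sigma>" for k using borel_measurable_circle_continuous[OF c] by simp
  show "integrable \<sigma> (\<lambda>x. en j x * cnj (en k x))" for j k by (intro integrable_continuous continuous_intros c)
  show "(\<integral>x. en j x * cnj (en k x) \<partial>\<sigma>) = (if j = k then 1 else 0)" for j k
  proof -
    have "(\<integral>x. en j x * cnj (en k x) \<partial>\<sigma>) = (\<integral>x. (1 / of_real (sqrt (Cn (Suc j)) * sqrt (Cn (Suc k)))) * (Ph (Suc j) x * cnj (Ph (Suc k) x)) \<partial>\<sigma>)"
      by (intro bint_cong refl) (simp add: en_def)
    also have "\<dots> = (1 / of_real (sqrt (Cn (Suc j)) * sqrt (Cn (Suc k)))) * (\<integral>x. Ph (Suc j) x * cnj (Ph (Suc k) x) \<partial>\<sigma>)"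
      by (rule integral_mult_right_zero)
    also have "\<dots> = (if j = k then 1 else 0)"
    proof (cases "j = k")
      case True
      then show ?thesis using Cn_pos[of "Suc k"] by (simp add: Ph_orthogonal flip: of_real_mult)
    qed (simp add: Ph_orthogonal)
    finally show ?thesis .
  qed
qed

text \<open>The recursion for \<open>Ps n / Cn n\<close> telescopes. The right-hand side is a partial sum of a
  series that does not depend on \<open>n\<close>, which makes the theory of orthonormal series
  applicable.\<close>

lemma Ps_expansion: "Ps n z / of_real (Cn n) = 1 + (\<Sum>k<n. cf k * en k z)"
proof (induction n)
  case (Suc n)
  have c: "of_real (Cn n) \<noteq> (0::complex)" "of_real (Cn (Suc n)) \<noteq> (0::complex)" using Cn_pos[of n] Cn_pos[of "Suc n"] by auto
  have eq: "Ps (Suc n) z - of_real (1 - (cmod (\<gamma> n))^2) * Ps n z = - \<gamma> n * Ph (Suc n) z"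
  proof -
    have "of_real (1 - (cmod (\<gamma> n))^2) = 1 - \<gamma> n * cnj (\<gamma> n)" by (simp only: of_real_diff complex_norm_square of_real_1)
    then show ?thesis by (simp only: Ps_Suc Ph_Suc) (simp add: algebra_simps)
  qed
  have "Ps (Suc n) z / of_real (Cn (Suc n)) = Ps n z / of_real (Cn n) + (Ps (Suc n) z - of_real (1 - (cmod (\<gamma> n))^2) * Ps n z) / of_real (Cn (Suc n))"
    using c gamma2[of n] by (simp add: Cn_Suc diff_divide_distrib del: of_real_diff)
  also have "\<dots> = Ps n z / of_real (Cn n) + cf n * en n z"
    unfolding eq cf_def en_def using Cn_pos[of "Suc n"] by (simp flip: of_real_mult)
  finally show ?case by (simp add: Suc.IH)
qed simp

end

section \<open>Schur iterates and the theorem of Geronimus\<close>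

lemma disc_identity:
  "(cmod (1 - cnj a * b))^2 - (cmod (b - a))^2 = (1 - (cmod a)^2) * (1 - (cmod b)^2)"
  unfolding cmod_power2 by (simp add: power2_eq_square algebra_simps)

lemma one_minus_mult_neq_0:
  assumes "cmod a < 1" "cmod b \<le> 1" shows "1 - a * b \<noteq> 0"
proof
  assume "1 - a * b = 0"
  then have "a * b = 1" by simp
  then have "cmod a * cmod b = 1" by (metis norm_mult norm_one)
  moreover have "cmod a * cmod b \<le> cmod a" using assms by (simp add: mult_left_le)
  ultimately show False using assms by simp
qed

lemma geometric_remainder:
  fixes x :: complex assumes "x \<noteq> 1"
  shows "1 / (1 - x) = (\<Sum>k<n. x ^ k) + x ^ n / (1 - x)"
proof -
  have "(1 - x) * (\<Sum>k<n. x ^ k) = 1 - x ^ n" by (rule one_diff_power_eq[symmetric])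
  then show ?thesis using assms by (simp add: field_simps)
qed

context opuc
begin

definition "ck k z = 1 / (1 - z * cnj k)" for k z :: complex

lemma continuous_ck: "cmod z < 1 \<Longrightarrow> continuous_on (sphere 0 1) (\<lambda>t. ck t z)"
  unfolding ck_def by (intro continuous_intros) (auto dest: one_minus_neq_0)

text \<open>Cauchy transforms of \<open>Ph n\<close> and \<open>Ps n\<close>, for the latter without the
  constant term of the kernel. They obey the recursion of the polynomials (\<open>Uf_Suc\<close>,
  \<open>Vf_Suc\<close>), and orthogonality makes them vanish at \<open>0\<close> to orders
  \<open>n\<close> and \<open>n + 1\<close>; \<open>Ut\<close> and \<open>Vt\<close> are the
  quotients.\<close>

definition "Uf n z = (\<integral>t. Ph n t * ck t z \<partial>\<sigma>)"
definition "Vf n z = (\<integral>t. Ps n t * (z * cnj t * ck t z) \<partial>\<sigma>)"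
definition "Ut n z = (\<integral>t. Ph n t * cnj (t ^ n) * ck t z \<partial>\<sigma>)"
definition "Vt n z = (\<integral>t. Ps n t * cnj (t ^ Suc n) * ck t z \<partial>\<sigma>)"

lemma Uf_Suc:
  assumes z: "cmod z < 1"
  shows "Uf (Suc n) z = z * Uf n z - cnj (\<gamma> n) * Vf n z"
proof -
  note ck = continuous_ck[OF z]
  have i: "integrable \<sigma> (\<lambda>t. Ph (Suc n) t * cnj (t ^ 0) * t)" "integrable \<sigma> (\<lambda>t. z * (Ph n t * ck t z))"
    "integrable \<sigma> (\<lambda>t. cnj (\<gamma> n) * (Ps n t * (z * cnj t * ck t z)))" "integrable \<sigma> (\<lambda>t. Ph (Suc n) t)"
    by (intro integrable_continuous continuous_intros ck)+
  have o: "(\<integral>t. Ph (Suc n) t \<partial>\<sigma>) = 0" using Ph_orth[of 0 "Suc n"] by simp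
  have "Uf (Suc n) z = (\<integral>t. Ph (Suc n) t + z * (Ph n t * ck t z) - cnj (\<gamma> n) * (Ps n t * (z * cnj t * ck t z)) \<partial>\<sigma>)"
    unfolding Uf_def
  proof (rule bint_cong)
    fix t assume "t \<in> space \<sigma>"
    then have e: "cmod t = 1" by simp
    have ne: "1 - z * cnj t \<noteq> 0" by (rule one_minus_neq_0[OF z e])
    have k: "ck t z = 1 + z * cnj t * ck t z" using ne by (simp add: ck_def field_simps)
    have k2: "t * ck t z = t + z * ck t z"
    proof -
      have "t * ck t z = t + z * (t * cnj t) * ck t z" by (subst k) (simp add: algebra_simps)
      then show ?thesis using circle_cnj_mult(1)[OF e] by simp
    qed
    have "Ph (Suc n) t * ck t z = Ph n t * (t * ck t z) - cnj (\<gamma> n) * Ps n t * ck t z"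
      by (simp only: Ph_Suc) (simp add: algebra_simps)
    also have "\<dots> = Ph n t * (t + z * ck t z) - cnj (\<gamma> n) * Ps n t * (1 + z * cnj t * ck t z)" using k k2 by metis
    also have "\<dots> = Ph (Suc n) t + z * (Ph n t * ck t z) - cnj (\<gamma> n) * (Ps n t * (z * cnj t * ck t z))"
      by (simp only: Ph_Suc) (simp add: algebra_simps)
    finally show "Ph (Suc n) t * ck t z = Ph (Suc n) t + z * (Ph n t * ck t z) - cnj (\<gamma> n) * (Ps n t * (z * cnj t * ck t z))" .
  qed simp
  also have "\<dots> = z * Uf n z - cnj (\<gamma> n) * Vf n z"
    unfolding bint_diff[OF Bochner_Integration.integrable_add[OF i(4,2)] i(3)]
      bint_add[OF i(4,2)] o Uf_def Vf_def by simp
  finally show ?thesis .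
qed

lemma Vf_Suc:
  assumes z: "cmod z < 1"
  shows "Vf (Suc n) z = Vf n z - \<gamma> n * (z * Uf n z)"
proof -
  note ck = continuous_ck[OF z]
  have i: "integrable \<sigma> (\<lambda>t. Ps n t * (z * cnj t * ck t z))" "integrable \<sigma> (\<lambda>t. \<gamma> n * z * (Ph n t * ck t z))"
    by (intro integrable_continuous continuous_intros ck)+
  have "Vf (Suc n) z = (\<integral>t. Ps n t * (z * cnj t * ck t z) - \<gamma> n * z * (Ph n t * ck t z) \<partial>\<sigma>)"
    unfolding Vf_def
  proof (rule bint_cong)
    fix t assume "t \<in> space \<sigma>"
    then have e: "t * cnj t = 1" by simp
    have "Ps (Suc n) t * (z * cnj t * ck t z) = Ps n t * (z * cnj t * ck t z) - \<gamma> n * z * (Ph n t * ck t z) * (t * cnj t)"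
      by (simp only: Ps_Suc) (simp add: algebra_simps)
    then show "Ps (Suc n) t * (z * cnj t * ck t z) = Ps n t * (z * cnj t * ck t z) - \<gamma> n * z * (Ph n t * ck t z)"
      using e by simp
  qed simp
  also have "\<dots> = Vf n z - \<gamma> n * (z * Uf n z)" unfolding bint_diff[OF i] integral_mult_right_zero Uf_def Vf_def by simp
  finally show ?thesis .
qed

text \<open>The first \<open>n\<close> terms of the geometric series of the kernel integrate to
  \<open>0\<close> by orthogonality.\<close>

lemma Uf_factor:
  assumes z: "cmod z < 1"
  shows "Uf n z = z ^ n * Ut n z"
proof -
  note ck = continuous_ck[OF z]
  have i: "integrable \<sigma> (\<lambda>t. \<Sum>k<n. z ^ k * (Ph n t * cnj (t ^ k)))" "integrable \<sigma> (\<lambda>t. z ^ n * (Ph n t * cnj (t ^ n) * ck t z))"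
    "\<And>k. integrable \<sigma> (\<lambda>t. z ^ k * (Ph n t * cnj (t ^ k)))"
    by (intro integrable_continuous continuous_intros ck)+
  have "Uf n z = (\<integral>t. (\<Sum>k<n. z ^ k * (Ph n t * cnj (t ^ k))) + z ^ n * (Ph n t * cnj (t ^ n) * ck t z) \<partial>\<sigma>)"
    unfolding Uf_def
  proof (rule bint_cong)
    fix t assume "t \<in> space \<sigma>"
    then have "1 - z * cnj t \<noteq> 0" by (intro one_minus_neq_0[OF z]) simp
    then have "ck t z = (\<Sum>k<n. (z * cnj t) ^ k) + (z * cnj t) ^ n * ck t z"
      unfolding ck_def times_divide_eq_right mult_1_right by (intro geometric_remainder) auto
    then have "Ph n t * ck t z = Ph n t * ((\<Sum>k<n. (z * cnj t) ^ k) + (z * cnj t) ^ n * ck t z)" by metis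
    also have "\<dots> = (\<Sum>k<n. z ^ k * (Ph n t * cnj (t ^ k))) + z ^ n * (Ph n t * cnj (t ^ n) * ck t z)"
      by (simp add: distrib_left sum_distrib_left power_mult_distrib mult_ac)
    finally show "Ph n t * ck t z = (\<Sum>k<n. z ^ k * (Ph n t * cnj (t ^ k))) + z ^ n * (Ph n t * cnj (t ^ n) * ck t z)" .
  qed simp
  also have "\<dots> = (\<Sum>k<n. z ^ k * (\<integral>t. Ph n t * cnj (t ^ k) \<partial>\<sigma>)) + z ^ n * Ut n z"
    unfolding bint_add[OF i(1,2)] Ut_def by (subst bint_sum[OF i(3)]) (simp only: integral_mult_right_zero)
  also have "(\<Sum>k<n. z ^ k * (\<integral>t. Ph n t * cnj (t ^ k) \<partial>\<sigma>)) = 0"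
    by (intro sum.neutral ballI) (simp only: Ph_orth lessThan_iff mult_zero_right)
  finally show ?thesis by simp
qed

lemma Vf_factor:
  assumes z: "cmod z < 1"
  shows "Vf n z = z ^ Suc n * Vt n z"
proof -
  note ck = continuous_ck[OF z]
  have i: "integrable \<sigma> (\<lambda>t. \<Sum>k<n. z ^ Suc k * (Ps n t * cnj (t ^ Suc k)))" "integrable \<sigma> (\<lambda>t. z ^ Suc n * (Ps n t * cnj (t ^ Suc n) * ck t z))"
    "\<And>k. integrable \<sigma> (\<lambda>t. z ^ Suc k * (Ps n t * cnj (t ^ Suc k)))"
    by (intro integrable_continuous continuous_intros ck)+
  have "Vf n z = (\<integral>t. (\<Sum>k<n. z ^ Suc k * (Ps n t * cnj (t ^ Suc k))) + z ^ Suc n * (Ps n t * cnj (t ^ Suc n) * ck t z) \<partial>\<sigma>)"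
    unfolding Vf_def
  proof (rule bint_cong)
    fix t assume "t \<in> space \<sigma>"
    then have "1 - z * cnj t \<noteq> 0" by (intro one_minus_neq_0[OF z]) simp
    then have "ck t z = (\<Sum>k<n. (z * cnj t) ^ k) + (z * cnj t) ^ n * ck t z"
      unfolding ck_def times_divide_eq_right mult_1_right by (intro geometric_remainder) auto
    then have "Ps n t * (z * cnj t * ck t z) = Ps n t * (z * cnj t * ((\<Sum>k<n. (z * cnj t) ^ k) + (z * cnj t) ^ n * ck t z))" by metis
    also have "\<dots> = (\<Sum>k<n. z ^ Suc k * (Ps n t * cnj (t ^ Suc k))) + z ^ Suc n * (Ps n t * cnj (t ^ Suc n) * ck t z)"
      by (simp add: distrib_left sum_distrib_left power_mult_distrib mult_ac)
    finally show "Ps n t * (z * cnj t * ck t z) = (\<Sum>k<n. z ^ Suc k * (Ps n t * cnj (t ^ Suc k))) + z ^ Suc n * (Ps n t * cnj (t ^ Suc n) * ck t z)" .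
  qed simp
  also have "\<dots> = (\<Sum>k<n. z ^ Suc k * (\<integral>t. Ps n t * cnj (t ^ Suc k) \<partial>\<sigma>)) + z ^ Suc n * Vt n z"
    unfolding bint_add[OF i(1,2)] Vt_def by (subst bint_sum[OF i(3)]) (simp only: integral_mult_right_zero)
  also have "(\<Sum>k<n. z ^ Suc k * (\<integral>t. Ps n t * cnj (t ^ Suc k) \<partial>\<sigma>)) = 0"
  proof (intro sum.neutral ballI)
    fix k assume "k \<in> {..<n}"
    then have "(\<integral>t. Ps n t * cnj (t ^ Suc k) \<partial>\<sigma>) = 0" by (intro Ps_orth) auto
    then show "z ^ Suc k * (\<integral>t. Ps n t * cnj (t ^ Suc k) \<partial>\<sigma>) = 0" by (simp only: mult_zero_right)
  qed
  finally show ?thesis by simp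
qed

lemma cauchy_tendsto_0:
  assumes g: "continuous_on (sphere 0 1) g"
  shows "((\<lambda>z. \<integral>t. g t * ck t z \<partial>\<sigma>) \<longlongrightarrow> (\<integral>t. g t \<partial>\<sigma>)) (at 0)"
proof (rule Lim_transform_bound[THEN LIM_zero_cancel])
  let ?K = "\<integral>t. cmod (g t) \<partial>\<sigma>"
  have "\<forall>\<^sub>F z in at (0::complex). cmod z < 1/2"
    using tendstoD[OF tendsto_ident_at, of "1/2" "0::complex" UNIV] by (simp add: dist_norm)
  then show "\<forall>\<^sub>F z in at 0. norm ((\<integral>t. g t * ck t z \<partial>\<sigma>) - (\<integral>t. g t \<partial>\<sigma>)) \<le> norm (2 * cmod z * ?K)"
  proof eventually_elim
    case (elim z)
    then have z: "cmod z < 1" by simp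
    note ck = continuous_ck[OF z]
    have i: "integrable \<sigma> (\<lambda>t. g t * ck t z)" "integrable \<sigma> g" "integrable \<sigma> (\<lambda>t. g t * ck t z - g t)" "integrable \<sigma> (\<lambda>t. 2 * cmod z * cmod (g t))"
      by (intro integrable_continuous continuous_intros ck g)+
    have "norm ((\<integral>t. g t * ck t z \<partial>\<sigma>) - (\<integral>t. g t \<partial>\<sigma>)) = norm (\<integral>t. g t * ck t z - g t \<partial>\<sigma>)"
      by (simp only: bint_diff[OF i(1,2)])
    also have "\<dots> \<le> (\<integral>t. 2 * cmod z * cmod (g t) \<partial>\<sigma>)"
    proof (rule Bochner_Integration.integral_norm_bound_integral[OF i(3,4)])
      fix t assume "t \<in> space \<sigma>"
      then have e: "cmod t = 1" by simp
      have ne: "1 - z * cnj t \<noteq> 0" by (rule one_minus_neq_0[OF z e])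
      have "cmod (1 - z * cnj t) \<ge> 1 - cmod z" using norm_triangle_ineq2[of 1 "z * cnj t"] e by (simp add: norm_mult)
      then have ge: "cmod (1 - z * cnj t) \<ge> 1/2" using elim by linarith
      have "g t * ck t z - g t = g t * (z * cnj t) / (1 - z * cnj t)" using ne by (simp add: ck_def field_simps)
      then have "cmod (g t * ck t z - g t) = cmod (g t) * cmod z / cmod (1 - z * cnj t)" using e by (simp add: norm_mult norm_divide)
      also have "\<dots> \<le> cmod (g t) * cmod z / (1/2)" using ge by (intro divide_left_mono) auto
      finally show "cmod (g t * ck t z - g t) \<le> 2 * cmod z * cmod (g t)" by (simp add: mult_ac)
    qed
    also have "\<dots> = 2 * cmod z * ?K" by (rule integral_mult_right_zero)
    also have "\<dots> \<le> norm \<dots>" by (simp only: real_norm_def abs_ge_self)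
    finally show ?case .
  qed
  have "((\<lambda>z. 2 * cmod z * ?K) \<longlongrightarrow> 2 * cmod 0 * ?K) (at 0)" by (intro tendsto_intros)
  then show "((\<lambda>z. 2 * cmod z * ?K) \<longlongrightarrow> 0) (at 0)" by simp
qed

lemma Ut_tendsto: "(Ut n \<longlongrightarrow> of_real (Cn n)) (at 0)"
proof -
  have "continuous_on (sphere 0 1) (\<lambda>t. Ph n t * cnj (t ^ n))" by (intro continuous_intros)
  from cauchy_tendsto_0[OF this] show ?thesis unfolding Ut_def[abs_def] Ph_integral_top .
qed

lemma Vt_tendsto: "(Vt n \<longlongrightarrow> \<gamma> n * of_real (Cn n)) (at 0)"
proof -
  have c: "continuous_on (sphere 0 1) (\<lambda>t. Ps n t * cnj (t ^ Suc n))" by (intro continuous_intros)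
  have i: "integrable \<sigma> (\<lambda>t. Ps n t * cnj (t ^ Suc n))" "integrable \<sigma> (\<lambda>t. \<gamma> n * (Ph n t * cnj (t ^ n)))"
    by (intro integrable_continuous continuous_intros)+
  have "0 = (\<integral>t. Ps (Suc n) t * cnj (t ^ Suc n) \<partial>\<sigma>)" by (rule Ps_orth[symmetric]) auto
  also have "\<dots> = (\<integral>t. Ps n t * cnj (t ^ Suc n) - \<gamma> n * (Ph n t * cnj (t ^ n)) \<partial>\<sigma>)"
  proof (rule bint_cong)
    fix t assume "t \<in> space \<sigma>"
    then have e: "t * cnj t = 1" by simp
    have "Ps (Suc n) t * cnj (t ^ Suc n) = Ps n t * cnj (t ^ Suc n) - \<gamma> n * (Ph n t * cnj (t ^ n)) * (t * cnj t)"
      by (simp add: Ps_Suc algebra_simps)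
    then show "Ps (Suc n) t * cnj (t ^ Suc n) = Ps n t * cnj (t ^ Suc n) - \<gamma> n * (Ph n t * cnj (t ^ n))" using e by simp
  qed simp
  also have "\<dots> = (\<integral>t. Ps n t * cnj (t ^ Suc n) \<partial>\<sigma>) - \<gamma> n * of_real (Cn n)"
    unfolding bint_diff[OF i] integral_mult_right_zero Ph_integral_top ..
  finally have "(\<integral>t. Ps n t * cnj (t ^ Suc n) \<partial>\<sigma>) = \<gamma> n * of_real (Cn n)" by simp
  then show ?thesis using cauchy_tendsto_0[OF c] unfolding Vt_def[abs_def] by simp
qed

text \<open>One step of the recursion turns \<open>\<bar>Ps\<bar>\<^sup>2 - \<bar>Ph\<bar>\<^sup>2\<close>
  into \<open>1 - \<bar>\<gamma> n\<bar>\<^sup>2\<close> times \<open>\<bar>Ps\<bar>\<^sup>2 -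
  \<bar>z * Ph\<bar>\<^sup>2\<close>, which is at least as large.\<close>

lemma Ph_le_Ps:
  assumes z: "cmod z \<le> 1" shows "Ps n z \<noteq> 0 \<and> cmod (Ph n z) \<le> cmod (Ps n z)"
proof (induction n)
  case (Suc n)
  have zP: "cmod (z * Ph n z) \<le> cmod (Ps n z)" using Suc z mult_mono[of "cmod z" 1 "cmod (Ph n z)" "cmod (Ps n z)"] by (simp add: norm_mult)
  have "cmod (Ps n z) - cmod (\<gamma> n) * cmod (Ps n z) \<le> cmod (Ps n z) - cmod (\<gamma> n) * cmod (z * Ph n z)"
    using zP by (intro diff_left_mono mult_left_mono) auto
  also have "\<dots> \<le> cmod (Ps (Suc n) z)" unfolding Ps_Suc using norm_triangle_ineq2[of "Ps n z" "\<gamma> n * (z * Ph n z)"] by (simp add: norm_mult)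
  finally have "(1 - cmod (\<gamma> n)) * cmod (Ps n z) \<le> cmod (Ps (Suc n) z)" by (simp add: algebra_simps)
  moreover have "0 < (1 - cmod (\<gamma> n)) * cmod (Ps n z)" using gamma[of n] Suc by simp
  ultimately have nz: "Ps (Suc n) z \<noteq> 0" by auto
  have "(cmod (Ps (Suc n) z))^2 - (cmod (Ph (Suc n) z))^2 = (1 - (cmod (\<gamma> n))^2) * ((cmod (Ps n z))^2 - (cmod (z * Ph n z))^2)"
    unfolding Ps_Suc Ph_Suc cmod_power2 by (simp add: power2_eq_square algebra_simps)
  also have "\<dots> \<ge> 0" using zP gamma2[of n] by (intro mult_nonneg_nonneg) (auto intro: power_mono)
  finally have "(cmod (Ph (Suc n) z))^2 \<le> (cmod (Ps (Suc n) z))^2" by simp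
  then have "cmod (Ph (Suc n) z) \<le> cmod (Ps (Suc n) z)" by (rule power2_le_imp_le) simp
  then show ?case using nz by simp
qed simp

lemmas Ps_nz = Ph_le_Ps[THEN conjunct1] and Ph_le = Ph_le_Ps[THEN conjunct2]

end

locale opuc_iterates = opuc +
  fixes f :: "nat \<Rightarrow> complex \<Rightarrow> complex"
  assumes iter: "schur_iterates \<sigma> f"
begin

lemma f_hol: "f n holomorphic_on ball 0 1" using iter by (simp add: schur_iterates_def)
lemma f_le: "cmod z < 1 \<Longrightarrow> cmod (f n z) \<le> 1" using iter by (simp add: schur_iterates_def)
lemma F_eq: "cmod z < 1 \<Longrightarrow> (\<integral>x. (x + z) / (x - z) \<partial>\<sigma>) = (1 + z * f 0 z) / (1 - z * f 0 z)"
  using iter by (simp add: schur_iterates_def)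
lemma f_Suc: "cmod z < 1 \<Longrightarrow> z * f (Suc n) z = (f n z - f n 0) / (1 - cnj (f n 0) * f n z)"
  using iter by (simp add: schur_iterates_def)

lemma zf_neq: "cmod z < 1 \<Longrightarrow> 1 - z * f n z \<noteq> 0" using one_minus_mult_neq_0 f_le by blast

lemma UV_0:
  assumes z: "cmod z < 1"
  shows "Uf 0 z = 1 / (1 - z * f 0 z)" "Vf 0 z = z * f 0 z * Uf 0 z"
proof -
  note ck = continuous_ck[OF z]
  have i: "integrable \<sigma> (\<lambda>t. 2 * ck t z)" "integrable \<sigma> (\<lambda>t. 1::complex)" "integrable \<sigma> (\<lambda>t. ck t z)"
    by (intro integrable_continuous continuous_intros ck)+
  have "(1 + z * f 0 z) / (1 - z * f 0 z) = (\<integral>t. 2 * ck t z - 1 \<partial>\<sigma>)" unfolding F_eq[OF z, symmetric]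
  proof (rule bint_cong)
    fix t assume "t \<in> space \<sigma>"
    then have e: "cmod t = 1" by simp
    have ne: "1 - z * cnj t \<noteq> 0" by (rule one_minus_neq_0[OF z e])
    have "t - z = t * (1 - z * cnj t)" "t + z = t * (1 + z * cnj t)" using circle_cnj_mult[OF e] by (simp_all add: algebra_simps)
    moreover have "t \<noteq> 0" using e by auto
    ultimately have "(t + z) / (t - z) = (1 + z * cnj t) / (1 - z * cnj t)" by simp
    then show "(t + z) / (t - z) = 2 * ck t z - 1" using ne by (simp add: ck_def field_simps)
  qed simp
  also have "\<dots> = 2 * Uf 0 z - 1" unfolding bint_diff[OF i(1,2)] integral_mult_right_zero Uf_def using prob_space by simp
  finally have "2 * Uf 0 z = (1 + z * f 0 z) / (1 - z * f 0 z) + 1" by simp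
  also have "\<dots> = 2 / (1 - z * f 0 z)" using zf_neq[OF z] by (simp add: field_simps)
  finally have "2 * Uf 0 z = 2 * (1 / (1 - z * f 0 z))" by (simp only: times_divide_eq_right mult_1_right)
  then show U: "Uf 0 z = 1 / (1 - z * f 0 z)" by (simp only: mult_cancel_left) simp
  have "Vf 0 z = (\<integral>t. ck t z - 1 \<partial>\<sigma>)" unfolding Vf_def
  proof (rule bint_cong)
    fix t assume "t \<in> space \<sigma>"
    then have ne: "1 - z * cnj t \<noteq> 0" by (intro one_minus_neq_0[OF z]) simp
    then show "Ps 0 t * (z * cnj t * ck t z) = ck t z - 1" by (simp add: ck_def field_simps)
  qed simp
  also have "\<dots> = Uf 0 z - 1" unfolding bint_diff[OF i(3,2)] Uf_def using prob_space by simp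
  finally show "Vf 0 z = z * f 0 z * Uf 0 z" unfolding U using zf_neq[OF z, of 0] by (simp add: field_simps)
qed

text \<open>Both sides of the hypothesis are divided by \<open>z ^ Suc n\<close> and \<open>z\<close> tends to
  \<open>0\<close>.\<close>

lemma geronimus_aux:
  assumes V: "\<And>z. cmod z < 1 \<Longrightarrow> Vf n z = z * f n z * Uf n z"
  shows "f n 0 = \<gamma> n"
proof -
  have "(f n \<longlongrightarrow> f n 0) (at 0)"
    using holomorphic_on_imp_continuous_on[OF f_hol[of n]] by (simp add: continuous_on_eq_continuous_at isCont_def)
  then have 1: "((\<lambda>z. f n z * Ut n z) \<longlongrightarrow> f n 0 * of_real (Cn n)) (at 0)" by (intro tendsto_intros Ut_tendsto)
  have "\<forall>\<^sub>F z in at (0::complex). cmod z < 1 \<and> z \<noteq> 0"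
    using tendstoD[OF tendsto_ident_at, of 1 "0::complex" UNIV] by (auto simp: dist_norm eventually_at_filter elim: eventually_mono)
  then have "\<forall>\<^sub>F z in at 0. Vt n z = f n z * Ut n z"
  proof eventually_elim
    case (elim z)
    have "z ^ Suc n * Vt n z = z ^ Suc n * (f n z * Ut n z)"
      using V[of z] elim Uf_factor[of z n] Vf_factor[of z n] by (simp add: mult_ac)
    then show ?case using elim by simp
  qed
  then have "(Vt n \<longlongrightarrow> f n 0 * of_real (Cn n)) (at 0)" using 1 by (subst tendsto_cong)
  then have "f n 0 * of_real (Cn n) = \<gamma> n * of_real (Cn n)" by (rule tendsto_unique[OF _ _ Vt_tendsto, rotated]) simp
  then show ?thesis using Cn_pos[of n] by simp
qed

text \<open>Geronimus' theorem. The quotient \<open>Vf n / Uf n\<close> and \<open>z * f n\<close> obey the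
  same recursion, provided that \<open>f n 0 = \<gamma> n\<close>, and this equality is in turn the
  leading coefficient of the \<open>n\<close>-th identity. Hence both are proved in one induction.\<close>

theorem geronimus: "(\<forall>z. cmod z < 1 \<longrightarrow> Vf n z = z * f n z * Uf n z) \<and> f n 0 = \<gamma> n"
proof (induction n)
  case 0
  then show ?case using UV_0(2) geronimus_aux[of 0] by blast
next
  case (Suc n)
  have "Vf (Suc n) z = z * f (Suc n) z * Uf (Suc n) z" if z: "cmod z < 1" for z
  proof -
    have V: "Vf n z = z * f n z * Uf n z" and g: "f n 0 = \<gamma> n" using Suc z by auto
    have ne: "1 - cnj (\<gamma> n) * f n z \<noteq> 0" using one_minus_mult_neq_0[of "cnj (\<gamma> n)" "f n z"] gamma f_le[OF z] by simp
    have "z * f (Suc n) z * Uf (Suc n) z = (f n z - \<gamma> n) / (1 - cnj (\<gamma> n) * f n z) * (z * (1 - cnj (\<gamma> n) * f n z) * Uf n z)"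
      unfolding Uf_Suc[OF z] V f_Suc[OF z] g by (simp add: algebra_simps)
    also have "\<dots> = z * (f n z - \<gamma> n) * Uf n z" using ne by simp
    also have "\<dots> = Vf (Suc n) z" unfolding Vf_Suc[OF z] V by (simp add: algebra_simps)
    finally show ?thesis by simp
  qed
  then show ?case using geronimus_aux[of "Suc n"] by blast
qed

lemma f_0: "f n 0 = \<gamma> n" using geronimus by blast

lemma f_less: assumes z: "cmod z < 1" shows "cmod (f n z) < 1"
proof (rule ccontr)
  assume "\<not> ?thesis"
  then have e: "cmod (f n z) = 1" using f_le[OF z, of n] by simp
  have "f n constant_on ball 0 1" by (rule maximum_modulus_principle[OF f_hol, of "ball 0 1" z]) (use z e f_le in auto)
  then have "f n 0 = f n z" using z by (auto simp: constant_on_def)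
  then show False using e gamma[of n] by (simp add: f_0)
qed

lemma f_step:
  assumes z: "cmod z < 1"
  shows "z * f (Suc n) z * (1 - cnj (\<gamma> n) * f n z) = f n z - \<gamma> n" "1 - cnj (\<gamma> n) * f n z \<noteq> 0"
proof -
  show ne: "1 - cnj (\<gamma> n) * f n z \<noteq> 0" using one_minus_mult_neq_0[of "cnj (\<gamma> n)" "f n z"] gamma f_le[OF z] by simp
  show "z * f (Suc n) z * (1 - cnj (\<gamma> n) * f n z) = f n z - \<gamma> n" using f_Suc[OF z, of n] ne by (simp add: f_0)
qed

text \<open>The denominator of \<open>(1 + z * f 0) / (1 - z * f 0)\<close> in terms of \<open>f n\<close>, up
  to normalisation: by \<open>X_Suc\<close> it picks up one explicit factor in each step.\<close>

definition "X n z = Ps n z - z * f n z * Ph n z"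

lemma X_nz: assumes z: "cmod z < 1" shows "X n z \<noteq> 0"
proof
  assume "X n z = 0"
  then have "cmod (Ps n z) = cmod (z * f n z * Ph n z)" by (simp add: X_def)
  also have "\<dots> \<le> cmod z * 1 * cmod (Ps n z)" unfolding norm_mult
    using f_le[OF z, of n] Ph_le[of z n] z by (intro mult_mono) auto
  also have "\<dots> < cmod (Ps n z)" using z Ps_nz[of z n] by simp
  finally show False by simp
qed

lemma X_Suc:
  assumes z: "cmod z < 1"
  shows "X (Suc n) z * (1 - cnj (\<gamma> n) * f n z) = of_real (1 - (cmod (\<gamma> n))^2) * X n z"
proof -
  let ?d = "1 - cnj (\<gamma> n) * f n z"
  have "X (Suc n) z * ?d = (Ps n z - \<gamma> n * (z * Ph n z)) * ?d - (z * f (Suc n) z * ?d) * (z * Ph n z - cnj (\<gamma> n) * Ps n z)"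
    unfolding X_def Ps_Suc Ph_Suc by (simp add: algebra_simps)
  also have "\<dots> = (Ps n z - \<gamma> n * (z * Ph n z)) * ?d - (f n z - \<gamma> n) * (z * Ph n z - cnj (\<gamma> n) * Ps n z)"
    unfolding f_step(1)[OF z] ..
  also have "\<dots> = (1 - \<gamma> n * cnj (\<gamma> n)) * X n z" unfolding X_def by (simp add: algebra_simps)
  also have "1 - \<gamma> n * cnj (\<gamma> n) = of_real (1 - (cmod (\<gamma> n))^2)" by (simp only: of_real_diff complex_norm_square of_real_1)
  finally show ?thesis .
qed

text \<open>This expression is the Poisson integral of \<open>\<sigma>\<close> for \<open>n = 0\<close> and
  decreases with \<open>n\<close> towards \<open>\<bar>D z\<bar>\<^sup>2\<close>; every step
  multiplies it by a ratio that measures the size of \<open>f n z\<close> (\<open>Q_Suc\<close>).\<close>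

definition "Q n z = Cn n * (1 - (cmod (z * f n z))^2) / (cmod (X n z))^2"

lemma zf_less: "cmod z < 1 \<Longrightarrow> cmod (z * f n z) < 1"
  using f_le[of z n] mult_left_le[of "cmod (f n z)" "cmod z"] by (simp add: norm_mult)

lemma Q_pos: assumes "cmod z < 1" shows "Q n z > 0" unfolding Q_def using Cn_pos[of n] zf_less[OF assms, of n] X_nz[OF assms, of n]
  by (intro divide_pos_pos mult_pos_pos) (auto simp: abs_square_less_1)

lemma Q_0:
  assumes z: "cmod z < 1" shows "Q 0 z = (\<integral>t. pk z t \<partial>\<sigma>)"
proof -
  have c: "continuous_on (sphere 0 1) (\<lambda>t. (t + z) / (t - z))"
    using circle_minus_pos[OF _ z] by (intro continuous_intros) auto
  have "(\<integral>t. pk z t \<partial>\<sigma>) = (\<integral>t. Re ((t + z) / (t - z)) \<partial>\<sigma>)"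
    by (intro bint_cong refl) (simp add: pk_schwarz(2)[OF z])
  also have "\<dots> = Re (\<integral>t. (t + z) / (t - z) \<partial>\<sigma>)" by (rule integral_Re[OF integrable_continuous[OF c]])
  also have "\<dots> = Re ((1 + z * f 0 z) / (1 - z * f 0 z))" by (simp only: F_eq[OF z])
  also have "\<dots> = (1 - (cmod (z * f 0 z))^2) / (cmod (1 - z * f 0 z))^2"
    by (subst complex_div_cnj) (simp only: cmod_power2 flip: of_real_power, simp add: power2_eq_square algebra_simps)
  finally show ?thesis by (simp add: Q_def X_def)
qed

lemma Q_Suc:
  assumes z: "cmod z < 1"
  shows "Q (Suc n) z = Q n z * ((1 - (cmod (f n z))^2) / (1 - (cmod (z * f n z))^2))"
proof -
  let ?d = "1 - cnj (\<gamma> n) * f n z"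
  let ?g = "1 - (cmod (\<gamma> n))^2"
  have d: "cmod ?d > 0" using f_step(2)[OF z] by simp
  have g: "?g > 0" by (rule gamma2)
  have "(cmod ?d)^2 - (cmod (f n z - \<gamma> n))^2 = ?g * (1 - (cmod (f n z))^2)" by (rule disc_identity)
  moreover have "(cmod (f n z - \<gamma> n))^2 = (cmod (z * f (Suc n) z))^2 * (cmod ?d)^2"
    unfolding f_step(1)[OF z, symmetric] norm_mult power_mult_distrib ..
  ultimately have 1: "(1 - (cmod (z * f (Suc n) z))^2) * (cmod ?d)^2 = ?g * (1 - (cmod (f n z))^2)" by (simp add: algebra_simps)
  have "(cmod (X (Suc n) z * ?d))^2 = (cmod (of_real ?g * X n z))^2" by (simp only: X_Suc[OF z])
  then have 2: "(cmod (X (Suc n) z))^2 * (cmod ?d)^2 = ?g\<^sup>2 * (cmod (X n z))^2"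
    using g by (simp only: norm_mult power_mult_distrib norm_of_real power2_abs)
  have z1: "1 - (cmod (z * f n z))^2 > 0" using zf_less[OF z, of n] by (simp add: abs_square_less_1)
  have "Q (Suc n) z = Cn n * ?g * ((1 - (cmod (z * f (Suc n) z))^2) * (cmod ?d)^2) / ((cmod (X (Suc n) z))^2 * (cmod ?d)^2)"
    unfolding Q_def Cn_Suc using d by simp
  also have "\<dots> = Cn n * (1 - (cmod (f n z))^2) / (cmod (X n z))^2" unfolding 1 2 using g by (simp add: power2_eq_square)
  also have "\<dots> = Q n z * ((1 - (cmod (f n z))^2) / (1 - (cmod (z * f n z))^2))" unfolding Q_def using z1 by simp
  finally show ?thesis .
qed

lemma Q_antimono: assumes z: "cmod z < 1" and "m \<le> n" shows "Q n z \<le> Q m z" using assms(2)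
proof (induction n rule: dec_induct)
  case (step n)
  have "1 - (cmod (f n z))^2 \<le> 1 - (cmod (z * f n z))^2"
    using z mult_left_le_one_le[of "cmod (f n z)" "cmod z"] by (auto simp: norm_mult intro: power_mono)
  moreover have "1 - (cmod (z * f n z))^2 > 0" using zf_less[OF z, of n] by (simp add: abs_square_less_1)
  ultimately have "(1 - (cmod (f n z))^2) / (1 - (cmod (z * f n z))^2) \<le> 1" by simp
  then have "Q (Suc n) z \<le> Q n z" unfolding Q_Suc[OF z] using Q_pos[OF z, of n] by (intro mult_left_le) auto
  then show ?case using step by simp
qed simp

end

section \<open>Szego's theorem\<close>

lemma ball_holomorphic_log:
  assumes h: "h holomorphic_on ball 0 1" and nz: "\<And>z. cmod z < 1 \<Longrightarrow> h z \<noteq> 0"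
  obtains L where "L holomorphic_on ball 0 1" "\<And>z. cmod z < 1 \<Longrightarrow> h z = exp (L z)" "\<And>z. cmod z < 1 \<Longrightarrow> Re (L z) = ln (cmod (h z))"
proof -
  obtain L where L: "L holomorphic_on ball 0 1" "\<And>z. z \<in> ball 0 1 \<Longrightarrow> h z = exp (L z)"
    using contractible_imp_holomorphic_log[OF h convex_imp_contractible[OF convex_ball]] nz by auto
  then show thesis by (intro that[of L]) auto
qed

lemma pk_0: "cmod t = 1 \<Longrightarrow> pk 0 t = 1" by (simp add: pk_def)

lemma mean_value_Re:
  assumes "L holomorphic_on ball 0 1" "0 \<le> r" "r < 1"
  shows "(\<ointegral>t. Re (L (of_real r * t))) = Re (L 0)"
proof -
  have "(\<ointegral>t. pk 0 t * Re (L (of_real r * t))) = Re (L (of_real r * 0))"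
    by (rule poisson_Re[OF holomorphic_dilation[OF assms]]) simp
  moreover have "(\<ointegral>t. pk 0 t * Re (L (of_real r * t))) = (\<ointegral>t. Re (L (of_real r * t)))"
    by (intro bint_cong refl) (simp add: pk_0)
  ultimately show ?thesis by simp
qed

lemma dil_less: "0 \<le> r \<Longrightarrow> r < 1 \<Longrightarrow> cmod t = 1 \<Longrightarrow> cmod (of_real r * t) < 1"
  by (simp add: norm_mult)

lemma jensen_zero_free:
  assumes h: "h holomorphic_on ball 0 1" and nz: "\<And>z. cmod z < 1 \<Longrightarrow> h z \<noteq> 0" and r: "0 \<le> r" "r < 1"
  shows "(\<ointegral>t. ln (cmod (h (of_real r * t)))) = ln (cmod (h 0))"
proof -
  obtain L where L: "L holomorphic_on ball 0 1" "\<And>z. cmod z < 1 \<Longrightarrow> Re (L z) = ln (cmod (h z))"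
    using ball_holomorphic_log[OF h nz] by metis
  have "(\<ointegral>t. ln (cmod (h (of_real r * t)))) = (\<ointegral>t. Re (L (of_real r * t)))"
    using L(2) dil_less[OF r] by (intro bint_cong refl) simp
  then show ?thesis using mean_value_Re[OF L(1) r] L(2)[of 0] by simp
qed

lemma continuous_ln_dilation:
  assumes h: "h holomorphic_on ball 0 1" and nz: "\<And>z. cmod z < 1 \<Longrightarrow> h z \<noteq> 0" and r: "0 \<le> r" "r < 1"
  shows "continuous_on (sphere 0 1) (\<lambda>t. ln (cmod (h (of_real r * t))))"
  using nz dil_less[OF r] by (intro continuous_intros dilation_continuous[OF h r]) auto

lemma nn_integral_lebesgue_decomposition:
  assumes dec: "circle_lebesgue_decomposition \<sigma> w \<sigma>s" and s: "sets \<sigma> = sets borel_circle"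
    and g: "g \<in> borel_measurable borel_circle"
  shows "(\<integral>\<^sup>+t. g t \<partial>\<sigma>) = (\<integral>\<^sup>+t. ennreal (w t) * g t \<partial>cm) + (\<integral>\<^sup>+t. g t \<partial>\<sigma>s)"
proof -
  have ss [measurable_cong]: "sets \<sigma>s = sets borel_circle" and wm [measurable]: "w \<in> borel_measurable borel_circle"
    and em: "\<And>A. A \<in> sets borel_circle \<Longrightarrow> emeasure \<sigma> A = emeasure (density cm (\<lambda>x. ennreal (w x))) A + emeasure \<sigma>s A"
    using dec by (auto simp: circle_lebesgue_decomposition_def)
  note s [measurable_cong]
  have sp: "space \<sigma> = sphere 0 1" "space \<sigma>s = sphere 0 1" using sets_eq_imp_space_eq[OF s] sets_eq_imp_space_eq[OF ss] by auto
  define d where "d = density cm (\<lambda>x. ennreal (w x))"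
  have sd [measurable_cong]: "sets d = sets borel_circle" and spd: "space d = sphere 0 1" by (auto simp: d_def)
  have "(\<integral>\<^sup>+t. g t \<partial>\<sigma>) = (\<integral>\<^sup>+t. g t \<partial>d) + (\<integral>\<^sup>+t. g t \<partial>\<sigma>s)"
    using g
  proof (induction rule: borel_measurable_induct)
    case (cong f g)
    have "integral\<^sup>N \<sigma> f = integral\<^sup>N \<sigma> g" "integral\<^sup>N d f = integral\<^sup>N d g" "integral\<^sup>N \<sigma>s f = integral\<^sup>N \<sigma>s g"
      by (rule nn_integral_cong, use cong(3) sp spd in simp)+
    then show ?case using cong(4) by simp
  next
    case (set A)
    then show ?case using em[OF set] by (simp add: d_def[symmetric] s ss sd)
  next
    case (mult u c)
    note mult(2)[measurable]
    show ?case using mult(4) by (simp add: nn_integral_cmult distrib_left)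
  next
    case (add u v)
    note add.hyps(1)[measurable] add.hyps(3)[measurable]
    show ?case using add.IH by (simp add: nn_integral_add add_ac)
  next
    case (seq U)
    note seq.hyps(1)[measurable]
    have U: "(\<integral>\<^sup>+t. (SUP i. U i) t \<partial>N) = (SUP i. \<integral>\<^sup>+t. U i t \<partial>N)" if "sets N = sets borel_circle" for N
      unfolding SUP_apply using seq.hyps(1,3) that by (intro nn_integral_monotone_convergence_SUP) (auto simp: measurable_cong_sets[OF that refl])
    have inc: "incseq (\<lambda>i. \<integral>\<^sup>+t. U i t \<partial>N)" for N
      using seq.hyps(3) by (auto simp: incseq_def le_fun_def intro!: nn_integral_mono)
    show ?case unfolding U[OF s] U[OF sd] U[OF ss] seq.IH by (rule ennreal_SUP_add[OF inc inc])
  qed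
  also have "(\<integral>\<^sup>+t. g t \<partial>d) = (\<integral>\<^sup>+t. ennreal (w t) * g t \<partial>cm)"
    unfolding d_def using g by (subst nn_integral_density) auto
  finally show ?thesis .
qed

locale opuc_szego = opuc_iterates +
  fixes w :: "complex \<Rightarrow> real" and \<sigma>s :: "complex measure"
  assumes dec: "circle_lebesgue_decomposition \<sigma> w \<sigma>s" and sq: "summable (\<lambda>n. (cmod (\<gamma> n))^2)"
begin

lemma Cn_lower: "\<exists>c>0. \<forall>n. c \<le> Cn n"
proof -
  have lnC: "ln (Cn n) = (\<Sum>k<n. ln (1 - (cmod (\<gamma> k))^2))" for n
    unfolding Cn_def by (rule ln_prod, simp) (metis gamma2(1) less_irrefl)
  have "summable (\<lambda>k. ln (1 - (cmod (\<gamma> k))^2))"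
  proof (rule summable_comparison_test_ev)
    have "(\<lambda>k. (cmod (\<gamma> k))^2) \<longlonglongrightarrow> 0" by (rule summable_LIMSEQ_zero[OF sq])
    then have "\<forall>\<^sub>F k in sequentially. (cmod (\<gamma> k))^2 < 1/2" by (rule order_tendstoD) simp
    then show "\<forall>\<^sub>F k in sequentially. norm (ln (1 - (cmod (\<gamma> k))^2)) \<le> 2 * (cmod (\<gamma> k))^2"
    proof eventually_elim
      case (elim k)
      let ?x = "(cmod (\<gamma> k))^2"
      have "- ?x - 2 * ?x\<^sup>2 \<le> ln (1 - ?x)" using elim by (intro ln_one_minus_pos_lower_bound) auto
      moreover have "2 * ?x\<^sup>2 \<le> ?x" using elim mult_right_mono[of ?x "1/2" ?x] by (simp add: power2_eq_square)
      moreover have "ln (1 - ?x) \<le> 0" using gamma2[of k] by simp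
      ultimately show ?case by simp
    qed
    show "summable (\<lambda>k. 2 * (cmod (\<gamma> k))^2)" by (intro summable_mult sq)
  qed
  then have "Bseq (\<lambda>n. \<Sum>k<n. ln (1 - (cmod (\<gamma> k))^2))"
    by (intro convergent_imp_Bseq) (simp add: summable_iff_convergent)
  then obtain K where K: "\<And>n. \<bar>ln (Cn n)\<bar> \<le> K" unfolding lnC Bseq_def by auto
  have "exp (- K) \<le> Cn n" for n
  proof -
    have "- K \<le> ln (Cn n)" using K[of n] by linarith
    then have "exp (-K) \<le> exp (ln (Cn n))" by simp
    then show ?thesis using Cn_pos[of n] by simp
  qed
  then show ?thesis by (intro exI[of _ "exp (- K)"]) auto
qed

definition Cinf :: real where "Cinf = lim Cn"

lemma Cn_lim: "Cn \<longlonglongrightarrow> Cinf" and Cinf_pos: "Cinf > 0" and Cinf_le: "Cinf \<le> Cn n"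
proof -
  obtain c where c: "c > 0" "\<And>n. c \<le> Cn n" using Cn_lower by blast
  have dec: "decseq Cn" by (intro decseq_SucI Cn_antimono)
  have "convergent Cn" using decseq_convergent[OF dec, of c] c(2) unfolding convergent_def by metis
  then show lim: "Cn \<longlonglongrightarrow> Cinf" unfolding Cinf_def by (simp add: convergent_LIMSEQ_iff)
  show "Cinf > 0" using LIMSEQ_le_const[OF lim, of c] c by force
  show "Cinf \<le> Cn n" by (rule decseq_ge[OF dec lim])
qed

lemma Ps_at_0: "Ps n 0 = 1" by (induction n) (simp_all add: Ps_Suc)

lemma X_hol: "X n holomorphic_on ball 0 1"
proof -
  have "(\<lambda>z. Ps n z - z * f n z * Ph n z) holomorphic_on ball 0 1"
    by (intro holomorphic_intros holomorphic_Ps holomorphic_Ph f_hol)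
  then show ?thesis by (simp add: X_def[abs_def])
qed

lemma X_at_0: "X n 0 = 1" by (simp add: X_def Ps_at_0)

lemma f_dil_cont: "0 \<le> r \<Longrightarrow> r < 1 \<Longrightarrow> continuous_on (sphere 0 1) (\<lambda>t. f n (of_real r * t))"
  by (rule dilation_continuous[OF f_hol])

lemma f_sq_less: "cmod z < 1 \<Longrightarrow> (cmod (f n z))^2 < 1" using f_less[of z n] by (simp add: abs_square_less_1)

lemma ln_Q_dil_cont:
  assumes r: "0 \<le> r" "r < 1" shows "continuous_on (sphere 0 1) (\<lambda>t. ln (Q n (of_real r * t)))"
proof -
  have "continuous_on (sphere 0 1) (\<lambda>t. Q n (of_real r * t))"
    unfolding Q_def using X_nz dil_less[OF r] by (intro continuous_intros f_dil_cont r dilation_continuous[OF X_hol r]) auto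
  then show ?thesis using Q_pos dil_less[OF r] by (intro continuous_intros) (auto simp: less_imp_neq[symmetric] intro: less_imp_neq)
qed

lemma integral_ln_Q:
  assumes r: "0 \<le> r" "r < 1"
  shows "(\<ointegral>t. ln (Q n (of_real r * t))) = ln (Cn n) + (\<ointegral>t. ln (1 - r^2 * (cmod (f n (of_real r * t)))^2))"
proof -
  have pos: "0 < 1 - r^2 * (cmod (f n (of_real r * t)))^2" if "cmod t = 1" for t
  proof -
    have "(cmod (of_real r * t * f n (of_real r * t)))^2 < 1" using zf_less[OF dil_less[OF r that], of n] by (simp add: abs_square_less_1)
    then show ?thesis using that r by (simp add: norm_mult power_mult_distrib)
  qed
  have c: "continuous_on (sphere 0 1) (\<lambda>t. ln (1 - r^2 * (cmod (f n (of_real r * t)))^2))"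
    by (intro continuous_intros f_dil_cont r) (metis less_irrefl mem_sphere_0 pos)
  have cX: "continuous_on (sphere 0 1) (\<lambda>t. ln (cmod (X n (of_real r * t))))"
    by (rule continuous_ln_dilation[OF X_hol X_nz r])
  have "(\<ointegral>t. ln (Q n (of_real r * t))) =
     (\<ointegral>t. (ln (Cn n) + ln (1 - r^2 * (cmod (f n (of_real r * t)))^2)) - 2 * ln (cmod (X n (of_real r * t))))"
  proof (rule bint_cong)
    fix t assume "t \<in> space cm"
    then have e: "cmod t = 1" by simp
    have x: "cmod (X n (of_real r * t)) > 0" using X_nz[OF dil_less[OF r e], of n] by simp
    have "(cmod (of_real r * t * f n (of_real r * t)))^2 = r^2 * (cmod (f n (of_real r * t)))^2" using e r by (simp add: norm_mult power_mult_distrib)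
    then show "ln (Q n (of_real r * t)) = (ln (Cn n) + ln (1 - r^2 * (cmod (f n (of_real r * t)))^2)) - 2 * ln (cmod (X n (of_real r * t)))"
      unfolding Q_def using Cn_pos[of n] pos[OF e] x by (simp add: ln_div ln_mult ln_realpow)
  qed simp
  also have "\<dots> = ln (Cn n) + (\<ointegral>t. ln (1 - r^2 * (cmod (f n (of_real r * t)))^2)) - 2 * (\<ointegral>t. ln (cmod (X n (of_real r * t))))"
    using integrable_cm_continuous[OF c] integrable_cm_continuous[OF cX] cm.prob_space by simp
  also have "(\<ointegral>t. ln (cmod (X n (of_real r * t)))) = 0" using jensen_zero_free[OF X_hol X_nz r] by (simp add: X_at_0)
  finally show ?thesis by simp
qed

lemma F_hol: "(\<lambda>z. (1 + z * f 0 z) / (1 - z * f 0 z)) holomorphic_on ball 0 1"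
  using zf_neq by (intro holomorphic_intros f_hol) auto

lemma Q0_eq_Re: "cmod z < 1 \<Longrightarrow> Q 0 z = Re ((1 + z * f 0 z) / (1 - z * f 0 z))"
proof -
  assume z: "cmod z < 1"
  have "Re ((1 + z * f 0 z) / (1 - z * f 0 z)) = (1 - (cmod (z * f 0 z))^2) / (cmod (1 - z * f 0 z))^2"
    by (subst complex_div_cnj) (simp only: cmod_power2 flip: of_real_power, simp add: power2_eq_square algebra_simps)
  then show ?thesis by (simp add: Q_def X_def)
qed

lemma integral_Q0:
  assumes r: "0 \<le> r" "r < 1" shows "(\<ointegral>t. Q 0 (of_real r * t)) = 1"
proof -
  have "(\<ointegral>t. Q 0 (of_real r * t)) = (\<ointegral>t. Re ((1 + of_real r * t * f 0 (of_real r * t)) / (1 - of_real r * t * f 0 (of_real r * t))))"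
    using Q0_eq_Re dil_less[OF r] by (intro bint_cong refl) simp
  also have "\<dots> = 1" using mean_value_Re[OF F_hol r] by simp
  finally show ?thesis .
qed

lemma Q0_dil_cont:
  assumes r: "0 \<le> r" "r < 1" shows "continuous_on (sphere 0 1) (\<lambda>t. Q 0 (of_real r * t))"
  unfolding Q_def using X_nz dil_less[OF r] by (intro continuous_intros f_dil_cont r dilation_continuous[OF X_hol r]) auto

text \<open>The logarithmic means of \<open>Q n\<close> decrease in \<open>n\<close> and are bounded below, so
  their differences tend to \<open>0\<close>; each difference dominates \<open>1 - r\<^sup>2\<close>
  times a square mean of \<open>f n\<close>.\<close>

lemma f_L2:
  assumes r: "0 < r" "r < 1"
  shows "(\<lambda>n. \<ointegral>t. (cmod (f n (of_real r * t)))^2) \<longlonglongrightarrow> 0"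
proof -
  have r': "0 \<le> r" "r < 1" using r by auto
  have r2: "0 < 1 - r^2" using r by (simp add: abs_square_less_1)
  define J where "J n = (\<ointegral>t. (cmod (f n (of_real r * t)))^2)" for n
  define I where "I n = (\<ointegral>t. ln (Q n (of_real r * t)))" for n
  have iJ: "integrable cm (\<lambda>t. (cmod (f n (of_real r * t)))^2)" for n
    by (intro integrable_cm_continuous continuous_intros f_dil_cont r')
  have iI: "integrable cm (\<lambda>t. ln (Q n (of_real r * t)))" for n by (intro integrable_cm_continuous ln_Q_dil_cont r')
  have step: "(1 - r^2) * J n \<le> I n - I (Suc n)" for n
  proof -
    have "(1 - r^2) * J n = (\<ointegral>t. (1 - r^2) * (cmod (f n (of_real r * t)))^2)" by (simp add: J_def)
    also have "\<dots> \<le> (\<ointegral>t. ln (Q n (of_real r * t)) - ln (Q (Suc n) (of_real r * t)))"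
    proof (rule integral_mono)
      fix t assume "t \<in> space cm"
      then have e: "cmod t = 1" by simp
      let ?z = "of_real r * t"
      have z: "cmod ?z < 1" by (rule dil_less[OF r' e])
      define x where "x = (cmod (f n ?z))^2"
      have x: "0 \<le> x" "x < 1" using f_sq_less[OF z, of n] by (auto simp: x_def)
      have zx: "(cmod (?z * f n ?z))^2 = r^2 * x" using e r by (simp add: x_def norm_mult power_mult_distrib)
      have rx: "r^2 * x < 1" using x r2 mult_left_le[of x "r^2"] by (smt (verit) mult.commute mult_left_le_one_le zero_le_power2)
      have "ln (Q (Suc n) ?z) = ln (Q n ?z) + ln ((1 - x) / (1 - r^2 * x))"
        unfolding Q_Suc[OF z] zx x_def[symmetric] using Q_pos[OF z, of n] x rx by (intro ln_mult_pos) auto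
      moreover have "ln ((1 - x) / (1 - r^2 * x)) \<le> (1 - x) / (1 - r^2 * x) - 1" using x rx by (intro ln_le_minus_one) auto
      moreover have "(1 - x) / (1 - r^2 * x) - 1 = - ((1 - r^2) * x) / (1 - r^2 * x)" using rx by (simp add: field_simps)
      moreover have "(1 - r^2) * x \<le> (1 - r^2) * x / (1 - r^2 * x)"
        using x rx r2 by (simp add: pos_le_divide_eq) (simp add: mult_left_le)
      ultimately show "(1 - r^2) * (cmod (f n ?z))^2 \<le> ln (Q n ?z) - ln (Q (Suc n) ?z)" unfolding x_def[symmetric] by linarith
    qed (use iJ iI in auto)
    also have "\<dots> = I n - I (Suc n)" using iI by (simp add: I_def)
    finally show ?thesis .
  qed
  have I0: "I 0 \<le> 0"
  proof -
    have "I 0 \<le> (\<ointegral>t. Q 0 (of_real r * t) - 1)" unfolding I_def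
    proof (rule integral_mono[OF iI])
      show "integrable cm (\<lambda>t. Q 0 (of_real r * t) - 1)" by (intro integrable_cm_continuous continuous_intros Q0_dil_cont r')
      fix t assume "t \<in> space cm"
      then show "ln (Q 0 (of_real r * t)) \<le> Q 0 (of_real r * t) - 1" using Q_pos[OF dil_less[OF r']] by (intro ln_le_minus_one) auto
    qed
    also have "\<dots> = 0" using integral_Q0[OF r'] integrable_cm_continuous[OF Q0_dil_cont[OF r']] cm.prob_space by simp
    finally show ?thesis .
  qed
  have In: "I n \<ge> ln Cinf + ln (1 - r^2)" for n
  proof -
    have "ln Cinf \<le> ln (Cn n)" using Cinf_pos Cinf_le[of n] by simp
    moreover have "ln (1 - r^2) \<le> (\<ointegral>t. ln (1 - r^2 * (cmod (f n (of_real r * t)))^2))"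
    proof -
      have le: "1 - r^2 \<le> 1 - r^2 * (cmod (f n (of_real r * t)))^2" if "cmod t = 1" for t
        using f_sq_less[OF dil_less[OF r' that], of n] by (simp add: mult_left_le)
      have "ln (1 - r^2) = (\<ointegral>t. ln (1 - r^2))" using cm.prob_space by simp
      also have "\<dots> \<le> (\<ointegral>t. ln (1 - r^2 * (cmod (f n (of_real r * t)))^2))"
      proof (rule integral_mono)
        show "integrable cm (\<lambda>t. ln (1 - r^2 * (cmod (f n (of_real r * t)))^2))"
          using le r2 by (intro integrable_cm_continuous continuous_intros f_dil_cont r') (auto, metis le less_le_trans less_irrefl diff_eq_eq diff_gt_0_iff_gt)
        show "ln (1 - r^2) \<le> ln (1 - r^2 * (cmod (f n (of_real r * t)))^2)" if "t \<in> space cm" for t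
          using le[of t] that r2 by (subst ln_le_cancel_iff) auto
      qed simp
      finally show ?thesis .
    qed
    ultimately show ?thesis unfolding I_def integral_ln_Q[OF r'] by linarith
  qed
  have "(\<Sum>j<n. (1 - r^2) * J j) \<le> - (ln Cinf + ln (1 - r^2))" for n
  proof -
    have "(\<Sum>j<n. (1 - r^2) * J j) \<le> (\<Sum>j<n. I j - I (Suc j))" by (intro sum_mono step)
    also have "\<dots> = I 0 - I n" by (rule sum_lessThan_telescope')
    also have "\<dots> \<le> - (ln Cinf + ln (1 - r^2))" using I0 In[of n] by linarith
    finally show ?thesis .
  qed
  then have "summable (\<lambda>j. (1 - r^2) * J j)" using r2 by (intro summableI_nonneg_bounded) (auto simp: J_def)
  then have "summable J" using r2 by (simp add: summable_cmult_iff)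
  then show ?thesis unfolding J_def by (rule summable_LIMSEQ_zero)
qed

text \<open>Poisson's formula on a circle of radius between \<open>\<rho>\<close> and \<open>1\<close> turns
  the means into pointwise bounds.\<close>

lemma f_unif:
  assumes \<rho>: "0 < \<rho>" "\<rho> < 1" and e: "e > 0"
  shows "\<forall>\<^sub>F n in sequentially. \<forall>z. cmod z \<le> \<rho> \<longrightarrow> cmod (f n z) \<le> e"
proof -
  define r where "r = (1 + \<rho>) / 2"
  have r: "0 < r" "r < 1" "\<rho> < r" using \<rho> by (auto simp: r_def)
  have r': "0 \<le> r" using r by simp
  define q where "q = 2 / (1 - \<rho> / r)"
  have q: "q > 0" using r \<rho> by (simp add: q_def)
  define e' where "e' = e / q"
  have e': "e' > 0" using e q by (simp add: e'_def)
  have "\<forall>\<^sub>F n in sequentially. (\<ointegral>t. (cmod (f n (of_real r * t)))^2) < e'\<^sup>2"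
    using f_L2[OF r(1,2)] e' by (intro order_tendstoD(2)) auto
  then show ?thesis
  proof eventually_elim
    case (elim n)
    have c: "continuous_on (sphere 0 1) (\<lambda>t. f n (of_real r * t))" by (rule f_dil_cont[OF r' r(2)])
    have L1: "(\<ointegral>t. cmod (f n (of_real r * t))) \<le> e'"
      by (rule integral_abs_le_of_square[OF c _ e']) (use elim in simp)
    show ?case
    proof (intro allI impI)
      fix z assume z: "cmod z \<le> \<rho>"
      define u where "u = z / of_real r"
      have u: "cmod u \<le> \<rho> / r" using z r by (simp add: u_def norm_divide divide_right_mono)
      have u1: "cmod u < 1" using u r \<rho> by (smt (verit) divide_less_eq_1_pos)
      have zu: "of_real r * u = z" using r by (simp add: u_def)
      have i: "integrable cm (\<lambda>t. pk u t *\<^sub>R f n (of_real r * t))" by (rule integrable_pk_scaleR[OF u1 integrable_cm_continuous[OF c]])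
      have "f n z = (\<ointegral>t. pk u t *\<^sub>R f n (of_real r * t))"
        using poisson_cm[OF holomorphic_dilation[OF f_hol r' r(2)] u1, of n] by (simp add: zu)
      also have "cmod \<dots> \<le> (\<ointegral>t. q * cmod (f n (of_real r * t)))"
      proof (rule Bochner_Integration.integral_norm_bound_integral[OF i])
        show "integrable cm (\<lambda>t. q * cmod (f n (of_real r * t)))" by (intro integrable_cm_continuous continuous_intros c)
        fix t assume "t \<in> space cm"
        then have e: "cmod t = 1" by simp
        have "pk u t \<le> 2 / (1 - cmod u)" by (rule pk_le[OF u1 e])
        also have "\<dots> \<le> q" unfolding q_def using u u1 r \<rho> by (intro divide_left_mono mult_pos_pos) auto
        finally show "norm (pk u t *\<^sub>R f n (of_real r * t)) \<le> q * cmod (f n (of_real r * t))"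
          using pk_pos[OF u1 e] by (simp add: mult_right_mono)
      qed
      also have "\<dots> = q * (\<ointegral>t. cmod (f n (of_real r * t)))" by (rule integral_mult_right_zero)
      also have "\<dots> \<le> q * e'" using L1 q by (intro mult_left_mono) auto
      also have "\<dots> = e" using q by (simp add: e'_def)
      finally show "cmod (f n z) \<le> e" .
    qed
  qed
qed

text \<open>One half of Szego's theorem before the passage to the boundary: \<open>Q 0 \<ge> Q n\<close>, and
  the logarithmic mean of \<open>Q n\<close> tends to \<open>ln Cinf\<close>.\<close>

lemma integral_ln_Q0_ge:
  assumes r: "0 < r" "r < 1" shows "(\<ointegral>t. ln (Q 0 (of_real r * t))) \<ge> ln Cinf"
proof -
  have r': "0 \<le> r" "r < 1" using r by auto
  have r2: "0 < 1 - r^2" using r by (simp add: abs_square_less_1)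
  define J where "J n = (\<ointegral>t. (cmod (f n (of_real r * t)))^2)" for n
  have J0: "J \<longlonglongrightarrow> 0" unfolding J_def by (rule f_L2[OF r])
  have ge: "(\<ointegral>t. ln (Q 0 (of_real r * t))) \<ge> ln Cinf - J n / (1 - r^2)" for n
  proof -
    have "(\<ointegral>t. ln (Q n (of_real r * t))) \<le> (\<ointegral>t. ln (Q 0 (of_real r * t)))"
      using Q_antimono[OF dil_less[OF r'], of _ 0 n] Q_pos[OF dil_less[OF r']]
      by (intro integral_mono integrable_cm_continuous ln_Q_dil_cont r') (auto intro!: ln_mono simp: ln_le_cancel_iff)
    moreover have "ln Cinf \<le> ln (Cn n)" using Cinf_pos Cinf_le[of n] by simp
    moreover have "(\<ointegral>t. ln (1 - r^2 * (cmod (f n (of_real r * t)))^2)) \<ge> (\<ointegral>t. - ((cmod (f n (of_real r * t)))^2 / (1 - r^2)))"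
    proof (rule integral_mono)
      have pos: "1 - r^2 \<le> 1 - r^2 * (cmod (f n (of_real r * t)))^2" if "cmod t = 1" for t
        using f_sq_less[OF dil_less[OF r' that], of n] by (simp add: mult_left_le)
      show "integrable cm (\<lambda>t. ln (1 - r^2 * (cmod (f n (of_real r * t)))^2))"
        using r2 by (intro integrable_cm_continuous continuous_intros f_dil_cont r') (auto, metis pos less_le_trans less_irrefl diff_eq_eq diff_gt_0_iff_gt)
      show "integrable cm (\<lambda>t. - ((cmod (f n (of_real r * t)))^2 / (1 - r^2)))"
        using r2 by (intro integrable_cm_continuous continuous_intros f_dil_cont r') auto
      fix t assume "t \<in> space cm"
      then have e: "cmod t = 1" by simp
      define x where "x = (cmod (f n (of_real r * t)))^2"
      have x: "0 \<le> x" "x < 1" using f_sq_less[OF dil_less[OF r' e], of n] by (auto simp: x_def)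
      define y where "y = 1 - r^2 * x"
      have y: "1 - r^2 \<le> y" "y > 0" using pos[OF e] r2 by (auto simp: y_def x_def)
      have "ln (1 / y) \<le> 1 / y - 1" using y by (intro ln_le_minus_one) auto
      then have "1 - 1 / y \<le> ln y" using y by (simp add: ln_div)
      moreover have "1 - 1 / y = - (r^2 * x / y)" using y by (simp add: y_def field_simps)
      moreover have "r^2 * x / y \<le> x / (1 - r^2)" using y r2 x by (intro frac_le) (auto intro: mult_left_le_one_le)
      ultimately show "- ((cmod (f n (of_real r * t)))^2 / (1 - r^2)) \<le> ln (1 - r^2 * (cmod (f n (of_real r * t)))^2)"
        unfolding x_def[symmetric] y_def[symmetric] by linarith
    qed
    moreover have "(\<ointegral>t. - ((cmod (f n (of_real r * t)))^2 / (1 - r^2))) = - (J n / (1 - r^2))" by (simp add: J_def)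
    ultimately show ?thesis unfolding integral_ln_Q[OF r'] by linarith
  qed
  have "(\<lambda>n. ln Cinf - J n / (1 - r^2)) \<longlonglongrightarrow> ln Cinf - 0 / (1 - r^2)" using r2 by (intro tendsto_intros J0) auto
  then show ?thesis using ge by (intro LIMSEQ_le_const2[of "\<lambda>n. ln Cinf - J n / (1 - r^2)"]) auto
qed

lemma wm [measurable]: "w \<in> borel_measurable borel_circle" and w_nonneg: "AE x in cm. 0 \<le> w x"
  and sets_s [measurable_cong, simp]: "sets \<sigma>s = sets borel_circle"
  using dec by (auto simp: circle_lebesgue_decomposition_def)

lemma space_s [simp]: "space \<sigma>s = sphere 0 1" using sets_eq_imp_space_eq[OF sets_s] by simp

lemma nn_sigma:
  "g \<in> borel_measurable borel_circle \<Longrightarrow> (\<integral>\<^sup>+t. g t \<partial>\<sigma>) = (\<integral>\<^sup>+t. ennreal (w t) * g t \<partial>cm) + (\<integral>\<^sup>+t. g t \<partial>\<sigma>s)"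
  by (rule nn_integral_lebesgue_decomposition[OF dec]) simp

lemma finite_s: "finite_measure \<sigma>s"
proof (rule finite_measureI)
  have "emeasure \<sigma>s (sphere 0 1) \<le> emeasure \<sigma> (sphere 0 1)"
    using dec sets.top[of cm] by (auto simp: circle_lebesgue_decomposition_def)
  also have "\<dots> < \<infinity>" by (simp add: less_top[symmetric])
  finally show "emeasure \<sigma>s (space \<sigma>s) \<noteq> \<infinity>" by simp
qed

lemma integrable_w_mult:
  assumes g: "g \<in> borel_measurable borel_circle" and nn: "\<And>t. cmod t = 1 \<Longrightarrow> g t \<ge> 0" and i: "integrable \<sigma> g"
  shows "integrable cm (\<lambda>t. w t * g t)" "(\<ointegral>t. w t * g t) \<le> (\<integral>t. g t \<partial>\<sigma>)"
proof -
  note g[measurable]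
  have nnw: "AE t in cm. 0 \<le> w t * g t" using w_nonneg AE_space[of cm] by eventually_elim (use nn in auto)
  have "(\<integral>\<^sup>+t. ennreal (w t * g t) \<partial>cm) = (\<integral>\<^sup>+t. ennreal (w t) * ennreal (g t) \<partial>cm)"
    by (rule nn_integral_cong_AE) (use w_nonneg AE_space[of cm] in \<open>eventually_elim, use nn in \<open>simp add: ennreal_mult\<close>\<close>)
  also have "\<dots> \<le> (\<integral>\<^sup>+t. ennreal (g t) \<partial>\<sigma>)" by (subst nn_sigma) auto
  also have "\<dots> = ennreal (\<integral>t. g t \<partial>\<sigma>)" using i nn by (intro nn_integral_eq_integral AE_I2) auto
  finally have le: "(\<integral>\<^sup>+t. ennreal (w t * g t) \<partial>cm) \<le> ennreal (\<integral>t. g t \<partial>\<sigma>)" .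
  show ii: "integrable cm (\<lambda>t. w t * g t)"
    by (rule integrableI_nonneg[OF _ nnw]) (use le in \<open>auto intro: le_less_trans\<close>)
  have "0 \<le> (\<integral>t. g t \<partial>\<sigma>)" using nn by (intro bint_nonneg_AE AE_I2) simp
  then show "(\<ointegral>t. w t * g t) \<le> (\<integral>t. g t \<partial>\<sigma>)"
    using le nn_integral_eq_integral[OF ii nnw] by simp
qed

lemma integrable_w: "integrable cm w" and integral_w: "(\<ointegral>t. w t) \<le> 1"
proof -
  have "integrable \<sigma> (\<lambda>_. 1::real)" by (intro integrable_continuous continuous_intros)
  note * = integrable_w_mult[OF _ _ this]
  show "integrable cm w" using *(1) by simp
  have "(\<ointegral>t. w t * 1) \<le> (\<integral>t. 1 \<partial>\<sigma>)" by (rule *(2)) auto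
  then show "(\<ointegral>t. w t) \<le> 1" using prob_space by simp
qed

lemma integral_pk_sigma:
  assumes z: "cmod z < 1"
  shows "(\<integral>t. pk z t \<partial>\<sigma>) = (\<ointegral>t. pk z t * w t) + (\<integral>t. pk z t \<partial>\<sigma>s)"
proof -
  have ip: "integrable \<sigma> (pk z)" "integrable \<sigma>s (pk z)"
    by (intro pk_integrable[OF z] finite_s finite_measure_axioms; simp)+
  have nn: "0 \<le> pk z t" if "cmod t = 1" for t using pk_pos[OF z that] by simp
  have iw: "integrable cm (\<lambda>t. pk z t * w t)" using integrable_pk_scaleR[OF z integrable_w] by simp
  have nnw: "AE t in cm. 0 \<le> pk z t * w t" using w_nonneg AE_space[of cm] by eventually_elim (use nn in auto)
  have 1: "(\<integral>\<^sup>+t. ennreal (w t) * ennreal (pk z t) \<partial>cm) = ennreal (\<ointegral>t. pk z t * w t)"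
  proof -
    have "(\<integral>\<^sup>+t. ennreal (w t) * ennreal (pk z t) \<partial>cm) = (\<integral>\<^sup>+t. ennreal (pk z t * w t) \<partial>cm)"
      by (rule nn_integral_cong_AE) (use w_nonneg AE_space[of cm] in \<open>eventually_elim, use nn in \<open>simp add: ennreal_mult mult.commute\<close>\<close>)
    then show ?thesis using nn_integral_eq_integral[OF iw nnw] by simp
  qed
  have 2: "(\<integral>\<^sup>+t. ennreal (pk z t) \<partial>\<sigma>) = ennreal (\<integral>t. pk z t \<partial>\<sigma>)" using nn by (intro nn_integral_eq_integral ip AE_I2) simp
  have 3: "(\<integral>\<^sup>+t. ennreal (pk z t) \<partial>\<sigma>s) = ennreal (\<integral>t. pk z t \<partial>\<sigma>s)" using nn by (intro nn_integral_eq_integral ip AE_I2) simp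
  have p: "0 \<le> (\<ointegral>t. pk z t * w t)" "0 \<le> (\<integral>t. pk z t \<partial>\<sigma>s)" "0 \<le> (\<integral>t. pk z t \<partial>\<sigma>)"
    using nn nnw by (auto intro!: bint_nonneg_AE)
  have "ennreal (\<integral>t. pk z t \<partial>\<sigma>) = ennreal (\<ointegral>t. pk z t * w t) + ennreal (\<integral>t. pk z t \<partial>\<sigma>s)"
    using nn_sigma[of "\<lambda>t. ennreal (pk z t)"] unfolding 1 2 3 by simp
  also have "\<dots> = ennreal ((\<ointegral>t. pk z t * w t) + (\<integral>t. pk z t \<partial>\<sigma>s))" using p by simp
  finally show ?thesis using p by (subst (asm) ennreal_inj) auto
qed

lemma pk_w_le_Q0: "cmod z < 1 \<Longrightarrow> (\<ointegral>t. pk z t * w t) \<le> Q 0 z"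
proof -
  assume z: "cmod z < 1"
  have "0 \<le> (\<integral>t. pk z t \<partial>\<sigma>s)" using pk_pos[OF z] by (intro bint_nonneg_AE AE_I2) (simp add: less_imp_le)
  then show ?thesis using integral_pk_sigma[OF z] Q_0[OF z] by linarith
qed

end

lemma lebesgue_points_real:
  fixes g :: "complex \<Rightarrow> real"
  assumes g: "integrable cm g"
  shows "AE x in cm. \<forall>C\<ge>0. ((\<lambda>z. \<ointegral>t. pk z t * g t) \<longlongrightarrow> g x) (at x within ntr C x)"
proof -
  have gc: "integrable cm (\<lambda>t. complex_of_real (g t))" using g by simp
  from lebesgue_points[OF gc] show ?thesis
  proof eventually_elim
    case (elim x)
    show ?case
    proof (intro allI impI)
      fix C :: real assume "C \<ge> 0"
      then have L: "((\<lambda>z. \<ointegral>t. pk z t * \<bar>g t - g x\<bar>) \<longlongrightarrow> 0) (at x within ntr C x)"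
        using elim by (simp flip: of_real_diff)
      have "\<forall>\<^sub>F z in at x within ntr C x. z \<in> ntr C x" by (simp add: eventually_at_filter)
      then have ev: "\<forall>\<^sub>F z in at x within ntr C x. norm ((\<ointegral>t. pk z t * g t) - g x) \<le> norm (\<ointegral>t. pk z t * \<bar>g t - g x\<bar>)"
      proof eventually_elim
        case (elim z)
        then have z: "cmod z < 1" by (simp add: ntr_def)
        have i1: "integrable cm (\<lambda>t. pk z t * g t)" using integrable_pk_scaleR[OF z g] by simp
        have i2: "integrable cm (\<lambda>t. pk z t * g x)" using pk_integrable[OF z cm.finite_measure_axioms] by simp
        have gx: "integrable cm (\<lambda>t. g t - g x)" using g by simp
        have i3: "integrable cm (\<lambda>t. pk z t * \<bar>g t - g x\<bar>)" using integrable_pk_scaleR[OF z integrable_norm[OF gx]] by simp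
        have i4: "integrable cm (\<lambda>t. pk z t * (g t - g x))" using integrable_pk_scaleR[OF z gx] by simp
        have "(\<ointegral>t. pk z t * g t) - g x = (\<ointegral>t. pk z t * (g t - g x))"
          using i1 i2 z by (simp add: right_diff_distrib)
        also have "norm \<dots> \<le> (\<ointegral>t. pk z t * \<bar>g t - g x\<bar>)"
        proof (rule Bochner_Integration.integral_norm_bound_integral[OF i4 i3])
          fix t assume "t \<in> space cm"
          then show "norm (pk z t * (g t - g x)) \<le> pk z t * \<bar>g t - g x\<bar>" using pk_pos[OF z, of t] by (simp add: abs_mult)
        qed
        finally show ?case by simp
      qed
      show "((\<lambda>z. \<ointegral>t. pk z t * g t) \<longlongrightarrow> g x) (at x within ntr C x)"
        by (rule Lim_transform_bound[OF ev L, THEN LIM_zero_cancel])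
    qed
  qed
qed

context opuc_szego begin

lemma Q0_limit: "AE x in cm. \<forall>C\<ge>0. (Q 0 \<longlongrightarrow> w x) (at x within ntr C x)"
proof -
  obtain N where N: "N \<in> null_sets cm" "emeasure \<sigma>s (sphere 0 1 - N) = 0"
    using dec by (auto simp: circle_lebesgue_decomposition_def)
  from lebesgue_points_real[OF integrable_w] singular_poisson[OF finite_s sets_s N]
  show ?thesis
  proof eventually_elim
    case (elim x)
    show ?case
    proof (intro allI impI)
      fix C :: real assume C: "C \<ge> 0"
      have "\<forall>\<^sub>F z in at x within ntr C x. Q 0 z = (\<ointegral>t. pk z t * w t) + (\<integral>t. pk z t \<partial>\<sigma>s)"
        using integral_pk_sigma Q_0 by (auto simp: eventually_at_filter ntr_def intro!: always_eventually)
      moreover have "((\<lambda>z. (\<ointegral>t. pk z t * w t) + (\<integral>t. pk z t \<partial>\<sigma>s)) \<longlongrightarrow> w x + 0) (at x within ntr C x)"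
        using elim C by (intro tendsto_add) auto
      ultimately show "(Q 0 \<longlongrightarrow> w x) (at x within ntr C x)" by (subst tendsto_cong) auto
    qed
  qed
qed

lemma Q0_radial: "AE x in cm. (\<lambda>j. Q 0 (of_real (1 - 1 / (real j + 2)) * x)) \<longlonglongrightarrow> w x"
  using Q0_limit AE_space[of cm]
proof eventually_elim
  case (elim x)
  then have "(Q 0 \<longlongrightarrow> w x) (at x within ntr 1 x)" "cmod x = 1" by auto
  then show ?case using filterlim_compose at_within_ntr_neq_bot(2)[of x 1] by fastforce
qed

end

text \<open>Fatou's lemma for \<open>ln\<close>, which is not bounded below. For \<open>e > 0\<close> the
  function \<open>e * x - ln e - 1 - ln x\<close> is nonnegative, so the lemma applies to it; the
  bound on the first moments keeps the linear term under control, and a suitable \<open>e\<close>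
  tending to \<open>0\<close> gives the sharp constant.\<close>

lemma fatou_log:
  fixes u :: "nat \<Rightarrow> complex \<Rightarrow> real"
  assumes c: "\<And>k. continuous_on (sphere 0 1) (u k)" and pos: "\<And>k t. cmod t = 1 \<Longrightarrow> u k t > 0"
    and lim: "AE t in cm. (\<lambda>k. u k t) \<longlonglongrightarrow> v t" and v: "v \<in> borel_measurable borel_circle"
    and one: "\<And>k. (\<ointegral>t. u k t) \<le> A" and ln: "\<And>k. (\<ointegral>t. ln (u k t)) \<ge> B"
  shows "AE t in cm. v t > 0" "integrable cm (\<lambda>t. ln (v t))" "(\<ointegral>t. ln (v t)) \<ge> B"
proof -
  note v[measurable]
  have um[measurable]: "u k \<in> borel_measurable borel_circle" for k by (rule borel_measurable_circle_continuous[OF c])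
  have cl: "continuous_on (sphere 0 1) (\<lambda>t. ln (u k t))" for k
    using pos by (intro continuous_intros c) (metis less_irrefl mem_sphere_0)
  define G where "G e x = (if x > 0 then ennreal (e * x - ln e - 1 - ln x) else \<top>)" for e x :: real
  have Gm: "G e \<in> borel_measurable borel" for e unfolding G_def by measurable
  have nn: "e * x - ln e - 1 - ln x \<ge> 0" if "e > 0" "x > 0" for e x :: real
    using ln_le_minus_one[of "e * x"] that by (simp add: ln_mult_pos)
  have Glim: "G e x \<le> liminf (\<lambda>k. G e (y k))" if e: "e > 0" and y: "\<And>k. y k > 0" "y \<longlonglongrightarrow> x" for e x and y :: "nat \<Rightarrow> real"
  proof (cases "x > 0")
    case True
    have "(\<lambda>k. ennreal (e * y k - ln e - 1 - ln (y k))) \<longlonglongrightarrow> ennreal (e * x - ln e - 1 - ln x)"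
      using True by (intro tendsto_ennrealI tendsto_intros y) auto
    then show ?thesis using True y(1) by (simp add: G_def lim_imp_Liminf)
  next
    case False
    have "x \<ge> 0" using LIMSEQ_le_const[OF y(2), of 0] y(1) by (meson less_imp_le)
    then have x0: "x = 0" using False by simp
    have "filterlim y (at_right 0) sequentially" using y x0 by (auto simp: filterlim_at less_imp_neq[symmetric] intro!: always_eventually)
    then have "filterlim (\<lambda>k. ln (y k)) at_bot sequentially" by (rule filterlim_compose[OF ln_at_0])
    then have "filterlim (\<lambda>k. - ln (y k)) at_top sequentially" by (simp add: filterlim_uminus_at_top)
    then have "filterlim (\<lambda>k. (e * y k - ln e - 1) + - ln (y k)) at_top sequentially"
      by (rule filterlim_tendsto_add_at_top[where c="e * x - ln e - 1", rotated]) (intro tendsto_intros y)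
    then have "(\<lambda>k. ennreal (e * y k - ln e - 1 - ln (y k))) \<longlonglongrightarrow> \<top>"
      by (simp add: ennreal_tendsto_top_eq_at_top)
    then have "liminf (\<lambda>k. G e (y k)) = \<top>" using y(1) by (simp add: G_def lim_imp_Liminf)
    then show ?thesis by simp
  qed
  have main: "(\<integral>\<^sup>+t. G e (v t) \<partial>cm) \<le> ennreal (e * A - ln e - 1 - B)" if e: "e > 0" for e
  proof -
    have "(\<integral>\<^sup>+t. G e (v t) \<partial>cm) \<le> (\<integral>\<^sup>+t. liminf (\<lambda>k. G e (u k t)) \<partial>cm)"
    proof (rule nn_integral_mono_AE, use lim AE_space[of cm] in eventually_elim)
      case (elim t)
      then show ?case by (intro Glim[OF e] pos) auto
    qed
    also have "\<dots> \<le> liminf (\<lambda>k. \<integral>\<^sup>+t. G e (u k t) \<partial>cm)"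
      by (rule nn_integral_liminf) (use um in \<open>auto intro: measurable_compose[OF _ Gm]\<close>)
    also have "\<dots> \<le> ennreal (e * A - ln e - 1 - B)"
    proof (rule Liminf_le)
      show "\<forall>\<^sub>F k in sequentially. (\<integral>\<^sup>+t. G e (u k t) \<partial>cm) \<le> ennreal (e * A - ln e - 1 - B)"
      proof (intro always_eventually allI)
        fix k
        have i: "integrable cm (\<lambda>t. e * u k t - ln e - 1 - ln (u k t))"
          by (intro integrable_cm_continuous continuous_intros c cl)
        have "(\<integral>\<^sup>+t. G e (u k t) \<partial>cm) = (\<integral>\<^sup>+t. ennreal (e * u k t - ln e - 1 - ln (u k t)) \<partial>cm)"
          using pos by (intro nn_integral_cong) (simp add: G_def)
        also have "\<dots> = ennreal (\<ointegral>t. e * u k t - ln e - 1 - ln (u k t))"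
          using nn[OF e] pos by (intro nn_integral_eq_integral i AE_I2) simp
        also have "(\<ointegral>t. e * u k t - ln e - 1 - ln (u k t)) = e * (\<ointegral>t. u k t) - ln e - 1 - (\<ointegral>t. ln (u k t))"
          using integrable_cm_continuous[OF c[of k]] integrable_cm_continuous[OF cl[of k]] cm.prob_space by simp
        also have "ennreal \<dots> \<le> ennreal (e * A - ln e - 1 - B)"
          using one[of k] ln[of k] e by (intro ennreal_leI diff_mono mult_left_mono) auto
        finally show "(\<integral>\<^sup>+t. G e (u k t) \<partial>cm) \<le> ennreal (e * A - ln e - 1 - B)" .
      qed
    qed simp
    finally show ?thesis .
  qed
  have "(\<integral>\<^sup>+t. G 1 (v t) \<partial>cm) \<noteq> \<infinity>" using main[of 1] by (auto simp: top_unique)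
  then have "AE t in cm. G 1 (v t) \<noteq> \<infinity>"
  proof (rule nn_integral_PInf_AE[rotated])
    have [measurable]: "(\<lambda>x. G 1 (v x)) \<in> borel_measurable borel_circle" by (rule measurable_compose[OF v Gm])
    show "(\<lambda>x. G 1 (v x)) \<in> borel_measurable cm" by measurable
  qed
  then show vp: "AE t in cm. v t > 0" by eventually_elim (auto simp: G_def split: if_splits)
  have iv: "integrable cm v" and v1: "(\<ointegral>t. v t) \<le> A"
  proof -
    have up: "AE x in cm. 0 \<le> u k x" for k using pos by (intro AE_I2) (simp add: less_imp_le)
    have ev: "\<forall>\<^sub>F k in sequentially. integral\<^sup>L cm (u k) \<le> A" using one by simp
    have vm: "v \<in> borel_measurable cm" by measurable
    show "integrable cm v" "(\<ointegral>t. v t) \<le> A" using fatou_bound[OF integrable_cm_continuous[OF c] up lim vm ev] by auto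
  qed
  have mainI: "integrable cm (\<lambda>t. e * v t - ln e - 1 - ln (v t)) \<and> (\<ointegral>t. e * v t - ln e - 1 - ln (v t)) \<le> e * A - ln e - 1 - B" if e: "e > 0" for e
  proof -
    have n: "AE t in cm. e * v t - ln e - 1 - ln (v t) \<ge> 0" using vp by eventually_elim (use nn[OF e] in auto)
    have eq: "(\<integral>\<^sup>+t. ennreal (e * v t - ln e - 1 - ln (v t)) \<partial>cm) = (\<integral>\<^sup>+t. G e (v t) \<partial>cm)"
    proof (rule nn_integral_cong_AE, use vp in eventually_elim)
      case (elim t) then show ?case by (simp add: G_def)
    qed
    have i: "integrable cm (\<lambda>t. e * v t - ln e - 1 - ln (v t))"
      by (rule integrableI_nonneg[OF _ n]) (use main[OF e] eq in \<open>auto intro: le_less_trans\<close>)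
    have nB: "e * A - ln e - 1 - B \<ge> 0"
    proof -
      have "0 \<le> (\<ointegral>t. e * u 0 t - ln e - 1 - ln (u 0 t))" using nn[OF e] pos by (intro bint_nonneg_AE AE_I2) simp
      also have "\<dots> = e * (\<ointegral>t. u 0 t) - ln e - 1 - (\<ointegral>t. ln (u 0 t))"
        using integrable_cm_continuous[OF c[of 0]] integrable_cm_continuous[OF cl[of 0]] cm.prob_space by simp
      also have "\<dots> \<le> e * A - ln e - 1 - B" using one[of 0] ln[of 0] e by (intro diff_mono mult_left_mono) auto
      finally show ?thesis .
    qed
    have "ennreal (\<ointegral>t. e * v t - ln e - 1 - ln (v t)) \<le> ennreal (e * A - ln e - 1 - B)"
      using nn_integral_eq_integral[OF i n] main[OF e] eq by simp
    then show ?thesis using i nB by (subst (asm) ennreal_le_iff) auto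
  qed
  have a: "integrable cm (\<lambda>t. v t - 1 - ln (v t))" using mainI[of 1] by simp
  have "integrable cm (\<lambda>t. (v t - 1) - (v t - 1 - ln (v t)))"
    by (rule Bochner_Integration.integrable_diff[OF _ a]) (use iv in simp)
  then show il: "integrable cm (\<lambda>t. ln (v t))" by simp
  have le: "B - e * (A - (\<ointegral>t. v t)) \<le> (\<ointegral>t. ln (v t))" if e: "e > 0" for e
  proof -
    have "(\<ointegral>t. e * v t - ln e - 1 - ln (v t)) = e * (\<ointegral>t. v t) - ln e - 1 - (\<ointegral>t. ln (v t))"
      using iv il cm.prob_space by simp
    then show ?thesis using mainI[OF e] by (simp add: algebra_simps)
  qed
  have "((\<lambda>e. B - e * (A - (\<ointegral>t. v t))) \<longlongrightarrow> B - 0 * (A - (\<ointegral>t. v t))) (at_right 0)"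
    by (intro tendsto_intros)
  then have "B - 0 * (A - (\<ointegral>t. v t)) \<le> (\<ointegral>t. ln (v t))"
    by (rule tendsto_upperbound) (use le in \<open>auto simp: eventually_at_filter intro!: always_eventually\<close>)
  then show "(\<ointegral>t. ln (v t)) \<ge> B" by simp
qed

context opuc_szego begin

text \<open>The nontrivial half of Szego's theorem. The Poisson integrals of \<open>\<sigma>\<close> on
  circles have logarithmic mean at least \<open>ln Cinf\<close>, and they converge to
  \<open>w\<close> almost everywhere on the boundary.\<close>

theorem szego: "AE t in cm. w t > 0" "integrable cm (\<lambda>t. ln (w t))" "(\<ointegral>t. ln (w t)) \<ge> ln Cinf"
proof -
  let ?u = "\<lambda>j t. Q 0 (of_real (1 - 1 / (real j + 2)) * t)"
  have c: "continuous_on (sphere 0 1) (?u j)" for j by (rule Q0_dil_cont) (rule rad_bounds)+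
  have p: "?u j t > 0" if "cmod t = 1" for j t by (intro Q_pos dil_less rad_bounds that)
  have 1: "(\<ointegral>t. ?u j t) \<le> 1" for j using integral_Q0[OF rad_bounds(1,2)[of j]] by simp
  have 2: "(\<ointegral>t. ln (?u j t)) \<ge> ln Cinf" for j by (rule integral_ln_Q0_ge[OF rad_bounds(3,2)])
  show "AE t in cm. w t > 0" "integrable cm (\<lambda>t. ln (w t))" "(\<ointegral>t. ln (w t)) \<ge> ln Cinf"
    using fatou_log[OF c p Q0_radial wm 1 2] by auto
qed

end

section \<open>The Szego function as a boundary limit\<close>

lemma hardy2_mult:
  assumes f: "hardy2 K f" and p: "p holomorphic_on UNIV" and z: "cmod z < 1"
  shows "(\<ointegral>t. pk z t *\<^sub>R (p t * bdv f t)) = p z * f z" "integrable cm (\<lambda>t. p t * bdv f t)"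
proof -
  have hol: "f holomorphic_on ball 0 1" and K: "\<And>s. 0 \<le> s \<Longrightarrow> s < 1 \<Longrightarrow> (\<ointegral>t. (cmod (f (of_real s * t)))^2) \<le> K" using f by (auto simp: hardy2_def)
  have cp: "continuous_on UNIV p" by (rule holomorphic_on_imp_continuous_on[OF p])
  have "bounded (p ` cball 0 1)" by (intro compact_imp_bounded compact_continuous_image continuous_on_subset[OF cp]) auto
  then obtain B where B: "B > 0" "\<And>t. cmod t \<le> 1 \<Longrightarrow> cmod (p t) \<le> B" unfolding bounded_pos by auto
  let ?g = "\<lambda>z. p z * f z"
  have gh: "?g holomorphic_on ball 0 1" by (intro holomorphic_intros hol holomorphic_on_subset[OF p]) auto
  have "(\<ointegral>t. (cmod (?g (of_real s * t)))^2) \<le> B^2 * K" if s: "0 \<le> s" "s < 1" for s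
  proof -
    have "(\<ointegral>t. (cmod (?g (of_real s * t)))^2) \<le> (\<ointegral>t. B\<^sup>2 * (cmod (f (of_real s * t)))^2)"
    proof (rule integral_mono)
      show "integrable cm (\<lambda>t. (cmod (?g (of_real s * t)))^2)" by (intro integrable_cm_continuous continuous_intros dilation_continuous[OF gh s])
      show "integrable cm (\<lambda>t. B\<^sup>2 * (cmod (f (of_real s * t)))^2)" by (intro integrable_cm_continuous continuous_intros dilation_continuous[OF hol s])
      fix t assume "t \<in> space cm"
      then have "cmod (of_real s * t) \<le> 1" using dil_less[OF s, of t] by simp
      then have "cmod (p (of_real s * t)) \<le> B" by (rule B(2))
      then show "(cmod (?g (of_real s * t)))^2 \<le> B^2 * (cmod (f (of_real s * t)))^2"
        by (simp only: norm_mult power_mult_distrib mult_right_mono power_mono norm_ge_zero zero_le_power2)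
    qed
    also have "\<dots> = B^2 * (\<ointegral>t. (cmod (f (of_real s * t)))^2)" by (rule integral_mult_right_zero)
    also have "\<dots> \<le> B^2 * K" by (intro mult_left_mono K s) simp
    finally show ?thesis .
  qed
  then have g: "hardy2 (B^2 * K) ?g" using gh by (auto simp: hardy2_def)
  have [measurable]: "bdv f \<in> borel_measurable borel_circle" "bdv ?g \<in> borel_measurable borel_circle"
    by (rule bdv_measurable[OF hol], rule bdv_measurable[OF gh])
  have [measurable]: "p \<in> borel_measurable borel_circle"
    by (rule borel_measurable_circle_continuous[OF continuous_on_subset[OF cp]]) simp
  have ae: "AE t in cm. bdv ?g t = p t * bdv f t" using bdv_radial[OF g] bdv_radial[OF f] AE_space[of cm]
  proof eventually_elim
    case (elim t)
    have r: "(\<lambda>j. of_real (1 - 1 / (real j + 2)) * t) \<longlonglongrightarrow> t"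
      using at_within_ntr_neq_bot(2)[of t 1] elim(3) by (auto simp: filterlim_at)
    have "(\<lambda>j. p (of_real (1 - 1 / (real j + 2)) * t)) \<longlonglongrightarrow> p t"
      using continuous_on_tendsto_compose[OF cp r] by simp
    then have "(\<lambda>j. ?g (of_real (1 - 1 / (real j + 2)) * t)) \<longlonglongrightarrow> p t * bdv f t"
      using elim(2) by (intro tendsto_mult)
    then show ?case using LIMSEQ_unique elim(1) by blast
  qed
  have "(\<ointegral>t. pk z t *\<^sub>R (p t * bdv f t)) = (\<ointegral>t. pk z t *\<^sub>R bdv ?g t)"
  proof (rule integral_cong_AE)
    show "AE t in cm. pk z t *\<^sub>R (p t * bdv f t) = pk z t *\<^sub>R bdv ?g t" using ae by eventually_elim simp
  qed measurable
  also have "\<dots> = p z * f z" by (rule hardy2_poisson(4)[OF g z])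
  finally show "(\<ointegral>t. pk z t *\<^sub>R (p t * bdv f t)) = p z * f z" .
  show "integrable cm (\<lambda>t. p t * bdv f t)"
    using hardy2_poisson(1)[OF g] by (subst integrable_cong_AE[OF _ _ AE_symmetric[OF ae]]) auto
qed

text \<open>Holomorphy under the integral sign, through an explicit power series in \<open>z\<close>.\<close>

lemma schwarz_integral_holomorphic:
  fixes g :: "complex \<Rightarrow> real"
  assumes g: "integrable cm g"
  shows "(\<lambda>z. \<ointegral>s. (s + z) / (s - z) * complex_of_real (g s)) holomorphic_on ball 0 1"
proof -
  have gm[measurable]: "g \<in> borel_measurable borel_circle" using borel_measurable_integrable[OF g] by simp
  define a where "a k = (if k = 0 then 1 else 2) * (\<ointegral>s. cnj (s ^ k) * complex_of_real (g s))" for k :: nat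
  have ck: "integrable cm (\<lambda>s. cnj (s ^ k) * complex_of_real (g s))" for k
  proof (rule bint_bound[OF integrable_norm[OF g]])
    have "(\<lambda>s. cnj (s ^ k)) \<in> borel_measurable borel_circle"
      by (intro borel_measurable_circle_continuous continuous_intros)
    then show "(\<lambda>s. cnj (s ^ k) * complex_of_real (g s)) \<in> borel_measurable cm" by measurable
    show "AE x in cm. norm (cnj (x ^ k) * complex_of_real (g x)) \<le> norm (norm (g x))"
      by (rule AE_I2) (simp add: norm_mult norm_power)
  qed
  have "psum a (\<lambda>z. \<ointegral>s. (s + z) / (s - z) * complex_of_real (g s))" unfolding psum_def
  proof (intro allI impI)
    fix z :: complex assume z: "cmod z < 1"
    let ?u = "\<lambda>k s. ((if k = 0 then 1 else 2) * z ^ k) * (cnj (s ^ k) * complex_of_real (g s))"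
    have nu: "norm (?u k s) \<le> 2 * (cmod z ^ k * \<bar>g s\<bar>)" if "cmod s = 1" for k s
      using that by (simp add: norm_mult norm_power)
    have "(\<lambda>k. \<ointegral>s. ?u k s) sums (\<ointegral>s. (\<Sum>k. ?u k s))"
    proof (rule sums_integral)
      show "integrable cm (?u k)" for k by (intro integrable_mult_right ck)
      show "AE s in cm. summable (\<lambda>k. norm (?u k s))"
      proof (rule AE_I2)
        fix s assume "s \<in> space cm"
        then have x: "cmod s = 1" by simp
        show "summable (\<lambda>k. norm (?u k s))"
          by (rule summable_comparison_test'[of "\<lambda>k. 2 * (cmod z ^ k * \<bar>g s\<bar>)" 0])
             (use nu[OF x] z in \<open>auto intro!: summable_mult summable_mult2 summable_geometric\<close>)
      qed
      show "summable (\<lambda>k. \<ointegral>s. norm (?u k s))"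
      proof (rule summable_comparison_test'[of "\<lambda>k. 2 * (cmod z ^ k * (\<ointegral>s. \<bar>g s\<bar>))" 0])
        show "summable (\<lambda>k. 2 * (cmod z ^ k * (\<ointegral>s. \<bar>g s\<bar>)))" using z by (intro summable_mult summable_mult2 summable_geometric) auto
        fix k
        have "(\<ointegral>s. norm (?u k s)) \<le> (\<ointegral>s. 2 * (cmod z ^ k * \<bar>g s\<bar>))"
          using g nu by (intro integral_mono integrable_norm integrable_mult_right ck) auto
        also have "\<dots> = 2 * (cmod z ^ k * (\<ointegral>s. \<bar>g s\<bar>))" by (simp only: integral_mult_right_zero)
        finally show "norm (\<ointegral>s. norm (?u k s)) \<le> 2 * (cmod z ^ k * (\<ointegral>s. \<bar>g s\<bar>))" by simp
      qed
    qed
    moreover have "(\<ointegral>s. ?u k s) = a k * z ^ k" for k by (subst integral_mult_right_zero) (simp add: a_def)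
    moreover have "(\<ointegral>s. (\<Sum>k. ?u k s)) = (\<ointegral>s. (s + z) / (s - z) * complex_of_real (g s))"
    proof (rule bint_cong)
      fix s assume "s \<in> space cm"
      then have x: "cmod s = 1" by simp
      have ne: "1 - z * cnj s \<noteq> 0" by (rule one_minus_neq_0[OF z x])
      have "cmod (z * cnj s) < 1" using z x by (simp add: norm_mult)
      then have "(\<lambda>k. (z * cnj s) ^ k) sums (1 / (1 - z * cnj s))" by (rule geometric_sums)
      then have "(\<lambda>k. 2 * (z * cnj s) ^ k) sums (2 * (1 / (1 - z * cnj s)))" by (rule sums_mult)
      moreover have "(\<lambda>k::nat. if k = 0 then 1 else (0::complex)) sums 1" using sums_single[of 0 "\<lambda>_. 1::complex"] by simp
      ultimately have "(\<lambda>k. 2 * (z * cnj s) ^ k - (if k = 0 then 1 else 0)) sums (2 * (1 / (1 - z * cnj s)) - 1)" by (rule sums_diff)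
      moreover have "2 * (z * cnj s) ^ k - (if k = 0 then 1 else 0) = ((if k = 0 then 1 else 2) * z ^ k) * cnj (s ^ k)" for k
        by (simp add: power_mult_distrib)
      ultimately have "(\<lambda>k. ((if k = 0 then 1 else 2) * z ^ k) * cnj (s ^ k)) sums (2 * (1 / (1 - z * cnj s)) - 1)" by (simp only:)
      moreover have "2 * (1 / (1 - z * cnj s)) - 1 = (s + z) / (s - z)"
      proof -
        have "s - z = s * (1 - z * cnj s)" "s + z = s * (1 + z * cnj s)" using circle_cnj_mult[OF x] by (simp_all add: algebra_simps)
        moreover have "s \<noteq> 0" using x by auto
        ultimately have "(s + z) / (s - z) = (1 + z * cnj s) / (1 - z * cnj s)" by simp
        then show ?thesis using ne by (simp add: field_simps)
      qed
      ultimately have "(\<lambda>k. ((if k = 0 then 1 else 2) * z ^ k) * cnj (s ^ k)) sums ((s + z) / (s - z))" by metis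
      from sums_mult2[OF this, of "complex_of_real (g s)"]
      show "(\<Sum>k. ?u k s) = (s + z) / (s - z) * complex_of_real (g s)" by (simp only: sums_iff mult.assoc)
    qed simp
    ultimately show "(\<lambda>k. a k * z ^ k) sums (\<ointegral>s. (s + z) / (s - z) * complex_of_real (g s))" by (simp only:)
  qed
  then show ?thesis by (rule psum_hol)
qed

lemma integrable_schwarz:
  assumes z: "cmod z < 1" and g: "integrable cm (g :: complex \<Rightarrow> real)"
  shows "integrable cm (\<lambda>u. (u + z) / (u - z) * complex_of_real (g u))"
proof (rule bint_bound)
  have gm[measurable]: "g \<in> borel_measurable borel_circle" using borel_measurable_integrable[OF g] by simp
  show "integrable cm (\<lambda>u. 2 / (1 - cmod z) * \<bar>g u\<bar>)" using g by simp
  have "(\<lambda>u. (u + z) / (u - z)) \<in> borel_measurable borel_circle"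
    using circle_minus_pos[OF _ z] by (intro borel_measurable_circle_continuous continuous_intros) auto
  then show "(\<lambda>u. (u + z) / (u - z) * complex_of_real (g u)) \<in> borel_measurable cm" by measurable
  show "AE u in cm. norm ((u + z) / (u - z) * complex_of_real (g u)) \<le> norm (2 / (1 - cmod z) * \<bar>g u\<bar>)"
  proof (rule AE_I2)
    fix u assume "u \<in> space cm"
    then have x: "cmod u = 1" by simp
    have "cmod (u + z) \<le> 2" using norm_triangle_ineq[of u z] x z by simp
    then have "cmod ((u + z) / (u - z)) \<le> 2 / (1 - cmod z)"
      unfolding norm_divide using circle_minus_ge[OF x, of z] z by (intro frac_le) auto
    then have "cmod ((u + z) / (u - z)) * \<bar>g u\<bar> \<le> 2 / (1 - cmod z) * \<bar>g u\<bar>" by (intro mult_right_mono) auto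
    then show "norm ((u + z) / (u - z) * complex_of_real (g u)) \<le> norm (2 / (1 - cmod z) * \<bar>g u\<bar>)"
    proof -
      have "norm (2 / (1 - cmod z) * \<bar>g u\<bar>) = 2 / (1 - cmod z) * \<bar>g u\<bar>" using z by simp
      then show ?thesis using \<open>cmod ((u + z) / (u - z)) * \<bar>g u\<bar> \<le> _\<close> by (simp only: norm_mult norm_of_real)
    qed
  qed
qed

context opuc_szego begin

definition "D z = szego_function w z"

lemma D_hol: "D holomorphic_on ball 0 1"
proof -
  have "(\<lambda>z. exp (1 / 2 * (\<ointegral>x. (x + z) / (x - z) * complex_of_real (ln (w x))))) holomorphic_on ball 0 1"
    by (intro holomorphic_intros schwarz_integral_holomorphic szego)
  then show ?thesis by (simp add: D_def[abs_def] szego_function_def)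
qed

lemma D_nz [simp]: "D z \<noteq> 0" by (simp add: D_def szego_function_def)

lemma D_sq:
  assumes z: "cmod z < 1" shows "(cmod (D z))^2 = exp (\<ointegral>t. pk z t * ln (w t))"
proof -
  have "Re (\<ointegral>x. (x + z) / (x - z) * complex_of_real (ln (w x))) = (\<ointegral>x. Re ((x + z) / (x - z) * complex_of_real (ln (w x))))"
    by (rule integral_Re[OF integrable_schwarz[OF z szego(2)], symmetric])
  also have "\<dots> = (\<ointegral>t. pk z t * ln (w t))"
  proof (intro bint_cong refl)
    fix x assume "x \<in> space cm"
    then show "Re ((x + z) / (x - z) * complex_of_real (ln (w x))) = pk z x * ln (w x)"
    proof -
      have "Re (u * complex_of_real b) = Re u * b" for u b by simp
      then show ?thesis using pk_schwarz(2)[OF z, of x] \<open>x \<in> space cm\<close> by (simp only: space_cm mem_sphere_0)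
    qed
  qed
  finally have "cmod (D z) = exp (1/2 * (\<ointegral>t. pk z t * ln (w t)))" by (simp add: D_def szego_function_def)
  then show ?thesis by (simp add: power2_eq_square flip: exp_add)
qed

text \<open>Jensen's inequality, by the tangent to the exponential function at the mean \<open>s\<close> of
  \<open>ln w\<close>.\<close>

lemma D_sq_le_pk_w:
  assumes z: "cmod z < 1" shows "(cmod (D z))^2 \<le> (\<ointegral>t. pk z t * w t)"
proof -
  define s where "s = (\<ointegral>t. pk z t * ln (w t))"
  have i: "integrable cm (\<lambda>t. pk z t * ln (w t))" "integrable cm (\<lambda>t. pk z t * w t)" "integrable cm (pk z)"
    using integrable_pk_scaleR[OF z szego(2)] integrable_pk_scaleR[OF z integrable_w] pk_integrable[OF z cm.finite_measure_axioms] by auto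
  have "exp s = (\<ointegral>t. exp s * ((1 - s) * pk z t + pk z t * ln (w t)))" using i z by (simp add: s_def)
  also have "\<dots> \<le> (\<ointegral>t. pk z t * w t)"
  proof (rule integral_mono_AE)
    show "AE t in cm. exp s * ((1 - s) * pk z t + pk z t * ln (w t)) \<le> pk z t * w t" using szego(1) AE_space[of cm]
    proof eventually_elim
      case (elim t)
      have p: "pk z t > 0" using pk_pos[OF z] elim(2) by simp
      have "1 + (ln (w t) - s) \<le> exp (ln (w t) - s)" by (rule exp_ge_add_one_self)
      also have "\<dots> = w t / exp s" using elim(1) by (simp add: exp_diff)
      finally have "exp s * (1 + (ln (w t) - s)) \<le> w t" by (simp add: field_simps)
      then have "pk z t * (exp s * (1 + (ln (w t) - s))) \<le> pk z t * w t" using p by (intro mult_left_mono) auto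
      then show ?case by (simp add: algebra_simps)
    qed
  qed (use i in auto)
  finally show ?thesis unfolding D_sq[OF z] s_def .
qed

lemma D_hardy: "hardy2 1 D" unfolding hardy2_def
proof (intro conjI allI impI D_hol)
  fix s :: real assume s: "0 \<le> s \<and> s < 1"
  then have s': "0 \<le> s" "s < 1" by auto
  have "(\<ointegral>t. (cmod (D (of_real s * t)))^2) \<le> (\<ointegral>t. Q 0 (of_real s * t))"
    using order_trans[OF D_sq_le_pk_w pk_w_le_Q0] dil_less[OF s']
    by (intro integral_mono integrable_cm_continuous continuous_intros dilation_continuous[OF D_hol s'] Q0_dil_cont[OF s']) auto
  then show "(\<ointegral>t. (cmod (D (of_real s * t)))^2) \<le> 1" by (simp add: integral_Q0[OF s'])
qed

definition "d = bdv D"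

lemma d_meas [measurable]: "d \<in> borel_measurable borel_circle" unfolding d_def by (rule bdv_measurable[OF D_hol])

lemma d_nontangential: "AE x in cm. \<forall>C\<ge>0. (D \<longlongrightarrow> d x) (at x within ntr C x)"
  unfolding d_def by (rule fatou_nontangential[OF D_hardy])

text \<open>The exponent of \<open>\<bar>D\<bar>\<^sup>2\<close> is the Poisson integral of \<open>ln
  w\<close>, which converges to \<open>ln w\<close> at Lebesgue points.\<close>

lemma d_sq: "AE x in cm. (cmod (d x))^2 = w x" using d_nontangential lebesgue_points_real[OF szego(2)] szego(1) AE_space[of cm]
proof eventually_elim
  case (elim x)
  let ?F = "at x within ntr 1 x"
  have nb: "?F \<noteq> bot" using at_within_ntr_neq_bot(1)[of x 1] elim by simp
  have "((\<lambda>z. (cmod (D z))^2) \<longlongrightarrow> (cmod (d x))^2) ?F" using elim(1) by (intro tendsto_intros) auto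
  moreover have "((\<lambda>z. exp (\<ointegral>t. pk z t * ln (w t))) \<longlongrightarrow> exp (ln (w x))) ?F" using elim(2) by (intro tendsto_intros) auto
  then have "((\<lambda>z. (cmod (D z))^2) \<longlongrightarrow> exp (ln (w x))) ?F"
  proof (subst tendsto_cong)
    show "\<forall>\<^sub>F z in ?F. (cmod (D z))^2 = exp (\<ointegral>t. pk z t * ln (w t))"
      using D_sq by (auto simp: eventually_at_filter ntr_def intro!: always_eventually)
  qed
  ultimately have "(cmod (d x))^2 = exp (ln (w x))" by (rule tendsto_unique[OF nb])
  then show ?case using elim(3) by simp
qed

lemma d_nz: "AE x in cm. d x \<noteq> 0" using d_sq szego(1) by eventually_elim auto

lemma D_0: "D 0 = of_real (cmod (D 0))" "cmod (D 0) \<ge> sqrt Cinf"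
proof -
  have "(\<ointegral>x. (x + 0) / (x - 0) * complex_of_real (ln (w x))) = (\<ointegral>x. complex_of_real (ln (w x)))"
    by (intro bint_cong refl) auto
  also have "\<dots> = of_real (\<ointegral>x. ln (w x))" by (rule integral_complex_of_real)
  finally have "1 / 2 * (\<ointegral>x. (x + 0) / (x - 0) * complex_of_real (ln (w x))) = of_real (1/2 * (\<ointegral>x. ln (w x)))" by simp
  then have D0: "D 0 = of_real (exp (1/2 * (\<ointegral>x. ln (w x))))"
    unfolding D_def szego_function_def by (simp only: exp_of_real)
  then have c: "cmod (D 0) = exp (1/2 * (\<ointegral>x. ln (w x)))" by simp
  show "D 0 = of_real (cmod (D 0))" unfolding c by (rule D0)
  have "exp (ln Cinf) \<le> exp (\<ointegral>x. ln (w x))" using szego(3) by simp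
  also have "\<dots> = (cmod (D 0))^2" unfolding c by (simp add: power2_eq_square flip: exp_add)
  finally show "cmod (D 0) \<ge> sqrt Cinf" using Cinf_pos by (simp add: real_le_rsqrt real_sqrt_le_iff real_le_lsqrt)
qed

definition "ps n z = Ps n z / of_real (sqrt (Cn n))"
definition "ph n z = Ph n z / of_real (sqrt (Cn n))"
definition "h n x = ps n x * d x - 1"

lemma sqrtC: "of_real (sqrt (Cn n)) \<noteq> (0::complex)" using Cn_pos[of n] by simp

lemma ps_entire: "ps n holomorphic_on UNIV" and ph_entire: "ph n holomorphic_on UNIV"
  unfolding ps_def[abs_def] ph_def[abs_def] using sqrtC by (intro holomorphic_intros holomorphic_Ps holomorphic_Ph; simp)+

lemma ps_cont: "continuous_on S (ps n)" and ph_cont: "continuous_on S (ph n)"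
  using holomorphic_on_imp_continuous_on[OF ps_entire] holomorphic_on_imp_continuous_on[OF ph_entire] continuous_on_subset by blast+

lemma ps_meas [measurable]: "ps n \<in> borel_measurable borel_circle" and ph_meas [measurable]: "ph n \<in> borel_measurable borel_circle"
  by (intro borel_measurable_circle_continuous ps_cont ph_cont)+

lemma h_meas [measurable]: "h n \<in> borel_measurable borel_circle" unfolding h_def[abs_def] by measurable

lemma ps_norm: "(\<integral>x. (cmod (ps n x))^2 \<partial>\<sigma>) = 1"
proof -
  have "(\<integral>x. (cmod (ps n x))^2 \<partial>\<sigma>) = (\<integral>x. (cmod (Ps n x))^2 / Cn n \<partial>\<sigma>)"
    using Cn_pos[of n] by (intro bint_cong refl) (simp add: ps_def norm_divide power_divide)
  then show ?thesis using Cn_pos[of n] by (simp add: Ps_norm)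
qed

text \<open>Expand the square: the first term is at most the \<open>\<sigma>\<close>-norm of \<open>ps
  n\<close>, and the mean of \<open>ps n * d\<close> is its value \<open>ps n 0 * D 0\<close> at the
  centre, where \<open>ps n 0 = 1 / sqrt (Cn n)\<close> and \<open>D 0 \<ge> sqrt Cinf\<close>.\<close>

lemma h_L2: "integrable cm (\<lambda>x. (cmod (h n x))^2)" "(\<ointegral>x. (cmod (h n x))^2) \<le> 2 - 2 * sqrt (Cinf / Cn n)"
proof -
  have i0: "integrable \<sigma> (\<lambda>x. (cmod (ps n x))^2)" by (intro integrable_continuous continuous_intros ps_cont)
  have iw: "integrable cm (\<lambda>x. w x * (cmod (ps n x))^2)" "(\<ointegral>x. w x * (cmod (ps n x))^2) \<le> 1"
    using integrable_w_mult[OF _ _ i0] by (auto simp: ps_norm)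
  have pd: "integrable cm (\<lambda>x. ps n x * d x)" unfolding d_def by (rule hardy2_mult(2)[OF D_hardy ps_entire, of 0]) simp
  have pd0: "(\<ointegral>x. ps n x * d x) = ps n 0 * D 0"
  proof -
    have "(\<ointegral>x. ps n x * d x) = (\<ointegral>x. pk 0 x *\<^sub>R (ps n x * d x))"
      by (intro bint_cong refl) (simp add: pk_0)
    also have "\<dots> = ps n 0 * D 0" unfolding d_def by (rule hardy2_mult(1)[OF D_hardy ps_entire]) simp
    finally show ?thesis .
  qed
  have eq: "AE x in cm. (cmod (h n x))^2 = w x * (cmod (ps n x))^2 - 2 * Re (ps n x * d x) + 1" using d_sq
  proof eventually_elim
    case (elim x)
    have "(cmod (h n x))^2 = (cmod (ps n x * d x))^2 - 2 * Re (ps n x * d x) + 1"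
      unfolding h_def cmod_power2 by (simp add: power2_eq_square algebra_simps)
    then show ?case using elim by (simp add: norm_mult power_mult_distrib mult.commute)
  qed
  have ir: "integrable cm (\<lambda>x. w x * (cmod (ps n x))^2 - 2 * Re (ps n x * d x) + 1)"
    using iw pd by (intro Bochner_Integration.integrable_add Bochner_Integration.integrable_diff integrable_mult_right integrable_Re) auto
  show "integrable cm (\<lambda>x. (cmod (h n x))^2)" by (subst integrable_cong_AE[OF _ _ eq]) (use ir in auto)
  have "(\<ointegral>x. (cmod (h n x))^2) = (\<ointegral>x. w x * (cmod (ps n x))^2 - 2 * Re (ps n x * d x) + 1)"
    by (rule integral_cong_AE[OF _ _ eq]) auto
  also have "\<dots> = (\<ointegral>x. w x * (cmod (ps n x))^2) - 2 * (\<ointegral>x. Re (ps n x * d x)) + 1"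
  proof -
    have "(\<ointegral>x. a x - 2 * R x + 1) = (\<ointegral>x. a x) - 2 * (\<ointegral>x. R x) + 1"
      if "integrable cm a" "integrable cm R" for a R :: "complex \<Rightarrow> real" using that cm.prob_space by simp
    from this[OF iw(1) integrable_Re[OF pd]] show ?thesis .
  qed
  also have "(\<ointegral>x. Re (ps n x * d x)) = Re (ps n 0 * D 0)" using integral_Re[OF pd] pd0 by simp
  also have "Re (ps n 0 * D 0) = cmod (D 0) / sqrt (Cn n)" by (subst D_0(1)) (simp add: ps_def Ps_at_0)
  finally have "(\<ointegral>x. (cmod (h n x))^2) \<le> 2 - 2 * (cmod (D 0) / sqrt (Cn n))" using iw(2) by simp
  moreover have "sqrt (Cinf / Cn n) \<le> cmod (D 0) / sqrt (Cn n)" unfolding real_sqrt_divide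
    using D_0(2) Cn_pos[of n] by (intro divide_right_mono) auto
  ultimately show "(\<ointegral>x. (cmod (h n x))^2) \<le> 2 - 2 * sqrt (Cinf / Cn n)" by simp
qed

lemma h_L2_lim: "(\<lambda>n. \<ointegral>x. (cmod (h n x))^2) \<longlonglongrightarrow> 0"
proof (rule tendsto_sandwich[where f="\<lambda>_. 0" and h="\<lambda>n. 2 - 2 * sqrt (Cinf / Cn n)"])
  have "(\<lambda>n. 2 - 2 * sqrt (Cinf / Cn n)) \<longlonglongrightarrow> 2 - 2 * sqrt (Cinf / Cinf)"
    using Cinf_pos by (intro tendsto_intros Cn_lim) auto
  then show "(\<lambda>n. 2 - 2 * sqrt (Cinf / Cn n)) \<longlonglongrightarrow> 0" using Cinf_pos by simp
qed (use h_L2 in auto)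

lemma h_integrable: "integrable cm (h n)"
  unfolding h_def[abs_def] d_def using hardy2_mult(2)[OF D_hardy ps_entire, of 0] by (intro Bochner_Integration.integrable_diff) auto

lemma h_poisson: assumes z: "cmod z < 1" shows "cmod (ps n z * D z - 1) \<le> (\<ointegral>t. pk z t * cmod (h n t))"
proof -
  have i: "integrable cm (\<lambda>t. ps n t * d t)" unfolding d_def by (rule hardy2_mult(2)[OF D_hardy ps_entire z])
  have "(\<ointegral>t. pk z t *\<^sub>R h n t) = (\<ointegral>t. pk z t *\<^sub>R (ps n t * d t) - pk z t *\<^sub>R 1)"
    by (simp add: h_def scaleR_diff_right)
  also have "\<dots> = (\<ointegral>t. pk z t *\<^sub>R (ps n t * d t)) - (\<ointegral>t. pk z t *\<^sub>R 1)"
    by (intro bint_diff integrable_pk_scaleR[OF z] i) auto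
  also have "\<dots> = ps n z * D z - 1"
    unfolding d_def hardy2_mult(1)[OF D_hardy ps_entire z] using poisson_cm[of "\<lambda>_. 1" z] z by simp
  finally have "ps n z * D z - 1 = (\<ointegral>t. pk z t *\<^sub>R h n t)" by simp
  also have "cmod \<dots> \<le> (\<ointegral>t. norm (pk z t *\<^sub>R h n t))" by (rule integral_norm_bound)
  also have "\<dots> = (\<ointegral>t. pk z t * cmod (h n t))" using pk_pos[OF z] by (intro bint_cong refl) (simp add: abs_of_pos)
  finally show ?thesis .
qed

section \<open>Comparison of Schur iterates with orthogonal polynomials\<close>

text \<open>Here \<open>w > 0\<close> almost everywhere is used: Lebesgue measure on the circle is absolutely
  continuous with respect to \<open>\<sigma>\<close>.\<close>

lemma AE_sigma_imp_cm:
  assumes "AE x in \<sigma>. P x" shows "AE x in cm. P x"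
proof -
  obtain N where N: "N \<in> null_sets \<sigma>" "{x \<in> space \<sigma>. \<not> P x} \<subseteq> N"
    using assms by (auto simp: eventually_ae_filter)
  have Ns: "N \<in> sets borel_circle" using N(1) by auto
  have "emeasure \<sigma> N = emeasure (density cm (\<lambda>u. ennreal (w u))) N + emeasure \<sigma>s N"
    using dec Ns by (simp add: circle_lebesgue_decomposition_def)
  then have "emeasure (density cm (\<lambda>u. ennreal (w u))) N = 0" using N(1) by (auto simp: null_sets_def)
  then have "N \<in> null_sets (density cm (\<lambda>u. ennreal (w u)))" using Ns by (auto simp: null_sets_def)
  then have "AE x in density cm (\<lambda>u. ennreal (w u)). P x" by (rule AE_I') (use N(2) in auto)
  then have "AE x in cm. 0 < ennreal (w x) \<longrightarrow> P x" by (subst (asm) AE_density) auto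
  then show ?thesis using szego(1) by eventually_elim (auto simp: )
qed

lemma ps_eq: "ps n z = of_real (sqrt (Cn n)) * (1 + (\<Sum>k<n. cf k * en k z))"
proof -
  have c: "complex_of_real (Cn n) = of_real (sqrt (Cn n)) * of_real (sqrt (Cn n))" using Cn_pos[of n] by (simp flip: of_real_mult)
  have "Ps n z = of_real (Cn n) * (1 + (\<Sum>k<n. cf k * en k z))"
    using Ps_expansion[of n z] Cn_pos[of n] by (simp add: field_simps)
  then show ?thesis unfolding ps_def using sqrtC[of n] by (simp add: c)
qed

lemma h_L1_lim: "(\<lambda>n. \<ointegral>x. cmod (h n x)) \<longlonglongrightarrow> 0"
proof (rule tendstoI)
  fix e :: real assume e: "e > 0"
  have "\<forall>\<^sub>F n in sequentially. (\<ointegral>x. (cmod (h n x))^2) < (e/2)\<^sup>2" using e by (intro order_tendstoD(2)[OF h_L2_lim]) auto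
  then show "\<forall>\<^sub>F n in sequentially. dist (\<ointegral>x. cmod (h n x)) 0 < e"
  proof eventually_elim
    case (elim n)
    have "(\<ointegral>x. cmod (h n x)) \<le> e/2" by (rule integral_abs_le_of_L2[OF h_integrable h_L2(1)]) (use elim e in auto)
    moreover have "0 \<le> (\<ointegral>x. cmod (h n x))" by simp
    ultimately show ?case using e by (simp add: dist_real_def)
  qed
qed

text \<open>The comparison function: \<open>X n\<close> normalised and multiplied by \<open>D\<close>. It has
  no zeros, is bounded by \<open>1\<close>, and its defect from \<open>1\<close> dominates
  \<open>\<bar>z * f n\<bar>\<^sup>2\<close> (\<open>Y_le\<close>).\<close>

definition "Y n z = (ps n z - z * f n z * ph n z) * D z"

lemma Y_eq: "Y n z = X n z * D z / of_real (sqrt (Cn n))"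
  by (simp add: Y_def X_def ps_def ph_def diff_divide_distrib left_diff_distrib right_diff_distrib mult_ac)

lemma Y_hol: "Y n holomorphic_on ball 0 1" unfolding Y_eq[abs_def] using sqrtC by (intro holomorphic_intros X_hol D_hol) auto

lemma Y_nz: "cmod z < 1 \<Longrightarrow> Y n z \<noteq> 0" using X_nz sqrtC by (simp add: Y_eq)

lemma Q_Y: assumes z: "cmod z < 1" shows "Q n z * (cmod (Y n z))^2 = (1 - (cmod (z * f n z))^2) * (cmod (D z))^2"
proof -
  have "(cmod (Y n z))^2 = (cmod (X n z))^2 * (cmod (D z))^2 / Cn n"
    unfolding Y_eq using Cn_pos[of n] by (simp add: norm_divide norm_mult power_mult_distrib power_divide)
  then show ?thesis unfolding Q_def using X_nz[OF z, of n] Cn_pos[of n] by simp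
qed

lemma ph_le_ps: "cmod z \<le> 1 \<Longrightarrow> cmod (ph n z) \<le> cmod (ps n z)"
  unfolding ph_def ps_def norm_divide by (intro divide_right_mono Ph_le) auto

lemma ps_D_lim: assumes z: "cmod z < 1" shows "(\<lambda>n. ps n z * D z) \<longlonglongrightarrow> 1"
proof (rule Lim_transform_bound[THEN LIM_zero_cancel])
  show "\<forall>\<^sub>F n in sequentially. norm (ps n z * D z - 1) \<le> norm (2 / (1 - cmod z) * (\<ointegral>x. cmod (h n x)))"
  proof (intro always_eventually allI)
    fix n
    have "norm (ps n z * D z - 1) \<le> (\<ointegral>t. pk z t * cmod (h n t))" by (rule h_poisson[OF z])
    also have "\<dots> \<le> (\<ointegral>t. 2 / (1 - cmod z) * cmod (h n t))"
      using integrable_pk_scaleR[OF z integrable_norm[OF h_integrable[of n]]] integrable_norm[OF h_integrable[of n]]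
      by (intro integral_mono integrable_mult_right mult_right_mono pk_le[OF z]) auto
    also have "\<dots> = 2 / (1 - cmod z) * (\<ointegral>x. cmod (h n x))" by (rule integral_mult_right_zero)
    also have "\<dots> \<le> norm \<dots>" by (simp only: real_norm_def abs_ge_self)
    finally show "norm (ps n z * D z - 1) \<le> norm (2 / (1 - cmod z) * (\<ointegral>x. cmod (h n x)))" .
  qed
  show "(\<lambda>n. 2 / (1 - cmod z) * (\<ointegral>x. cmod (h n x))) \<longlonglongrightarrow> 0"
    using tendsto_mult_left[OF h_L1_lim, of "2 / (1 - cmod z)"] by simp
qed

lemma f_lim: assumes z: "cmod z < 1" shows "(\<lambda>n. f n z) \<longlonglongrightarrow> 0"
proof (rule tendstoI)
  fix e :: real assume e: "e > 0"
  define r where "r = (1 + cmod z) / 2"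
  have r: "0 < r" "r < 1" "cmod z \<le> r" using z norm_ge_zero[of z] by (auto simp: r_def simp del: norm_ge_zero)
  have e2: "e / 2 > 0" using e by simp
  from f_unif[OF r(1,2) e2] show "\<forall>\<^sub>F n in sequentially. dist (f n z) 0 < e"
  proof eventually_elim
    case (elim n)
    then have "cmod (f n z) \<le> e / 2" using r(3) by blast
    then show ?case using e by simp
  qed
qed

text \<open>\<open>Q n z\<close> decreases with \<open>n\<close>, and its limit is \<open>\<bar>D
  z\<bar>\<^sup>2\<close> because \<open>f n z\<close> tends to \<open>0\<close> and \<open>ps n z *
  D z\<close> to \<open>1\<close>.\<close>

lemma D_le_Q: assumes z: "cmod z < 1" shows "(cmod (D z))^2 \<le> Q n z"
proof -
  have fl: "(\<lambda>m. f m z) \<longlonglongrightarrow> 0" by (rule f_lim[OF z])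
  have "(\<lambda>m. z * f m z * (ph m z * D z)) \<longlonglongrightarrow> 0"
  proof (rule Lim_transform_bound)
    show "\<forall>\<^sub>F m in sequentially. norm (z * f m z * (ph m z * D z)) \<le> norm (f m z * (ps m z * D z))"
    proof (intro always_eventually allI)
      fix m
      have "norm (z * f m z * (ph m z * D z)) = cmod z * (cmod (f m z) * (cmod (ph m z) * cmod (D z)))" by (simp add: norm_mult mult_ac)
      also have "\<dots> \<le> 1 * (cmod (f m z) * (cmod (ps m z) * cmod (D z)))"
        using z ph_le_ps[of z m] by (intro mult_mono mult_left_mono mult_right_mono) auto
      finally show "norm (z * f m z * (ph m z * D z)) \<le> norm (f m z * (ps m z * D z))" by (simp add: norm_mult)
    qed
    show "(\<lambda>m. f m z * (ps m z * D z)) \<longlonglongrightarrow> 0" using tendsto_mult[OF fl ps_D_lim[OF z]] by simp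
  qed
  then have "(\<lambda>m. ps m z * D z - z * f m z * (ph m z * D z)) \<longlonglongrightarrow> 1 - 0" by (intro tendsto_diff ps_D_lim z)
  then have Yl: "(\<lambda>m. Y m z) \<longlonglongrightarrow> 1" by (simp add: Y_def algebra_simps)
  have "(\<lambda>m. (1 - (cmod (z * f m z))^2) * (cmod (D z))^2 / (cmod (Y m z))^2) \<longlonglongrightarrow> (1 - (cmod (z * 0))^2) * (cmod (D z))^2 / (cmod 1)^2"
    by (intro tendsto_intros fl Yl) auto
  moreover have "(1 - (cmod (z * f m z))^2) * (cmod (D z))^2 / (cmod (Y m z))^2 = Q m z" for m
    using Q_Y[OF z, of m] Y_nz[OF z, of m] by (simp add: field_simps)
  ultimately have "(\<lambda>m. Q m z) \<longlonglongrightarrow> (cmod (D z))^2" by simp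
  then show ?thesis by (rule LIMSEQ_le_const2) (use Q_antimono[OF z] in blast)
qed

lemma Y_le: assumes z: "cmod z < 1" shows "(cmod (Y n z))^2 \<le> 1 - (cmod (z * f n z))^2"
proof -
  have "(cmod (D z))^2 * (cmod (Y n z))^2 \<le> Q n z * (cmod (Y n z))^2" by (intro mult_right_mono D_le_Q z) auto
  also have "\<dots> = (cmod (D z))^2 * (1 - (cmod (z * f n z))^2)" unfolding Q_Y[OF z] by (rule mult.commute)
  finally show ?thesis using mult_le_cancel_left_pos[of "(cmod (D z))^2"] by simp
qed

lemma Y_le_1: "cmod z < 1 \<Longrightarrow> cmod (Y n z) \<le> 1"
proof -
  assume z: "cmod z < 1"
  have "(cmod (Y n z))^2 \<le> 1\<^sup>2" using Y_le[OF z, of n] zero_le_power2[of "cmod (z * f n z)"] unfolding one_power2 by linarith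
  then show ?thesis by (rule power2_le_imp_le) simp
qed

lemma f0_hardy: "hardy2 1 (f 0)" unfolding hardy2_def
proof (intro conjI allI impI f_hol)
  fix s :: real assume "0 \<le> s \<and> s < 1"
  then have s: "0 \<le> s" "s < 1" by auto
  have "(\<ointegral>t. (cmod (f 0 (of_real s * t)))^2) \<le> (\<ointegral>t. 1)"
    using f_le[OF dil_less[OF s]] by (intro integral_mono integrable_cm_continuous continuous_intros f_dil_cont s) (auto intro: power_le_one)
  then show "(\<ointegral>t. (cmod (f 0 (of_real s * t)))^2) \<le> 1" using cm.prob_space by simp
qed

definition "f0b = bdv (f 0)"

lemma f0b_nontangential: "AE x in cm. \<forall>C\<ge>0. (f 0 \<longlongrightarrow> f0b x) (at x within ntr C x)"
  unfolding f0b_def by (rule fatou_nontangential[OF f0_hardy])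

text \<open>The function \<open>1 - z * f 0\<close> has no zeros and value \<open>1\<close> at the origin, so
  its logarithmic means are \<open>0\<close>, and the boundary function cannot vanish on a set of
  positive measure.\<close>

lemma f0b_neq: "AE x in cm. 1 - x * f0b x \<noteq> 0"
proof -
  have [measurable]: "f0b \<in> borel_measurable borel_circle" unfolding f0b_def by (rule bdv_measurable[OF f_hol])
  have [measurable]: "(\<lambda>x. x) \<in> borel_measurable borel_circle" by (intro borel_measurable_circle_continuous continuous_intros)
  let ?u = "\<lambda>j t. cmod (X 0 (of_real (1 - 1 / (real j + 2)) * t))"
  let ?v = "\<lambda>t. cmod (1 - t * f0b t)"
  have c: "continuous_on (sphere 0 1) (?u j)" for j by (intro continuous_intros dilation_continuous[OF X_hol] rad_bounds)
  have p: "?u j t > 0" if "cmod t = 1" for j t using X_nz[OF dil_less[OF rad_bounds(1,2) that]] by simp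
  have lim: "AE t in cm. (\<lambda>j. ?u j t) \<longlonglongrightarrow> ?v t" using bdv_radial[OF f0_hardy] AE_space[of cm]
  proof eventually_elim
    case (elim t)
    have r: "(\<lambda>j. of_real (1 - 1 / (real j + 2)) * t) \<longlonglongrightarrow> t"
      using at_within_ntr_neq_bot(2)[of t 1] elim(2) by (auto simp: filterlim_at)
    show ?case unfolding X_def Ps_0 Ph_0 f0b_def by (simp only: mult_1_right) (intro tendsto_intros r elim(1))
  qed
  have vm: "?v \<in> borel_measurable borel_circle" by measurable
  have le: "(\<ointegral>t. ?u j t) \<le> 2" for j
  proof -
    have "(\<ointegral>t. ?u j t) \<le> (\<ointegral>t. 2)"
    proof (rule integral_mono[OF integrable_cm_continuous[OF c]])
      fix t assume "t \<in> space cm"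
      then have z: "cmod (of_real (1 - 1 / (real j + 2)) * t) < 1" by (intro dil_less rad_bounds) simp
      from zf_less[OF z, of 0] show "?u j t \<le> 2"
        unfolding X_def Ps_0 Ph_0 mult_1_right using norm_triangle_ineq4[of 1 "of_real (1 - 1 / (real j + 2)) * t * f 0 (of_real (1 - 1 / (real j + 2)) * t)"] by simp
    qed simp
    then show ?thesis using cm.prob_space by simp
  qed
  have "(\<ointegral>t. ln (?u j t)) \<ge> 0" for j
    using jensen_zero_free[OF X_hol X_nz rad_bounds(1,2), of 0 j] by (simp add: X_at_0)
  from fatou_log(1)[OF c p lim vm le this] show ?thesis by (rule AE_mp) auto
qed

text \<open>On the boundary \<open>w = (1 - \<bar>f 0\<bar>\<^sup>2) / \<bar>1 - z * f
  0\<bar>\<^sup>2\<close>, and \<open>w > 0\<close> almost everywhere.\<close>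

lemma f0b_less: "AE u in cm. cmod (f0b u) < 1" using f0b_nontangential f0b_neq Q0_limit szego(1) AE_space[of cm]
proof eventually_elim
  case (elim u)
  let ?F = "at u within ntr 1 u"
  have x: "cmod u = 1" using elim by simp
  have nb: "?F \<noteq> bot" using at_within_ntr_neq_bot(1)[of u 1] x by simp
  have f0: "(f 0 \<longlongrightarrow> f0b u) ?F" and Q: "(Q 0 \<longlongrightarrow> w u) ?F" using elim by auto
  have "((\<lambda>z. (1 - (cmod (z * f 0 z))^2) / (cmod (1 - z * f 0 z))^2) \<longlongrightarrow> (1 - (cmod (u * f0b u))^2) / (cmod (1 - u * f0b u))^2) ?F"
    using elim(2) by (intro tendsto_intros f0) auto
  then have "(Q 0 \<longlongrightarrow> (1 - (cmod (u * f0b u))^2) / (cmod (1 - u * f0b u))^2) ?F"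
    by (simp add: Q_def[abs_def] X_def)
  then have "w u = (1 - (cmod (f0b u))^2) / (cmod (1 - u * f0b u))^2" using tendsto_unique[OF nb Q] x by (simp add: norm_mult)
  then have "0 < (1 - (cmod (f0b u))^2) / (cmod (1 - u * f0b u))^2" using elim(4) by simp
  then have "(cmod (f0b u))^2 < 1" using elim(2) by (simp add: zero_less_divide_iff)
  then show ?case by (simp add: abs_square_less_1)
qed

definition "phase x = d x / cnj (d x)"

lemma phase_le: "cmod (phase x) \<le> 1" by (cases "d x = 0") (auto simp: phase_def norm_divide)

lemma phase_integrable: "integrable cm phase"
proof (rule cm.integrable_const_bound[where B=1])
  have "(\<lambda>x. cnj (d x)) \<in> borel_measurable borel_circle" by (rule measurable_compose[OF d_meas]) (intro borel_measurable_continuous_onI continuous_intros)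
  then show "phase \<in> borel_measurable cm" unfolding phase_def[abs_def] by measurable
qed (use phase_le in auto)

text \<open>On the circle \<open>ph n = t ^ n * cnj (ps n)\<close>, so \<open>ph n * d\<close> is \<open>phase
  * t ^ n * (1 + cnj (h n))\<close>. Replacing the phase by the constant \<open>c\<close> costs the
  second term, dropping \<open>h n\<close> the third, and the Poisson integral of \<open>t ^
  n\<close> is \<open>z ^ n\<close>.\<close>

lemma ph_bound:
  assumes z: "cmod z < 1" and c: "cmod c \<le> 1"
  shows "cmod (ph n z * D z) \<le> cmod z ^ n + (\<ointegral>t. pk z t * cmod (phase t - c)) + (\<ointegral>t. pk z t * cmod (h n t))"
proof -
  have ic: "integrable cm (\<lambda>t. c * t ^ n)" by (intro integrable_cm_continuous continuous_intros)
  have i: "integrable cm (\<lambda>t. ph n t * d t)" unfolding d_def by (rule hardy2_mult(2)[OF D_hardy ph_entire z])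
  have iu: "integrable cm (\<lambda>t. phase t - c)" using phase_integrable by simp
  have zn: "(\<ointegral>t. pk z t *\<^sub>R (c * t ^ n)) = c * z ^ n" by (rule poisson_cm[OF _ z]) (intro holomorphic_intros)
  have eq: "ph n z * D z - c * z ^ n = (\<ointegral>t. pk z t *\<^sub>R (ph n t * d t)) - (\<ointegral>t. pk z t *\<^sub>R (c * t ^ n))"
    unfolding zn d_def hardy2_mult(1)[OF D_hardy ph_entire z] ..
  have eq2: "\<dots> = (\<ointegral>t. pk z t *\<^sub>R (ph n t * d t) - pk z t *\<^sub>R (c * t ^ n))"
    by (rule bint_diff[symmetric]) (intro integrable_pk_scaleR z i ic)+
  have "cmod (ph n z * D z - c * z ^ n) \<le> (\<ointegral>t. norm (pk z t *\<^sub>R (ph n t * d t) - pk z t *\<^sub>R (c * t ^ n)))"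
    unfolding eq eq2 by (rule integral_norm_bound)
  also have "\<dots> \<le> (\<ointegral>t. pk z t * cmod (phase t - c) + pk z t * cmod (h n t))"
  proof (rule integral_mono_AE)
    show "integrable cm (\<lambda>t. norm (pk z t *\<^sub>R (ph n t * d t) - pk z t *\<^sub>R (c * t ^ n)))"
      by (intro integrable_norm Bochner_Integration.integrable_diff integrable_pk_scaleR z i ic)
    show "integrable cm (\<lambda>t. pk z t * cmod (phase t - c) + pk z t * cmod (h n t))"
      using integrable_pk_scaleR[OF z integrable_norm[OF iu]] integrable_pk_scaleR[OF z integrable_norm[OF h_integrable[of n]]] by auto
    show "AE t in cm. norm (pk z t *\<^sub>R (ph n t * d t) - pk z t *\<^sub>R (c * t ^ n)) \<le> pk z t * cmod (phase t - c) + pk z t * cmod (h n t)"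
      using d_nz AE_space[of cm]
    proof eventually_elim
      case (elim t)
      then have e: "cmod t = 1" by simp
      have p: "pk z t > 0" by (rule pk_pos[OF z e])
      have "t ^ n * cnj (t ^ n) = 1" using circle_cnj_mult[OF e] by (simp flip: power_mult_distrib)
      then have "ph n t = t ^ n * cnj (ps n t)" unfolding ph_def ps_def Ps_circle[OF e] by (simp add: mult.assoc[symmetric])
      moreover have "cnj (ps n t) = (1 + cnj (h n t)) / cnj (d t)" using elim(1) by (simp add: h_def)
      ultimately have "ph n t * d t = t ^ n * (phase t * (1 + cnj (h n t)))" by (simp add: phase_def)
      then have "ph n t * d t - c * t ^ n = t ^ n * ((phase t - c) + phase t * cnj (h n t))" by (simp add: algebra_simps)
      then have "cmod (ph n t * d t - c * t ^ n) = cmod ((phase t - c) + phase t * cnj (h n t))" using e by (simp add: norm_mult norm_power)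
      also have "\<dots> \<le> cmod (phase t - c) + cmod (phase t) * cmod (h n t)" using norm_triangle_ineq[of "phase t - c" "phase t * cnj (h n t)"] by (simp add: norm_mult)
      also have "\<dots> \<le> cmod (phase t - c) + 1 * cmod (h n t)" by (intro add_left_mono mult_right_mono phase_le) auto
      finally have le: "cmod (ph n t * d t - c * t ^ n) \<le> cmod (phase t - c) + cmod (h n t)" by simp
      have "norm (pk z t *\<^sub>R (ph n t * d t) - pk z t *\<^sub>R (c * t ^ n)) = pk z t * cmod (ph n t * d t - c * t ^ n)"
        using p by (simp flip: scaleR_diff_right)
      also have "\<dots> \<le> pk z t * (cmod (phase t - c) + cmod (h n t))" using le p by (intro mult_left_mono) auto
      finally show ?case by (simp add: distrib_left)
    qed
  qed
  also have "\<dots> = (\<ointegral>t. pk z t * cmod (phase t - c)) + (\<ointegral>t. pk z t * cmod (h n t))"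
    using integrable_pk_scaleR[OF z integrable_norm[OF iu]] integrable_pk_scaleR[OF z integrable_norm[OF h_integrable[of n]]] by simp
  finally have "cmod (ph n z * D z - c * z ^ n) \<le> (\<ointegral>t. pk z t * cmod (phase t - c)) + (\<ointegral>t. pk z t * cmod (h n t))" .
  moreover have "cmod (ph n z * D z) \<le> cmod (c * z ^ n) + cmod (ph n z * D z - c * z ^ n)"
    using norm_triangle_ineq[of "c * z ^ n" "ph n z * D z - c * z ^ n"] by simp
  moreover have "cmod (c * z ^ n) \<le> cmod z ^ n" using c mult_right_mono[of "cmod c" 1 "cmod z ^ n"] by (simp add: norm_mult norm_power)
  ultimately show ?thesis by linarith
qed

end

text \<open>The conclusion of Menshov's theorems, taken as an assumption so that the rest of the argument does
  not distinguish the two cases.\<close>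

locale opuc_max = opuc_szego +
  assumes maxf: "maximal_convergent \<sigma> cf en"
begin

text \<open>The majorant is of the order of \<open>1 + w * \<bar>G\<bar>\<close>, which is integrable since
  \<open>G\<close> is so for \<open>\<sigma>\<close>. The partial sums have some limit almost
  everywhere; the convergence in \<open>L\<^sup>2\<close> identifies the limit of \<open>h n\<close>
  as \<open>0\<close>.\<close>

lemma h_dominated: "\<exists>T. integrable cm T \<and> (AE u in cm. \<forall>n. cmod (h n u) \<le> T u) \<and> (AE u in cm. (\<lambda>n. h n u) \<longlonglongrightarrow> 0)"
proof -
  obtain G where G: "integrable \<sigma> G" "AE x in \<sigma>. (\<forall>n. (cmod (\<Sum>k<n. cf k * en k x))^2 \<le> G x) \<and> convergent (\<lambda>n. \<Sum>k<n. cf k * en k x)"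
    using maxf by blast
  have ae: "AE x in cm. (\<forall>n. (cmod (\<Sum>k<n. cf k * en k x))^2 \<le> G x) \<and> convergent (\<lambda>n. \<Sum>k<n. cf k * en k x)"
    by (rule AE_sigma_imp_cm[OF G(2)])
  have Gm: "G \<in> borel_measurable borel_circle" using borel_measurable_integrable[OF G(1)] by simp
  have iG: "integrable cm (\<lambda>u. w u * \<bar>G u\<bar>)" by (rule integrable_w_mult(1)) (use Gm G(1) in auto)
  define V where "V u = 2 * w u + 2 * (w u * \<bar>G u\<bar>)" for u
  have iV: "integrable cm (\<lambda>u. 2 + V u)" unfolding V_def using iG integrable_w by auto
  have dom: "AE u in cm. \<forall>n. cmod (h n u) \<le> 2 + V u" using ae d_sq w_nonneg
  proof eventually_elim
    case (elim u)
    show ?case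
    proof
      fix n
      have "cmod (1 + (\<Sum>k<n. cf k * en k u)) \<le> 1 + cmod (\<Sum>k<n. cf k * en k u)" using norm_triangle_ineq[of 1 "\<Sum>k<n. cf k * en k u"] by simp
      then have "(cmod (1 + (\<Sum>k<n. cf k * en k u)))^2 \<le> (1 + cmod (\<Sum>k<n. cf k * en k u))^2" by (intro power_mono) auto
      also have "\<dots> \<le> (1 + 1) * 1\<^sup>2 + (1 + 1/1) * (cmod (\<Sum>k<n. cf k * en k u))^2" by (rule square_add_le) simp
      also have "\<dots> \<le> 2 + 2 * \<bar>G u\<bar>"
      proof -
        have "(cmod (\<Sum>k<n. cf k * en k u))^2 \<le> G u" using elim(1) by blast
        then show ?thesis by simp
      qed
      finally have a: "(cmod (1 + (\<Sum>k<n. cf k * en k u)))^2 \<le> 2 + 2 * \<bar>G u\<bar>" .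
      have "Cn n \<le> 1" by (induction n) (auto intro: order_trans[OF Cn_antimono])
      then have "Cn n * (cmod (1 + (\<Sum>k<n. cf k * en k u)))^2 \<le> 1 * (2 + 2 * \<bar>G u\<bar>)" using a Cn_pos[of n] by (intro mult_mono) auto
      moreover have "(cmod (ps n u))^2 = Cn n * (cmod (1 + (\<Sum>k<n. cf k * en k u)))^2"
        unfolding ps_eq norm_mult power_mult_distrib using Cn_pos[of n] by simp
      ultimately have "(cmod (ps n u * d u))^2 \<le> (2 + 2 * \<bar>G u\<bar>) * w u"
        unfolding norm_mult power_mult_distrib elim(2) using elim(3) by (intro mult_right_mono) auto
      then have b: "(cmod (ps n u * d u))^2 \<le> V u" by (simp add: V_def algebra_simps)
      have "0 \<le> (cmod (ps n u * d u) - 1)^2" by simp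
      then have "2 * cmod (ps n u * d u) \<le> (cmod (ps n u * d u))^2 + 1" by (simp add: power2_diff)
      then have "cmod (ps n u * d u) \<le> 1 + V u" using b norm_ge_zero[of "ps n u * d u"] by linarith
      then show "cmod (h n u) \<le> 2 + V u" unfolding h_def using norm_triangle_ineq4[of "ps n u * d u" 1] by simp
    qed
  qed
  have conv: "AE u in cm. convergent (\<lambda>n. h n u)" using ae
  proof eventually_elim
    case (elim u)
    then obtain l where l: "(\<lambda>n. \<Sum>k<n. cf k * en k u) \<longlonglongrightarrow> l" by (auto simp: convergent_def)
    have "(\<lambda>n. h n u) \<longlonglongrightarrow> of_real (sqrt Cinf) * (1 + l) * d u - 1"
      unfolding h_def ps_eq by (intro tendsto_intros l Cn_lim)
    then show ?case by (rule convergentI)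
  qed
  define L where "L u = lim (\<lambda>n. h n u)" for u
  have Lm[measurable]: "L \<in> borel_measurable borel_circle" unfolding L_def[abs_def] by (rule borel_measurable_lim_metric) measurable
  have Ll: "AE u in cm. (\<lambda>n. h n u) \<longlonglongrightarrow> L u" using conv by eventually_elim (simp add: L_def convergent_LIMSEQ_iff)
  have Ll2: "AE u in cm. (\<lambda>n. (cmod (h n u))^2) \<longlonglongrightarrow> (cmod (L u))^2" using Ll by eventually_elim (intro tendsto_intros)
  have fat: "integrable cm (\<lambda>u. (cmod (L u))^2) \<and> (\<ointegral>u. (cmod (L u))^2) \<le> e" if e: "e > 0" for e
  proof -
    have "\<forall>\<^sub>F n in sequentially. (\<ointegral>u. (cmod (h n u))^2) < e" using e by (intro order_tendstoD(2)[OF h_L2_lim])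
    then have "\<forall>\<^sub>F n in sequentially. (\<ointegral>u. (cmod (h n u))^2) \<le> e" by eventually_elim simp
    from fatou_bound[OF h_L2(1) _ Ll2 _ this] show ?thesis by auto
  qed
  have "(\<ointegral>u. (cmod (L u))^2) \<le> 0" by (rule field_le_epsilon) (use fat in simp)
  moreover have "0 \<le> (\<ointegral>u. (cmod (L u))^2)" by simp
  ultimately have "(\<ointegral>u. (cmod (L u))^2) = 0" by linarith
  then have "AE u in cm. (cmod (L u))^2 = 0" using fat[of 1] by (subst (asm) integral_nonneg_eq_0_iff_AE) auto
  then have "AE u in cm. (\<lambda>n. h n u) \<longlonglongrightarrow> 0" using Ll by eventually_elim simp
  then show ?thesis using iV dom by blast
qed

text \<open>The functions \<open>H N = sup {\<bar>h n\<bar> | n \<ge> N}\<close> tend to \<open>0\<close> in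
  mean by dominated convergence, and the weak type inequality for \<open>H N\<close> treats all
  \<open>n \<ge> N\<close> and all points of the region at once.\<close>

theorem h_poisson_uniform:
  "AE u in cm. \<forall>C\<ge>0. \<forall>e>0. \<exists>N. \<forall>n\<ge>N. \<forall>z\<in>ntr C u. (\<ointegral>t. pk z t * cmod (h n t)) \<le> e"
proof -
  obtain T where T: "integrable cm T" "AE u in cm. \<forall>n. cmod (h n u) \<le> T u" "AE u in cm. (\<lambda>n. h n u) \<longlonglongrightarrow> 0"
    using h_dominated by blast
  have Tm[measurable]: "T \<in> borel_measurable borel_circle" using borel_measurable_integrable[OF T(1)] by simp
  define k where "k n u = min (cmod (h n u)) \<bar>T u\<bar>" for n u
  have k: "0 \<le> k n u" "k n u \<le> \<bar>T u\<bar>" for n u by (auto simp: k_def)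
  have bdd: "bdd_above ((\<lambda>n. k n u) ` {N..})" for N u using k by (intro bdd_aboveI[of _ "\<bar>T u\<bar>"]) auto
  define H where "H N u = (SUP n\<in>{N..}. k n u)" for N u
  have km[measurable]: "k n \<in> borel_measurable borel_circle" for n unfolding k_def[abs_def] by measurable
  have Hm[measurable]: "H N \<in> borel_measurable borel_circle" for N
    unfolding H_def[abs_def] by (rule borel_measurable_cSUP) (use bdd in auto)
  have kH: "k n u \<le> H N u" if "n \<ge> N" for n N u unfolding H_def using that bdd by (intro cSUP_upper) auto
  have H0: "0 \<le> H N u" for N u using k(1)[of N u] kH[of N N u] by linarith
  have HT: "H N u \<le> \<bar>T u\<bar>" for N u unfolding H_def using k by (intro cSUP_least) auto
  have iH: "integrable cm (H N)" for N by (rule bint_bound[OF T(1)]) (use H0 HT in auto)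
  have "(\<lambda>N. \<ointegral>u. H N u) \<longlonglongrightarrow> (\<ointegral>u. 0)"
  proof (rule integral_dominated_convergence[where w="\<lambda>u. \<bar>T u\<bar>"])
    show "AE u in cm. (\<lambda>N. H N u) \<longlonglongrightarrow> 0" using T(3)
    proof eventually_elim
      case (elim u)
      show ?case
      proof (rule LIMSEQ_I)
        fix e :: real assume e: "e > 0"
        have "\<forall>\<^sub>F n in sequentially. dist (h n u) 0 < e/2" using elim e by (intro tendstoD) auto
        then obtain N where N: "\<And>n. n \<ge> N \<Longrightarrow> cmod (h n u) < e / 2" by (auto simp: eventually_sequentially)
        have "H M u \<le> e / 2" if "M \<ge> N" for M unfolding H_def
        proof (rule cSUP_least)
          fix n assume "n \<in> {M..}"
          then have "cmod (h n u) < e/2" using N that by auto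
          then show "k n u \<le> e / 2" by (simp add: k_def)
        qed simp
        have "H M u < e" if "M \<ge> N" for M using \<open>\<And>M. M \<ge> N \<Longrightarrow> H M u \<le> e / 2\<close>[OF that] e by linarith
        then show "\<exists>no. \<forall>n\<ge>no. norm (H n u - 0) < e" using H0 by (intro exI[of _ N]) auto
      qed
    qed
    show "AE u in cm. norm (H N u) \<le> \<bar>T u\<bar>" for N using H0 HT by simp
  qed (use T(1) in auto)
  then have Hl: "(\<lambda>N. \<ointegral>u. H N u) \<longlonglongrightarrow> 0" by simp
  have hk: "AE u in cm. \<forall>n. cmod (h n u) = k n u" using T(2)
  proof eventually_elim
    case (elim u)
    show ?case
    proof
      fix n have "cmod (h n u) \<le> T u" using elim by blast
      then show "cmod (h n u) = k n u" by (simp add: k_def)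
    qed
  qed
  define P where "P j u \<longleftrightarrow> (\<exists>N. \<forall>C\<ge>0. \<forall>n\<ge>N. \<forall>z\<in>ntr C u. (\<ointegral>t. pk z t * cmod (h n t)) \<le> 16 * (1 + C) / real (Suc j))" for j u
  have "AE u in cm. P j u" for j
  proof (rule AE_small)
    fix e :: real assume e: "e > 0"
    define l where "l = 1 / real (Suc j)"
    have l: "l > 0" by (simp add: l_def)
    have "\<forall>\<^sub>F N in sequentially. (\<ointegral>u. H N u) < e * l / 20" using e l by (intro order_tendstoD(2)[OF Hl]) auto
    then obtain N where N: "(\<ointegral>u. H N u) < e * l / 20" by (auto simp: eventually_sequentially)
    obtain A where A: "A\<in>sets cm" "emeasure cm A \<le> ennreal (20 / l * (\<ointegral>t. norm (H N t)))"
      "\<And>u C z. u\<in>sphere 0 1 - A \<Longrightarrow> C\<ge>0 \<Longrightarrow> z\<in>ntr C u \<Longrightarrow> (\<ointegral>t. pk z t * norm (H N t)) \<le> 16 * (1 + C) * l"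
      using weak_type_fun[OF iH[of N] l] by blast
    have "20 / l * (\<ointegral>t. norm (H N t)) \<le> 20 / l * (e * l / 20)" using N l H0 by (intro mult_left_mono) auto
    also have "\<dots> = e" using l by simp
    finally have Ae: "emeasure cm A \<le> ennreal e" using A(2) by (meson ennreal_leI order_trans)
    have "P j u" if x: "u\<in>sphere 0 1 - A" for u unfolding P_def
    proof (intro exI[of _ N] allI impI ballI)
      fix C :: real and n z assume C: "C \<ge> 0" and n: "n \<ge> N" and z: "z \<in> ntr C u"
      have z1: "cmod z < 1" using z by (simp add: ntr_def)
      have "(\<ointegral>t. pk z t * cmod (h n t)) \<le> (\<ointegral>t. pk z t * norm (H N t))"
      proof (rule integral_mono_AE)
        show "integrable cm (\<lambda>t. pk z t * cmod (h n t))" "integrable cm (\<lambda>t. pk z t * norm (H N t))"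
          using integrable_pk_scaleR[OF z1 integrable_norm[OF h_integrable[of n]]] integrable_pk_scaleR[OF z1 integrable_norm[OF iH[of N]]] by auto
        show "AE t in cm. pk z t * cmod (h n t) \<le> pk z t * norm (H N t)" using hk AE_space[of cm]
        proof eventually_elim
          case (elim t)
          have "cmod (h n t) \<le> norm (H N t)" using elim(1) kH[OF n, of t] H0[of N t] by simp
          then show ?case using pk_pos[OF z1, of t] elim(2) by (intro mult_left_mono) auto
        qed
      qed
      also have "\<dots> \<le> 16 * (1 + C) * l" by (rule A(3)[OF x C z])
      finally show "(\<ointegral>t. pk z t * cmod (h n t)) \<le> 16 * (1 + C) / real (Suc j)" by (simp add: l_def)
    qed
    then show "\<exists>A\<in>sets cm. emeasure cm A \<le> ennreal e \<and> (\<forall>u\<in>sphere 0 1 - A. P j u)" using A(1) Ae by blast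
  qed
  then have "AE u in cm. \<forall>j. P j u" by (simp add: AE_all_countable)
  then show ?thesis
  proof eventually_elim
    case (elim u)
    show ?case
    proof (intro allI impI)
      fix C e :: real assume C: "C \<ge> 0" and e: "e > 0"
      obtain j where j: "16 * (1 + C) / e < real (Suc j)"
        using reals_Archimedean2[of "16 * (1 + C) / e"] by (metis less_Suc_eq of_nat_less_iff order.strict_trans)
      then have j2: "16 * (1 + C) / real (Suc j) \<le> e" using e by (simp add: field_simps)
      obtain N where N: "\<And>n z. n \<ge> N \<Longrightarrow> z\<in>ntr C u \<Longrightarrow> (\<ointegral>t. pk z t * cmod (h n t)) \<le> 16 * (1 + C) / real (Suc j)"
        using elim C unfolding P_def by blast
      then show "\<exists>N. \<forall>n\<ge>N. \<forall>z\<in>ntr C u. (\<ointegral>t. pk z t * cmod (h n t)) \<le> e" using j2 order_trans by blast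
    qed
  qed
qed

end

section \<open>Schur iterates at depth at least of order 1/n\<close>

text \<open>A boundary point at which the almost everywhere statements needed below hold. All that follows
  takes place at one fixed such point and involves no further exceptional sets.\<close>

locale good_point = opuc_szego +
  fixes \<xi> :: complex
  assumes x: "cmod \<xi> = 1"
    and h_lim: "(\<lambda>n. h n \<xi>) \<longlonglongrightarrow> 0"
    and h_unif: "\<forall>C\<ge>0. \<forall>e>0. \<exists>N. \<forall>n\<ge>N. \<forall>z\<in>ntr C \<xi>. (\<ointegral>t. pk z t * cmod (h n t)) \<le> e"
    and f0_lim: "\<forall>C\<ge>0. (f 0 \<longlongrightarrow> f0b \<xi>) (at \<xi> within ntr C \<xi>)" and fb1: "cmod (f0b \<xi>) < 1"
    and D_lim: "\<forall>C\<ge>0. (D \<longlongrightarrow> d \<xi>) (at \<xi> within ntr C \<xi>)" and d0: "d \<xi> \<noteq> 0"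
    and phase_lim: "\<forall>C\<ge>0. ((\<lambda>z. \<ointegral>t. pk z t * norm (phase t - phase \<xi>)) \<longlongrightarrow> 0) (at \<xi> within ntr C \<xi>)"
begin

lemma near:
  fixes g :: "complex \<Rightarrow> 'b::real_normed_vector"
  assumes "(g \<longlongrightarrow> l) (at \<xi> within ntr C \<xi>)" "e > 0"
  obtains r where "0 < r" "\<And>z. z \<in> ntr C \<xi> \<Longrightarrow> cmod (z - \<xi>) < r \<Longrightarrow> norm (g z - l) < e"
proof -
  have "\<forall>\<^sub>F z in at \<xi> within ntr C \<xi>. norm (g z - l) < e" using tendstoD[OF assms] by (simp add: dist_norm)
  then obtain r where "r > 0" "\<forall>z\<in>ntr C \<xi>. z \<noteq> \<xi> \<and> dist z \<xi> < r \<longrightarrow> norm (g z - l) < e"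
    by (auto simp: eventually_at)
  then show ?thesis using x by (intro that[of r]) (auto simp: ntr_def dist_norm)
qed

lemma ps_D_unif:
  assumes "C \<ge> 0" "e > 0"
  obtains N where "\<And>n z. n \<ge> N \<Longrightarrow> z \<in> ntr C \<xi> \<Longrightarrow> cmod (ps n z * D z - 1) \<le> e"
    "\<And>n z. n \<ge> N \<Longrightarrow> z \<in> ntr C \<xi> \<Longrightarrow> (\<ointegral>t. pk z t * cmod (h n t)) \<le> e"
proof -
  obtain N where N: "\<And>n z. n \<ge> N \<Longrightarrow> z \<in> ntr C \<xi> \<Longrightarrow> (\<ointegral>t. pk z t * cmod (h n t)) \<le> e"
    using h_unif assms by blast
  show ?thesis
  proof (rule that[OF _ N])
    fix n z assume n: "n \<ge> N" and z: "z \<in> ntr C \<xi>"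
    then have "cmod z < 1" by (simp add: ntr_def)
    from order_trans[OF h_poisson[OF this] N[OF n z]] show "cmod (ps n z * D z - 1) \<le> e" .
  qed
qed

text \<open>In \<open>Y n = ps n * D - z * f n * (ph n * D)\<close> the first term is close to
  \<open>1\<close> and the second is at most \<open>\<bar>z\<bar> ^ n\<close> plus a small error.\<close>

lemma Y_lower:
  assumes C: "C \<ge> 0" and e: "e > 0"
  obtains N r where "0 < r" "\<And>n z. n \<ge> N \<Longrightarrow> z \<in> ntr C \<xi> \<Longrightarrow> cmod (z - \<xi>) < r \<Longrightarrow> cmod (Y n z) \<ge> 1 - e - cmod z ^ n"
proof -
  have e3: "e / 3 > 0" using e by simp
  obtain N where N: "\<And>n z. n \<ge> N \<Longrightarrow> z \<in> ntr C \<xi> \<Longrightarrow> cmod (ps n z * D z - 1) \<le> e/3"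
    "\<And>n z. n \<ge> N \<Longrightarrow> z \<in> ntr C \<xi> \<Longrightarrow> (\<ointegral>t. pk z t * cmod (h n t)) \<le> e/3"
    using ps_D_unif[OF C e3] by blast
  obtain r where r: "r > 0" "\<And>z. z \<in> ntr C \<xi> \<Longrightarrow> cmod (z - \<xi>) < r \<Longrightarrow> norm ((\<ointegral>t. pk z t * norm (phase t - phase \<xi>)) - 0) < e / 3"
    using near[OF phase_lim[rule_format, OF C] e3] by blast
  show ?thesis
  proof (rule that[OF r(1)])
    fix n z assume n: "n \<ge> N" and z: "z \<in> ntr C \<xi>" and d: "cmod (z - \<xi>) < r"
    have z1: "cmod z < 1" using z by (simp add: ntr_def)
    have "cmod (ph n z * D z) \<le> cmod z ^ n + e / 3 + e / 3"
      using ph_bound[OF z1 phase_le[of \<xi>], of n] N(2)[OF n z] r(2)[OF z d] by (simp del: norm_ge_zero)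
    moreover have "cmod (z * f n z * (ph n z * D z)) \<le> 1 * cmod (ph n z * D z)"
      unfolding norm_mult[of "z * f n z"] using zf_less[OF z1, of n] by (intro mult_right_mono) auto
    moreover have "Y n z = 1 - ((1 - ps n z * D z) + z * f n z * (ph n z * D z))" by (simp add: Y_def algebra_simps)
    then have "cmod (Y n z) \<ge> 1 - (cmod (1 - ps n z * D z) + cmod (z * f n z * (ph n z * D z)))"
      using norm_triangle_ineq2[of 1 "(1 - ps n z * D z) + z * f n z * (ph n z * D z)"] norm_triangle_ineq[of "1 - ps n z * D z" "z * f n z * (ph n z * D z)"] by simp
    ultimately show "cmod (Y n z) \<ge> 1 - e - cmod z ^ n" using N(1)[OF n z] by (simp add: norm_minus_commute)
  qed
qed

lemma radial_point:
  assumes "0 \<le> c" "c \<le> 1"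
  shows "cmod (of_real (1 - c) * \<xi>) = 1 - c" "cmod (of_real (1 - c) * \<xi> - \<xi>) = c"
proof -
  show "cmod (of_real (1 - c) * \<xi>) = 1 - c" using assms x unfolding norm_mult norm_of_real by simp
  have "of_real (1 - c) * \<xi> - \<xi> = - (of_real c * \<xi>)" by (simp add: algebra_simps)
  then show "cmod (of_real (1 - c) * \<xi> - \<xi>) = c" using assms x by (simp add: norm_mult)
qed

lemma power_le_exp:
  assumes "A / real n \<le> 1 - t" "0 \<le> t" "n > 0" shows "t ^ n \<le> exp (- A)"
proof -
  have "t \<le> exp (- (A / real n))" using exp_ge_add_one_self[of "- (A / real n)"] assms(1) by linarith
  then have "t ^ n \<le> exp (- (A / real n)) ^ n" using assms(2) by (intro power_mono)
  also have "\<dots> = exp (- A)" using assms(3) by (simp flip: exp_of_nat_mult)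
  finally show ?thesis .
qed

text \<open>At depth \<open>A / n\<close> the previous bound gives \<open>- ln \<bar>Y n\<bar>\<close> of the
  order of \<open>exp (- A)\<close>. From there Harnack's inequality descends to depth \<open>\<eta>
  / n\<close> at the price of a factor of the order of \<open>(1 + C + A / \<eta>)\<^sup>2\<close>,
  which is polynomial in \<open>A\<close> and therefore beaten by \<open>exp (- A)\<close>.\<close>

lemma Y_near_1:
  assumes C: "C \<ge> 1" and \<eta>: "\<eta> > 0" and e: "0 < e" "e \<le> 1"
  obtains N r where "0 < r" "\<And>n z. n \<ge> N \<Longrightarrow> z \<in> ntr C \<xi> \<Longrightarrow> cmod (z - \<xi>) < r \<Longrightarrow> \<eta> / real n \<le> 1 - cmod z \<Longrightarrow> cmod (Y n z) \<ge> 1 - e"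
proof -
  define K where "K A = (1 + C + A / \<eta>)^2" for A
  have "((\<lambda>A. exp (- A) * (8 * K A)) \<longlongrightarrow> 0) at_top" unfolding K_def using \<eta> C by real_asymp
  then have "\<forall>\<^sub>F A in at_top. exp (- A) * (8 * K A) < e / 2" using e by (intro order_tendstoD) auto
  then have "\<forall>\<^sub>F A in at_top. 1 \<le> A \<and> exp (- A) * (8 * K A) < e / 2" by (intro eventually_conj eventually_ge_at_top)
  then obtain A where A: "A \<ge> 1" "exp (- A) * (8 * K A) < e / 2" using eventually_happens'[OF trivial_limit_at_top_linorder] by blast
  have K1: "K A \<ge> 1" unfolding K_def using C A \<eta> by (intro one_le_power) auto
  \<comment> \<open>Both sources of error, \<open>exp (- A)\<close> and \<open>e'\<close>, contribute at most \<open>e / 4\<close> each after Harnack.\<close>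
  define e' where "e' = e / 2 / (8 * K A)"
  have e': "e' > 0" "e' * (8 * K A) = e / 2" "e' \<le> e / 16" using K1 e by (auto simp: e'_def field_simps)
  have Ae: "exp (- A) \<le> e / 16"
  proof -
    have "exp (- A) * 8 \<le> exp (- A) * (8 * K A)" using K1 by (intro mult_left_mono) auto
    then show ?thesis using A by linarith
  qed
  obtain N r where Nr: "0 < r" "\<And>n z. n \<ge> N \<Longrightarrow> z \<in> ntr C \<xi> \<Longrightarrow> cmod (z - \<xi>) < r \<Longrightarrow> cmod (Y n z) \<ge> 1 - e' - cmod z ^ n"
    by (rule Y_lower[OF order_trans[OF zero_le_one C] e'(1)], rule that)
  obtain M where M: "real M > A + A / r" using reals_Archimedean2 by blast
  show ?thesis
  proof (rule that[OF Nr(1), of "max N M"])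
    fix n z assume n: "n \<ge> max N M" and z: "z \<in> ntr C \<xi>" and d: "cmod (z - \<xi>) < r" and dep: "\<eta> / real n \<le> 1 - cmod z"
    have z1: "cmod z < 1" and zC: "cmod (z - \<xi>) \<le> C * (1 - cmod z)" using z by (auto simp: ntr_def)
    have nM: "real n > A + A / r" using M n by linarith
    have Ar: "A / r > 0" using A Nr(1) by simp
    have n0: "real n > 0" using nM Ar A by linarith
    have An: "A / real n \<le> 1" "A / real n < r" "A / real n > 0"
    proof -
      have "A / r < real n" "A \<le> real n" using nM Ar A by linarith+
      then show "A / real n \<le> 1" "A / real n < r" "A / real n > 0" using n0 Nr(1) A by (auto simp: field_simps)
    qed
    show "cmod (Y n z) \<ge> 1 - e"
    proof (cases "A / real n \<le> 1 - cmod z")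
      case True
      then have "cmod z ^ n \<le> exp (- A)" using n0 by (intro power_le_exp) auto
      then show ?thesis using Nr(2)[OF _ z d] n e'(3) Ae e by fastforce
    next
      case False
      define u where "u = of_real (1 - A / real n) * \<xi>"
      have u: "cmod u = 1 - A / real n" "cmod (u - \<xi>) = A / real n" unfolding u_def using radial_point[of "A / real n"] An by auto
      have un: "u \<in> ntr C \<xi>" using u An mult_right_mono[OF C, of "A / real n"] by (simp add: ntr_def)
      define s where "s = e' + exp (- A)"
      have s: "s > 0" "s \<le> 1 / 8" using e' Ae e by (auto simp: s_def add_pos_pos)
      have "cmod u ^ n \<le> exp (- A)" using n0 u An by (intro power_le_exp) auto
      then have Yu: "cmod (Y n u) \<ge> 1 - s" using Nr(2)[OF _ un] n u An by (fastforce simp: s_def)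
      obtain L where L: "L holomorphic_on ball 0 1" "\<And>z. cmod z < 1 \<Longrightarrow> Y n z = exp (L z)" "\<And>z. cmod z < 1 \<Longrightarrow> Re (L z) = ln (cmod (Y n z))"
        by (rule ball_holomorphic_log[OF Y_hol[of n] Y_nz], assumption, rule that)
      have "- ln (cmod (Y n u)) = ln (1 / cmod (Y n u))" using Yu s by (simp add: ln_div)
      also have "\<dots> \<le> 1 / cmod (Y n u) - 1" using Yu s by (intro ln_le_minus_one) auto
      also have "\<dots> \<le> 1 / (1 - s) - 1" using Yu s by (simp add: frac_le)
      also have "\<dots> \<le> 2 * s" using s by (simp add: field_simps)
      finally have Lu: "- ln (cmod (Y n u)) \<le> 2 * s" .
      have h: "- ln (cmod (Y n z)) \<le> (1 - (cmod z)^2) / (1 - (cmod u)^2) * (1 + cmod (z - u) / (1 - cmod z))^2 * - ln (cmod (Y n u))"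
      proof -
        have u1: "cmod u < 1" using u An by simp
        have "0 \<le> Re (- L y)" if "cmod y < 1" for y using L(3)[OF that] Y_le_1[OF that, of n] Y_nz[OF that, of n] by simp
        from harnack[OF holomorphic_on_minus[OF L(1)] this z1 u1] show ?thesis by (simp add: L(3) z1 u1)
      qed
      have a: "(1 - (cmod z)^2) / (1 - (cmod u)^2) \<le> 2"
      proof -
        have "1 - (cmod z)^2 = (1 - cmod z) * (1 + cmod z)" by (simp add: power2_eq_square algebra_simps)
        also have "\<dots> \<le> A / real n * 2" using False z1 by (intro mult_mono) auto
        finally have 1: "1 - (cmod z)^2 \<le> 2 * (A / real n)" by (simp add: mult.commute)
        have "(cmod u)^2 \<le> cmod u * 1" unfolding power2_eq_square using u An by (intro mult_left_mono) auto
        then have 2: "1 - (cmod u)^2 \<ge> A / real n" using u by simp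
        then have "1 - (cmod u)^2 > 0" using An by linarith
        then show ?thesis unfolding pos_divide_le_eq[OF \<open>1 - (cmod u)^2 > 0\<close>] by (intro order_trans[OF 1 mult_left_mono[OF 2]]) simp
      qed
      have "cmod (z - u) \<le> C * (1 - cmod z) + A / real n" using norm_triangle_ineq4[of "z - \<xi>" "u - \<xi>"] zC u by simp
      also have "A / real n = A / \<eta> * (\<eta> / real n)" using \<eta> by simp
      also have "\<dots> \<le> A / \<eta> * (1 - cmod z)" using dep A \<eta> by (intro mult_left_mono) auto
      finally have "cmod (z - u) / (1 - cmod z) \<le> C + A / \<eta>" using z1 by (simp add: divide_le_eq distrib_right)
      then have b: "(1 + cmod (z - u) / (1 - cmod z))^2 \<le> K A" unfolding K_def using z1 by (intro power_mono) auto
      have Y1: "0 \<le> - ln (cmod (Y n u))" using Y_le_1[of u n] Y_nz[of u n] u An by simp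
      have "- ln (cmod (Y n z)) \<le> 2 * K A * (2 * s)" by (rule order_trans[OF h]) (intro mult_mono a b Lu Y1, use K1 in auto)
      also have "\<dots> \<le> e / 2" using e' A by (simp add: s_def algebra_simps)
      finally have "ln (cmod (Y n z)) \<ge> - e / 2" by simp
      then have "cmod (Y n z) \<ge> exp (- e / 2)" using Y_nz[OF z1, of n] by (simp add: ln_ge_iff)
      then show ?thesis using exp_ge_add_one_self[of "- e / 2"] e by linarith
    qed
  qed
qed

text \<open>Near \<open>\<xi>\<close> this follows from the lower bound for \<open>\<bar>Y n\<bar>\<close>;
  points of the region at a distance from \<open>\<xi>\<close> stay in a compact part of the disc,
  where \<open>f n\<close> tends to \<open>0\<close> uniformly.\<close>

lemma f_small_deep:
  assumes C: "C \<ge> 0" and \<eta>: "\<eta> > 0" and e: "e > 0"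
  obtains N where "\<And>n z. n \<ge> N \<Longrightarrow> z \<in> ntr C \<xi> \<Longrightarrow> \<eta> / real n \<le> 1 - cmod z \<Longrightarrow> cmod (f n z) \<le> e"
proof -
  \<comment> \<open>\<open>\<bar>Y n\<bar> \<ge> 1 - \<tau>\<close> gives \<open>\<bar>z * f n\<bar>\<^sup>2 \<le> 2 * \<tau> \<le> (e / 2)\<^sup>2\<close>; the rest is \<open>\<bar>z\<bar> \<ge> 1 / 2\<close>.\<close>
  define \<tau> where "\<tau> = min 1 (e^2 / 8)"
  have \<tau>: "0 < \<tau>" "\<tau> \<le> 1" "8 * \<tau> \<le> e^2" using e by (auto simp: \<tau>_def)
  have C1: "C + 1 \<ge> 1" using C by simp
  obtain r N where Nr: "0 < r" "\<And>n z. n \<ge> N \<Longrightarrow> z \<in> ntr (C+1) \<xi> \<Longrightarrow> cmod (z - \<xi>) < r \<Longrightarrow> \<eta> / real n \<le> 1 - cmod z \<Longrightarrow> cmod (Y n z) \<ge> 1 - \<tau>"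
    by (rule Y_near_1[OF C1 \<eta> \<tau>(1,2)], rule that)
  define r' where "r' = min r (1/2)"
  have r': "0 < r'" "r' \<le> r" "r' \<le> 1/2" using Nr(1) by (auto simp: r'_def)
  have \<rho>: "0 < 1 - r' / (C + 1)" "1 - r' / (C + 1) < 1" using r' C by (auto simp: field_simps)
  obtain M where M: "\<And>n z. n \<ge> M \<Longrightarrow> cmod z \<le> 1 - r' / (C + 1) \<Longrightarrow> cmod (f n z) \<le> e"
    using f_unif[OF \<rho> e] by (auto simp: eventually_sequentially)
  show ?thesis
  proof (rule that[of "max N M"])
    fix n z assume n: "n \<ge> max N M" and z: "z \<in> ntr C \<xi>" and dep: "\<eta> / real n \<le> 1 - cmod z"
    have z1: "cmod z < 1" and zC: "cmod (z - \<xi>) \<le> C * (1 - cmod z)" using z by (auto simp: ntr_def)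
    have zC1: "cmod (z - \<xi>) \<le> (C + 1) * (1 - cmod z)" using zC z1 by (simp add: distrib_right)
    show "cmod (f n z) \<le> e"
    proof (cases "cmod (z - \<xi>) < r'")
      case True
      have "cmod (Y n z) \<ge> 1 - \<tau>" using Nr(2)[of n z] n zC1 z1 True r' dep by (simp add: ntr_def)
      then have "(1 - \<tau>)^2 \<le> (cmod (Y n z))^2" using \<tau> by (intro power_mono) auto
      then have "(cmod (z * f n z))^2 \<le> 1 - (1 - \<tau>)^2" using Y_le[OF z1, of n] by linarith
      also have "\<dots> \<le> 2 * \<tau>" by (simp add: power2_diff)
      also have "\<dots> \<le> (e / 2)^2" using \<tau> by (simp add: power_divide)
      finally have "cmod (z * f n z) \<le> e / 2" by (rule power2_le_imp_le) (use e in simp)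
      moreover have "1 / 2 * cmod (f n z) \<le> cmod (z * f n z)"
      proof -
        have "1 / 2 \<le> cmod z" using True r'(3) x norm_triangle_ineq2[of \<xi> z] unfolding norm_minus_commute[of \<xi> z] by linarith
        then show ?thesis unfolding norm_mult by (intro mult_right_mono) auto
      qed
      ultimately show ?thesis by simp
    next
      case False
      then have "r' / (C + 1) \<le> 1 - cmod z" using zC1 C by (simp add: divide_le_eq mult.commute)
      then show ?thesis using M[of n z] n by simp
    qed
  qed
qed

end

section \<open>Wall polynomials\<close>

lemma linear_factor_radial:
  assumes "0 \<le> r" "r \<le> s" "s \<le> 1" and y: "cmod y \<ge> 1" and u: "cmod u = 1"
  shows "cmod (of_real s * u - y) \<le> (1 + s) / (1 + r) * cmod (of_real r * u - y)"
proof -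
  define v where "v = y * cnj u"
  have v1: "cmod v \<ge> 1" using y u by (simp add: v_def norm_mult)
  have red: "cmod (of_real t * u - y) = cmod (of_real t - v)" for t
  proof -
    have "of_real t - v = (of_real t * u - y) * cnj u" using circle_cnj_mult[OF u] by (simp add: v_def algebra_simps)
    then show ?thesis using u by (simp add: norm_mult)
  qed
  define q where "q = (cmod v)^2"
  have "cmod v * 1 \<le> cmod v * cmod v" using v1 by (intro mult_left_mono) auto
  then have q1: "q \<ge> 1" "- Re v \<le> q" using v1 abs_Re_le_cmod[of v] by (auto simp: q_def power2_eq_square)
  have sq: "(cmod (of_real t - v))^2 = t^2 - 2 * t * Re v + q" for t
    unfolding q_def cmod_power2 by (simp add: power2_eq_square algebra_simps)
  have rs: "r * s \<le> 1" using assms by (simp add: mult_le_one)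
  have "(1 + s)^2 * (r^2 - 2 * r * Re v + q) - (1 + r)^2 * (s^2 - 2 * s * Re v + q)
    = (s - r) * ((q - 1) * (r + s + 2 * (r * s)) + 2 * (1 - r * s) * (q + Re v))" by (simp add: power2_eq_square algebra_simps)
  also have "\<dots> \<ge> 0"
  proof -
    have "0 \<le> (q - 1) * (r + s + 2 * (r * s))" "0 \<le> 2 * (1 - r * s) * (q + Re v)"
      using assms(1,2) q1 rs by (intro mult_nonneg_nonneg; simp)+
    then show ?thesis using assms(2) by simp
  qed
  finally have "((1 + r) * cmod (of_real s - v))^2 \<le> ((1 + s) * cmod (of_real r - v))^2" by (simp add: power_mult_distrib sq)
  then have "(1 + r) * cmod (of_real s - v) \<le> (1 + s) * cmod (of_real r - v)" by (rule power2_le_imp_le) (use assms in auto)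
  then show ?thesis unfolding red using assms by (simp add: field_simps)
qed

text \<open>Moving outwards along a radius increases the distance to a point outside the disc by at most the
  factor \<open>(1 + s) / (1 + r)\<close>; multiply over the zeros. For \<open>s - r\<close> of the
  order of \<open>1 / n\<close> the resulting factor is bounded.\<close>

lemma zero_free_poly_radial:
  assumes rs: "0 \<le> r" "r \<le> s" "s \<le> 1" and u: "cmod u = 1"
    and "\<And>y. cmod y < 1 \<Longrightarrow> poly p y \<noteq> 0" and "degree p \<le> n"
  shows "cmod (poly p (of_real s * u)) \<le> ((1 + s) / (1 + r)) ^ n * cmod (poly p (of_real r * u))" using assms(5,6)
proof (induction n arbitrary: p)
  case 0
  then obtain c where "p = [:c:]" by (metis degree_eq_zeroE le_zero_eq)
  then show ?case by simp
next
  case (Suc n)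
  have q1: "(1 + s) / (1 + r) \<ge> 1" using rs by simp
  show ?case
  proof (cases "degree p \<le> n")
    case True
    have "((1 + s) / (1 + r)) ^ n \<le> ((1 + s) / (1 + r)) ^ Suc n" by (rule power_increasing[OF _ q1]) simp
    then show ?thesis using Suc.IH[OF Suc.prems(1) True] by (meson mult_right_mono norm_ge_zero order_trans)
  next
    case False
    then have "\<not> constant (poly p)" by (simp add: constant_degree)
    then obtain y where y: "poly p y = 0" using fundamental_theorem_of_algebra by blast
    then obtain q where q: "p = [:- y, 1:] * q" using poly_eq_0_iff_dvd[of p y] by (auto elim: dvdE)
    have y1: "cmod y \<ge> 1" using Suc.prems(1) y not_le by blast
    have "q \<noteq> 0" using q False by auto
    then have dq: "degree q \<le> n" using Suc.prems(2) degree_mult_eq[of "[:- y, 1:]" q] unfolding q by simp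
    have IH: "cmod (poly q (of_real s * u)) \<le> ((1 + s) / (1 + r)) ^ n * cmod (poly q (of_real r * u))"
      using Suc.prems(1) by (intro Suc.IH dq) (auto simp: q)
    have "cmod (of_real s * u - y) * cmod (poly q (of_real s * u))
      \<le> ((1 + s) / (1 + r) * cmod (of_real r * u - y)) * (((1 + s) / (1 + r)) ^ n * cmod (poly q (of_real r * u)))"
      by (intro mult_mono linear_factor_radial rs y1 u IH) (use rs in auto)
    moreover have "cmod (poly p t) = cmod (t - y) * cmod (poly q t)" for t
      unfolding q norm_mult[symmetric] by (simp add: algebra_simps)
    ultimately show ?thesis by (simp only: power_Suc mult_ac)
  qed
qed

text \<open>Cauchy's estimate for the derivative. The \<open>+ 1\<close> only turns the weak bound on
  \<open>g\<close> into a strict one.\<close>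

lemma entire_lipschitz:
  assumes g: "g holomorphic_on UNIV" and r: "r > 0" and M: "\<And>z. cmod (z - c) \<le> 2 * r \<Longrightarrow> cmod (g z) \<le> M"
    and z: "cmod (z - c) \<le> r" and y: "cmod (y - c) \<le> r"
  shows "cmod (g z - g y) \<le> (M + 1) / r * cmod (z - y)"
proof (rule field_differentiable_bound)
  show "convex (cball c r)" by simp
  show "(g has_field_derivative deriv g t) (at t within cball c r)" for t
    using g by (meson DERIV_subset UNIV_I holomorphic_derivI open_UNIV top_greatest)
  fix t assume t: "t \<in> cball c r"
  have "norm ((deriv ^^ 1) g t) \<le> fact 1 * (M + 1) / r ^ 1"
  proof (rule Cauchy_higher_deriv_bound)
    show "g holomorphic_on ball t r" "continuous_on (cball t r) g" using g
      by (auto intro: holomorphic_on_subset holomorphic_on_imp_continuous_on)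
    fix s assume "s \<in> ball t r"
    then have "dist c s \<le> 2 * r" using t dist_triangle[of c s t] by simp
    then show "g s \<in> ball 0 (M + 1)" using M[of s] by (simp add: dist_norm norm_minus_commute)
  qed (use r in auto)
  then show "norm (deriv g t) \<le> (M + 1) / r" by simp
qed (use z y in \<open>auto simp: dist_norm norm_minus_commute\<close>)

context opuc begin

text \<open>Multiplication of a row vector by the \<open>n\<close> transfer matrices with rows \<open>(z,
  \<gamma> k)\<close> and \<open>(cnj (\<gamma> k) * z, 1)\<close>. The images of the two unit
  vectors are the rows of Wall polynomials (\<open>wall_schur\<close>), while \<open>(z, -1)\<close>
  produces the orthogonal polynomials (\<open>wall_row_Szego\<close>).\<close>

primrec wall_row :: "nat \<Rightarrow> complex \<Rightarrow> complex \<times> complex \<Rightarrow> complex \<times> complex" where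
  "wall_row 0 z v = v"
| "wall_row (Suc n) z v = (z * (fst (wall_row n z v) + cnj (\<gamma> n) * snd (wall_row n z v)), \<gamma> n * fst (wall_row n z v) + snd (wall_row n z v))"

abbreviation "wa n z \<equiv> fst (wall_row n z (1, 0))"
abbreviation "wA n z \<equiv> snd (wall_row n z (1, 0))"
abbreviation "wb n z \<equiv> fst (wall_row n z (0, 1))"
abbreviation "wB n z \<equiv> snd (wall_row n z (0, 1))"
abbreviation "walls_le n z K \<equiv> cmod (wa n z) \<le> K \<and> cmod (wb n z) \<le> K \<and> cmod (wA n z) \<le> K \<and> cmod (wB n z) \<le> K"

lemma wall_row_linear: "fst (wall_row n z (s, t)) = s * wa n z + t * wb n z \<and> snd (wall_row n z (s, t)) = s * wA n z + t * wB n z"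
  by (induction n) (simp_all add: algebra_simps)

lemma wall_row_poly: "\<exists>p q. degree p \<le> n \<and> degree q \<le> n \<and> (\<forall>z. wall_row n z v = (poly p z, poly q z))"
proof (induction n)
  case 0 show ?case by (intro exI[of _ "[:fst v:]"] exI[of _ "[:snd v:]"]) simp
next
  case (Suc n)
  then obtain p q where pq: "degree p \<le> n" "degree q \<le> n" "\<And>z. wall_row n z v = (poly p z, poly q z)" by blast
  have "degree (p + smult (cnj (\<gamma> n)) q) \<le> n" using pq degree_smult_le[of "cnj (\<gamma> n)" q] by (intro degree_add_le) auto
  then have "degree (pCons 0 (p + smult (cnj (\<gamma> n)) q)) \<le> Suc n" by (meson degree_pCons_le le_trans Suc_le_mono)
  moreover have "degree (smult (\<gamma> n) p + q) \<le> Suc n" using pq degree_smult_le[of "\<gamma> n" p] by (intro degree_add_le) auto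
  ultimately show ?case
    by (intro exI[of _ "pCons 0 (p + smult (cnj (\<gamma> n)) q)"] exI[of _ "smult (\<gamma> n) p + q"]) (simp add: pq(3))
qed

lemma wall_row_entire: "(\<lambda>z. fst (wall_row n z v)) holomorphic_on UNIV" "(\<lambda>z. snd (wall_row n z v)) holomorphic_on UNIV"
  by (induction n) (auto intro!: holomorphic_intros)

lemma wall_row_Szego: "wall_row n z (z, -1) = (z * Ph n z, - Ps n z)"
  by (induction n) (simp_all add: Ph_0 Ps_0 Ph_Suc Ps_Suc algebra_simps)

lemma Ps_wall: "Ps n z = wB n z - z * wA n z"
  using wall_row_linear[of n z z "-1"] by (simp add: wall_row_Szego) (metis minus_minus minus_diff_eq)

lemma wall_det: "wa n z * wB n z - wA n z * wb n z = z ^ n * of_real (Cn n)"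
proof (induction n)
  case (Suc n)
  have g: "complex_of_real ((cmod (\<gamma> n))^2) = \<gamma> n * cnj (\<gamma> n)" by (rule complex_norm_square)
  have "wa (Suc n) z * wB (Suc n) z - wA (Suc n) z * wb (Suc n) z
    = z * (1 - \<gamma> n * cnj (\<gamma> n)) * (wa n z * wB n z - wA n z * wb n z)" by (simp add: algebra_simps)
  moreover have "complex_of_real (Cn (Suc n)) = of_real (Cn n) * (1 - \<gamma> n * cnj (\<gamma> n))"
    unfolding Cn_Suc of_real_mult of_real_diff of_real_1 g ..
  ultimately show ?case unfolding Suc power_Suc by (simp only: mult_ac)
qed simp

lemma wall_reflect:
  assumes z: "z \<noteq> 0"
  shows "wa n z = z ^ n * cnj (wB n (inverse (cnj z))) \<and> wb n z = z ^ n * cnj (wA n (inverse (cnj z)))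
    \<and> wA n z = z ^ n * cnj (wb n (inverse (cnj z))) \<and> wB n z = z ^ n * cnj (wa n (inverse (cnj z)))"
proof (induction n)
  case (Suc n)
  have zi: "z * (inverse z * y) = y" for y using z by simp
  show ?case using Suc by (simp add: distrib_left distrib_right mult_ac zi)
qed simp

text \<open>The transfer matrices multiply the form \<open>\<bar>y\<bar>\<^sup>2 -
  \<bar>x\<bar>\<^sup>2\<close> by \<open>1 - \<bar>\<gamma> k\<bar>\<^sup>2\<close> on the circle,
  and increase it further inside.\<close>

lemma wall_row_energy:
  assumes z: "cmod z \<le> 1"
  shows "(cmod (snd (wall_row n z v)))^2 - (cmod (fst (wall_row n z v)))^2 \<ge> Cn n * ((cmod (snd v))^2 - (cmod (fst v))^2)"
proof (induction n)
  case (Suc n)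
  let ?x = "fst (wall_row n z v)" and ?y = "snd (wall_row n z v)"
  have "cmod (z * (?x + cnj (\<gamma> n) * ?y)) \<le> 1 * cmod (?x + cnj (\<gamma> n) * ?y)"
    unfolding norm_mult[of z] by (intro mult_right_mono z) auto
  then have "(cmod (z * (?x + cnj (\<gamma> n) * ?y)))^2 \<le> (cmod (?x + cnj (\<gamma> n) * ?y))^2" by (intro power_mono) auto
  moreover have "(cmod (\<gamma> n * ?x + ?y))^2 - (cmod (?x + cnj (\<gamma> n) * ?y))^2 = (1 - (cmod (\<gamma> n))^2) * ((cmod ?y)^2 - (cmod ?x)^2)"
    unfolding cmod_power2 by (simp add: power2_eq_square algebra_simps)
  moreover have "(1 - (cmod (\<gamma> n))^2) * (Cn n * ((cmod (snd v))^2 - (cmod (fst v))^2)) \<le> (1 - (cmod (\<gamma> n))^2) * ((cmod ?y)^2 - (cmod ?x)^2)"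
    using gamma2(1)[of n] by (intro mult_left_mono Suc) auto
  moreover have "Cn (Suc n) * ((cmod (snd v))^2 - (cmod (fst v))^2) = (1 - (cmod (\<gamma> n))^2) * (Cn n * ((cmod (snd v))^2 - (cmod (fst v))^2))" by (simp add: Cn_Suc)
  ultimately show ?case unfolding wall_row.simps fst_conv snd_conv by linarith
qed simp

text \<open>All four bounds are instances of the energy inequality. For \<open>\<bar>wA\<bar> \<le>
  \<bar>wB\<bar>\<close> it is applied to the row \<open>(1, - wA / wB)\<close>, whose second
  component is mapped to \<open>0\<close>.\<close>

lemma wall_bounds:
  assumes z: "cmod z \<le> 1"
  shows "sqrt (Cn n) \<le> cmod (wB n z)" "cmod (wb n z) < cmod (wB n z)" "cmod (wA n z) \<le> cmod (wB n z)" "cmod (wa n z) \<le> 2 * cmod (wB n z)"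
proof -
  have B: "(cmod (wB n z))^2 - (cmod (wb n z))^2 \<ge> Cn n" using wall_row_energy[OF z, of n "(0, 1)"] by simp
  then have CB: "Cn n \<le> (cmod (wB n z))^2" using zero_le_power2[of "cmod (wb n z)"] by linarith
  then show "sqrt (Cn n) \<le> cmod (wB n z)" by (simp add: real_le_lsqrt)
  have "(cmod (wb n z))^2 < (cmod (wB n z))\<^sup>2" using B Cn_pos[of n] by linarith
  then show "cmod (wb n z) < cmod (wB n z)" by (rule power2_less_imp_less) simp
  have B0: "wB n z \<noteq> 0" using CB Cn_pos[of n] by auto
  show AB: "cmod (wA n z) \<le> cmod (wB n z)"
  proof (rule ccontr)
    assume "\<not> ?thesis"
    then have l: "cmod (wA n z / wB n z) > 1" using B0 by (simp add: norm_divide)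
    have 0: "snd (wall_row n z (1, - (wA n z / wB n z))) = 0" using wall_row_linear[of n z 1 "- (wA n z / wB n z)"] B0 by simp
    have "0 \<ge> Cn n * ((cmod (wA n z / wB n z))^2 - 1)"
    proof -
      have "Cn n * ((cmod (wA n z / wB n z))^2 - 1) \<le> 0 - (cmod (fst (wall_row n z (1, - (wA n z / wB n z)))))^2"
        using wall_row_energy[OF z, of n "(1, - (wA n z / wB n z))"] unfolding 0 fst_conv snd_conv norm_minus_cancel norm_one norm_zero one_power2 zero_power2 .
      then show ?thesis using zero_le_power2[of "cmod (fst (wall_row n z (1, - (wA n z / wB n z))))"] by linarith
    qed
    moreover have "(cmod (wA n z / wB n z))^2 > 1" using l by (intro one_less_power) auto
    ultimately show False using mult_pos_pos[OF Cn_pos[of n], of "(cmod (wA n z / wB n z))^2 - 1"] by linarith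
  qed
  have "(cmod (wa n z))^2 \<le> (cmod (wA n z))^2 + Cn n" using wall_row_energy[OF z, of n "(1, 0)"] by simp
  also have "\<dots> \<le> (cmod (wB n z))^2 + (cmod (wB n z))^2" using AB CB by (intro add_mono power_mono) auto
  also have "\<dots> \<le> (2 * cmod (wB n z))^2" by (simp add: power_mult_distrib)
  finally show "cmod (wa n z) \<le> 2 * cmod (wB n z)" by (rule power2_le_imp_le) simp
qed

end

context opuc_iterates begin

text \<open>The Schur algorithm read backwards: \<open>f k\<close> is the image of \<open>f (Suc k)\<close>
  under the \<open>k\<close>-th transfer matrix.\<close>

lemma wall_schur:
  assumes z: "cmod z < 1"
  shows "f 0 z * (wb n z * f n z + wB n z) = wa n z * f n z + wA n z"
proof (induction n)
  case (Suc n)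
  define g where "g = f (Suc n) z"
  define c where "c = 1 - cnj (\<gamma> n) * f n z"
  have s: "z * g * c = f n z - \<gamma> n" "c \<noteq> 0" unfolding g_def c_def by (rule f_step[OF z])+
  have k: "c * (z * g * x + \<gamma> n * x + y + z * g * cnj (\<gamma> n) * y) = (1 - \<gamma> n * cnj (\<gamma> n)) * (x * f n z + y)" for x y
  proof -
    have "c * (z * g * x + \<gamma> n * x + y + z * g * cnj (\<gamma> n) * y) = (z * g * c) * (x + cnj (\<gamma> n) * y) + c * (\<gamma> n * x + y)"
      by (simp add: algebra_simps)
    also have "\<dots> = (1 - \<gamma> n * cnj (\<gamma> n)) * (x * f n z + y)" unfolding s(1) by (simp add: c_def algebra_simps)
    finally show ?thesis .
  qed
  have e: "fst (wall_row (Suc n) z v) * g + snd (wall_row (Suc n) z v)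
     = (1 - \<gamma> n * cnj (\<gamma> n)) / c * (fst (wall_row n z v) * f n z + snd (wall_row n z v))" for v
    using k[of "fst (wall_row n z v)" "snd (wall_row n z v)"] s(2) by (simp add: field_simps)
  have "f 0 z * (fst (wall_row (Suc n) z (0, 1)) * g + snd (wall_row (Suc n) z (0, 1))) = fst (wall_row (Suc n) z (1, 0)) * g + snd (wall_row (Suc n) z (1, 0))"
    unfolding e mult.left_commute[of "f 0 z"] Suc ..
  then show ?case unfolding g_def .
qed simp

end

context good_point begin

section \<open>The scale 1/n and below\<close>

text \<open>\<open>ps n\<close> is close to \<open>1 / D\<close>, and \<open>D\<close> is close to \<open>d
  \<xi> \<noteq> 0\<close>.\<close>

lemma Ps_near_bound:
  assumes C: "C \<ge> 0"
  obtains N r where "0 < r" "\<And>n z. n \<ge> N \<Longrightarrow> z \<in> ntr C \<xi> \<Longrightarrow> cmod (z - \<xi>) < r \<Longrightarrow> cmod (Ps n z) \<le> 4 / cmod (d \<xi>)"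
proof -
  have d2: "cmod (d \<xi>) / 2 > 0" using d0 by simp
  obtain N where N: "\<And>n z. n \<ge> N \<Longrightarrow> z \<in> ntr C \<xi> \<Longrightarrow> cmod (ps n z * D z - 1) \<le> 1"
    by (rule ps_D_unif[OF C zero_less_one], rule that)
  obtain r where r: "r > 0" "\<And>z. z \<in> ntr C \<xi> \<Longrightarrow> cmod (z - \<xi>) < r \<Longrightarrow> cmod (D z - d \<xi>) < cmod (d \<xi>) / 2"
    using near[OF D_lim[rule_format, OF C] d2] by blast
  show ?thesis
  proof (rule that[OF r(1)])
    fix n z assume n: "n \<ge> N" and z: "z \<in> ntr C \<xi>" and d: "cmod (z - \<xi>) < r"
    have D: "cmod (D z) \<ge> cmod (d \<xi>) / 2" using r(2)[OF z d] norm_triangle_ineq2[of "d \<xi>" "D z"] by (simp add: norm_minus_commute)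
    have Cn1: "sqrt (Cn n) \<le> 1" by (induction n) (auto intro: order_trans[OF Cn_antimono])
    have "cmod (Ps n z) * (cmod (d \<xi>) / 2) \<le> cmod (Ps n z) * cmod (D z)" using D by (rule mult_left_mono) simp
    also have "\<dots> = sqrt (Cn n) * cmod (ps n z * D z)" using Cn_pos[of n] by (simp add: ps_def norm_mult norm_divide)
    also have "\<dots> \<le> 1 * 2"
      using Cn1 N[OF n z] norm_triangle_ineq2[of "ps n z * D z" 1] Cn_pos[of n] by (intro mult_mono) auto
    finally show "cmod (Ps n z) \<le> 4 / cmod (d \<xi>)" using d2 by (simp add: field_simps)
  qed
qed

text \<open>Eliminating \<open>wA\<close> from \<open>Ps n = wB - z * wA\<close> gives \<open>wB * (1 - z * f
  0)\<close> up to terms that carry the small factor \<open>f n\<close>. As \<open>\<bar>f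
  0\<bar>\<close> stays below a constant less than \<open>1\<close> near \<open>\<xi>\<close>,
  \<open>wB\<close> is at most a constant times \<open>Ps n\<close>.\<close>

lemma wB_bound_deep:
  assumes C: "C \<ge> 0"
  obtains M N r where "0 < M" "0 < r" "\<And>n z. n \<ge> N \<Longrightarrow> z \<in> ntr C \<xi> \<Longrightarrow> cmod (z - \<xi>) < r \<Longrightarrow> 1 / real n \<le> 1 - cmod z \<Longrightarrow> cmod (wB n z) \<le> M"
proof -
  \<comment> \<open>For \<open>\<bar>f 0\<bar> \<le> 1 - \<kappa> / 2\<close> and \<open>\<bar>f n\<bar> \<le> \<kappa> / 12\<close> all terms but \<open>Ps n\<close> sum to at most \<open>(1 - \<kappa> / 4) * \<bar>wB\<bar>\<close>.\<close>
  define \<kappa> where "\<kappa> = 1 - cmod (f0b \<xi>)"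
  have \<kappa>: "\<kappa> > 0" "\<kappa> / 2 > 0" "\<kappa> / 12 > 0" using fb1 by (auto simp: \<kappa>_def)
  obtain r1 where r1: "r1 > 0" "\<And>z. z \<in> ntr C \<xi> \<Longrightarrow> cmod (z - \<xi>) < r1 \<Longrightarrow> cmod (f 0 z - f0b \<xi>) < \<kappa> / 2"
    using near[OF f0_lim[rule_format, OF C] \<kappa>(2)] by blast
  obtain N2 r2 where Pb: "r2 > 0" "\<And>n z. n \<ge> N2 \<Longrightarrow> z \<in> ntr C \<xi> \<Longrightarrow> cmod (z - \<xi>) < r2 \<Longrightarrow> cmod (Ps n z) \<le> 4 / cmod (d \<xi>)"
    by (rule Ps_near_bound[OF C], rule that)
  obtain N3 where 3: "\<And>n z. n \<ge> N3 \<Longrightarrow> z \<in> ntr C \<xi> \<Longrightarrow> 1 / real n \<le> 1 - cmod z \<Longrightarrow> cmod (f n z) \<le> \<kappa> / 12"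
    by (rule f_small_deep[OF C zero_less_one \<kappa>(3)], rule that)
  show ?thesis
  proof (rule that[of "16 / (cmod (d \<xi>) * \<kappa>)" "min r1 r2" "max N2 N3"])
    fix n z assume n: "n \<ge> max N2 N3" and z: "z \<in> ntr C \<xi>" and zr: "cmod (z - \<xi>) < min r1 r2" and dep: "1 / real n \<le> 1 - cmod z"
    have z1: "cmod z < 1" using z by (simp add: ntr_def)
    have "cmod (f 0 z - f0b \<xi>) < \<kappa> / 2" using r1(2)[OF z] zr by simp
    then have f0: "cmod (f 0 z) \<le> 1 - \<kappa> / 2" using norm_triangle_ineq2[of "f 0 z" "f0b \<xi>"] unfolding \<kappa>_def by argo
    have fn: "cmod (f n z) \<le> \<kappa> / 12" using 3[OF _ z dep] n by simp
    have "f 0 z * (wb n z * f n z + wB n z) - wa n z * f n z = wA n z" using wall_schur[OF z1, of n] by simp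
    then have "Ps n z = wB n z - z * (f 0 z * (wb n z * f n z + wB n z) - wa n z * f n z)" by (simp add: Ps_wall)
    then have B: "wB n z = Ps n z + z * (f 0 z * wB n z + f n z * (f 0 z * wb n z - wa n z))" by (simp add: algebra_simps)
    have "cmod (f 0 z * wb n z) \<le> 1 * cmod (wB n z)"
      unfolding norm_mult using f_le[OF z1] wall_bounds(2)[of z n] z1 by (intro mult_mono) auto
    then have "cmod (f 0 z * wb n z - wa n z) \<le> 3 * cmod (wB n z)"
      using norm_triangle_ineq4[of "f 0 z * wb n z" "wa n z"] wall_bounds(4)[of z n] z1 by simp
    then have 1: "cmod (f n z * (f 0 z * wb n z - wa n z)) \<le> \<kappa> / 12 * (3 * cmod (wB n z))"
      unfolding norm_mult[of "f n z"] using fn \<kappa> by (intro mult_mono) auto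
    have 2: "cmod (f 0 z * wB n z) \<le> (1 - \<kappa> / 2) * cmod (wB n z)" unfolding norm_mult using f0 by (rule mult_right_mono) simp
    have "cmod (z * (f 0 z * wB n z + f n z * (f 0 z * wb n z - wa n z))) \<le> 1 * cmod (f 0 z * wB n z + f n z * (f 0 z * wb n z - wa n z))"
      unfolding norm_mult[of z] using z1 by (intro mult_right_mono) auto
    also have "\<dots> \<le> (1 - \<kappa> / 4) * cmod (wB n z)"
      using 1 2 norm_triangle_ineq[of "f 0 z * wB n z" "f n z * (f 0 z * wb n z - wa n z)"] by (simp add: algebra_simps)
    finally have "cmod (wB n z) \<le> cmod (Ps n z) + (1 - \<kappa> / 4) * cmod (wB n z)"
      using norm_triangle_ineq[of "Ps n z" "z * (f 0 z * wB n z + f n z * (f 0 z * wb n z - wa n z))"] unfolding B[symmetric] by linarith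
    then have "\<kappa> / 4 * cmod (wB n z) \<le> 4 / cmod (d \<xi>)" using Pb(2)[OF _ z, of n] zr n by (simp add: algebra_simps)
    then show "cmod (wB n z) \<le> 16 / (cmod (d \<xi>) * \<kappa>)" using \<kappa> d0 by (simp add: field_simps)
  qed (use \<kappa> d0 r1 Pb in auto)
qed

lemma reflect_dist: "z \<noteq> 0 \<Longrightarrow> cmod (inverse (cnj z) - \<xi>) = cmod (z - \<xi>) / cmod z"
proof -
  assume z: "z \<noteq> 0"
  have "cnj z * (inverse (cnj z) - \<xi>) = \<xi> * cnj (\<xi> - z)" using z circle_cnj_mult[OF x] by (simp add: algebra_simps)
  then have "cmod z * cmod (inverse (cnj z) - \<xi>) = cmod (z - \<xi>)"
    by (metis complex_mod_cnj mult_1 norm_minus_commute norm_mult x)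
  then show ?thesis using z by (simp add: field_simps)
qed

text \<open>In the closed disc, a point too close to the circle is compared with the point at depth \<open>1 /
  n\<close> on the same radius, which lies in a nontangential region of aperture \<open>R +
  1\<close>. Outside the disc the polynomials are the reflections of one another.\<close>

lemma wall_local_bound:
  assumes R: "R > 0"
  obtains M N where "0 < M" "\<And>n z. n \<ge> N \<Longrightarrow> cmod (z - \<xi>) \<le> R / real n \<Longrightarrow>
    walls_le n z M"
proof -
  have R1: "R + 1 \<ge> 0" using R by simp
  obtain M0 N0 r0 where 0: "0 < M0" "0 < r0" "\<And>n z. n \<ge> N0 \<Longrightarrow> z \<in> ntr (R+1) \<xi> \<Longrightarrow> cmod (z - \<xi>) < r0 \<Longrightarrow> 1 / real n \<le> 1 - cmod z \<Longrightarrow> cmod (wB n z) \<le> M0"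
    by (rule wB_bound_deep[OF R1], rule that)
  obtain N1 where N1: "real N1 > R + 1 + (R + 1) / r0" using reals_Archimedean2 by blast
  define M1 where "M1 = exp 1 * M0"
  have M1: "M1 > 0" "M0 \<le> M1" using 0(1) mult_right_mono[of 1 "exp 1" M0] by (auto simp: M1_def)
  have disc: "cmod (wB n z) \<le> M1" if n: "n \<ge> max N0 N1" and z: "cmod z \<le> 1" and zR: "cmod (z - \<xi>) \<le> R / real n" for n z
  proof -
    have "real n \<ge> real N1" using n by simp
    moreover have "(R + 1) / r0 > 0" using R 0 by simp
    ultimately have nn: "real n > R + 1" "real n > (R + 1) / r0" using N1 R by linarith+
    then have n0: "real n > 1" "(R + 1) / real n < r0" using R 0(2) by (auto simp: field_simps)
    have deep: "cmod (wB n y) \<le> M0" if "1 / real n \<le> 1 - cmod y" "cmod (y - \<xi>) \<le> (R + 1) / real n" for y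
    proof (rule 0(3))
      have "(R + 1) * (1 / real n) \<le> (R + 1) * (1 - cmod y)" using that R by (intro mult_left_mono) auto
      then have "cmod (y - \<xi>) \<le> (R + 1) * (1 - cmod y)" using that(2) by simp
      moreover have "cmod y < 1" using that(1) n0 by (smt (verit) divide_pos_pos)
      ultimately show "y \<in> ntr (R + 1) \<xi>" by (simp add: ntr_def)
    qed (use n that n0 in auto)
    have RR: "R / real n \<le> (R + 1) / real n" using n0 by (intro divide_right_mono) auto
    show ?thesis
    proof (cases "1 / real n \<le> 1 - cmod z")
      case True
      then show ?thesis using deep[OF True order_trans[OF zR RR]] M1 by simp
    next
      case False
      have i1: "1 / real n < 1" using n0 by simp
      then have z0: "z \<noteq> 0" using False by auto
      define u where "u = z / of_real (cmod z)"
      define r where "r = 1 - 1 / real n"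
      have u: "cmod u = 1" "z = of_real (cmod z) * u" using z0 by (auto simp: u_def norm_divide)
      have r: "0 \<le> r" "r \<le> cmod z" using False i1 by (auto simp: r_def)
      have ru: "cmod (of_real r * u) = r" using r u by (simp add: norm_mult)
      have "z - of_real r * u = of_real (cmod z - r) * u" by (subst u(2)) (simp add: algebra_simps)
      then have "cmod (z - of_real r * u) = \<bar>cmod z - r\<bar>" by (metis mult.right_neutral norm_mult norm_of_real u(1))
      then have "cmod (z - of_real r * u) \<le> 1 / real n" using r z by (simp add: r_def)
      then have "cmod (of_real r * u - \<xi>) \<le> R / real n + 1 / real n"
        using norm_triangle_ineq4[of "z - \<xi>" "z - of_real r * u"] zR by simp
      then have Bu: "cmod (wB n (of_real r * u)) \<le> M0" by (intro deep) (simp_all add: ru, simp_all add: r_def add_divide_distrib)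
      obtain p where p: "degree p \<le> n" "\<And>y. wB n y = poly p y" using wall_row_poly[of n "(0, 1)"] by (metis snd_conv)
      have pz: "poly p y \<noteq> 0" if "cmod y < 1" for y
        using wall_bounds(1)[of y n] that Cn_pos[of n] by (auto simp: p(2)[symmetric])
      have q0: "0 \<le> (1 + cmod z) / (1 + r)" using r by simp
      have "(1 + cmod z) / (1 + r) \<le> 1 + 1 / real n"
      proof -
        have "(1 / real n) * (1 / real n) \<le> 1 / real n * 1" using i1 by (intro mult_left_mono) auto
        then have "1 + cmod z \<le> (1 + 1 / real n) * (1 + r)" unfolding r_def using z by (simp add: algebra_simps)
        then show ?thesis using r by (simp add: divide_le_eq)
      qed
      also have "\<dots> \<le> exp (1 / real n)" by (rule exp_ge_add_one_self)
      finally have "((1 + cmod z) / (1 + r)) ^ n \<le> exp (1 / real n) ^ n" using q0 by (intro power_mono)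
      also have "\<dots> = exp 1" using n0 by (simp flip: exp_of_nat_mult)
      finally have q: "((1 + cmod z) / (1 + r)) ^ n \<le> exp 1" .
      have "cmod (wB n z) \<le> ((1 + cmod z) / (1 + r)) ^ n * cmod (wB n (of_real r * u))"
        using zero_free_poly_radial[OF r z u(1) pz p(1)] u(2) by (simp add: p(2))
      also have "\<dots> \<le> exp 1 * M0" using q Bu by (intro mult_mono) auto
      finally show ?thesis by (simp add: M1_def)
    qed
  qed
  have all: "walls_le n z (2 * M1)"
    if "n \<ge> max N0 N1" "cmod z \<le> 1" "cmod (z - \<xi>) \<le> R / real n" for n z
    using disc[OF that] wall_bounds(2-4)[OF that(2), of n] M1 by auto
  have M: "2 * M1 \<le> exp R * (2 * M1)" using R M1 mult_right_mono[of 1 "exp R" "2 * M1"] by simp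
  show ?thesis
  proof (rule that[of "exp R * (2 * M1)" "max 1 (max N0 N1)"])
    fix n z assume n: "n \<ge> max 1 (max N0 N1)" and zR: "cmod (z - \<xi>) \<le> R / real n"
    show "walls_le n z (exp R * (2 * M1))"
    proof (cases "cmod z \<le> 1")
      case True
      then show ?thesis using all[OF _ True zR] n M by (meson max.bounded_iff order_trans)
    next
      case False
      then have z0: "z \<noteq> 0" and z1: "cmod z > 1" by auto
      let ?y = "inverse (cnj z)"
      have y1: "cmod ?y \<le> 1" using z1 by (simp add: norm_inverse inverse_le_1_iff)
      have "cmod (?y - \<xi>) \<le> cmod (z - \<xi>) / 1" unfolding reflect_dist[OF z0] using z1 by (intro divide_left_mono) auto
      then have y2: "cmod (?y - \<xi>) \<le> R / real n" using zR by simp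
      have "cmod z \<le> 1 + R / real n" using norm_triangle_ineq2[of z \<xi>] zR x by simp
      also have "\<dots> \<le> exp (R / real n)" by (rule exp_ge_add_one_self)
      finally have "cmod z ^ n \<le> exp (R / real n) ^ n" by (intro power_mono) auto
      also have "\<dots> = exp R" using n by (simp flip: exp_of_nat_mult)
      finally have zn: "cmod z ^ n \<le> exp R" .
      have red: "cmod (z ^ n * cnj v) \<le> exp R * (2 * M1)" if "cmod v \<le> 2 * M1" for v
        unfolding norm_mult norm_power complex_mod_cnj using zn that by (intro mult_mono) auto
      have b: "walls_le n ?y (2 * M1)" using all[OF _ y1 y2] n by simp
      have e: "wa n z = z ^ n * cnj (wB n ?y)" "wb n z = z ^ n * cnj (wA n ?y)" "wA n z = z ^ n * cnj (wb n ?y)" "wB n z = z ^ n * cnj (wa n ?y)"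
        using wall_reflect[OF z0, of n] by blast+
      show ?thesis unfolding e using b by (intro conjI red) auto
    qed
  qed (use M1 in auto)
qed

lemma wall_quotient:
  assumes z: "cmod z < 1" shows "f n z * (wa n z - f 0 z * wb n z) = f 0 z * wB n z - wA n z"
  using wall_schur[OF z, of n] by (simp add: algebra_simps)

text \<open>It remains to treat depths below \<open>\<eta> / n\<close>. The function \<open>G = f 0 * wB -
  wA\<close> is small at the radial point \<open>y\<close> of depth \<open>\<eta> / n\<close> and
  varies little between \<open>y\<close> and \<open>z\<close>. The determinant identity shows that
  the factor \<open>wa - f 0 * wb\<close>, by which \<open>G\<close> differs from \<open>f
  n\<close>, is bounded below.\<close>

theorem f_small:
  assumes C: "C \<ge> 0" and e: "e > 0"
  obtains N where "\<And>n z. n \<ge> N \<Longrightarrow> z \<in> ntr C \<xi> \<Longrightarrow> cmod (f n z) \<le> e"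
proof -
  obtain M N1 where M: "0 < M" "\<And>n z. n \<ge> N1 \<Longrightarrow> cmod (z - \<xi>) \<le> 2 / real n \<Longrightarrow>
    walls_le n z M" by (rule wall_local_bound[of 2], simp, rule that)
  \<comment> \<open>\<open>Cinf / (4 * M)\<close> is the lower bound for \<open>wa - f 0 * wb\<close> found below.\<close>
  define \<nu> where "\<nu> = min 1 e * (Cinf / (4 * M))"
  have \<nu>: "\<nu> > 0" "\<nu> \<le> e * (Cinf / (4 * M))" "M * \<nu> \<le> Cinf / 4"
  proof -
    have k: "Cinf / (4 * M) > 0" using Cinf_pos M(1) by simp
    show "\<nu> > 0" unfolding \<nu>_def by (rule mult_pos_pos[OF _ k]) (use e in simp)
    show "\<nu> \<le> e * (Cinf / (4 * M))" unfolding \<nu>_def using k by (intro mult_right_mono) auto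
    have "\<nu> \<le> 1 * (Cinf / (4 * M))" unfolding \<nu>_def using k by (intro mult_right_mono) auto
    then show "M * \<nu> \<le> Cinf / 4" using M(1) by (simp add: field_simps)
  qed
  define \<eta> where "\<eta> = min (1/2) (\<nu> / (4 * (M + 1))) / (C + 1)"
  have "\<eta> * (C + 1) = min (1/2) (\<nu> / (4 * (M + 1)))" using C by (simp add: \<eta>_def)
  then have "\<eta> * (C + 1) \<le> 1/2" "\<eta> * (C + 1) \<le> \<nu> / (4 * (M + 1))" by linarith+
  moreover have "\<eta> > 0" using \<nu>(1) M(1) C by (simp add: \<eta>_def)
  ultimately have \<eta>: "\<eta> > 0" "\<eta> * (C + 1) \<le> 1/2" "\<eta> * (C + 1) \<le> \<nu> / (4 * (M + 1))" by blast+
  have "\<eta> * 1 \<le> \<eta> * (C + 1)" using \<eta>(1) C by (intro mult_left_mono) auto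
  then have \<eta>2: "\<eta> \<le> 1/2" using \<eta>(2) by linarith
  \<comment> \<open>The choices of \<open>\<eta>\<close> and \<open>\<tau>\<close> allot \<open>\<nu> / 2\<close> to the variation of \<open>wA\<close>, \<open>wB\<close> and \<open>\<nu> / 2\<close> to that of \<open>f 0\<close> and to \<open>G y\<close>.\<close>
  define \<tau> where "\<tau> = \<nu> / (8 * M)"
  have \<tau>: "\<tau> > 0" "4 * \<tau> * M = \<nu> / 2" using \<nu> M(1) by (auto simp: \<tau>_def)
  have C1: "C + 1 \<ge> 0" using C by simp
  have e\<tau>: "min e \<tau> > 0" using e \<tau> by simp
  obtain N2 where N2: "\<And>n z. n \<ge> N2 \<Longrightarrow> z \<in> ntr (C+1) \<xi> \<Longrightarrow> \<eta> / real n \<le> 1 - cmod z \<Longrightarrow> cmod (f n z) \<le> min e \<tau>"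
    by (rule f_small_deep[OF C1 \<eta>(1) e\<tau>], rule that)
  obtain r where r: "r > 0" "\<And>z. z \<in> ntr (C+1) \<xi> \<Longrightarrow> cmod (z - \<xi>) < r \<Longrightarrow> cmod (f 0 z - f0b \<xi>) < \<tau>"
    using near[OF f0_lim[rule_format, OF C1] \<tau>(1)] by blast
  obtain N3 where N3: "real N3 > 1 / r" using reals_Archimedean2 by blast
  show ?thesis
  proof (rule that[of "max (max N1 N2) (max 1 N3)"])
    fix n z assume n: "n \<ge> max (max N1 N2) (max 1 N3)" and z: "z \<in> ntr C \<xi>"
    have z1: "cmod z < 1" and zC: "cmod (z - \<xi>) \<le> C * (1 - cmod z)" using z by (auto simp: ntr_def)
    have z': "z \<in> ntr (C + 1) \<xi>" using z1 zC by (simp add: ntr_def distrib_right)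
    show "cmod (f n z) \<le> e"
    proof (cases "\<eta> / real n \<le> 1 - cmod z")
      case True
      then show ?thesis using N2[OF _ z' True] n by simp
    next
      case False
      have n1: "real n \<ge> 1" using n by simp
      have "real n \<ge> real N3" using n by simp
      then have "1 / r < real n" using N3 by linarith
      then have nr: "1 / real n < r" using r n1 by (simp add: field_simps)
      have \<eta>n: "0 < \<eta> / real n" "\<eta> / real n \<le> 1/2" using \<eta>(1) \<eta>2 n1 by (auto simp: field_simps)
      define y where "y = of_real (1 - \<eta> / real n) * \<xi>"
      have y: "cmod y = 1 - \<eta> / real n" "cmod (y - \<xi>) = \<eta> / real n" unfolding y_def using radial_point[of "\<eta> / real n"] \<eta>n by auto
      have y1: "cmod y < 1" using y \<eta>n by simp
      have y': "y \<in> ntr (C + 1) \<xi>" using y y1 C \<eta>n mult_right_mono[of 1 "C+1" "\<eta> / real n"] by (simp add: ntr_def)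
      have "C * (1 - cmod z) \<le> C * (\<eta> / real n)" using False C by (intro mult_left_mono) auto
      then have zx: "cmod (z - \<xi>) \<le> C * (\<eta> / real n)" using zC by linarith
      have zy: "cmod (z - y) \<le> \<eta> * (C + 1) / real n"
        using norm_triangle_ineq4[of "z - \<xi>" "y - \<xi>"] zx y by (simp add: algebra_simps add_divide_distrib)
      have zx2: "cmod (z - \<xi>) \<le> 1 / real n" and yx2: "cmod (y - \<xi>) \<le> 1 / real n"
      proof -
        have "C * \<eta> \<le> 1" "\<eta> \<le> 1" using \<eta> \<eta>2 by (auto simp: algebra_simps)
        then have "C * \<eta> / real n \<le> 1 / real n" "\<eta> / real n \<le> 1 / real n" using n1 by (auto intro!: divide_right_mono)
        then show "cmod (z - \<xi>) \<le> 1 / real n" "cmod (y - \<xi>) \<le> 1 / real n" using zx y by auto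
      qed
      have bd: "cmod (wa n t) \<le> M" "cmod (wb n t) \<le> M" "cmod (wA n t) \<le> M" "cmod (wB n t) \<le> M" if "cmod (t - \<xi>) \<le> 2 * (1 / real n)" for t
        using M(2)[of n t] n that by auto
      have in0: "1 / real n > 0" using n1 by simp
      have Mz: "(M + 1) / (1 / real n) * cmod (z - y) \<le> \<nu> / 4"
      proof -
        have "(M + 1) / (1 / real n) * cmod (z - y) \<le> (M + 1) / (1 / real n) * (\<eta> * (C + 1) / real n)"
          using M(1) n1 by (intro mult_left_mono zy) auto
        also have "\<dots> = (M + 1) * (\<eta> * (C + 1))" using n1 by simp
        also have "\<dots> \<le> (M + 1) * (\<nu> / (4 * (M + 1)))" using M(1) by (intro mult_left_mono \<eta>) auto
        also have "\<dots> = \<nu> / 4" using M(1) by (simp add: field_simps)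
        finally show ?thesis .
      qed
      have LB: "cmod (wB n z - wB n y) \<le> \<nu> / 4"
        by (rule order_trans[OF entire_lipschitz[OF wall_row_entire(2) in0 bd(4) zx2 yx2] Mz])
      have LA: "cmod (wA n z - wA n y) \<le> \<nu> / 4"
        by (rule order_trans[OF entire_lipschitz[OF wall_row_entire(2) in0 bd(3) zx2 yx2] Mz])
      have zx3: "cmod (z - \<xi>) \<le> 2 * (1 / real n)" "cmod (y - \<xi>) \<le> 2 * (1 / real n)" using zx2 yx2 in0 by linarith+
      define G where "G t = f 0 t * wB n t - wA n t" for t
      have Gq: "f n t * (wa n t - f 0 t * wb n t) = G t" if "cmod t < 1" for t unfolding G_def by (rule wall_quotient[OF that])
      have f0: "cmod (f 0 z - f 0 y) \<le> 2 * \<tau>"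
        using r(2)[OF z'] r(2)[OF y'] zx2 yx2 nr norm_triangle_ineq4[of "f 0 z - f0b \<xi>" "f 0 y - f0b \<xi>"] by simp
      have "cmod (f 0 y * wb n y) \<le> 1 * M" unfolding norm_mult using bd(2)[OF zx3(2)] f_le[OF y1, of 0] by (intro mult_mono) auto
      then have "cmod (wa n y - f 0 y * wb n y) \<le> M + 1 * M" using bd(1)[OF zx3(2)] by (intro norm_triangle_le_diff add_mono)
      then have "cmod (f n y * (wa n y - f 0 y * wb n y)) \<le> \<tau> * (M + 1 * M)"
        unfolding norm_mult[of "f n y"] using N2[of n y, OF _ y'] n y \<tau> by (intro mult_mono) auto
      then have Gy: "cmod (G y) \<le> 2 * \<tau> * M" unfolding Gq[OF y1] by simp
      have "G z = G y + ((f 0 z - f 0 y) * wB n z + f 0 y * (wB n z - wB n y) - (wA n z - wA n y))" by (simp add: G_def algebra_simps)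
      then have "cmod (G z) \<le> cmod (G y) + ((cmod (f 0 z - f 0 y) * cmod (wB n z) + cmod (f 0 y) * cmod (wB n z - wB n y)) + cmod (wA n z - wA n y))"
        by (simp only: norm_mult[symmetric]) (intro norm_triangle_mono norm_triangle_le_diff order_refl add_mono norm_triangle_ineq)
      also have "\<dots> \<le> 2 * \<tau> * M + ((2 * \<tau> * M + 1 * (\<nu> / 4)) + \<nu> / 4)"
        using \<tau>(1) \<nu>(1) by (intro add_mono Gy mult_mono f0 bd(4)[OF zx3(1)] f_le[OF y1] LB LA) auto
      also have "\<dots> = \<nu>" using \<tau>(2) by (simp add: mult_ac)
      finally have Gz: "cmod (G z) \<le> \<nu>" .
      have "1 + real n * (- (\<eta> / real n)) \<le> (1 + - (\<eta> / real n)) ^ n" by (rule Bernoulli_inequality) (use \<eta>n in linarith)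
      also have "\<dots> \<le> cmod z ^ n" by (rule power_mono) (use False \<eta>n in linarith)+
      finally have zn: "cmod z ^ n \<ge> 1/2" using n1 \<eta>2 by simp
      have "wB n z * (wa n z - f 0 z * wb n z) + wb n z * G z = z ^ n * of_real (Cn n)"
        using wall_det[of n z] by (simp add: G_def algebra_simps)
      moreover have "cmod (z ^ n * of_real (Cn n)) \<ge> 1/2 * Cinf"
        using zn Cinf_le[of n] Cinf_pos Cn_pos[of n] unfolding norm_mult norm_power by (intro mult_mono) auto
      moreover have "cmod (wb n z * G z) \<le> M * \<nu>" unfolding norm_mult using bd(2)[OF zx3(1)] Gz M(1) by (intro mult_mono) auto
      ultimately have "cmod (wB n z * (wa n z - f 0 z * wb n z)) \<ge> Cinf / 4"
        using norm_triangle_ineq[of "wB n z * (wa n z - f 0 z * wb n z)" "wb n z * G z"] \<nu>(3) by simp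
      moreover have "cmod (wB n z * (wa n z - f 0 z * wb n z)) \<le> M * cmod (wa n z - f 0 z * wb n z)"
        unfolding norm_mult[of "wB n z"] using bd(4)[OF zx3(1)] by (rule mult_right_mono) simp
      ultimately have den: "Cinf / (4 * M) \<le> cmod (wa n z - f 0 z * wb n z)" using M(1) by (simp add: field_simps)
      have "cmod (f n z) * (Cinf / (4 * M)) \<le> cmod (f n z) * cmod (wa n z - f 0 z * wb n z)" using den by (rule mult_left_mono) simp
      also have "\<dots> = cmod (G z)" unfolding norm_mult[symmetric] Gq[OF z1] ..
      also have "\<dots> \<le> e * (Cinf / (4 * M))" using Gz \<nu>(2) by linarith
      finally show ?thesis by (rule mult_right_le_imp_le) (use M(1) Cinf_pos in simp)
    qed
  qed
qed

text \<open>\<open>f n\<close> is a fractional linear function of \<open>f 0\<close> with continuous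
  coefficients. Its denominator does not vanish in the limit because \<open>\<bar>wb\<bar> <
  \<bar>wa\<bar>\<close> on the circle.\<close>

lemma f_boundary: "\<exists>b. \<forall>C\<ge>0. (f n \<longlongrightarrow> b) (at \<xi> within ntr C \<xi>)"
proof -
  have \<xi>0: "\<xi> \<noteq> 0" using x by auto
  have c: "((\<lambda>z. wa n z) \<longlongrightarrow> wa n \<xi>) (at \<xi> within S)" "((\<lambda>z. wb n z) \<longlongrightarrow> wb n \<xi>) (at \<xi> within S)"
    "((\<lambda>z. wA n z) \<longlongrightarrow> wA n \<xi>) (at \<xi> within S)" "((\<lambda>z. wB n z) \<longlongrightarrow> wB n \<xi>) (at \<xi> within S)" for S
    using holomorphic_on_imp_continuous_on[OF wall_row_entire(1)[of n]] holomorphic_on_imp_continuous_on[OF wall_row_entire(2)[of n]]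
    by (auto simp: continuous_on_eq_continuous_at isCont_def intro: tendsto_within_subset[OF _ subset_UNIV])
  have ii: "inverse (cnj \<xi>) = \<xi>" by (rule inverse_unique) (rule circle_cnj_mult(2)[OF x])
  have "cmod (wa n \<xi>) = cmod (wB n \<xi>)"
    unfolding conjunct1[OF wall_reflect[OF \<xi>0, of n]] ii norm_mult norm_power by (simp add: x)
  moreover have "cmod (f0b \<xi> * wb n \<xi>) \<le> 1 * cmod (wb n \<xi>)" unfolding norm_mult using fb1 by (intro mult_right_mono) auto
  moreover have "cmod (wb n \<xi>) < cmod (wB n \<xi>)" using wall_bounds(2)[of \<xi> n] x by simp
  ultimately have ne: "wa n \<xi> - f0b \<xi> * wb n \<xi> \<noteq> 0" by auto
  show ?thesis
  proof (intro exI[of _ "(f0b \<xi> * wB n \<xi> - wA n \<xi>) / (wa n \<xi> - f0b \<xi> * wb n \<xi>)"] allI impI)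
    fix C :: real assume C: "C \<ge> 0"
    let ?F = "at \<xi> within ntr C \<xi>"
    have f0: "(f 0 \<longlongrightarrow> f0b \<xi>) ?F" using f0_lim C by blast
    have "((\<lambda>z. wa n z - f 0 z * wb n z) \<longlongrightarrow> wa n \<xi> - f0b \<xi> * wb n \<xi>) ?F" by (intro tendsto_intros f0 c)
    note ev = tendsto_imp_eventually_ne[OF this ne]
    have "\<forall>\<^sub>F z in ?F. (f 0 z * wB n z - wA n z) / (wa n z - f 0 z * wb n z) = f n z"
    proof (rule eventually_elim2[OF ev])
      show "\<forall>\<^sub>F z in ?F. z \<in> ntr C \<xi>" by (auto simp: eventually_at_filter)
      fix z assume "wa n z - f 0 z * wb n z \<noteq> 0" "z \<in> ntr C \<xi>"
      moreover from this have "cmod z < 1" by (simp add: ntr_def)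
      ultimately show "(f 0 z * wB n z - wA n z) / (wa n z - f 0 z * wb n z) = f n z" by (simp flip: wall_quotient)
    qed
    then show "(f n \<longlongrightarrow> (f0b \<xi> * wB n \<xi> - wA n \<xi>) / (wa n \<xi> - f0b \<xi> * wb n \<xi>)) ?F"
      by (rule Lim_transform_eventually[rotated]) (intro tendsto_intros f0 c ne)
  qed
qed

lemma Ps_scaled_lim:
  assumes v: "v \<in> ball (- 2) 1"
  shows "(\<lambda>n. Ps n (\<xi> * (1 + v / of_nat n))) \<longlonglongrightarrow> of_real (sqrt Cinf) / d \<xi>"
proof -
  define z where "z n = \<xi> * (1 + v / of_nat n)" for n
  have v2: "cmod (v + 2) < 1" using v by (simp add: dist_norm norm_minus_commute add.commute)
  have v3: "cmod v \<le> 3" using v2 norm_triangle_ineq4[of "v + 2" 2] by simp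
  have zn: "z n \<in> ntr 3 \<xi> \<and> z n \<noteq> \<xi>" if n: "n \<ge> 2" for n
  proof -
    have n0: "real n \<ge> 2" using n by simp
    have "1 + v / of_nat n = of_real (1 - 2 / real n) + (v + 2) / of_nat n" by (simp add: add_divide_distrib)
    then have "cmod (1 + v / of_nat n) \<le> cmod (of_real (1 - 2 / real n)) + cmod ((v + 2) / of_nat n)" by (metis norm_triangle_ineq)
    also have "\<dots> = (1 - 2 / real n) + cmod (v + 2) / real n" unfolding norm_of_real norm_divide norm_of_nat using n0 by simp
    also have "\<dots> \<le> (1 - 2 / real n) + 1 / real n" using v2 by (intro add_left_mono divide_right_mono) auto
    finally have 1: "1 / real n \<le> 1 - cmod (z n)" using x by (simp add: z_def norm_mult)
    have "z n - \<xi> = \<xi> * (v / of_nat n)" by (simp add: z_def algebra_simps)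
    then have d: "cmod (z n - \<xi>) = cmod v / real n" using x by (simp add: norm_mult norm_divide)
    also have "\<dots> \<le> 3 * (1 / real n)" using divide_right_mono[OF v3, of "real n"] by simp
    also have "\<dots> \<le> 3 * (1 - cmod (z n))" using 1 by (rule mult_left_mono) simp
    finally have "cmod (z n - \<xi>) \<le> 3 * (1 - cmod (z n))" .
    moreover have "1 / real n > 0" using n0 by simp
    then have "cmod (z n) < 1" using 1 by linarith
    ultimately show ?thesis using x by (auto simp: ntr_def)
  qed
  have "(\<lambda>n. v / of_nat n) \<longlonglongrightarrow> 0" by (intro tendsto_divide_0[OF tendsto_const] tendsto_of_nat)
  then have "(\<lambda>n. \<xi> * (1 + v / of_nat n)) \<longlonglongrightarrow> \<xi> * (1 + 0)" by (intro tendsto_intros)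
  then have "z \<longlonglongrightarrow> \<xi>" by (simp add: z_def[abs_def])
  then have "filterlim z (at \<xi> within ntr 3 \<xi>) sequentially"
    unfolding filterlim_at using zn by (auto intro: eventually_sequentiallyI[of 2])
  then have Dz: "(\<lambda>n. D (z n)) \<longlonglongrightarrow> d \<xi>" by (rule filterlim_compose[rotated]) (use D_lim in simp)
  have "(\<lambda>n. ps n (z n) * D (z n)) \<longlonglongrightarrow> 1"
  proof (rule LIMSEQ_I)
    fix e :: real assume e: "e > 0"
    have 3: "(3::real) \<ge> 0" and e2: "e / 2 > 0" using e by auto
    obtain N where N: "\<And>n z. n \<ge> N \<Longrightarrow> z \<in> ntr 3 \<xi> \<Longrightarrow> cmod (ps n z * D z - 1) \<le> e / 2"
      by (rule ps_D_unif[OF 3 e2], rule that)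
    have "cmod (ps n (z n) * D (z n) - 1) < e" if "n \<ge> max N 2" for n using N[of n "z n"] zn[of n] that e by fastforce
    then show "\<exists>no. \<forall>n\<ge>no. norm (ps n (z n) * D (z n) - 1) < e" by blast
  qed
  from tendsto_divide[OF this Dz d0]
  have "(\<lambda>n. of_real (sqrt (Cn n)) * (ps n (z n) * D (z n) / D (z n))) \<longlonglongrightarrow> of_real (sqrt Cinf) * (1 / d \<xi>)"
    by (intro tendsto_mult tendsto_of_real tendsto_real_sqrt Cn_lim)
  moreover have "\<forall>\<^sub>F n in sequentially. of_real (sqrt (Cn n)) * (ps n (z n) * D (z n) / D (z n)) = Ps n (z n)"
  proof (rule eventually_sequentiallyI[of 2])
    fix n :: nat assume "2 \<le> n"
    then have "cmod (z n) < 1" using zn[of n] by (simp add: ntr_def)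
    then show "of_real (sqrt (Cn n)) * (ps n (z n) * D (z n) / D (z n)) = Ps n (z n)" using D_nz sqrtC[of n] by (simp add: ps_def)
  qed
  ultimately show ?thesis unfolding z_def by (auto intro: Lim_transform_eventually)
qed

text \<open>Otherwise some subsequence of the rescaled polynomials has zeros \<open>v\<close> with
  \<open>\<bar>v\<bar> \<le> R\<close>. By Montel's theorem a further subsequence converges locally
  uniformly, and the limit is the nonzero constant of \<open>Ps_scaled_lim\<close>, by analytic
  continuation from the disc on which the limit is known.\<close>

lemma Ps_zero_free_near:
  assumes R: "R > 0"
  shows "\<exists>N. \<forall>n\<ge>N. \<forall>z. cmod (z - \<xi>) \<le> R / real n \<longrightarrow> Ps n z \<noteq> 0"
proof (rule ccontr)
  assume "\<not> ?thesis"
  then have bad: "\<forall>N. \<exists>n z. n \<ge> N \<and> cmod (z - \<xi>) \<le> R / real n \<and> Ps n z = 0" by blast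
  have R4: "R + 4 > 0" using R by simp
  obtain M N0 where M: "0 < M" "\<And>n z. n \<ge> N0 \<Longrightarrow> cmod (z - \<xi>) \<le> (R + 4) / real n \<Longrightarrow>
    walls_le n z M" by (rule wall_local_bound[OF R4], rule that)
  have "\<forall>j. \<exists>n z. n \<ge> max (max N0 1) j \<and> cmod (z - \<xi>) \<le> R / real n \<and> Ps n z = 0" using bad by blast
  from choice[OF this] obtain k where "\<forall>j. \<exists>z. k j \<ge> max (max N0 1) j \<and> cmod (z - \<xi>) \<le> R / real (k j) \<and> Ps (k j) z = 0" by blast
  from choice[OF this] obtain y where y: "\<And>j. k j \<ge> max (max N0 1) j \<and> cmod (y j - \<xi>) \<le> R / real (k j) \<and> Ps (k j) (y j) = 0" by blast
  have k: "k j \<ge> N0" "real (k j) \<ge> 1" "k j \<ge> j" for j using y[of j] by auto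
  define F where "F j v = Ps (k j) (\<xi> * (1 + v / of_nat (k j)))" for j v
  let ?S = "ball (0::complex) (R + 4)"
  have bnd: "cmod (F j v) \<le> M + (1 + (R + 4)) * M" if v: "v \<in> ?S" for j v
  proof -
    let ?z = "\<xi> * (1 + v / of_nat (k j))"
    have v': "cmod v \<le> R + 4" using v by simp
    have "?z - \<xi> = \<xi> * (v / of_nat (k j))" by (simp add: algebra_simps)
    then have zd: "cmod (?z - \<xi>) = cmod v / real (k j)" using x by (simp add: norm_mult norm_divide)
    then have z1: "cmod (?z - \<xi>) \<le> (R + 4) / real (k j)" using divide_right_mono[OF v', of "real (k j)"] by simp
    also have "\<dots> \<le> (R + 4) / 1" using k(2)[of j] R by (intro divide_left_mono) auto
    finally have z2: "cmod ?z \<le> 1 + (R + 4)" using norm_triangle_ineq2[of ?z \<xi>] x by simp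
    have b: "cmod (wA (k j) ?z) \<le> M" "cmod (wB (k j) ?z) \<le> M" using M(2)[OF k(1) z1] by auto
    have "cmod (F j v) \<le> cmod (wB (k j) ?z) + cmod ?z * cmod (wA (k j) ?z)"
      unfolding F_def Ps_wall by (metis norm_mult norm_triangle_ineq4)
    also have "\<dots> \<le> M + (1 + (R + 4)) * M" using b z2 R by (intro add_mono mult_mono) auto
    finally show ?thesis .
  qed
  have hol: "F j holomorphic_on ?S" for j unfolding F_def[abs_def] Ps_def by (intro holomorphic_intros) (use k(2)[of j] in auto)
  obtain g r where gr: "g holomorphic_on ?S" "strict_mono (r :: nat \<Rightarrow> nat)"
     "\<And>v. v \<in> ?S \<Longrightarrow> ((\<lambda>n. F (r n) v) \<longlongrightarrow> g v) sequentially"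
     "\<And>K. compact K \<Longrightarrow> K \<subseteq> ?S \<Longrightarrow> uniform_limit K (F \<circ> r) g sequentially"
  proof (rule Montel[of ?S "range F" F])
    fix K assume "compact K" "K \<subseteq> ?S"
    then show "\<exists>B. \<forall>h\<in>range F. \<forall>z\<in>K. norm (h z) \<le> B" using bnd by (intro exI[of _ "M + (1 + (R + 4)) * M"]) auto
  qed (use hol in auto)
  let ?c = "complex_of_real (sqrt Cinf) / d \<xi>"
  have c0: "?c \<noteq> 0" using d0 Cinf_pos by simp
  have sub: "ball (- 2) 1 \<subseteq> ?S"
  proof
    fix v :: complex assume "v \<in> ball (- 2) 1"
    then have "cmod (v + 2) < 1" by (simp add: dist_norm norm_minus_commute add.commute)
    then show "v \<in> ?S" using norm_triangle_ineq4[of "v + 2" 2] R by simp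
  qed
  have kr: "filterlim (\<lambda>j. k (r j)) at_top sequentially"
    by (rule filterlim_at_top_mono[OF filterlim_subseq[OF gr(2)]]) (use k(3) in auto)
  have g1: "g v = ?c" if v: "v \<in> ball (- 2) 1" for v
    using filterlim_compose[OF Ps_scaled_lim[OF v] kr] gr(3)[of v] sub v unfolding F_def by (blast intro: LIMSEQ_unique)
  have gc: "g v = ?c" if v: "v \<in> ?S" for v
    by (rule analytic_continuation_open[of "ball (- 2) 1" ?S g "\<lambda>_. ?c"]) (use sub gr(1) g1 v in auto)
  have "uniform_limit (cball 0 R) (F \<circ> r) g sequentially" by (rule gr(4)) auto
  then have "\<forall>\<^sub>F j in sequentially. \<forall>v\<in>cball 0 R. dist (F (r j) v) (g v) < cmod ?c"
    unfolding uniform_limit_iff comp_def using c0 unfolding zero_less_norm_iff[symmetric] by blast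
  then obtain j where j: "\<And>v. v \<in> cball 0 R \<Longrightarrow> dist (F (r j) v) (g v) < cmod ?c" using eventually_happens'[OF sequentially_bot] by blast
  define v where "v = (y (r j) / \<xi> - 1) * of_nat (k (r j))"
  have \<xi>0: "\<xi> \<noteq> 0" using x by auto
  have kn: "real (k (r j)) > 0" using k(2)[of "r j"] by linarith
  have "(y (r j) / \<xi> - 1) * \<xi> = y (r j) - \<xi>" using \<xi>0 by (simp add: field_simps)
  then have "cmod (y (r j) / \<xi> - 1) = cmod (y (r j) - \<xi>)" using x by (metis mult.right_neutral norm_mult)
  then have "cmod v = cmod (y (r j) - \<xi>) * real (k (r j))" by (simp add: v_def norm_mult)
  then have "cmod v \<le> R" using y[of "r j"] kn by (simp add: field_simps)
  moreover have "\<xi> * (1 + v / of_nat (k (r j))) = y (r j)" using \<xi>0 kn by (simp add: v_def)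
  then have "F (r j) v = 0" using y[of "r j"] by (simp add: F_def)
  ultimately show False using j[of v] gc[of v] by simp
qed

lemma zeros_eq: "OP_zeros \<sigma> n = {z \<in> ball 0 1. Ph n z = 0}"
  using Ph_norm[of n] Cn_pos[of n] unfolding OP_zeros_def orthonormal_OP_def Ph_def[symmetric] by (auto simp: Ph_def)

text \<open>Reflection turns a zero of \<open>Ph n\<close> within \<open>R / n\<close> of \<open>\<xi>\<close>
  into a zero of \<open>Ps n\<close> within \<open>2 * R / n\<close>. The set of zeros is nonempty
  for \<open>n > 0\<close>, so the default value of \<^const>\<open>infdist\<close> for the empty
  set does not interfere.\<close>

lemma zeros_far: "filterlim (\<lambda>n. infdist \<xi> (OP_zeros \<sigma> n) * real n) at_top sequentially"
  unfolding filterlim_at_top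
proof
  fix Z :: real
  define R where "R = max 1 Z"
  have R: "R \<ge> 1" "Z \<le> R" by (auto simp: R_def)
  obtain N where N: "\<And>n z. n \<ge> N \<Longrightarrow> cmod (z - \<xi>) \<le> 2 * R / real n \<Longrightarrow> Ps n z \<noteq> 0"
    using Ps_zero_free_near[of "2 * R"] R by auto
  obtain N' where N': "real N' > 2 * R" using reals_Archimedean2 by blast
  show "\<forall>\<^sub>F n in sequentially. Z \<le> infdist \<xi> (OP_zeros \<sigma> n) * real n"
  proof (rule eventually_sequentiallyI[of "max N N'"])
    fix n assume n: "max N N' \<le> n"
    then have "real n \<ge> real N'" by simp
    then have nR: "real n > 2 * R" using N' by linarith
    have refl: "Ps n (inverse (cnj z)) = 0" if "z \<noteq> 0" "Ph n z = 0" for z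
      using Ps_reflect[of "inverse (cnj z)" n] that by simp
    have "degree (monic_OP \<sigma> n) \<noteq> 0" using nR R by (simp add: degree_monic)
    then obtain y where y: "Ph n y = 0" unfolding Ph_def using fundamental_theorem_of_algebra[of "monic_OP \<sigma> n"] unfolding constant_degree by blast
    have "cmod y < 1"
    proof (rule ccontr)
      assume "\<not> ?thesis"
      then have "y \<noteq> 0" "cmod (inverse (cnj y)) \<le> 1" by (auto simp: norm_inverse inverse_le_1_iff)
      then show False using refl[OF _ y] Ps_nz by blast
    qed
    then have ne: "OP_zeros \<sigma> n \<noteq> {}" using y by (auto simp: zeros_eq)
    have "R / real n \<le> infdist \<xi> (OP_zeros \<sigma> n)" unfolding infdist_notempty[OF ne]
    proof (rule cINF_greatest[OF ne])
      fix z assume "z \<in> OP_zeros \<sigma> n"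
      then have z: "Ph n z = 0" by (simp add: zeros_eq)
      show "R / real n \<le> dist \<xi> z"
      proof (rule ccontr)
        assume "\<not> ?thesis"
        then have d: "cmod (z - \<xi>) < R / real n" by (simp add: dist_norm norm_minus_commute)
        have "R / real n < 1 / 2" using nR R by (simp add: field_simps)
        then have z2: "cmod z > 1 / 2" using d norm_triangle_ineq2[of \<xi> z] x unfolding norm_minus_commute[of \<xi> z] by linarith
        then have z0: "z \<noteq> 0" by auto
        have "cmod (inverse (cnj z) - \<xi>) \<le> cmod (z - \<xi>) / (1 / 2)"
          unfolding reflect_dist[OF z0] using z2 z0 by (intro divide_left_mono) auto
        also have "\<dots> \<le> 2 * R / real n" using d by simp
        finally show False using N[of n] n refl[OF z0 z] by simp
      qed
    qed
    then have "R \<le> infdist \<xi> (OP_zeros \<sigma> n) * real n" using nR R by (simp add: divide_le_eq)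
    then show "Z \<le> infdist \<xi> (OP_zeros \<sigma> n) * real n" using R by simp
  qed
qed

section \<open>Almost every point is good\<close>

lemma star_orthonormal: "cmod (poly (poly_star (orthonormal_OP \<sigma> n)) \<xi>) = cmod (ps n \<xi>)"
proof -
  have \<xi>0: "\<xi> \<noteq> 0" using x by auto
  have s: "sqrt (Cn n) > 0" using Cn_pos[of n] by simp
  define c where "c = 1 / complex_of_real (sqrt (Cn n))"
  have c0: "c \<noteq> 0" using s by (simp add: c_def)
  have o: "orthonormal_OP \<sigma> n = smult c (monic_OP \<sigma> n)"
    using Ph_norm[of n] unfolding orthonormal_OP_def c_def Ph_def by simp
  have "poly (poly_star (orthonormal_OP \<sigma> n)) \<xi> = cnj c * poly (poly_star (monic_OP \<sigma> n)) \<xi>"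
    unfolding poly_star_poly_nz[OF \<xi>0] o using c0 by simp
  then have "cmod (poly (poly_star (orthonormal_OP \<sigma> n)) \<xi>) = cmod c * cmod (Ps n \<xi>)" by (simp add: norm_mult Ps_def)
  then show ?thesis using s by (simp add: c_def ps_def norm_divide)
qed

lemma nontangential_ntr:
  assumes "\<forall>C\<ge>0. (g \<longlongrightarrow> l) (at \<xi> within ntr C \<xi>)"
  shows "has_nontangential_limit g \<xi> l" unfolding has_nontangential_limit_def
proof
  fix \<rho> :: real assume \<rho>: "\<rho> \<in> {0<..<1}"
  have "(g \<longlongrightarrow> l) (at \<xi> within ntr (2 / (1 - \<rho>)) \<xi>)" using assms \<rho> by simp
  then have "(g \<longlongrightarrow> l) (at \<xi> within stolz_angle \<rho> \<xi> - {\<xi>})"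
    by (rule tendsto_within_subset) (use stolz_angle_subset_ntr[OF _ _ x] \<rho> in auto)
  then show "(g \<longlongrightarrow> l) (at \<xi> within stolz_angle \<rho> \<xi>)" by (simp add: at_within_def)
qed

lemma conclusion:
  assumes a: "a > 0"
  shows "(\<exists>d. has_nontangential_limit (szego_function w) \<xi> d \<and> d \<noteq> 0 \<and>
        (\<lambda>n. (cmod (poly (poly_star (orthonormal_OP \<sigma> n)) \<xi>))^2) \<longlonglongrightarrow> (cmod (inverse d))^2) \<and>
     filterlim (\<lambda>n. infdist \<xi> (OP_zeros \<sigma> n) * real n) at_top sequentially \<and>
     (\<lambda>n. f n (complex_of_real (1 - a / real n) * \<xi>)) \<longlonglongrightarrow> 0 \<and>
     (\<exists>b. (\<forall>n. has_nontangential_limit (f n) \<xi> (b n)) \<and>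
        (\<forall>\<rho> \<in> {0<..<1}.
           (\<lambda>n. SUP z \<in> stolz_angle \<rho> \<xi>. cmod (((f n)(\<xi> := b n)) z)) \<longlonglongrightarrow> 0))"
proof (intro conjI)
  have "szego_function w = D" by (simp add: D_def[abs_def])
  then have 1: "has_nontangential_limit (szego_function w) \<xi> (d \<xi>)" using nontangential_ntr[OF D_lim] by simp
  have "(\<lambda>n. (1 + h n \<xi>) / d \<xi>) \<longlonglongrightarrow> (1 + 0) / d \<xi>" by (intro tendsto_intros h_lim d0)
  then have "(\<lambda>n. ps n \<xi>) \<longlonglongrightarrow> inverse (d \<xi>)" using d0 by (simp add: h_def inverse_eq_divide)
  then have "(\<lambda>n. (cmod (ps n \<xi>))^2) \<longlonglongrightarrow> (cmod (inverse (d \<xi>)))^2" by (intro tendsto_intros)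
  then show "\<exists>d. has_nontangential_limit (szego_function w) \<xi> d \<and> d \<noteq> 0 \<and>
      (\<lambda>n. (cmod (poly (poly_star (orthonormal_OP \<sigma> n)) \<xi>))^2) \<longlonglongrightarrow> (cmod (inverse d))^2"
    unfolding star_orthonormal using 1 d0 by blast
  show "filterlim (\<lambda>n. infdist \<xi> (OP_zeros \<sigma> n) * real n) at_top sequentially" by (rule zeros_far)
  show "(\<lambda>n. f n (complex_of_real (1 - a / real n) * \<xi>)) \<longlonglongrightarrow> 0"
  proof (rule LIMSEQ_I)
    fix e :: real assume e: "e > 0"
    then have e2: "e / 2 > 0" by simp
    obtain N where N: "\<And>n z. n \<ge> N \<Longrightarrow> z \<in> ntr 1 \<xi> \<Longrightarrow> cmod (f n z) \<le> e / 2"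
      by (rule f_small[OF zero_le_one e2], rule that)
    obtain N' where N': "real N' > a" using reals_Archimedean2 by blast
    have "cmod (f n (of_real (1 - a / real n) * \<xi>) - 0) < e" if n: "n \<ge> max N N'" for n
    proof -
      have "real n \<ge> real N'" using n by simp
      then have nn: "real n > a" using N' by linarith
      then have an: "0 < a / real n" "a / real n \<le> 1" using a by auto
      have "of_real (1 - a / real n) * \<xi> \<in> ntr 1 \<xi>"
        unfolding ntr_def using radial_point[OF less_imp_le[OF an(1)] an(2)] an by simp
      from N[OF _ this, of n] show ?thesis using n e by simp
    qed
    then show "\<exists>no. \<forall>n\<ge>no. norm (f n (of_real (1 - a / real n) * \<xi>) - 0) < e" by blast
  qed
  have "\<forall>n. \<exists>b. \<forall>C\<ge>0. (f n \<longlongrightarrow> b) (at \<xi> within ntr C \<xi>)" using f_boundary by blast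
  from choice[OF this] obtain b where b: "\<forall>n. \<forall>C\<ge>0. (f n \<longlongrightarrow> b n) (at \<xi> within ntr C \<xi>)" by blast
  show "\<exists>b. (\<forall>n. has_nontangential_limit (f n) \<xi> (b n)) \<and>
        (\<forall>\<rho> \<in> {0<..<1}. (\<lambda>n. SUP z \<in> stolz_angle \<rho> \<xi>. cmod (((f n)(\<xi> := b n)) z)) \<longlonglongrightarrow> 0)"
  proof (intro exI[of _ b] conjI allI ballI)
    show "has_nontangential_limit (f n) \<xi> (b n)" for n using nontangential_ntr b by blast
    fix \<rho> :: real assume \<rho>: "\<rho> \<in> {0<..<1}"
    define C where "C = 2 / (1 - \<rho>)"
    have C: "C \<ge> 1" using \<rho> by (simp add: C_def)
    show "(\<lambda>n. SUP z \<in> stolz_angle \<rho> \<xi>. cmod (((f n)(\<xi> := b n)) z)) \<longlonglongrightarrow> 0"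
    proof (rule LIMSEQ_I)
      fix e :: real assume e: "e > 0"
      then have e2: "e / 2 > 0" by simp
      obtain N where N: "\<And>n z. n \<ge> N \<Longrightarrow> z \<in> ntr C \<xi> \<Longrightarrow> cmod (f n z) \<le> e / 2"
        by (rule f_small[OF order_trans[OF zero_le_one C] e2], rule that)
      have "norm ((SUP z \<in> stolz_angle \<rho> \<xi>. cmod (((f n)(\<xi> := b n)) z)) - 0) < e" if n: "n \<ge> N" for n
      proof -
        have "(f n \<longlongrightarrow> b n) (at \<xi> within ntr C \<xi>)" using b C by simp
        then have bn: "cmod (b n) \<le> e / 2"
          by (rule Lim_norm_ubound[OF at_within_ntr_neq_bot(1)[OF x C]]) (use N[OF n] in \<open>simp add: eventually_at_filter\<close>)
        have le: "cmod (((f n)(\<xi> := b n)) z) \<le> e / 2" if z: "z \<in> stolz_angle \<rho> \<xi>" for z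
        proof (cases "z = \<xi>")
          case False
          then have "z \<in> ntr C \<xi>" using stolz_angle_subset_ntr[OF _ _ x, of \<rho>] \<rho> z unfolding C_def by auto
          then show ?thesis using False N[OF n] by simp
        qed (use bn in simp)
        have in_st: "\<xi> \<in> stolz_angle \<rho> \<xi>" unfolding stolz_angle_def by (simp add: hull_inc)
        have "cmod (((f n)(\<xi> := b n)) \<xi>) \<le> (SUP z \<in> stolz_angle \<rho> \<xi>. cmod (((f n)(\<xi> := b n)) z))"
          by (intro cSUP_upper[OF in_st] bdd_aboveI2[of _ _ "e / 2"] le)
        then have "0 \<le> (SUP z \<in> stolz_angle \<rho> \<xi>. cmod (((f n)(\<xi> := b n)) z))" by (rule order_trans[OF norm_ge_zero])
        moreover have "(SUP z \<in> stolz_angle \<rho> \<xi>. cmod (((f n)(\<xi> := b n)) z)) \<le> e / 2"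
          by (rule cSUP_least) (use in_st le in auto)
        ultimately show ?thesis using e by simp
      qed
      then show "\<exists>no. \<forall>n\<ge>no. norm ((SUP z \<in> stolz_angle \<rho> \<xi>. cmod (((f n)(\<xi> := b n)) z)) - 0) < e" by blast
    qed
  qed
qed

end

lemma (in opuc_max) AE_good_point: "AE \<xi> in cm. good_point \<sigma> \<gamma> f w \<sigma>s \<xi>"
proof -
  have "AE \<xi> in cm. (\<lambda>n. h n \<xi>) \<longlonglongrightarrow> 0" using h_dominated by blast
  then show ?thesis
    using h_poisson_uniform f0b_nontangential f0b_less d_nontangential d_nz lebesgue_points[OF phase_integrable] AE_space[of cm]
    by eventually_elim (intro good_point.intro opuc_szego_axioms good_point_axioms.intro, simp_all)
qed

text \<open>The coefficients \<open>cf k\<close> exceed the Schur parameters in modulus by a bounded factor,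
  which is removed before Menshov's theorems are applied, since \<open>menshov_lp\<close> asks for
  coefficients bounded by \<open>1\<close>.\<close>

lemma (in opuc_szego) maximal_function:
  assumes c: "(\<exists>p::real. 1 \<le> p \<and> p < 2 \<and> summable (\<lambda>n. cmod (\<gamma> n) powr p)) \<or> summable (\<lambda>n. (cmod (\<gamma> n) * ln (real n + 2))^2)"
  shows "maximal_convergent \<sigma> cf en"
proof -
  define s where "s = sqrt Cinf"
  have s: "s > 0" using Cinf_pos by (simp add: s_def)
  define c' where "c' k = of_real s * cf k" for k
  have le: "cmod (c' k) \<le> cmod (\<gamma> k)" for k
  proof -
    have "s \<le> sqrt (Cn (Suc k))" using Cinf_le[of "Suc k"] by (simp add: s_def)
    then have "s / sqrt (Cn (Suc k)) \<le> 1" using Cn_pos[of "Suc k"] by (simp add: divide_le_eq_1)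
    then have "s / sqrt (Cn (Suc k)) * cmod (\<gamma> k) \<le> 1 * cmod (\<gamma> k)" by (intro mult_right_mono) auto
    then show ?thesis using s Cn_pos[of "Suc k"] by (simp add: c'_def cf_def norm_mult norm_divide)
  qed
  interpret orthonormal_system \<sigma> en by (rule en_orthonormal)
  have "maximal_convergent \<sigma> c' en" using c
  proof (elim disjE exE conjE)
    fix p :: real assume p: "1 \<le> p" "p < 2" "summable (\<lambda>n. cmod (\<gamma> n) powr p)"
    show ?thesis
    proof (rule menshov_lp[OF _ p(1,2)])
      show "cmod (c' k) \<le> 1" for k using le[of k] gamma[of k] by linarith
      show "summable (\<lambda>k. cmod (c' k) powr p)"
        by (rule summable_comparison_test'[OF p(3), of 0]) (use le p in \<open>auto intro: powr_mono2\<close>)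
    qed
  next
    assume l: "summable (\<lambda>n. (cmod (\<gamma> n) * ln (real n + 2))^2)"
    show ?thesis
    proof (rule menshov_log, rule summable_comparison_test'[OF l, of 0])
      fix n :: nat
      have "(cmod (c' n) * ln (real n + 2))^2 \<le> (cmod (\<gamma> n) * ln (real n + 2))^2"
        by (intro power_mono mult_right_mono le) auto
      then show "norm ((cmod (c' n) * ln (real n + 2))^2) \<le> (cmod (\<gamma> n) * ln (real n + 2))^2" by simp
    qed
  qed
  then obtain G where G: "integrable \<sigma> G" "AE x in \<sigma>. (\<forall>n. (cmod (\<Sum>k<n. c' k * en k x))^2 \<le> G x) \<and> convergent (\<lambda>n. \<Sum>k<n. c' k * en k x)"
    by blast
  have sm: "(\<Sum>k<n. cf k * en k x) = of_real (1 / s) * (\<Sum>k<n. c' k * en k x)" for n x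
    unfolding sum_distrib_left c'_def by (rule sum.cong) (use s in auto)
  show ?thesis
  proof (intro exI[of _ "\<lambda>x. (1 / s)^2 * G x"] conjI)
    show "integrable \<sigma> (\<lambda>x. (1 / s)^2 * G x)" using G(1) by simp
    show "AE x in \<sigma>. (\<forall>n. (cmod (\<Sum>k<n. cf k * en k x))^2 \<le> (1 / s)^2 * G x) \<and> convergent (\<lambda>n. \<Sum>k<n. cf k * en k x)"
      using G(2)
    proof eventually_elim
      case (elim x)
      show ?case unfolding sm
      proof (intro conjI allI)
        fix n
        have "(cmod (of_real (1 / s) * (\<Sum>k<n. c' k * en k x)))^2 = (1 / s)^2 * (cmod (\<Sum>k<n. c' k * en k x))^2"
          using s unfolding norm_mult power_mult_distrib norm_of_real by simp
        also have "\<dots> \<le> (1 / s)^2 * G x" using elim by (intro mult_left_mono) auto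
        finally show "(cmod (of_real (1 / s) * (\<Sum>k<n. c' k * en k x)))^2 \<le> (1 / s)^2 * G x" .
        show "convergent (\<lambda>n. of_real (1 / s) * (\<Sum>k<n. c' k * en k x))" using elim by (intro convergent_mult convergent_const) auto
      qed
    qed
  qed
qed

lemma square_summable:
  fixes \<gamma> :: "nat \<Rightarrow> complex"
  assumes g: "\<And>n. cmod (\<gamma> n) < 1"
    and c: "(\<exists>p::real. 1 \<le> p \<and> p < 2 \<and> summable (\<lambda>n. cmod (\<gamma> n) powr p)) \<or> summable (\<lambda>n. (cmod (\<gamma> n) * ln (real n + 2))^2)"
  shows "summable (\<lambda>n. (cmod (\<gamma> n))^2)" using c
proof (elim disjE exE conjE)
  fix p :: real assume p: "1 \<le> p" "p < 2" "summable (\<lambda>n. cmod (\<gamma> n) powr p)"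
  show ?thesis
  proof (rule summable_comparison_test'[OF p(3), of 0])
    fix n
    have "(cmod (\<gamma> n))^2 \<le> cmod (\<gamma> n) powr p"
    proof (cases "\<gamma> n = 0")
      case False
      then have "(cmod (\<gamma> n))^2 = cmod (\<gamma> n) powr 2" by simp
      also have "\<dots> \<le> cmod (\<gamma> n) powr p" using False g[of n] p by (intro powr_mono') auto
      finally show ?thesis .
    qed simp
    then show "norm ((cmod (\<gamma> n))^2) \<le> cmod (\<gamma> n) powr p" by simp
  qed
next
  assume l: "summable (\<lambda>n. (cmod (\<gamma> n) * ln (real n + 2))^2)"
  have l2: "ln (2::real) > 0" by simp
  have "summable (\<lambda>n. (1 / ln 2)^2 * (cmod (\<gamma> n) * ln (real n + 2))^2)" by (intro summable_mult l)
  then show ?thesis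
  proof (rule summable_comparison_test'[of _ 0])
    fix n :: nat
    have "ln 2 * cmod (\<gamma> n) \<le> ln (real n + 2) * cmod (\<gamma> n)" by (intro mult_right_mono) auto
    then have "cmod (\<gamma> n) \<le> 1 / ln 2 * (cmod (\<gamma> n) * ln (real n + 2))" using l2 by (simp add: field_simps)
    then have "(cmod (\<gamma> n))^2 \<le> (1 / ln 2 * (cmod (\<gamma> n) * ln (real n + 2)))^2" by (intro power_mono) auto
    then show "norm ((cmod (\<gamma> n))^2) \<le> (1 / ln 2)^2 * (cmod (\<gamma> n) * ln (real n + 2))^2" by (simp only: power_mult_distrib norm_power) simp
  qed
qed

theorem corollary3p3:
  fixes \<gamma> :: "nat \<Rightarrow> complex"
    and \<sigma> \<sigma>s :: "complex measure"
    and w :: "complex \<Rightarrow> real"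
    and f :: "nat \<Rightarrow> complex \<Rightarrow> complex"
    and a :: real
  assumes "\<And>n. cmod (\<gamma> n) < 1"
    and "\<sigma> \<in> nontrivial_circle_measures"
    and "schur_parameters \<sigma> \<gamma>"
    and "circle_lebesgue_decomposition \<sigma> w \<sigma>s"
    and "schur_iterates \<sigma> f"
    and "(\<exists>p::real. 1 \<le> p \<and> p < 2 \<and> summable (\<lambda>n. cmod (\<gamma> n) powr p)) \<or>
         summable (\<lambda>n. (cmod (\<gamma> n) * ln (real n + 2))\<^sup>2)"
    and "a > 0"
  shows "AE \<xi> in circle_measure.
     (\<exists>d. has_nontangential_limit (szego_function w) \<xi> d \<and> d \<noteq> 0 \<and>
        (\<lambda>n. (cmod (poly (poly_star (orthonormal_OP \<sigma> n)) \<xi>))\<^sup>2)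
          \<longlonglongrightarrow> (cmod (inverse d))\<^sup>2) \<and>
     filterlim (\<lambda>n. infdist \<xi> (OP_zeros \<sigma> n) * real n) at_top sequentially \<and>
     (\<lambda>n. f n (complex_of_real (1 - a / real n) * \<xi>)) \<longlonglongrightarrow> 0 \<and>
     (\<exists>b. (\<forall>n. has_nontangential_limit (f n) \<xi> (b n)) \<and>
        (\<forall>\<rho> \<in> {0<..<1}.
           (\<lambda>n. SUP z \<in> stolz_angle \<rho> \<xi>. cmod (((f n)(\<xi> := b n)) z)) \<longlonglongrightarrow> 0))"
proof -
  interpret opuc_szego \<sigma> \<gamma> f w \<sigma>s
    by unfold_locales (use assms square_summable[OF assms(1,6)] in auto)
  interpret opuc_max \<sigma> \<gamma> f w \<sigma>s
    by unfold_locales (rule maximal_function[OF assms(6)])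
  show ?thesis
    using AE_good_point by eventually_elim (rule good_point.conclusion[OF _ assms(7)])
qed

end
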